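(* Let $q\ge 2$ and let $I=(L(u,v))\subset S=k[x_1,\ldots,x_n]$ be a completely squarefree lexsegment ideal generated in degree $q$, determined by the monomials $u=x_1x_{i_2}\cdots x_{i_q}=x_1x_F$, $2\leq i_2<\ldots<i_q\leq n$, and $v=x_{j_1}\cdots x_{j_q}$, $2\leq j_1<\ldots<j_q\leq n$, where $F=\{i_2,\ldots,i_q\}$. Assume that $I$ is neither an initial nor a final squarefree lexsegment ideal. Let $A_t=[j_t]\setminus\{j_1,\ldots,j_{t-1}\}$ for $1\leq t\leq q$, and let $s$ be the unique index in $\{1,\dots,q\}$ such that $|A_s|\leq n-q$ and $|A_{s+1}|=n-q+1$ (with $s=q$ if $|A_q|\le n-q$). Then $I$ is sequentially Cohen--Macaulay if and only if the ideal $$\bigl(L^i(x_{A_s}x_{q+j_s-s+2}\,x_{q+j_s-s+3}\cdots x_n)\bigr)\cap\bigl(L^f(\mathrm{succ}(x_{F^c\setminus\{1\}}))\bigr)$$ has an $(n-q+1)$-linear resolution. (If $|A_s|=n-q$, the monomial $x_{A_s}x_{q+j_s-s+2}\cdots x_n$ is understood to be $x_{A_s}$.)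
   Context: $k$ is a field, $S=k[x_1,\ldots,x_n]$, $[n]=\{1,\ldots,n\}$. Monomials are ordered lexicographically with $x_1>x_2>\cdots>x_n$. $\mathrm{Mon}_d^s(S)$ is the set of squarefree monomials of degree $d$ in $S$. For $u,v\in \mathrm{Mon}_d^s(S)$: $L(u,v)=\{w\in \mathrm{Mon}_d^s(S): u\geq_{lex}w\geq_{lex} v\}$, $L^i(v)=\{w\in \mathrm{Mon}_d^s(S): w\geq_{lex} v\}$, $L^f(u)=\{w\in \mathrm{Mon}_d^s(S): u\geq_{lex} w\}$; the ideals generated by these sets are called squarefree lexsegment, initial squarefree lexsegment and final squarefree lexsegment ideals, respectively. The (squarefree) shadow of a set $T$ of squarefree monomials is $\mathrm{Shad}(T)=\{wx_i: w\in T,\ x_i\nmid w,\ 1\leq i\leq n\}$; a squarefree lexsegment set (and the ideal it generates) is completely lexsegment if all of its iterated shadows are again squarefree lexsegment sets. For $A\subset[n]$, $x_A=\prod_{i\in A}x_i$ and $A^c=[n]\setminus A$. For a squarefree monomial $m$ of degree $d$, $\mathrm{succ}(m)$ is the lexicographically largest squarefree monomial $w$ of degree $d$ with $m>_{lex}w$. The sets $L^i$ and $L^f$ in the displayed formula consist of monomials of degree $n-q$. An ideal $I$ is called sequentially Cohen--Macaulay if $S/I$ is a sequentially Cohen--Macaulay $S$-module; for a squarefree monomial ideal $I=I_\Delta$ this is equivalent to all pure skeletons of $\Delta$ being Cohen--Macaulay over $k$, and to the Alexander dual ideal $I^\vee=I_{\Delta^\vee}$ being componentwise linear. A graded ideal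 has a $d$-linear resolution if it is generated in degree $d$ and has a linear minimal graded free resolution. *)

theory Defs
  imports
    "HOL-Algebra.Module"
    "HOL-Algebra.QuotRing"
    "HOL-Library.Poly_Mapping"
    "HOL-Library.Extended_Nat"
begin

section \<open>Modules over a commutative ring\<close>

definition mod_span :: "('a, 'm) ring_scheme \<Rightarrow> ('a, 'b, 'c) module_scheme \<Rightarrow> 'b set \<Rightarrow> 'b set" where
  "mod_span R M X = \<Inter>{N. submodule N R M \<and> X \<subseteq> N}"

text \<open>\<open>X M\<close>, for a set \<open>X\<close> of ring elements; it equals \<open>(X) M\<close> for the ideal \<open>(X)\<close>.\<close>

definition set_smult :: "('a, 'm) ring_scheme \<Rightarrow> 'a set \<Rightarrow> ('a, 'b, 'c) module_scheme \<Rightarrow> 'b set" where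
  "set_smult R X M = mod_span R M {x \<odot>\<^bsub>M\<^esub> y | x y. x \<in> X \<and> y \<in> carrier M}"

text \<open>Module records extend ring records; their \<open>mult\<close> and \<open>one\<close> fields carry no meaning.\<close>

definition mod_quot :: "('a, 'b, 'c) module_scheme \<Rightarrow> 'b set \<Rightarrow> ('a, 'b set) module" where
  "mod_quot M N =
     \<lparr>carrier = a_rcosets\<^bsub>M\<^esub> N, mult = undefined, one = undefined, zero = N, add = set_add M,
      smult = (\<lambda>r X. \<Union>x\<in>X. N +>\<^bsub>M\<^esub> (r \<odot>\<^bsub>M\<^esub> x))\<rparr>"

lemma module_mod_quot:
  assumes "Module.module R M" "submodule N R M"
  shows "Module.module R (mod_quot M N)"
proof -
  interpret M: Module.module R M by fact
  interpret N: submodule N R M by fact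
  interpret N': abelian_subgroup N M
    by (rule abelian_subgroupI3) (auto simp: additive_subgroup_def N.subgroup_axioms Module.module.axioms(2)[OF assms(1)])
  have sm: "r \<odot>\<^bsub>mod_quot M N\<^esub> (N +>\<^bsub>M\<^esub> x) = N +>\<^bsub>M\<^esub> (r \<odot>\<^bsub>M\<^esub> x)"
    if rx: "r \<in> carrier R" "x \<in> carrier M" for r x
  proof -
    have *: "N +>\<^bsub>M\<^esub> (r \<odot>\<^bsub>M\<^esub> y) = N +>\<^bsub>M\<^esub> (r \<odot>\<^bsub>M\<^esub> x)" if y: "y \<in> N +>\<^bsub>M\<^esub> x" for y
    proof -
      obtain h where h: "h \<in> N" "y = h \<oplus>\<^bsub>M\<^esub> x" using y by (auto simp: a_r_coset_def')
      have hM: "h \<in> carrier M" using h by auto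
      have "r \<odot>\<^bsub>M\<^esub> y = r \<odot>\<^bsub>M\<^esub> h \<oplus>\<^bsub>M\<^esub> r \<odot>\<^bsub>M\<^esub> x"
        using rx hM by (simp add: h(2) M.smult_r_distr)
      moreover have "r \<odot>\<^bsub>M\<^esub> h \<in> N" using h rx by (simp add: N.smult_closed)
      ultimately have "r \<odot>\<^bsub>M\<^esub> y \<in> N +>\<^bsub>M\<^esub> (r \<odot>\<^bsub>M\<^esub> x)" by (auto simp: a_r_coset_def')
      then show ?thesis
        using M.M.a_repr_independence[OF _ _ N.subgroup_axioms] M.smult_closed[OF rx] by simp
    qed
    have "x \<in> N +>\<^bsub>M\<^esub> x" using rx N'.a_rcos_self by blast
    then have "(\<Union>y\<in>N +>\<^bsub>M\<^esub> x. N +>\<^bsub>M\<^esub> (r \<odot>\<^bsub>M\<^esub> y)) = N +>\<^bsub>M\<^esub> (r \<odot>\<^bsub>M\<^esub> x)"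
      using * by (intro equalityI UN_least) blast+
    then show ?thesis by (simp add: mod_quot_def)
  qed
  have ad: "(N +>\<^bsub>M\<^esub> x) \<oplus>\<^bsub>mod_quot M N\<^esub> (N +>\<^bsub>M\<^esub> y) = N +>\<^bsub>M\<^esub> (x \<oplus>\<^bsub>M\<^esub> y)"
    if "x \<in> carrier M" "y \<in> carrier M" for x y
    using N'.a_rcos_sum[OF that] by (simp add: mod_quot_def)
  have car: "carrier (mod_quot M N) = {N +>\<^bsub>M\<^esub> x | x. x \<in> carrier M}"
    by (auto simp: mod_quot_def A_RCOSETS_def')
  have zz: "\<zero>\<^bsub>mod_quot M N\<^esub> = N +>\<^bsub>M\<^esub> \<zero>\<^bsub>M\<^esub>"
    using N'.a_rcos_const[OF N'.zero_closed] by (simp add: mod_quot_def)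
  have z: "\<zero>\<^bsub>mod_quot M N\<^esub> \<in> {N +>\<^bsub>M\<^esub> x | x. x \<in> carrier M}"
    using zz by auto
  have "abelian_group (mod_quot M N)"
  proof (rule abelian_groupI)
    show z: "\<zero>\<^bsub>mod_quot M N\<^esub> \<in> carrier (mod_quot M N)"
      using z by (auto simp: car)
    fix X assume "X \<in> carrier (mod_quot M N)"
    then obtain x where x: "x \<in> carrier M" "X = N +>\<^bsub>M\<^esub> x" by (auto simp: car)
    show "\<exists>y\<in>carrier (mod_quot M N). y \<oplus>\<^bsub>mod_quot M N\<^esub> X = \<zero>\<^bsub>mod_quot M N\<^esub>"
      by (rule bexI[of _ "N +>\<^bsub>M\<^esub> (\<ominus>\<^bsub>M\<^esub> x)"]) (use x in \<open>auto simp: car ad zz M.M.l_neg\<close>)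
    show "\<zero>\<^bsub>mod_quot M N\<^esub> \<oplus>\<^bsub>mod_quot M N\<^esub> X = X"
      using x by (simp add: zz ad)
    fix Y assume "Y \<in> carrier (mod_quot M N)"
    then obtain y where y: "y \<in> carrier M" "Y = N +>\<^bsub>M\<^esub> y" by (auto simp: car)
    show "X \<oplus>\<^bsub>mod_quot M N\<^esub> Y \<in> carrier (mod_quot M N)"
      using x y by (auto simp: ad car)
    show "X \<oplus>\<^bsub>mod_quot M N\<^esub> Y = Y \<oplus>\<^bsub>mod_quot M N\<^esub> X"
      using x y by (simp add: ad M.M.a_comm)
    fix Z assume "Z \<in> carrier (mod_quot M N)"
    then obtain z where z: "z \<in> carrier M" "Z = N +>\<^bsub>M\<^esub> z" by (auto simp: car)
    show "X \<oplus>\<^bsub>mod_quot M N\<^esub> Y \<oplus>\<^bsub>mod_quot M N\<^esub> Z = X \<oplus>\<^bsub>mod_quot M N\<^esub> (Y \<oplus>\<^bsub>mod_quot M N\<^esub> Z)"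
      using x y z by (simp add: ad M.M.a_assoc)
  qed
  show ?thesis
  proof (rule Module.moduleI)
    show "cring R" by (rule M.R.cring_axioms)
  next
    show "abelian_group (mod_quot M N)" by fact
  next
    fix X assume "X \<in> carrier (mod_quot M N)"
    then obtain x where "x \<in> carrier M" "X = N +>\<^bsub>M\<^esub> x" by (auto simp: car)
    then show "\<one>\<^bsub>R\<^esub> \<odot>\<^bsub>mod_quot M N\<^esub> X = X"
      by (simp add: sm)
  next
    fix r X assume r: "r \<in> carrier R" and "X \<in> carrier (mod_quot M N)"
    then obtain x where x: "x \<in> carrier M" "X = N +>\<^bsub>M\<^esub> x" by (auto simp: car)
    show "r \<odot>\<^bsub>mod_quot M N\<^esub> X \<in> carrier (mod_quot M N)"
      using r x by (auto simp: sm car)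
    fix t assume t: "t \<in> carrier R"
    show "(r \<oplus>\<^bsub>R\<^esub> t) \<odot>\<^bsub>mod_quot M N\<^esub> X = r \<odot>\<^bsub>mod_quot M N\<^esub> X \<oplus>\<^bsub>mod_quot M N\<^esub> t \<odot>\<^bsub>mod_quot M N\<^esub> X"
      using r t x by (simp add: sm ad M.smult_l_distr)
    show "(r \<otimes>\<^bsub>R\<^esub> t) \<odot>\<^bsub>mod_quot M N\<^esub> X = r \<odot>\<^bsub>mod_quot M N\<^esub> (t \<odot>\<^bsub>mod_quot M N\<^esub> X)"
      using r t x by (simp add: sm M.smult_assoc1)
  next
    fix r X Y
    assume r: "r \<in> carrier R" and "X \<in> carrier (mod_quot M N)" "Y \<in> carrier (mod_quot M N)"
    then obtain x y where "x \<in> carrier M" "X = N +>\<^bsub>M\<^esub> x" "y \<in> carrier M" "Y = N +>\<^bsub>M\<^esub> y"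
      by (auto simp: car)
    then show "r \<odot>\<^bsub>mod_quot M N\<^esub> (X \<oplus>\<^bsub>mod_quot M N\<^esub> Y) = r \<odot>\<^bsub>mod_quot M N\<^esub> X \<oplus>\<^bsub>mod_quot M N\<^esub> r \<odot>\<^bsub>mod_quot M N\<^esub> Y"
      using r by (simp add: sm ad M.smult_r_distr)
  qed
qed

definition mod_hom ::
    "('a, 'm) ring_scheme \<Rightarrow> ('a, 'b, 'c) module_scheme \<Rightarrow> ('a, 'd, 'e) module_scheme \<Rightarrow> ('b \<Rightarrow> 'd) set" where
  "mod_hom R M N = {h \<in> carrier M \<rightarrow> carrier N.
     (\<forall>x\<in>carrier M. \<forall>y\<in>carrier M. h (x \<oplus>\<^bsub>M\<^esub> y) = h x \<oplus>\<^bsub>N\<^esub> h y) \<and>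
     (\<forall>r\<in>carrier R. \<forall>x\<in>carrier M. h (r \<odot>\<^bsub>M\<^esub> x) = r \<odot>\<^bsub>N\<^esub> h x)}"

definition annihilator :: "('a, 'm) ring_scheme \<Rightarrow> ('a, 'b, 'c) module_scheme \<Rightarrow> 'a set" where
  "annihilator R M = {r \<in> carrier R. \<forall>x\<in>carrier M. r \<odot>\<^bsub>M\<^esub> x = \<zero>\<^bsub>M\<^esub>}"

definition krull_dim :: "('a, 'm) ring_scheme \<Rightarrow> enat" where
  "krull_dim R = Sup {enat l | l. \<exists>P :: nat \<Rightarrow> 'a set.
     (\<forall>i\<le>l. primeideal (P i) R) \<and> (\<forall>i<l. P i \<subset> P (Suc i))}"

definition mod_dim :: "('a, 'm) ring_scheme \<Rightarrow> ('a, 'b, 'c) module_scheme \<Rightarrow> enat" where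
  "mod_dim R M = krull_dim (R Quot (annihilator R M))"

definition regular_sequence ::
    "('a, 'm) ring_scheme \<Rightarrow> ('a, 'b, 'c) module_scheme \<Rightarrow> 'a list \<Rightarrow> bool" where
  "regular_sequence R M xs \<longleftrightarrow>
     set xs \<subseteq> carrier R \<and>
     (\<forall>i<length xs. \<forall>y\<in>carrier (mod_quot M (set_smult R (set (take i xs)) M)).
        (xs ! i) \<odot>\<^bsub>mod_quot M (set_smult R (set (take i xs)) M)\<^esub> y
          = \<zero>\<^bsub>mod_quot M (set_smult R (set (take i xs)) M)\<^esub>
        \<longrightarrow> y = \<zero>\<^bsub>mod_quot M (set_smult R (set (take i xs)) M)\<^esub>) \<and>
     set_smult R (set xs) M \<noteq> carrier M"

definition depth :: "('a, 'm) ring_scheme \<Rightarrow> 'a set \<Rightarrow> ('a, 'b, 'c) module_scheme \<Rightarrow> enat" where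
  "depth R \<mm> M = Sup {enat (length xs) | xs. set xs \<subseteq> \<mm> \<and> regular_sequence R M xs}"

text \<open>The next two notions are meant for finitely generated graded modules over a standard graded
  \<open>k\<close>-algebra \<open>R\<close> with graded maximal ideal \<open>\<mm>\<close>.  Both suprema above are \<open>0\<close> for the zero module;
  it does not occur as a quotient in a strict filtration.\<close>

definition cohen_macaulay :: "('a, 'm) ring_scheme \<Rightarrow> 'a set \<Rightarrow> ('a, 'b, 'c) module_scheme \<Rightarrow> bool" where
  "cohen_macaulay R \<mm> M \<longleftrightarrow> depth R \<mm> M = mod_dim R M"

text \<open>A grading on \<open>M\<close> is given by its homogeneous components \<open>G d\<close>, \<open>d \<in> \<int>\<close>.\<close>

definition graded_submodule ::
    "('a, 'm) ring_scheme \<Rightarrow> ('a, 'b, 'c) module_scheme \<Rightarrow> (int \<Rightarrow> 'b set) \<Rightarrow> 'b set \<Rightarrow> bool" where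
  "graded_submodule R M G N \<longleftrightarrow> submodule N R M \<and>
     (\<forall>x\<in>N. \<exists>D f. finite D \<and> (\<forall>d\<in>D. f d \<in> N \<inter> G d) \<and> x = (\<Oplus>\<^bsub>M\<^esub>d\<in>D. f d))"

definition sequentially_CM ::
    "('a, 'm) ring_scheme \<Rightarrow> 'a set \<Rightarrow> ('a, 'b, 'c) module_scheme \<Rightarrow> (int \<Rightarrow> 'b set) \<Rightarrow> bool" where
  "sequentially_CM R \<mm> M G \<longleftrightarrow>
     (\<exists>(r::nat) (N :: nat \<Rightarrow> 'b set).
        N 0 = {\<zero>\<^bsub>M\<^esub>} \<and> N r = carrier M \<and>
        (\<forall>i\<le>r. graded_submodule R M G (N i)) \<and>
        (\<forall>i<r. N i \<subset> N (Suc i) \<and>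
                cohen_macaulay R \<mm> (mod_quot (M\<lparr>carrier := N (Suc i)\<rparr>) (N i))) \<and>
        (\<forall>i. Suc i < r \<longrightarrow>
           mod_dim R (mod_quot (M\<lparr>carrier := N (Suc i)\<rparr>) (N i))
             < mod_dim R (mod_quot (M\<lparr>carrier := N (Suc (Suc i))\<rparr>) (N (Suc i)))))"

definition graded_hom ::
    "('a, 'm) ring_scheme \<Rightarrow> ('a, 'b, 'c) module_scheme \<Rightarrow> (int \<Rightarrow> 'b set) \<Rightarrow>
      ('a, 'd, 'e) module_scheme \<Rightarrow> (int \<Rightarrow> 'd set) \<Rightarrow> ('b \<Rightarrow> 'd) set" where
  "graded_hom R M G N H = {h \<in> mod_hom R M N. \<forall>d. h ` G d \<subseteq> H d}"


section \<open>The graded polynomial ring \<open>k[x\<^sub>1, \<dots>, x\<^sub>n]\<close>\<close>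

text \<open>Monomials are identified with their exponent vectors, so that \<open>+\<close> on monomials is the product.
  The order \<open>\<le>\<close> on \<open>nat \<Rightarrow>\<^sub>0 nat\<close> from \<open>Poly_Mapping\<close> compares exponents at the smallest index where
  they differ: it is the lexicographic order with \<open>x\<^sub>1 > x\<^sub>2 > \<dots>\<close>.\<close>

type_synonym mon = "nat \<Rightarrow>\<^sub>0 nat"

definition mdeg :: "mon \<Rightarrow> nat" where
  "mdeg m = (\<Sum>i\<in>Poly_Mapping.keys m. Poly_Mapping.lookup m i)"

definition poly_ring :: "nat \<Rightarrow> (mon \<Rightarrow>\<^sub>0 'k::field) ring" where
  "poly_ring n = \<lparr>carrier = {p. \<forall>m\<in>Poly_Mapping.keys p. Poly_Mapping.keys m \<subseteq> {1..n}},
     mult = (*), one = 1, zero = 0, add = (+)\<rparr>"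

lemma cring_poly_ring: "cring (poly_ring n :: (mon \<Rightarrow>\<^sub>0 'k::field) ring)"
proof (rule cringI)
  show "abelian_group (poly_ring n :: (mon \<Rightarrow>\<^sub>0 'k) ring)"
  proof (rule abelian_groupI)
    fix x y :: "mon \<Rightarrow>\<^sub>0 'k"
    assume "x \<in> carrier (poly_ring n)" "y \<in> carrier (poly_ring n)"
    then show "x \<oplus>\<^bsub>poly_ring n\<^esub> y \<in> carrier (poly_ring n)"
      using keys_add[of x y] by (force simp: poly_ring_def)
  next
    fix x :: "mon \<Rightarrow>\<^sub>0 'k" assume "x \<in> carrier (poly_ring n)"
    then show "\<exists>y\<in>carrier (poly_ring n). y \<oplus>\<^bsub>poly_ring n\<^esub> x = \<zero>\<^bsub>poly_ring n\<^esub>"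
      by (intro bexI[of _ "-x"]) (auto simp: poly_ring_def)
  qed (auto simp: poly_ring_def algebra_simps)
  show "Group.comm_monoid (poly_ring n :: (mon \<Rightarrow>\<^sub>0 'k) ring)"
  proof (rule comm_monoidI)
    fix x y :: "mon \<Rightarrow>\<^sub>0 'k"
    assume x: "x \<in> carrier (poly_ring n)" and y: "y \<in> carrier (poly_ring n)"
    show "x \<otimes>\<^bsub>poly_ring n\<^esub> y \<in> carrier (poly_ring n)"
      unfolding poly_ring_def
    proof (simp, intro ballI)
      fix m assume "m \<in> Poly_Mapping.keys (x * y)"
      then obtain a b where "m = a + b" "a \<in> Poly_Mapping.keys x" "b \<in> Poly_Mapping.keys y"
        using keys_mult[of x y] by blast
      then show "Poly_Mapping.keys m \<subseteq> {Suc 0..n}"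
        using x y keys_add[of a b] by (fastforce simp: poly_ring_def)
    qed
  qed (auto simp: poly_ring_def algebra_simps)
qed (auto simp: poly_ring_def algebra_simps)

definition poly_comp :: "nat \<Rightarrow> int \<Rightarrow> (mon \<Rightarrow>\<^sub>0 'k::field) set" where
  "poly_comp n d = {p \<in> carrier (poly_ring n). \<forall>m\<in>Poly_Mapping.keys p. int (mdeg m) = d}"

definition mon_ideal :: "nat \<Rightarrow> mon set \<Rightarrow> (mon \<Rightarrow>\<^sub>0 'k::field) set" where
  "mon_ideal n T = Idl\<^bsub>poly_ring n\<^esub> ((\<lambda>m. Poly_Mapping.single m 1) ` T)"

definition irrelevant_ideal :: "nat \<Rightarrow> (mon \<Rightarrow>\<^sub>0 'k::field) set" where
  "irrelevant_ideal n = mon_ideal n ((\<lambda>i. Poly_Mapping.single i 1) ` {1..n})"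

text \<open>The graded free module \<open>S(-a\<^sub>0) \<oplus> \<dots> \<oplus> S(-a\<^sub>b\<^sub>-\<^sub>1)\<close> for a list \<open>a\<close> of length \<open>b\<close>.\<close>

definition free_mod :: "nat \<Rightarrow> int list \<Rightarrow> ((mon \<Rightarrow>\<^sub>0 'k::field), nat \<Rightarrow> (mon \<Rightarrow>\<^sub>0 'k)) module" where
  "free_mod n a =
     \<lparr>carrier = {f. (\<forall>i<length a. f i \<in> carrier (poly_ring n)) \<and> (\<forall>i\<ge>length a. f i = 0)},
      mult = undefined, one = undefined, zero = (\<lambda>i. 0), add = (\<lambda>f g i. f i + g i),
      smult = (\<lambda>p f i. p * f i)\<rparr>"

lemma module_free_mod: "Module.module (poly_ring n) (free_mod n a :: (mon \<Rightarrow>\<^sub>0 'k::field, nat \<Rightarrow> mon \<Rightarrow>\<^sub>0 'k) module)"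
proof (rule Module.moduleI)
  interpret P: cring "poly_ring n :: (mon \<Rightarrow>\<^sub>0 'k::field) ring" by (rule cring_poly_ring)
  have add: "p + r \<in> carrier (poly_ring n)" and mult: "p * r \<in> carrier (poly_ring n)"
    if "p \<in> carrier (poly_ring n)" "r \<in> carrier (poly_ring n)" for p r :: "mon \<Rightarrow>\<^sub>0 'k"
    using P.a_closed[OF that] P.m_closed[OF that] by (auto simp: poly_ring_def)
  show "cring (poly_ring n :: (mon \<Rightarrow>\<^sub>0 'k::field) ring)" by (rule cring_poly_ring)
  show "abelian_group (free_mod n a :: (mon \<Rightarrow>\<^sub>0 'k::field, nat \<Rightarrow> mon \<Rightarrow>\<^sub>0 'k) module)"
  proof (rule abelian_groupI)
    fix x :: "nat \<Rightarrow> mon \<Rightarrow>\<^sub>0 'k" assume x: "x \<in> carrier (free_mod n a)"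
    show "\<exists>y\<in>carrier (free_mod n a). y \<oplus>\<^bsub>free_mod n a\<^esub> x = \<zero>\<^bsub>free_mod n a\<^esub>"
      by (rule bexI[of _ "\<lambda>i. - x i"]) (use x in \<open>auto simp: free_mod_def poly_ring_def\<close>)
  qed (auto simp: free_mod_def algebra_simps add, auto simp: poly_ring_def)
  show "r \<odot>\<^bsub>free_mod n a\<^esub> x \<in> carrier (free_mod n a)"
    if "r \<in> carrier (poly_ring n)" "x \<in> carrier (free_mod n a)" for r :: "mon \<Rightarrow>\<^sub>0 'k" and x
    using that mult by (auto simp: free_mod_def)
qed (auto simp: free_mod_def poly_ring_def algebra_simps)

definition free_comp :: "nat \<Rightarrow> int list \<Rightarrow> int \<Rightarrow> (nat \<Rightarrow> (mon \<Rightarrow>\<^sub>0 'k::field)) set" where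
  "free_comp n a d = {f \<in> carrier (free_mod n a). \<forall>i<length a. f i \<in> poly_comp n (d - a ! i)}"

text \<open>\<open>\<cdots> \<rightarrow> F\<^sub>1 \<rightarrow> F\<^sub>0 \<rightarrow> M \<rightarrow> 0\<close> with \<open>F\<^sub>i = free_mod n (a i)\<close>, augmentation \<open>e\<close> and
  differentials \<open>\<delta> i : F\<^sub>i\<^sub>+\<^sub>1 \<rightarrow> F\<^sub>i\<close>.\<close>

definition graded_free_resolution ::
    "nat \<Rightarrow> ((mon \<Rightarrow>\<^sub>0 'k::field), 'b, 'c) module_scheme \<Rightarrow> (int \<Rightarrow> 'b set) \<Rightarrow> (nat \<Rightarrow> int list) \<Rightarrow>
      ((nat \<Rightarrow> (mon \<Rightarrow>\<^sub>0 'k)) \<Rightarrow> 'b) \<Rightarrow> (nat \<Rightarrow> (nat \<Rightarrow> (mon \<Rightarrow>\<^sub>0 'k)) \<Rightarrow> (nat \<Rightarrow> (mon \<Rightarrow>\<^sub>0 'k))) \<Rightarrow> bool" where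
  "graded_free_resolution n M G a e \<delta> \<longleftrightarrow>
     e \<in> graded_hom (poly_ring n) (free_mod n (a 0)) (free_comp n (a 0)) M G \<and>
     e ` carrier (free_mod n (a 0)) = carrier M \<and>
     (\<forall>i. \<delta> i \<in> graded_hom (poly_ring n) (free_mod n (a (Suc i))) (free_comp n (a (Suc i)))
                   (free_mod n (a i)) (free_comp n (a i))) \<and>
     \<delta> 0 ` carrier (free_mod n (a 1)) = a_kernel (free_mod n (a 0)) M e \<and>
     (\<forall>i. \<delta> (Suc i) ` carrier (free_mod n (a (Suc (Suc i))))
            = a_kernel (free_mod n (a (Suc i))) (free_mod n (a i)) (\<delta> i))"

definition minimal_graded_free_resolution ::
    "nat \<Rightarrow> ((mon \<Rightarrow>\<^sub>0 'k::field), 'b, 'c) module_scheme \<Rightarrow> (int \<Rightarrow> 'b set) \<Rightarrow> (nat \<Rightarrow> int list) \<Rightarrow>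
      ((nat \<Rightarrow> (mon \<Rightarrow>\<^sub>0 'k)) \<Rightarrow> 'b) \<Rightarrow> (nat \<Rightarrow> (nat \<Rightarrow> (mon \<Rightarrow>\<^sub>0 'k)) \<Rightarrow> (nat \<Rightarrow> (mon \<Rightarrow>\<^sub>0 'k))) \<Rightarrow> bool" where
  "minimal_graded_free_resolution n M G a e \<delta> \<longleftrightarrow>
     graded_free_resolution n M G a e \<delta> \<and>
     (\<forall>i. \<delta> i ` carrier (free_mod n (a (Suc i)))
            \<subseteq> set_smult (poly_ring n) (irrelevant_ideal n) (free_mod n (a i)))"

definition ring_mod :: "nat \<Rightarrow> ((mon \<Rightarrow>\<^sub>0 'k::field), (mon \<Rightarrow>\<^sub>0 'k)) module" where
  "ring_mod n = \<lparr>carrier = carrier (poly_ring n),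
     mult = (*), one = 1, zero = 0, add = (+), smult = (*)\<rparr>"

lemma module_ring_mod: "Module.module (poly_ring n) (ring_mod n :: (mon \<Rightarrow>\<^sub>0 'k::field, mon \<Rightarrow>\<^sub>0 'k) module)"
proof -
  interpret P: cring "poly_ring n :: (mon \<Rightarrow>\<^sub>0 'k::field) ring" by (rule cring_poly_ring)
  have c: "carrier (ring_mod n) = carrier (poly_ring n)"
    and ops: "p \<oplus>\<^bsub>ring_mod n\<^esub> r = p \<oplus>\<^bsub>poly_ring n\<^esub> r" "p \<odot>\<^bsub>ring_mod n\<^esub> r = p \<otimes>\<^bsub>poly_ring n\<^esub> r"
      "\<zero>\<^bsub>ring_mod n\<^esub> = \<zero>\<^bsub>poly_ring n\<^esub>" for p r :: "mon \<Rightarrow>\<^sub>0 'k"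
    by (simp_all add: ring_mod_def poly_ring_def)
  have "abelian_group (ring_mod n :: (mon \<Rightarrow>\<^sub>0 'k::field, mon \<Rightarrow>\<^sub>0 'k) module)"
  proof (rule abelian_groupI)
    fix x :: "mon \<Rightarrow>\<^sub>0 'k" assume "x \<in> carrier (ring_mod n)"
    then show "\<exists>y\<in>carrier (ring_mod n). y \<oplus>\<^bsub>ring_mod n\<^esub> x = \<zero>\<^bsub>ring_mod n\<^esub>"
      unfolding c ops by (intro bexI[of _ "\<ominus>\<^bsub>poly_ring n\<^esub> x"] P.l_neg P.a_inv_closed)
  qed (simp_all add: c ops P.a_ac)
  then show ?thesis
    by (intro Module.moduleI cring_poly_ring) (simp_all add: c ops P.l_distr P.r_distr P.m_assoc)
qed

definition has_linear_resolution :: "nat \<Rightarrow> nat \<Rightarrow> (mon \<Rightarrow>\<^sub>0 'k::field) set \<Rightarrow> bool" where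
  "has_linear_resolution n d J \<longleftrightarrow>
     J = Idl\<^bsub>poly_ring n\<^esub> (J \<inter> poly_comp n (int d)) \<and>
     (\<exists>a e \<delta>. minimal_graded_free_resolution n
        ((ring_mod n)\<lparr>carrier := J\<rparr>) (\<lambda>c. J \<inter> poly_comp n c) a e \<delta> \<and>
        (\<forall>i. set (a i) \<subseteq> {int (d + i)}))"

definition sequentially_CM_ideal :: "nat \<Rightarrow> (mon \<Rightarrow>\<^sub>0 'k::field) set \<Rightarrow> bool" where
  "sequentially_CM_ideal n I \<longleftrightarrow>
     sequentially_CM (poly_ring n) (irrelevant_ideal n) (mod_quot (ring_mod n) I)
       (\<lambda>d. (\<lambda>p. I +>\<^bsub>ring_mod n\<^esub> p) ` poly_comp n d)"


section \<open>Squarefree lexsegments\<close>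

definition xmon :: "nat set \<Rightarrow> mon" where
  "xmon A = (\<Sum>i\<in>A. Poly_Mapping.single i 1)"

definition sf_mon :: "nat \<Rightarrow> nat \<Rightarrow> mon set" where
  "sf_mon n d = {m. Poly_Mapping.keys m \<subseteq> {1..n} \<and> (\<forall>i. Poly_Mapping.lookup m i \<le> 1) \<and> mdeg m = d}"

definition lexseg :: "nat \<Rightarrow> nat \<Rightarrow> mon \<Rightarrow> mon \<Rightarrow> mon set" where
  "lexseg n d u v = {w \<in> sf_mon n d. u \<ge> w \<and> w \<ge> v}"

definition init_lexseg :: "nat \<Rightarrow> nat \<Rightarrow> mon \<Rightarrow> mon set" where
  "init_lexseg n d v = {w \<in> sf_mon n d. w \<ge> v}"

definition final_lexseg :: "nat \<Rightarrow> nat \<Rightarrow> mon \<Rightarrow> mon set" where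
  "final_lexseg n d u = {w \<in> sf_mon n d. u \<ge> w}"

definition initial_sf_lexseg_ideal :: "nat \<Rightarrow> (mon \<Rightarrow>\<^sub>0 'k::field) set \<Rightarrow> bool" where
  "initial_sf_lexseg_ideal n I \<longleftrightarrow> (\<exists>d. \<exists>v\<in>sf_mon n d. I = mon_ideal n (init_lexseg n d v))"

definition final_sf_lexseg_ideal :: "nat \<Rightarrow> (mon \<Rightarrow>\<^sub>0 'k::field) set \<Rightarrow> bool" where
  "final_sf_lexseg_ideal n I \<longleftrightarrow> (\<exists>d. \<exists>u\<in>sf_mon n d. I = mon_ideal n (final_lexseg n d u))"

definition shad :: "nat \<Rightarrow> mon set \<Rightarrow> mon set" where
  "shad n T = {w + Poly_Mapping.single i 1 | w i. w \<in> T \<and> i \<in> {1..n} \<and> Poly_Mapping.lookup w i = 0}"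

text \<open>The empty set counts as a lexsegment, since iterated shadows vanish in degrees above \<open>n\<close>.\<close>

definition sf_lexseg_set :: "nat \<Rightarrow> nat \<Rightarrow> mon set \<Rightarrow> bool" where
  "sf_lexseg_set n d T \<longleftrightarrow> T = {} \<or> (\<exists>u\<in>sf_mon n d. \<exists>v\<in>sf_mon n d. T = lexseg n d u v)"

definition completely_sf_lexseg :: "nat \<Rightarrow> nat \<Rightarrow> mon set \<Rightarrow> bool" where
  "completely_sf_lexseg n d T \<longleftrightarrow> (\<forall>i. sf_lexseg_set n (d + i) ((shad n ^^ i) T))"

definition lex_succ :: "nat \<Rightarrow> mon \<Rightarrow> mon" where
  "lex_succ n m = Max {w \<in> sf_mon n (mdeg m). m > w}"

end

theory Submission
  imports Defs "HOL-Library.Function_Algebras"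
begin

text \<open>Let \<open>\<Delta>\<close> be the complex of \<open>I\<close> and \<open>\<Delta>'\<close> its part generated by faces of size at least \<open>q\<close>.
  Completeness makes the higher pure parts shifted, so \<open>I\<close> is sequentially Cohen--Macaulay iff
  \<open>\<Delta>'\<close> has depth \<open>q\<close>.  Now \<open>\<Delta>'\<close> is the union of a shifted complex \<open>D\<close> (faces below \<open>v\<close>) and the
  cone over a shifted complex \<open>\<Gamma>\<close> (faces above \<open>F\<close>), and the ideal in the theorem is the Alexander
  dual of \<open>X = D \<inter> \<Gamma>\<close>.  By Mayer--Vietoris \<open>\<Delta>'\<close> has depth \<open>q\<close> iff \<open>X\<close> has depth \<open>q - 1\<close>.  Instead of
  invoking the Eagon--Reiner theorem, depth of \<open>X\<close> and linearity of its dual are compared directly: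
  both obey the same gluing rules, which determine them for complexes such as \<open>X\<close> by induction.
  Depth is witnessed from below by the elementary symmetric polynomials, from above by Koszul
  homology.\<close>

text \<open>The field may be finite, so parameters cannot be taken as generic linear forms; the
  elementary symmetric polynomials of all variables serve every complex at once, over any field.
  That the same sequence is used on all pieces is also what allows regularity to be glued. The price
  is an asymmetry: regularity of a prescribed sequence is easily assembled from pieces, but not
  easily read off from a whole. Koszul homology has exact sequences in every direction and supplies
  the dismantling half. Hence there are two depth predicates, a strong one \<open>Th\<close> and a
  weak one \<open>Dep\<close>, with \<open>Th\<close> implying \<open>Dep\<close>. The way back is
  taken only for \<open>X\<close>, and only through \<open>Reg\<close>, which satisfies both kinds
  of rules on its own: \<open>Dep\<close> gives \<open>Reg\<close>, and \<open>Reg\<close> gives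
  \<open>Th\<close>. For this reason the rules are isolated in locales and the induction over
  lexsegment data is carried out once, for abstract predicates.\<close>

declare One_nat_def [simp del] (* keeps {1..n} from turning into {Suc 0..n} *)

type_synonym 'k pol = "mon \<Rightarrow>\<^sub>0 'k"

section \<open>Koszul complexes of subquotients\<close>

text \<open>A Koszul chain on the variables \<open>vs\<close> assigns a coefficient to each list of Booleans, read as the
  indicator of a subset of \<open>vs\<close>.  Subquotients \<open>N/K\<close> of an ambient module are never formed: cycles
  and boundaries are taken modulo \<open>K\<close>.\<close>

primrec kd :: "(nat \<Rightarrow> 'b \<Rightarrow> 'b) \<Rightarrow> nat list \<Rightarrow> (bool list \<Rightarrow> 'b) \<Rightarrow> bool list \<Rightarrow> 'b::ab_group_add" where
  "kd X [] c = (\<lambda>l. 0)"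
| "kd X (v # vs) c = (\<lambda>l. case l of [] \<Rightarrow> 0 | b # k \<Rightarrow>
     if b then - kd X vs (\<lambda>k. c (True # k)) k
     else kd X vs (\<lambda>k. c (False # k)) k + X v (c (True # k)))"

text \<open>The index \<open>t\<close> is the total degree: each of the \<open>j\<close> exterior
  generators has degree one, which leaves \<open>t - int j\<close> for the coefficients. Chains
  vanish on lists of the wrong shape, so equality of functions is equality of chains.\<close>

definition kch :: "(int \<Rightarrow> 'b set) \<Rightarrow> nat list \<Rightarrow> 'b set \<Rightarrow> nat \<Rightarrow> int \<Rightarrow> (bool list \<Rightarrow> 'b::ab_group_add) \<Rightarrow> bool" where
  "kch G vs N j t c \<longleftrightarrow> (\<forall>l. c l \<in> N \<inter> G (t - int j) \<and>
     (c l \<noteq> 0 \<longrightarrow> length l = length vs \<and> count_list l True = j))"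

text \<open>Stability under the listed variables is the only module structure demanded, so that the
  same homological lemmas apply to polynomials and to tuples of polynomials.\<close>

definition ksub :: "(nat \<Rightarrow> 'b \<Rightarrow> 'b) \<Rightarrow> nat list \<Rightarrow> 'b::ab_group_add set \<Rightarrow> bool" where
  "ksub X vs N \<longleftrightarrow> 0 \<in> N \<and> (\<forall>x\<in>N. \<forall>y\<in>N. x - y \<in> N) \<and> (\<forall>v\<in>set vs. \<forall>x\<in>N. X v x \<in> N)"

text \<open>For graded \<open>K \<subseteq> N\<close> and \<open>vs\<close> listing all variables,
  this is the vanishing of the degree \<open>t\<close> part of Tor_j between \<open>N/K\<close> and
  the residue field.\<close>

definition Hz :: "(nat \<Rightarrow> 'b \<Rightarrow> 'b::ab_group_add) \<Rightarrow> (int \<Rightarrow> 'b set) \<Rightarrow> nat list \<Rightarrow> 'b set \<Rightarrow> 'b set \<Rightarrow> nat \<Rightarrow> int \<Rightarrow> bool" where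
  "Hz X G vs N K j t \<longleftrightarrow> (\<forall>c. kch G vs N j t c \<and> (\<forall>l. kd X vs c l \<in> K) \<longrightarrow>
     (\<exists>g. kch G vs N (Suc j) t g \<and> (\<forall>l. c l - kd X vs g l \<in> K)))"

lemma HzD:
  assumes "Hz X G vs N K j t" "kch G vs N j t c" "\<And>l. kd X vs c l \<in> K"
  obtains g where "kch G vs N (Suc j) t g" "\<And>l. c l - kd X vs g l \<in> K" using assms unfolding Hz_def by blast

lemma HzI:
  assumes "\<And>c. kch G vs N j t c \<Longrightarrow> (\<And>l. kd X vs c l \<in> K) \<Longrightarrow>
     \<exists>g. kch G vs N (Suc j) t g \<and> (\<forall>l. c l - kd X vs g l \<in> K)"
  shows "Hz X G vs N K j t" using assms unfolding Hz_def by blast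

lemma ksub_0: "ksub X vs N \<Longrightarrow> 0 \<in> N"
  and ksub_diff: "ksub X vs N \<Longrightarrow> x \<in> N \<Longrightarrow> y \<in> N \<Longrightarrow> x - y \<in> N"
  and ksub_X: "ksub X vs N \<Longrightarrow> v \<in> set vs \<Longrightarrow> x \<in> N \<Longrightarrow> X v x \<in> N" by (auto simp: ksub_def)

lemma ksub_uminus: "ksub X vs N \<Longrightarrow> x \<in> N \<Longrightarrow> - x \<in> N" using ksub_diff[of X vs N 0 x] ksub_0[of X vs N] by simp

lemma ksub_add: "ksub X vs N \<Longrightarrow> x \<in> N \<Longrightarrow> y \<in> N \<Longrightarrow> x + y \<in> N"
  using ksub_diff[of X vs N x "- y"] ksub_uminus[of X vs N y] by simp

lemma ksub_tail: "ksub X (v # vs) N \<Longrightarrow> ksub X vs N" by (auto simp: ksub_def)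

lemma kd_mem: "ksub X vs K \<Longrightarrow> (\<And>l. c l \<in> K) \<Longrightarrow> kd X vs c l \<in> K"
proof (induction vs arbitrary: c l)
  case Nil then show ?case by (auto simp: ksub_0)
next case (Cons v vs)
  note t = ksub_tail[OF Cons.prems(1)]
  have "kd X vs (\<lambda>k. c (b # k)) k \<in> K" for b k by (rule Cons.IH[OF t]) (rule Cons.prems(2))
  then show ?case
    using Cons.prems by (auto split: list.split intro!: ksub_uminus ksub_add ksub_0 ksub_X[of X "v # vs"])
qed

lemma kch_mono: "kch G vs N j t c \<Longrightarrow> N \<subseteq> N' \<Longrightarrow> kch G vs N' j t c" unfolding kch_def by blast

lemma kch_restrict: "kch G vs N j t c \<Longrightarrow> (\<And>l. c l \<in> N') \<Longrightarrow> kch G vs N' j t c" unfolding kch_def by blast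

text \<open>No decomposition into homogeneous parts is required of \<open>G\<close>; the constant
  family \<open>UNIV\<close> is admissible and yields ungraded Koszul homology.\<close>

locale kmod =
  fixes X :: "nat \<Rightarrow> 'b::ab_group_add \<Rightarrow> 'b" and G :: "int \<Rightarrow> 'b set"
  assumes X_add: "X v (a + b) = X v a + X v b"
    and X_comm: "X v (X w a) = X w (X v a)"
    and G_0: "0 \<in> G d"
    and G_diff: "a \<in> G d \<Longrightarrow> b \<in> G d \<Longrightarrow> a - b \<in> G d"
    and G_X: "a \<in> G d \<Longrightarrow> X v a \<in> G (d + 1)"
begin

lemma X_0: "X v 0 = 0" using X_add[of v 0 0] by simp

lemma X_uminus: "X v (- a) = - X v a"
  using X_add[of v a "- a"] by (simp add: X_0 eq_neg_iff_add_eq_0 add.commute)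

lemma X_diff: "X v (a - b) = X v a - X v b" using X_add[of v a "- b"] by (simp add: X_uminus)

lemma G_uminus: "a \<in> G d \<Longrightarrow> - a \<in> G d" using G_diff[of 0 d a] G_0 by simp

lemma G_add: "a \<in> G d \<Longrightarrow> b \<in> G d \<Longrightarrow> a + b \<in> G d" using G_diff[of a d "- b"] G_uminus by simp

lemma kd_0: "kd X vs (\<lambda>l. 0) = (\<lambda>l. 0)" by (induction vs) (auto simp: X_0 fun_eq_iff split: list.split)

lemma kd_add: "kd X vs (\<lambda>l. a l + b l) l = kd X vs a l + kd X vs b l"
  by (induction vs arbitrary: a b l) (auto simp: X_add algebra_simps split: list.split)

lemma kd_uminus: "kd X vs (\<lambda>l. - a l) l = - kd X vs a l"
  by (induction vs arbitrary: a l) (auto simp: X_uminus algebra_simps split: list.split)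

lemma kd_diff: "kd X vs (\<lambda>l. a l - b l) l = kd X vs a l - kd X vs b l"
  using kd_add[of vs a "\<lambda>l. - b l" l] by (simp add: kd_uminus)

lemma kd_X: "kd X vs (\<lambda>l. X v (a l)) l = X v (kd X vs a l)"
  by (induction vs arbitrary: a l) (auto simp: X_add X_uminus X_0 X_comm[of v] split: list.split)

lemma kd_kd: "kd X vs (kd X vs c) l = 0"
proof (induction vs arbitrary: c l)
  case (Cons v vs) show ?case by (cases l) (auto simp: kd_add kd_uminus kd_X X_uminus Cons)
qed auto

text \<open>Splitting off the first variable exhibits the Koszul complex as the mapping cone of that
  variable on the complex of the others. For \<open>j = 0\<close> the component along the variable
  has to vanish, there being no chains of index -1.\<close>

lemma kch_Cons:
  "kch G (v # vs) N j t c \<longleftrightarrow> c [] \<in> N \<and> c [] = 0 \<and> kch G vs N j t (\<lambda>k. c (False # k)) \<and>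
     (case j of 0 \<Rightarrow> 0 \<in> N \<and> (\<forall>k. c (True # k) = 0) | Suc i \<Rightarrow> kch G vs N i (t - 1) (\<lambda>k. c (True # k)))"
    (is "?L \<longleftrightarrow> ?R")
proof
  assume L: ?L
  have "c (True # k) = 0" if "j = 0" for k using L that by (force simp: kch_def)
  moreover have "c [] = 0" using L by (force simp: kch_def)
  ultimately show ?R using L by (auto simp: kch_def split: nat.split) (smt (verit, ccfv_SIG))+
next
  assume R: ?R
  have F: "kch G vs N j t (\<lambda>k. c (False # k))" using R by simp
  show ?L unfolding kch_def
  proof (rule allI)
    fix l
    show "c l \<in> N \<inter> G (t - int j) \<and> (c l \<noteq> 0 \<longrightarrow> length l = length (v # vs) \<and> count_list l True = j)"
    proof (cases l)
      case Nil have "c [] \<in> N" "c [] = 0" using R by blast+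
      then show ?thesis using G_0[of "t - int j"] Nil by auto
    next case (Cons b k) show ?thesis
      proof (cases b)
        case False then show ?thesis using F[unfolded kch_def, rule_format, of k] Cons by simp
      next case True show ?thesis
        proof (cases j)
          case 0 then show ?thesis using R True Cons G_0 by simp
        next case (Suc i)
          then have "kch G vs N i (t - 1) (\<lambda>k. c (True # k))" using R by simp
          from this[unfolded kch_def, rule_format, of k] show ?thesis using Suc True Cons by (simp add: algebra_simps)
        qed
      qed
    qed
  qed
qed

lemma kch_diff: "kch G vs N j t a \<Longrightarrow> kch G vs N j t b \<Longrightarrow> ksub X ws N \<Longrightarrow> kch G vs N j t (\<lambda>l. a l - b l)"
  unfolding kch_def
proof (rule allI)
  fix l
  assume a: "\<forall>l. a l \<in> N \<inter> G (t - int j) \<and> (a l \<noteq> 0 \<longrightarrow> length l = length vs \<and> count_list l True = j)"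
    "\<forall>l. b l \<in> N \<inter> G (t - int j) \<and> (b l \<noteq> 0 \<longrightarrow> length l = length vs \<and> count_list l True = j)"
    and s: "ksub X ws N"
  have "a l - b l \<noteq> 0 \<Longrightarrow> a l \<noteq> 0 \<or> b l \<noteq> 0" by auto
  then show "a l - b l \<in> N \<inter> G (t - int j) \<and>
      (a l - b l \<noteq> 0 \<longrightarrow> length l = length vs \<and> count_list l True = j)" using a ksub_diff[OF s] G_diff by blast
qed

lemma kch_0: "ksub X ws N \<Longrightarrow> kch G vs N j t (\<lambda>l. 0)" unfolding kch_def by (auto simp: G_0 ksub_0)

lemma kch_uminus: "kch G vs N j t a \<Longrightarrow> ksub X ws N \<Longrightarrow> kch G vs N j t (\<lambda>l. - a l)"
  using kch_diff[OF kch_0, of ws N vs j t a] by simp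

lemma kch_add: "kch G vs N j t a \<Longrightarrow> kch G vs N j t b \<Longrightarrow> ksub X ws N \<Longrightarrow> kch G vs N j t (\<lambda>l. a l + b l)"
  using kch_diff[of vs N j t a "\<lambda>l. - b l"] kch_uminus by simp

lemma kch_X: "kch G vs N j t a \<Longrightarrow> ksub X ws N \<Longrightarrow> v \<in> set ws \<Longrightarrow> kch G vs N j (t + 1) (\<lambda>l. X v (a l))"
  unfolding kch_def
proof (rule allI)
  fix l
  assume a: "\<forall>l. a l \<in> N \<inter> G (t - int j) \<and> (a l \<noteq> 0 \<longrightarrow> length l = length vs \<and> count_list l True = j)"
    and s: "ksub X ws N" "v \<in> set ws"
  have "X v (a l) \<noteq> 0 \<Longrightarrow> a l \<noteq> 0" using X_0 by auto
  moreover have "X v (a l) \<in> G (t + 1 - int j)" using a G_X[of "a l" "t - int j" v] by (simp add: algebra_simps)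
  ultimately show "X v (a l) \<in> N \<inter> G (t + 1 - int j) \<and>
      (X v (a l) \<noteq> 0 \<longrightarrow> length l = length vs \<and> count_list l True = j)" using a ksub_X[OF s] by blast
qed

lemma kch_kd: "kch G vs N (Suc j) t c \<Longrightarrow> ksub X vs N \<Longrightarrow> kch G vs N j t (kd X vs c)"
proof (induction vs arbitrary: c j t)
  case Nil then show ?case by (auto simp: kch_def G_0 ksub_0)
next case (Cons v vs)
  note s = ksub_tail[OF Cons.prems(2)]
  have 0: "kch G vs N (Suc j) t (\<lambda>k. c (False # k))" and 1: "kch G vs N j (t - 1) (\<lambda>k. c (True # k))"
    using Cons.prems(1) by (auto simp: kch_Cons)
  have "kch G vs N j t (\<lambda>k. X v (c (True # k)))" using kch_X[OF 1 Cons.prems(2), of v] by simp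
  then have a: "kch G vs N j t (\<lambda>k. kd X vs (\<lambda>k. c (False # k)) k + X v (c (True # k)))"
    by (rule kch_add[OF Cons.IH[OF 0 s] _ s])
  have b: "kch G vs N i (t - 1) (\<lambda>k. - kd X vs (\<lambda>k. c (True # k)) k)" if "j = Suc i" for i
    by (rule kch_uminus[OF Cons.IH[OF _ s] s]) (use 1 that in simp)
  have z: "kd X vs (\<lambda>k. c (True # k)) k = 0" if j: "j = 0" for k
  proof -
    have "kch G vs N 0 (t - 1) (\<lambda>k. c (True # k))" using 1 j by simp
    moreover have "kch G vs N 0 t d \<Longrightarrow> kd X vs d k = 0" for d t k
    proof (induction vs arbitrary: d k t)
      case (Cons w ws)
      then have "kch G ws N 0 t (\<lambda>k. d (False # k))" "\<And>k. d (True # k) = 0" by (auto simp: kch_Cons)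
      then show ?case using Cons.IH by (auto simp: kd_0 X_0 split: list.split)
    qed auto
    ultimately show ?thesis by blast
  qed
  show ?case using a b z ksub_0[OF s] by (auto simp: kch_Cons split: nat.split)
qed

lemma kd_kch_0: "kch G vs N 0 t d \<Longrightarrow> kd X vs d k = 0"
proof (induction vs arbitrary: d k t)
  case (Cons w ws)
  then have "kch G ws N 0 t (\<lambda>k. d (False # k))" "\<And>k. d (True # k) = 0" by (auto simp: kch_Cons)
  then show ?case using Cons.IH by (auto simp: kd_0 X_0 split: list.split)
qed auto

subsection \<open>Long exact sequences\<close>

text \<open>Exactness in the middle of the long sequence of 0 -> L/K -> N/K -> N/L -> 0;
  \<open>Hz_sub\<close> and \<open>Hz_quot\<close> are exactness at the outer terms. Each is a chase
  on representatives in which \<open>kd_kd\<close> absorbs the corrections.\<close>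

lemma Hz_ext:
  assumes KL: "K \<subseteq> L" and LN: "L \<subseteq> N" and s: "ksub X vs N"
    and 1: "Hz X G vs L K j t" and 2: "Hz X G vs N L j t"
    and sL: "ksub X vs L" and sK: "ksub X vs K"
  shows "Hz X G vs N K j t"
proof (rule HzI)
  fix c assume c: "kch G vs N j t c" and dc: "\<And>l. kd X vs c l \<in> K"
  obtain g where g: "kch G vs N (Suc j) t g" "\<And>l. c l - kd X vs g l \<in> L" using HzD[OF 2 c] dc KL by blast
  let ?c = "\<lambda>l. c l - kd X vs g l"
  have "kch G vs L j t ?c" by (rule kch_restrict[OF kch_diff[OF c kch_kd[OF g(1) s] s]]) (rule g(2))
  moreover have "kd X vs ?c l \<in> K" for l using dc by (simp add: kd_diff kd_kd)
  ultimately obtain h where h: "kch G vs L (Suc j) t h" "\<And>l. ?c l - kd X vs h l \<in> K" by (rule HzD[OF 1]) blast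
  have "kch G vs N (Suc j) t (\<lambda>l. g l + h l)" by (rule kch_add[OF g(1) kch_mono[OF h(1) LN] s])
  moreover have "c l - kd X vs (\<lambda>l. g l + h l) l \<in> K" for l using h(2)[of l] by (simp add: kd_add algebra_simps)
  ultimately show "\<exists>g. kch G vs N (Suc j) t g \<and> (\<forall>l. c l - kd X vs g l \<in> K)" by blast
qed

lemma Hz_sub:
  assumes KL: "K \<subseteq> L" and LN: "L \<subseteq> N" and s: "ksub X vs N"
    and 1: "Hz X G vs N K j t" and 2: "Hz X G vs N L (Suc j) t"
    and sL: "ksub X vs L" and sK: "ksub X vs K"
  shows "Hz X G vs L K j t"
proof (rule HzI)
  fix c assume c: "kch G vs L j t c" and dc: "\<And>l. kd X vs c l \<in> K"
  obtain g where g: "kch G vs N (Suc j) t g" "\<And>l. c l - kd X vs g l \<in> K"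
    using HzD[OF 1 kch_mono[OF c LN]] dc by blast
  have "kd X vs g l \<in> L" for l
  proof -
    have "c l \<in> L" using c by (auto simp: kch_def)
    moreover have "c l - kd X vs g l \<in> L" using g(2) KL by blast
    ultimately show ?thesis using ksub_diff[OF sL, of "c l" "c l - kd X vs g l"] by simp
  qed
  then obtain h where h: "kch G vs N (Suc (Suc j)) t h" "\<And>l. g l - kd X vs h l \<in> L"
    using HzD[OF 2 g(1)] by blast
  have "kch G vs L (Suc j) t (\<lambda>l. g l - kd X vs h l)"
    by (rule kch_restrict[OF kch_diff[OF g(1) kch_kd[OF h(1) s] s]]) (rule h(2))
  moreover have "c l - kd X vs (\<lambda>l. g l - kd X vs h l) l \<in> K" for l
    using g(2)[of l] by (simp add: kd_diff kd_kd)
  ultimately show "\<exists>g. kch G vs L (Suc j) t g \<and> (\<forall>l. c l - kd X vs g l \<in> K)" by blast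
qed

text \<open>The connecting map lands in index \<open>j - 1\<close>. A chain of index 0 has zero
  boundary, so nothing has to be corrected there, which is why the condition on \<open>L\<close> is
  guarded.\<close>

lemma Hz_quot:
  assumes KL: "K \<subseteq> L" and LN: "L \<subseteq> N" and s: "ksub X vs N"
    and 1: "Hz X G vs N K j t" and 2: "j > 0 \<Longrightarrow> Hz X G vs L K (j - 1) t"
    and sL: "ksub X vs L" and sK: "ksub X vs K"
  shows "Hz X G vs N L j t"
proof (rule HzI)
  fix c assume c: "kch G vs N j t c" and dc: "\<And>l. kd X vs c l \<in> L"
  have "\<exists>g. kch G vs L j t g \<and> (\<forall>l. kd X vs c l - kd X vs g l \<in> K)"
  proof (cases j)
    case 0
    then have "kd X vs c l = 0" for l using kd_kch_0[of vs N t c] c by simp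
    then show ?thesis using kch_0[OF sL] ksub_0[OF sK] by (intro exI[of _ "\<lambda>l. 0"]) (auto simp: kd_0)
  next case (Suc i) have "kch G vs L i t (kd X vs c)"
      by (rule kch_restrict[OF kch_kd[OF _ s]]) (use c dc Suc in auto)
    then show ?thesis using HzD[OF 2, of "kd X vs c"] Suc ksub_0[OF sK] by (simp add: kd_kd) blast
  qed
  then obtain g where g: "kch G vs L j t g" "\<And>l. kd X vs c l - kd X vs g l \<in> K" by blast
  have "kch G vs N j t (\<lambda>l. c l - g l)" by (rule kch_diff[OF c kch_mono[OF g(1) LN] s])
  then obtain h where h: "kch G vs N (Suc j) t h" "\<And>l. (c l - g l) - kd X vs h l \<in> K"
    using HzD[OF 1, of "\<lambda>l. c l - g l"] g(2) by (auto simp: kd_diff)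
  have "c l - kd X vs h l \<in> L" for l
  proof -
    have "g l \<in> L" using g(1) by (auto simp: kch_def)
    moreover have "(c l - g l) - kd X vs h l \<in> L" using h(2) KL by blast
    ultimately have "(c l - g l) - kd X vs h l + g l \<in> L" by (intro ksub_add[OF sL])
    moreover have "(c l - g l) - kd X vs h l + g l = c l - kd X vs h l" by simp
    ultimately show ?thesis by metis
  qed
  then show "\<exists>g. kch G vs N (Suc j) t g \<and> (\<forall>l. c l - kd X vs g l \<in> L)" using h(1) by blast
qed

subsection \<open>The variables act trivially on Koszul homology\<close>

text \<open>Exterior multiplication by the basis vector of \<open>v\<close>; the sign comes from
  moving it past the basis vectors of earlier variables.\<close>

primrec ksh :: "nat \<Rightarrow> nat list \<Rightarrow> (bool list \<Rightarrow> 'b) \<Rightarrow> bool list \<Rightarrow> 'b" where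
  "ksh v [] c = (\<lambda>l. 0)"
| "ksh v (w # ws) c = (\<lambda>l. case l of [] \<Rightarrow> 0 | b # k \<Rightarrow>
     if w = v then (if b then c (False # k) else 0)
     else if b then - ksh v ws (\<lambda>k. c (True # k)) k else ksh v ws (\<lambda>k. c (False # k)) k)"

lemma ksh_add: "ksh v vs (\<lambda>l. a l + b l) l = ksh v vs a l + ksh v vs b l"
  by (induction vs arbitrary: a b l) (auto split: list.split)

lemma ksh_uminus: "ksh v vs (\<lambda>l. - b l) l = - ksh v vs b l"
  by (induction vs arbitrary: b l) (auto split: list.split)

lemma ksh_X: "ksh v vs (\<lambda>l. X w (b l)) l = X w (ksh v vs b l)"
  by (induction vs arbitrary: b l) (auto simp: X_uminus X_0 split: list.split)

lemma kch_ksh: "kch G vs N j t c \<Longrightarrow> ksub X ws N \<Longrightarrow> kch G vs N (Suc j) (t + 1) (ksh v vs c)"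
proof (induction vs arbitrary: c j t)
  case Nil then show ?case by (auto simp: kch_def G_0 ksub_0)
next case (Cons w vs) have 0: "kch G vs N j t (\<lambda>k. c (False # k))" using Cons.prems(1) by (auto simp: kch_Cons)
  show ?case
  proof (cases "w = v")
    case True then show ?thesis using 0 Cons.prems ksub_0 by (auto simp: kch_Cons kch_0 split: nat.split)
  next case False have "kch G vs N j t (\<lambda>k. - ksh v vs (\<lambda>k. c (True # k)) k)"
    proof (cases j)
      case 0
      then have "\<And>k. c (True # k) = 0" using Cons.prems(1) by (simp add: kch_Cons)
      moreover have "ksh v vs (\<lambda>k. 0) k = 0" for k using ksh_add[of v vs "\<lambda>k. 0" "\<lambda>k. 0" k] by simp
      ultimately show ?thesis using kch_0 Cons.prems by simp
    next case (Suc i)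
      then have "kch G vs N i (t - 1) (\<lambda>k. c (True # k))" using Cons.prems(1) by (simp add: kch_Cons)
      from kch_uminus[OF Cons.IH[OF this Cons.prems(2)] Cons.prems(2)] Suc show ?thesis by simp
    qed
    then show ?thesis using False Cons.IH[OF 0 Cons.prems(2)] ksub_0[OF Cons.prems(2)] by (auto simp: kch_Cons)
  qed
qed

lemma ksh_mem: "ksub X ws K \<Longrightarrow> (\<And>l. c l \<in> K) \<Longrightarrow> ksh v vs c l \<in> K"
  by (induction vs arbitrary: c l) (auto simp: ksub_0 ksub_uminus split: list.split)

text \<open>Leibniz rule: differentiating the product of a chain with the basis vector of
  \<open>v\<close> gives \<open>X v\<close> times the chain minus the product with its
  boundary.\<close>

lemma ksh_homotopy:
  assumes "v \<in> set vs" "length l = length vs"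
  shows "kd X vs (ksh v vs c) l + ksh v vs (kd X vs c) l = X v (c l)" using assms
proof (induction vs arbitrary: c l)
  case (Cons w vs)
  obtain b k where l: "l = b # k" "length k = length vs" using Cons.prems by (cases l) auto
  show ?case
  proof (cases "w = v")
    case True then show ?thesis using l by (auto simp: kd_0 X_0)
  next case False
    then have v: "v \<in> set vs" using Cons.prems by auto
    show ?thesis using l(1) False Cons.IH[OF v l(2), of "\<lambda>k. c (b # k)"]
      by (cases b) (auto simp: kd_uminus ksh_uminus ksh_add ksh_X X_uminus algebra_simps)
  qed
qed auto

lemma X_boundary:
  assumes s: "ksub X vs N" "ksub X vs K" and v: "v \<in> set vs"
    and c: "kch G vs N j t c" and dc: "\<And>l. kd X vs c l \<in> K"
  shows "\<exists>g. kch G vs N (Suc j) (t + 1) g \<and> (\<forall>l. X v (c l) - kd X vs g l \<in> K)"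
proof (intro exI[of _ "ksh v vs c"] conjI allI)
  show "kch G vs N (Suc j) (t + 1) (ksh v vs c)" by (rule kch_ksh[OF c s(1)])
  fix l
  show "X v (c l) - kd X vs (ksh v vs c) l \<in> K"
  proof (cases "length l = length vs")
    case True have "ksh v vs (kd X vs c) l \<in> K" by (rule ksh_mem[OF s(2)]) (rule dc)
    then show ?thesis using ksh_homotopy[OF v True, of c] by (metis add_diff_cancel_left')
  next case False have "kch G vs N j (t + 1) (kd X vs (ksh v vs c))" by (rule kch_kd[OF kch_ksh[OF c s(1)] s(1)])
    then have "c l = 0" "kd X vs (ksh v vs c) l = 0" using c False by (auto simp: kch_def)
    then show ?thesis using ksub_0[OF s(2)] by (simp add: X_0)
  qed
qed

text \<open>If the next variable is added, surjectivity of its action on homology together with a lower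
  bound on the degrees gives vanishing (a graded form of Nakayama's lemma).\<close>

lemma Hz_drop:
  assumes s: "ksub X (v # vs) N" "ksub X (v # vs) K"
    and H: "\<And>t. Hz X G (v # vs) N K j t" and low: "\<And>d. d < 0 \<Longrightarrow> N \<inter> G d = {0}"
  shows "Hz X G vs N K j t"
proof (rule HzI)
  note s' = s[THEN ksub_tail]
  fix c assume "kch G vs N j t c" and "\<And>l. kd X vs c l \<in> K"
  then show "\<exists>g. kch G vs N (Suc j) t g \<and> (\<forall>l. c l - kd X vs g l \<in> K)"
  proof (induction "nat (t - int j + 1)" arbitrary: t c rule: less_induct)
    case less
    note c = less.prems(1) and dc = less.prems(2)
    show ?case
    proof (cases "t - int j < 0")
      case True
      then have "c l = 0" for l using c low[of "t - int j"] unfolding kch_def by blast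
      then show ?thesis using kch_0[OF s'(1)] ksub_0[OF s'(2)] by (intro exI[of _ "\<lambda>l. 0"]) (auto simp: kd_0)
    next case False
      \<comment> \<open>\<open>c\<close> viewed as a chain not involving \<open>v\<close>. A
        bounding chain for it splits in two, and the part along \<open>v\<close> is a cycle one
        degree lower, to which the induction applies.\<close>
      define c' where "c' = (\<lambda>l. case l of [] \<Rightarrow> 0 | b # k \<Rightarrow> if b then 0 else c k)"
      have "kch G (v # vs) N j t c'" unfolding kch_Cons
        using c ksub_0[OF s'(1)] kch_0[OF s'(1)] by (auto simp: c'_def split: nat.split)
      moreover have "kd X (v # vs) c' l \<in> K" for l
        using dc ksub_0[OF s'(2)] by (auto simp: c'_def X_0 kd_0 split: list.split)
      ultimately obtain g where g: "kch G (v # vs) N (Suc j) t g"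
        "\<And>l. c' l - kd X (v # vs) g l \<in> K" by (rule HzD[OF H]) blast
      let ?g0 = "\<lambda>k. g (False # k)" and ?g1 = "\<lambda>k. g (True # k)"
      have g0: "kch G vs N (Suc j) t ?g0" and g1: "kch G vs N j (t - 1) ?g1" using g(1) by (auto simp: kch_Cons)
      have e0: "c k - (kd X vs ?g0 k + X v (?g1 k)) \<in> K" for k using g(2)[of "False # k"] by (simp add: c'_def)
      have e1: "kd X vs ?g1 k \<in> K" for k using g(2)[of "True # k"] by (simp add: c'_def)
      have "nat (t - 1 - int j + 1) < nat (t - int j + 1)" using False by simp
      from less.hyps[OF this g1 e1]
      obtain h where h: "kch G vs N (Suc j) (t - 1) h" "\<And>l. ?g1 l - kd X vs h l \<in> K" by blast
      have "kch G vs N (Suc j) t (\<lambda>l. X v (h l))" using kch_X[OF h(1) s(1), of v] by simp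
      from kch_add[OF g0 this s'(1)]
      have "kch G vs N (Suc j) t (\<lambda>l. ?g0 l + X v (h l))" .
      moreover have "c l - kd X vs (\<lambda>l. ?g0 l + X v (h l)) l \<in> K" for l
      proof -
        have "X v (?g1 l - kd X vs h l) \<in> K" using ksub_X[OF s(2) _ h(2)] by simp
        from ksub_add[OF s(2) e0[of l] this] show ?thesis by (simp add: kd_add kd_X X_diff algebra_simps)
      qed
      ultimately show ?thesis by blast
    qed
  qed
qed

text \<open>Leads to Koszul complexes on fewer variables at an unchanged index, where that index may
  become the top one.\<close>

lemma Hz_drop_list:
  assumes s: "ksub X (ws @ vs) N" "ksub X (ws @ vs) K"
    and H: "\<And>t. Hz X G (ws @ vs) N K j t" and low: "\<And>d. d < 0 \<Longrightarrow> N \<inter> G d = {0}"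
  shows "Hz X G vs N K j t" using s H
proof (induction ws arbitrary: t)
  case (Cons w ws)
  have "ksub X (ws @ vs) N" "ksub X (ws @ vs) K" using Cons.prems(1,2) by (auto intro: ksub_tail)
  moreover have "Hz X G (ws @ vs) N K j t" for t by (rule Hz_drop[where v = w]) (use Cons.prems low in auto)
  ultimately show ?case by (rule Cons.IH)
qed auto

text \<open>Top Koszul homology is the socle: \<open>y\<close> placed on the full subset is a cycle,
  and since there are no chains above it, it bounds only if it lies in \<open>K\<close>.\<close>

lemma Hz_top:
  assumes H: "Hz X G vs N K (length vs) t" and s: "ksub X vs N" "ksub X vs K"
    and y: "y \<in> N" "y \<in> G (t - int (length vs))" and X: "\<And>v. v \<in> set vs \<Longrightarrow> X v y \<in> K"
  shows "y \<in> K"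
proof -
  define c where "c = (\<lambda>l. if l = replicate (length vs) True then y else 0)"
  have cnt: "count_list (replicate m True) True = m" for m by (induction m) auto
  have "kch G vs N (length vs) t c" using y G_0 ksub_0[OF s(1)] by (auto simp: kch_def c_def cnt)
  moreover have "kd X vs c l \<in> K" for l using X unfolding c_def
  proof (induction vs arbitrary: l)
    case Nil then show ?case using ksub_0[OF s(2)] by simp
  next case (Cons v vs) have "(\<lambda>k. if True # k = replicate (length (v # vs)) True then y else 0)
       = (\<lambda>k. if k = replicate (length vs) True then y else 0)" by auto
    moreover have "kd X vs (\<lambda>k. if k = replicate (length vs) True then y else 0) k \<in> K" for k
      by (rule Cons.IH) (use Cons.prems in auto)
    ultimately show ?case using Cons.prems[of v] ksub_0[OF s(2)] ksub_uminus[OF s(2)]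
      by (auto simp: kd_0 X_0 split: list.split)
  qed
  ultimately obtain g where g: "kch G vs N (Suc (length vs)) t g" "\<And>l. c l - kd X vs g l \<in> K"
    by (rule HzD[OF H]) blast
  have "g l = 0" for l
  proof (rule ccontr)
    assume "g l \<noteq> 0"
    then have "length l = length vs" "count_list l True = Suc (length vs)"
      using g(1) unfolding kch_def by blast+
    then show False using count_le_length[of l True] by simp
  qed
  then have "g = (\<lambda>l. 0)" by auto
  then show ?thesis using g(2)[of "replicate (length vs) True"] by (simp add: c_def kd_0)
qed

lemma Hz_above: assumes "length vs < j" "ksub X vs N" "ksub X vs K" shows "Hz X G vs N K j t"
proof (rule HzI)
  fix c assume c: "kch G vs N j t c"
  have "c l = 0" for l
  proof (rule ccontr)
    assume "c l \<noteq> 0"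
    then have "length l = length vs" "count_list l True = j" using c unfolding kch_def by blast+
    then show False using count_le_length[of l True] assms by simp
  qed
  then show "\<exists>g. kch G vs N (Suc j) t g \<and> (\<forall>l. c l - kd X vs g l \<in> K)"
    using kch_0[OF assms(2)] ksub_0[OF assms(3)] by (intro exI[of _ "\<lambda>l. 0"]) (auto simp: kd_0)
qed

end

text \<open>\<open>\<phi>\<close> induces an isomorphism of \<open>N/K\<close> onto
  \<open>N'/K'\<close> raising degrees by \<open>\<delta>\<close>. Surjectivity is asked degree by
  degree and modulo \<open>K'\<close>, which is enough to lift chains one coefficient at a
  time.\<close>

lemma Hz_iso:
  fixes X :: "nat \<Rightarrow> 'b::ab_group_add \<Rightarrow> 'b" and X' :: "nat \<Rightarrow> 'c::ab_group_add \<Rightarrow> 'c"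
  assumes k: "kmod X G" and k': "kmod X' G'"
    and s: "ksub X vs N" "ksub X' vs N'" "ksub X' vs K'"
    and add: "\<And>x y. x \<in> N \<Longrightarrow> y \<in> N \<Longrightarrow> \<phi> (x + y) = \<phi> x + \<phi> y" and X: "\<And>v x. v \<in> set vs \<Longrightarrow> x \<in> N \<Longrightarrow> \<phi> (X v x) = X' v (\<phi> x)"
    and im: "\<And>d x. x \<in> N \<Longrightarrow> x \<in> G d \<Longrightarrow> \<phi> x \<in> N' \<inter> G' (d + \<delta>)"
    and surj: "\<And>d y. y \<in> N' \<Longrightarrow> y \<in> G' (d + \<delta>) \<Longrightarrow> \<exists>x. x \<in> N \<and> x \<in> G d \<and> y - \<phi> x \<in> K'"
    and inj: "\<And>x. x \<in> N \<Longrightarrow> \<phi> x \<in> K' \<longleftrightarrow> x \<in> K"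
  shows "Hz X G vs N K j t \<longleftrightarrow> Hz X' G' vs N' K' j (t + \<delta>)"
proof -
  interpret k: kmod X G by fact
  interpret k': kmod X' G' by fact
  have p0: "\<phi> 0 = 0" using add[of 0 0] ksub_0[OF s(1)] by simp
  have pm: "\<phi> (- x) = - \<phi> x" if "x \<in> N" for x
    using add[OF that ksub_uminus[OF s(1) that]] p0 by (simp add: eq_neg_iff_add_eq_0 add.commute)
  have pd: "\<phi> (x - y) = \<phi> x - \<phi> y" if "x \<in> N" "y \<in> N" for x y
    using add[OF that(1) ksub_uminus[OF s(1) that(2)]] pm[OF that(2)] by simp
  have kdN': "kd X ws c l \<in> N" if "\<And>l. c l \<in> N" "set ws \<subseteq> set vs" for c l ws
    by (rule kd_mem) (use that s(1) in \<open>auto simp: ksub_def\<close>)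
  have phi_kd: "\<phi> (kd X ws c l) = kd X' ws (\<lambda>l. \<phi> (c l)) l" if "\<And>l. c l \<in> N" "set ws \<subseteq> set vs" for c l ws
    using that
  proof (induction ws arbitrary: c l)
    case (Cons w ws) have "\<phi> (kd X ws (\<lambda>k. c (b # k)) k) = kd X' ws (\<lambda>k. \<phi> (c (b # k))) k" for b k
      by (rule Cons.IH) (use Cons.prems in auto)
    moreover have "kd X ws (\<lambda>k. c (b # k)) k \<in> N" for b k by (rule kdN') (use Cons.prems in auto)
    moreover have "X w (c k) \<in> N" for k using ksub_X[OF s(1)] Cons.prems by auto
    ultimately show ?case using Cons.prems by (auto simp: p0 pm add X split: list.split)
  qed (auto simp: p0)
  have kdN: "kd X vs c l \<in> N" if "\<And>l. c l \<in> N" for c l by (rule kdN') (use that in auto)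
  have kchp: "kch G' vs N' j (t + \<delta>) (\<lambda>l. \<phi> (c l))" if c: "kch G vs N j t c" for j c
  proof -
    have "\<phi> (c l) \<in> N' \<inter> G' (t + \<delta> - int j)" for l
      using c im[of "c l" "t - int j"] by (auto simp: kch_def algebra_simps)
    moreover have "\<phi> (c l) \<noteq> 0 \<Longrightarrow> c l \<noteq> 0" for l using p0 by auto
    ultimately show ?thesis using c unfolding kch_def by blast
  qed
  have lift: "\<exists>c. kch G vs N j t c \<and> (\<forall>l. c' l - \<phi> (c l) \<in> K')" if c': "kch G' vs N' j (t + \<delta>) c'" for j c'
  proof -
    \<comment> \<open>A zero coefficient must be lifted to zero, or the lift would violate the
      support condition on chains.\<close>
    have "\<exists>x. x \<in> N \<and> x \<in> G (t - int j) \<and> c' l - \<phi> x \<in> K' \<and> (x \<noteq> 0 \<longrightarrow> c' l \<noteq> 0)" for l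
    proof (cases "c' l = 0")
      case True then show ?thesis using ksub_0[OF s(1)] k.G_0 ksub_0[OF s(3)] p0 by (intro exI[of _ 0]) auto
    next case False have "c' l \<in> N'" "c' l \<in> G' (t - int j + \<delta>)" using c' by (auto simp: kch_def algebra_simps)
      from surj[OF this] False show ?thesis by blast
    qed
    then obtain c where c: "\<And>l. c l \<in> N \<and> c l \<in> G (t - int j) \<and> c' l - \<phi> (c l) \<in> K' \<and> (c l \<noteq> 0 \<longrightarrow> c' l \<noteq> 0)"
      by metis
    then have "kch G vs N j t c" using c' unfolding kch_def by blast
    then show ?thesis using c by blast
  qed
  show ?thesis
  proof
    assume H: "Hz X G vs N K j t"
    show "Hz X' G' vs N' K' j (t + \<delta>)"
    proof (rule HzI)
      fix c' assume c': "kch G' vs N' j (t + \<delta>) c'" and dc': "\<And>l. kd X' vs c' l \<in> K'"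
      obtain c where c: "kch G vs N j t c" "\<And>l. c' l - \<phi> (c l) \<in> K'" using lift[OF c'] by blast
      have cN: "c l \<in> N" for l using c(1) by (auto simp: kch_def)
      have "kd X vs c l \<in> K" for l
      proof -
        have "kd X' vs (\<lambda>l. c' l - \<phi> (c l)) l \<in> K'" by (rule kd_mem[OF s(3)]) (rule c(2))
        then have "kd X' vs c' l - \<phi> (kd X vs c l) \<in> K'" using phi_kd[where c = c and l = l and ws = vs, OF cN subset_refl] by (simp add: k'.kd_diff)
        then have "\<phi> (kd X vs c l) \<in> K'"
          using ksub_diff[OF s(3) dc'[of l]] by (metis diff_diff_eq2 add_diff_cancel_left')
        then show ?thesis using inj[OF kdN[where c = c, OF cN]] by simp
      qed
      then obtain g where g: "kch G vs N (Suc j) t g" "\<And>l. c l - kd X vs g l \<in> K" using HzD[OF H c(1)] by blast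
      have gN: "g l \<in> N" for l using g(1) by (auto simp: kch_def)
      have "c' l - kd X' vs (\<lambda>l. \<phi> (g l)) l \<in> K'" for l
      proof -
        have "c l - kd X vs g l \<in> N" by (intro ksub_diff[OF s(1)] cN kdN gN)
        then have "\<phi> (c l - kd X vs g l) \<in> K'" using inj g(2) by blast
        from ksub_add[OF s(3) c(2)[of l] this] show ?thesis using phi_kd[where c = g and l = l and ws = vs, OF gN subset_refl]
          by (simp add: pd[OF cN kdN[where c = g, OF gN]])
      qed
      then show "\<exists>g. kch G' vs N' (Suc j) (t + \<delta>) g \<and> (\<forall>l. c' l - kd X' vs g l \<in> K')"
        using kchp[OF g(1)] by blast
    qed
  next
    assume H: "Hz X' G' vs N' K' j (t + \<delta>)"
    show "Hz X G vs N K j t"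
    proof (rule HzI)
      fix c assume c: "kch G vs N j t c" and dc: "\<And>l. kd X vs c l \<in> K"
      have cN: "c l \<in> N" for l using c(1) by (auto simp: kch_def)
      have "kd X' vs (\<lambda>l. \<phi> (c l)) l \<in> K'" for l
        using phi_kd[where c = c and l = l and ws = vs, OF cN subset_refl] inj[OF kdN[where c = c, OF cN]] dc by metis
      then obtain g' where g': "kch G' vs N' (Suc j) (t + \<delta>) g'" "\<And>l. \<phi> (c l) - kd X' vs g' l \<in> K'"
        using HzD[OF H kchp[OF c]] by blast
      obtain g where g: "kch G vs N (Suc j) t g" "\<And>l. g' l - \<phi> (g l) \<in> K'" using lift[OF g'(1)] by blast
      have gN: "g l \<in> N" for l using g(1) by (auto simp: kch_def)
      have "c l - kd X vs g l \<in> K" for l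
      proof -
        have "kd X' vs (\<lambda>l. g' l - \<phi> (g l)) l \<in> K'" by (rule kd_mem[OF s(3)]) (rule g(2))
        from ksub_add[OF s(3) g'(2)[of l] this] have "\<phi> (c l - kd X vs g l) \<in> K'"
          using phi_kd[where c = g and l = l and ws = vs, OF gN subset_refl]
          by (simp add: k'.kd_diff pd[OF cN kdN[where c = g, OF gN]])
        moreover have "c l - kd X vs g l \<in> N" by (intro ksub_diff[OF s(1)] cN kdN gN)
        ultimately show ?thesis using inj by blast
      qed
      then show "\<exists>g. kch G vs N (Suc j) t g \<and> (\<forall>l. c l - kd X vs g l \<in> K)" using g(1) by blast
    qed
  qed
qed

section \<open>Simplicial complexes and gluing\<close>

definition cplx :: "nat \<Rightarrow> nat set set \<Rightarrow> bool" where
  "cplx n \<Delta> \<longleftrightarrow> (\<forall>T\<in>\<Delta>. T \<subseteq> {1..n} \<and> (\<forall>U\<subseteq>T. U \<in> \<Delta>))"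

definition cone :: "nat \<Rightarrow> nat set set \<Rightarrow> nat set set" where
  "cone c Z = {T. T - {c} \<in> Z}"

lemma cplx_sub: "cplx n \<Delta> \<Longrightarrow> T \<in> \<Delta> \<Longrightarrow> T \<subseteq> {1..n}"
  and cplx_down: "cplx n \<Delta> \<Longrightarrow> T \<in> \<Delta> \<Longrightarrow> U \<subseteq> T \<Longrightarrow> U \<in> \<Delta>" by (auto simp: cplx_def)

lemma cplx_fin: "cplx n \<Delta> \<Longrightarrow> T \<in> \<Delta> \<Longrightarrow> finite T" using cplx_sub finite_subset by (metis finite_atLeastAtMost)

lemma cplxI: "(\<And>T. T \<in> \<Delta> \<Longrightarrow> T \<subseteq> {1..n}) \<Longrightarrow> (\<And>T U. T \<in> \<Delta> \<Longrightarrow> U \<subseteq> T \<Longrightarrow> U \<in> \<Delta>) \<Longrightarrow> cplx n \<Delta>" by (auto simp: cplx_def)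

lemma cplx_Un: "cplx n A \<Longrightarrow> cplx n B \<Longrightarrow> cplx n (A \<union> B)"
  and cplx_Int: "cplx n A \<Longrightarrow> cplx n B \<Longrightarrow> cplx n (A \<inter> B)" by (auto simp: cplx_def)

lemma cplx_skel: "cplx n A \<Longrightarrow> cplx n {T \<in> A. card T \<le> d}" unfolding cplx_def
  by (auto intro: order_trans[OF card_mono] finite_subset[OF _ finite_atLeastAtMost])

lemma cplx_cone: "cplx n Z \<Longrightarrow> c \<in> {1..n} \<Longrightarrow> cplx n (cone c Z)"
proof (rule cplxI)
  fix T assume Z: "cplx n Z" "c \<in> {1..n}" and T: "T \<in> cone c Z"
  show "T \<subseteq> {1..n}" using cplx_sub[OF Z(1), of "T - {c}"] Z(2) T by (auto simp: cone_def)
  fix U assume "U \<subseteq> T"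
  then have "U - {c} \<subseteq> T - {c}" by auto
  then show "U \<in> cone c Z" using cplx_down[OF Z(1)] T by (auto simp: cone_def)
qed

lemma card_exchange: "finite B \<Longrightarrow> t \<in> B \<Longrightarrow> y \<notin> B \<Longrightarrow> card (insert y (B - {t})) = card B" by (cases "card B") auto

lemma pure_extend:
  assumes ext: "\<And>T. T \<in> \<Delta> \<Longrightarrow> card T < d \<Longrightarrow> \<exists>y. y \<notin> T \<and> insert y T \<in> \<Delta>"
    and fin: "\<And>T. T \<in> \<Delta> \<Longrightarrow> finite T" and T: "T \<in> \<Delta>" "card T \<le> d"
  shows "\<exists>B\<in>\<Delta>. T \<subseteq> B \<and> card B = d" using T
proof (induction "d - card T" arbitrary: T)
  case 0 then show ?case by auto
next case (Suc k)
  then have "card T < d" by linarith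
  then obtain y where y: "y \<notin> T" "insert y T \<in> \<Delta>" using ext Suc.prems(1) by blast
  have "card (insert y T) = Suc (card T)" using fin Suc.prems y by simp
  then have "\<exists>B\<in>\<Delta>. insert y T \<subseteq> B \<and> card B = d" using Suc y by (intro Suc.hyps(1)) auto
  then show ?case by blast
qed

text \<open>The rules are those of depth: \<open>glue\<close> is Mayer--Vietoris,
  \<open>cone\<close> adds one parameter, and the void complex has every depth because its ring is
  zero. The size bound in \<open>cone\<close> serves the elementary symmetric polynomials, the next
  of which must become a power of the apex variable.\<close>

locale glue_cone =
  fixes P :: "nat set set \<Rightarrow> nat \<Rightarrow> bool" and n :: nat
  assumes void: "P {} d"
    and base: "P {{}} 0"
    and glue: "cplx n A \<Longrightarrow> cplx n B \<Longrightarrow> P A (Suc d) \<Longrightarrow> P B (Suc d) \<Longrightarrow> P (A \<inter> B) d \<Longrightarrow> P (A \<union> B) (Suc d)"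
    and cone: "cplx n Z \<Longrightarrow> c \<in> {1..n} \<Longrightarrow> (\<And>T. T \<in> Z \<Longrightarrow> c \<notin> T \<and> card T \<le> d) \<Longrightarrow> P Z d \<Longrightarrow> P (cone c Z) (Suc d)"
begin

text \<open>A shifted pure complex is the union of the cone over the link of its smallest vertex and the
  pure part of the deletion; these meet in the codimension one skeleton of the latter.\<close>

lemma shifted:
  assumes "cplx n \<Delta>" "V \<subseteq> {1..n}" "\<And>T. T \<in> \<Delta> \<Longrightarrow> T \<subseteq> V" "\<And>T. T \<in> \<Delta> \<Longrightarrow> card T \<le> r"
    and "\<And>T. T \<in> \<Delta> \<Longrightarrow> \<exists>B\<in>\<Delta>. T \<subseteq> B \<and> card B = r"
    and "\<And>B t y. B \<in> \<Delta> \<Longrightarrow> card B = r \<Longrightarrow> t \<in> B \<Longrightarrow> y \<in> V - B \<Longrightarrow> (p y :: int) < p t \<Longrightarrow> insert y (B - {t}) \<in> \<Delta>"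
    and "inj_on p V"
  shows "P \<Delta> r" using assms
proof (induction "card V" arbitrary: V \<Delta> r rule: less_induct)
  case less
  note cx = less.prems(1) and V = less.prems(2) and sub = less.prems(3) and le = less.prems(4)
    and pure = less.prems(5) and shift = less.prems(6) and inj = less.prems(7)
  have finV: "finite V" using V finite_subset by blast
  have fin: "finite T" if "T \<in> \<Delta>" for T using sub[OF that] finV finite_subset by blast
  consider "\<Delta> = {}" | "\<Delta> \<noteq> {}" "r = 0" | d where "\<Delta> \<noteq> {}" "r = Suc d" by (cases r) auto
  then show ?case
  proof cases
    case 1 then show ?thesis by (simp add: void)
  next case 2 have "T = {}" if "T \<in> \<Delta>" for T using le[OF that] fin[OF that] 2 by auto
    then have "\<Delta> = {{}}" using 2 by auto
    then show ?thesis using 2 base by simp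
  next case (3 d)
    obtain B0 where "B0 \<in> \<Delta>" "card B0 = r" using 3 pure by blast
    then have "V \<noteq> {}" using sub 3 by fastforce
    \<comment> \<open>\<open>p\<close> only orders the vertices: \<open>int\<close> makes exchanges
      go to smaller vertices and its negative to larger ones, so one proof covers the complexes
      above \<open>F\<close> and those below \<open>v\<close>.\<close>
    define x where "x = arg_min_on p V"
    have x: "x \<in> V" "\<And>y. y \<in> V \<Longrightarrow> p x \<le> p y"
      using arg_min_if_finite[OF finV \<open>V \<noteq> {}\<close>, of p] unfolding x_def by force+
    have px: "p x < p y" if "y \<in> V - {x}" for y using x(2)[of y] that inj x(1) unfolding inj_on_def by force
    have x1: "x \<in> {1..n}" using x V by blast
    define V' where "V' = V - {x}"
    have card: "card V' < card V" unfolding V'_def using x(1) finV by (meson card_Diff1_less)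
    define L where "L = {T \<in> \<Delta>. x \<notin> T \<and> insert x T \<in> \<Delta>}"
    define D1 where "D1 = {T. \<exists>B\<in>\<Delta>. card B = r \<and> x \<notin> B \<and> T \<subseteq> B}"
    define M where "M = {T \<in> D1. card T \<le> d}"
    have inj': "inj_on p V'" using inj unfolding V'_def by (rule inj_on_subset) auto
    have D1D: "D1 \<subseteq> \<Delta>" unfolding D1_def using cplx_down[OF cx] by blast
    have cL: "cplx n L"
    proof (rule cplxI)
      fix T U assume "T \<in> L" "U \<subseteq> T"
      moreover have "insert x U \<subseteq> insert x T" using \<open>U \<subseteq> T\<close> by auto
      ultimately show "U \<in> L" unfolding L_def using cplx_down[OF cx] by blast
    qed (use cplx_sub[OF cx] in \<open>auto simp: L_def\<close>)
    have cD: "cplx n D1"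
    proof (rule cplxI)
      fix T U assume "T \<in> D1" "U \<subseteq> T"
      then show "U \<in> D1" unfolding D1_def by blast
    qed (use cplx_sub[OF cx] in \<open>auto simp: D1_def\<close>)
    have cM: "cplx n M" unfolding M_def by (rule cplx_skel[OF cD])
    have V'n: "V' \<subseteq> {1..n}" using V V'_def by auto
    have PL: "P L d"
    proof (rule less.hyps[OF card cL V'n])
      fix T assume T: "T \<in> L"
      show "T \<subseteq> V'" using T sub by (auto simp: L_def V'_def)
      have "card (insert x T) \<le> r" using T le by (auto simp: L_def)
      then show "card T \<le> d" using T fin 3 by (auto simp: L_def)
      obtain B where B: "B \<in> \<Delta>" "insert x T \<subseteq> B" "card B = r" using T pure unfolding L_def by blast
      then have "B - {x} \<in> L" "T \<subseteq> B - {x}" "card (B - {x}) = d"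
        using T 3 cplx_down[OF cx, of B] fin[OF B(1)] by (auto simp: L_def insert_absorb)
      then show "\<exists>B\<in>L. T \<subseteq> B \<and> card B = d" by blast
    next
      fix B t y assume B: "B \<in> L" "card B = d" "t \<in> B" "y \<in> V' - B" "p y < p t"
      have "insert x B \<in> \<Delta>" "card (insert x B) = r" using B fin 3 by (auto simp: L_def)
      then have *: "insert y (insert x B - {t}) \<in> \<Delta>" by (rule shift) (use B in \<open>auto simp: V'_def\<close>)
      have "insert y (insert x B - {t}) = insert x (insert y (B - {t}))" using B by (auto simp: L_def)
      with * have **: "insert x (insert y (B - {t})) \<in> \<Delta>" by metis
      then have "insert y (B - {t}) \<in> \<Delta>" using cplx_down[OF cx] by blast
      then show "insert y (B - {t}) \<in> L" using ** B by (auto simp: L_def V'_def)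
    qed (rule inj')
    have PD: "P D1 r"
    proof (rule less.hyps[OF card cD V'n])
      fix T assume T: "T \<in> D1"
      show "T \<subseteq> V'" using T sub by (auto simp: D1_def V'_def)
      show "card T \<le> r" using T D1D le by blast
      show "\<exists>B\<in>D1. T \<subseteq> B \<and> card B = r" using T unfolding D1_def by blast
    next
      fix B t y assume B: "B \<in> D1" "card B = r" "t \<in> B" "y \<in> V' - B" "p y < p t"
      have "insert y (B - {t}) \<in> \<Delta>" by (rule shift) (use B D1D in \<open>auto simp: V'_def\<close>)
      moreover have "card (insert y (B - {t})) = r"
        using card_exchange[of B t y] B fin[of B] D1D by (metis DiffD2 subsetD)
      moreover have "x \<notin> B" using B(1,2) fin unfolding D1_def by (auto simp: card_subset_eq)
      ultimately show "insert y (B - {t}) \<in> D1" using B unfolding D1_def V'_def by auto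
    qed (rule inj')
    have PM: "P M d"
    proof (rule less.hyps[OF card cM V'n])
      fix T assume T: "T \<in> M"
      show "T \<subseteq> V'" using T sub by (auto simp: M_def D1_def V'_def)
      show "card T \<le> d" using T by (simp add: M_def)
      obtain B where B: "B \<in> \<Delta>" "card B = r" "x \<notin> B" "T \<subseteq> B" using T unfolding M_def D1_def by blast
      obtain C where C: "T \<subseteq> C" "C \<subseteq> B" "card C = d"
        using exists_subset_between[of T d B] B 3 T fin[OF B(1)] by (auto simp: M_def)
      then show "\<exists>B\<in>M. T \<subseteq> B \<and> card B = d" using B unfolding M_def D1_def by auto
    next
      fix C t y assume C: "C \<in> M" "card C = d" "t \<in> C" "y \<in> V' - C" "p y < p t"
      obtain B where B: "B \<in> \<Delta>" "card B = r" "x \<notin> B" "C \<subseteq> B" using C unfolding M_def D1_def by blast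
      have cd: "card (insert y (C - {t})) = d"
        using card_exchange[of C t y] C B fin[of B] finite_subset[of C B] by blast
      show "insert y (C - {t}) \<in> M"
      proof (cases "y \<in> B")
        case True
        then have "insert y (C - {t}) \<subseteq> B" using B by auto
        then show ?thesis using B cd unfolding M_def D1_def by auto
      next case False have "insert y (B - {t}) \<in> \<Delta>" by (rule shift) (use B C False in \<open>auto simp: V'_def\<close>)
        moreover have "card (insert y (B - {t})) = r" using card_exchange[of B t y] B C fin[of B] False by blast
        moreover have "x \<notin> insert y (B - {t})" using B C by (auto simp: V'_def)
        moreover have "insert y (C - {t}) \<subseteq> insert y (B - {t})" using B by auto
        ultimately show ?thesis using cd unfolding M_def D1_def by blast
      qed
    qed (rule inj')
    have *: "cone x L \<inter> D1 = M"
    proof (intro equalityI subsetI)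
      fix T assume T: "T \<in> cone x L \<inter> D1"
      then have "x \<notin> T" by (auto simp: D1_def)
      then have "T \<in> L" using T by (simp add: cone_def)
      then have "card (insert x T) \<le> r" "finite T" using le[of "insert x T"] fin[of T] by (simp_all add: L_def)
      then show "T \<in> M" using T \<open>x \<notin> T\<close> 3 by (simp add: M_def)
    next
      fix T assume T: "T \<in> M"
      obtain B where B: "B \<in> \<Delta>" "card B = r" "x \<notin> B" "T \<subseteq> B" using T unfolding M_def D1_def by blast
      \<comment> \<open>A face of size at most \<open>d\<close> leaves room in \<open>B\<close>: a
        vertex outside \<open>T\<close> can be exchanged for the minimal vertex \<open>x\<close>,
        which puts \<open>T\<close> into the link.\<close>
      have "T \<noteq> B" using T B 3 by (auto simp: M_def)
      then obtain t where t: "t \<in> B" "t \<notin> T" using B by blast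
      have "insert x (B - {t}) \<in> \<Delta>" using B t sub px x(1) by (intro shift) auto
      moreover have "insert x T \<subseteq> insert x (B - {t})" using B t by auto
      ultimately have "insert x T \<in> \<Delta>" using cplx_down[OF cx] by blast
      then have "T \<in> L" "x \<notin> T" using B cplx_down[OF cx] by (auto simp: L_def)
      then show "T \<in> cone x L \<inter> D1" using T by (simp add: cone_def M_def)
    qed
    have "cone x L \<union> D1 = \<Delta>"
    proof (intro equalityI subsetI)
      fix T assume T: "T \<in> cone x L \<union> D1"
      show "T \<in> \<Delta>"
      proof (cases "T \<in> D1")
        case True then show ?thesis using D1D by blast
      next case False
        then have "insert x (T - {x}) \<in> \<Delta>" using T by (auto simp: cone_def L_def)
        then show ?thesis using cplx_down[OF cx] by blast
      qed
    next
      fix T assume T: "T \<in> \<Delta>"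
      obtain B where B: "B \<in> \<Delta>" "T \<subseteq> B" "card B = r" using pure[OF T] by blast
      show "T \<in> cone x L \<union> D1"
      proof (cases "x \<in> B")
        case True have "insert x (T - {x}) \<in> \<Delta>" by (rule cplx_down[OF cx B(1)]) (use True B in auto)
        moreover have "T - {x} \<in> \<Delta>" by (rule cplx_down[OF cx T]) auto
        ultimately show ?thesis by (auto simp: cone_def L_def)
      next case False then show ?thesis using B unfolding D1_def by blast
      qed
    qed
    moreover have "P (cone x L) (Suc d)"
    proof (rule cone[OF cL x1 _ PL])
      fix T assume T: "T \<in> L"
      then have "card (insert x T) \<le> r" "finite T" using le[of "insert x T"] fin[of T] by (simp_all add: L_def)
      then show "x \<notin> T \<and> card T \<le> d" using T 3 by (auto simp: L_def)
    qed
    ultimately show ?thesis using glue[OF cplx_cone[OF cL x1] cD, of d] PD PM * 3 by simp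
  qed
qed

end

section \<open>Complexes of lexsegments\<close>

text \<open>\<open>Dc n v\<close> is generated by the sets \<open>{j\<^sub>1, \<dots>, j\<^sub>t\<^sub>-\<^sub>1} \<union> {j\<^sub>t + 1, \<dots>, n}\<close> of size at least \<open>q\<close>,
  where \<open>v = [j\<^sub>1, \<dots>, j\<^sub>q]\<close>; its faces of size \<open>q\<close> are the sets below \<open>v\<close>.  The facets of
  \<open>Gc n c F\<close> are the sets above \<open>F\<close> among the subsets of \<open>{c + 1, \<dots>, n}\<close> of the same size.\<close>

primrec Dc :: "nat \<Rightarrow> nat list \<Rightarrow> nat set set" where
  "Dc n [] = {}"
| "Dc n (b # v) = (if b + length (b # v) \<le> n
     then {T. T \<subseteq> {b..n} \<and> (b \<in> T \<longrightarrow> T - {b} \<in> Dc n v)} else {})"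

primrec Gc :: "nat \<Rightarrow> nat \<Rightarrow> nat list \<Rightarrow> nat set set" where
  "Gc n c [] = {}"
| "Gc n c (x # F) = {T. T \<subseteq> {c<..n} \<and> card T \<le> length (x # F) \<and>
     ((\<exists>y\<in>T. y < x) \<or> c + 1 < x \<and> card T < length (x # F) \<or> T - {x} \<in> Gc n x F)}"

lemma Dc_gt: "T \<in> Dc n v \<Longrightarrow> (\<And>z. z \<in> set v \<Longrightarrow> w < z) \<Longrightarrow> T \<subseteq> {w<..n}"
proof (cases v)
  case (Cons b v')
  assume T: "T \<in> Dc n v" and w: "\<And>z. z \<in> set v \<Longrightarrow> w < z"
  then have "T \<subseteq> {b..n}" "w < b" by (simp_all add: Cons split: if_splits)
  then show ?thesis by auto
qed simp

lemma Dc_cplx: "(\<And>z. z \<in> set v \<Longrightarrow> 1 \<le> z) \<Longrightarrow> cplx n (Dc n v)"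
proof (rule cplxI)
  fix T assume v: "\<And>z. z \<in> set v \<Longrightarrow> 1 \<le> z" and T: "T \<in> Dc n v"
  show "T \<subseteq> {1..n}" using Dc_gt[OF T, of 0] v by force
  fix U assume "U \<subseteq> T"
  with T show "U \<in> Dc n v"
  proof (induction v arbitrary: T U)
    case (Cons b v) have "U - {b} \<subseteq> T - {b}" using Cons.prems by auto
    then have "b \<in> U \<Longrightarrow> U - {b} \<in> Dc n v" using Cons by (auto split: if_splits)
    then show ?case using Cons.prems by (auto split: if_splits)
  qed auto
qed

lemma Dc_shift:
  "T \<in> Dc n v \<Longrightarrow> t \<in> T \<Longrightarrow> y \<notin> T \<Longrightarrow> t < y \<Longrightarrow> y \<le> n \<Longrightarrow> insert y (T - {t}) \<in> Dc n v"
proof (induction v arbitrary: T)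
  case (Cons b v) have "insert y (T - {t}) - {b} \<in> Dc n v" if b: "b \<in> insert y (T - {t})"
  proof -
    have "b \<in> T" "b \<noteq> t" using b Cons.prems by (auto split: if_splits)
    moreover have "insert y (T - {b} - {t}) \<in> Dc n v"
      using Cons.prems calculation by (intro Cons.IH) (auto split: if_splits)
    moreover have "insert y (T - {b} - {t}) = insert y (T - {t}) - {b}" using calculation Cons.prems by auto
    ultimately show ?thesis by metis
  qed
  then show ?case using Cons.prems by (auto split: if_splits)
qed auto

text \<open>If the first entry \<open>b\<close> is absent from \<open>T\<close>, the condition
  \<open>b + length (b # v) \<le> n\<close> leaves a free vertex above \<open>b\<close>; otherwise
  the recursion applies. Purity of the skeleta rests on this.\<close>

lemma Dc_extend:
  assumes "sorted_wrt (<) v" "T \<in> Dc n v" "card T < length v"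
  shows "\<exists>y. y \<notin> T \<and> insert y T \<in> Dc n v" using assms
proof (induction v arbitrary: T)
  case (Cons b v) have n: "b + length (b # v) \<le> n" and T: "T \<subseteq> {b..n}" "b \<in> T \<Longrightarrow> T - {b} \<in> Dc n v"
    using Cons.prems by (auto split: if_splits)
  have finT: "finite T" using T finite_subset by blast
  show ?case
  proof (cases "b \<in> T")
    case False have "\<not> {b<..n} \<subseteq> T"
    proof
      assume "{b<..n} \<subseteq> T"
      then have "card {b<..n} \<le> card T" using finT card_mono by blast
      then show False using n Cons.prems by simp
    qed
    then obtain y where "y \<in> {b<..n}" "y \<notin> T" by blast
    then show ?thesis using n T False by (intro exI[of _ y]) auto
  next case True have "card (T - {b}) < length v" using True finT Cons.prems(3)
      by (metis Suc_less_eq card.remove length_Cons)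
    then obtain y where y: "y \<notin> T - {b}" "insert y (T - {b}) \<in> Dc n v"
      using Cons.IH[OF _ T(2)[OF True]] Cons.prems(1) by auto
    then have "y > b" "y \<le> n" using Dc_gt[OF y(2), of b] Cons.prems(1) by auto
    moreover have "insert y T - {b} = insert y (T - {b})" using \<open>y > b\<close> by auto
    ultimately show ?thesis using y T n True by (intro exI[of _ y]) auto
  qed
qed auto

text \<open>The whole complex need not be pure, but its skeleta up to \<open>length v\<close> are,
  and they are closed under exchanges toward larger vertices.\<close>

lemma (in glue_cone) Dc_skel:
  assumes v: "sorted_wrt (<) v" "set v \<subseteq> {1..n}" and e: "e \<le> length v"
  shows "P {T \<in> Dc n v. card T \<le> e} e"
proof (rule shifted[where V = "{1..n}" and p = "\<lambda>x. - int x"])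
  have cx: "cplx n (Dc n v)" by (rule Dc_cplx) (use v in auto)
  show "cplx n {T \<in> Dc n v. card T \<le> e}" by (rule cplx_skel[OF cx])
  fix T assume T: "T \<in> {T \<in> Dc n v. card T \<le> e}"
  show "T \<subseteq> {1..n}" "card T \<le> e" using T cplx_sub[OF cx] by auto
  have "\<exists>B\<in>Dc n v. T \<subseteq> B \<and> card B = e"
    by (rule pure_extend) (use T Dc_extend[OF v(1)] cplx_fin[OF cx] e in auto)
  then show "\<exists>B\<in>{T \<in> Dc n v. card T \<le> e}. T \<subseteq> B \<and> card B = e" by auto
next
  fix B t y assume B: "B \<in> {T \<in> Dc n v. card T \<le> e}" "card B = e" "t \<in> B" "y \<in> {1..n} - B" "- int y < - int t"
  have "finite B" using B Dc_cplx[of v n] v cplx_fin by fastforce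
  then show "insert y (B - {t}) \<in> {T \<in> Dc n v. card T \<le> e}"
    using B card_exchange[of B t y] Dc_shift[of B n v t y] by simp
qed (auto simp: inj_on_def)

section \<open>Complexes of the sets above F\<close>

lemma Gc_sub: "T \<in> Gc n c F \<Longrightarrow> T \<subseteq> {c<..n}"
  and Gc_card: "T \<in> Gc n c F \<Longrightarrow> card T \<le> length F" by (cases F; simp)+

lemma Gc_cplx: "cplx n (Gc n c F)"
proof (rule cplxI)
  fix T assume T: "T \<in> Gc n c F"
  show "T \<subseteq> {1..n}" using Gc_sub[OF T] by auto
  fix U assume "U \<subseteq> T"
  with T show "U \<in> Gc n c F"
  proof (induction F arbitrary: c T U)
    case (Cons x F) have fin: "finite T" using Gc_sub[OF Cons.prems(1)] finite_subset by blast
    have U: "U \<subseteq> {c<..n}" "card U \<le> card T" using Gc_sub[OF Cons.prems(1)] Cons.prems(2) card_mono[OF fin] by auto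
    have sub: "U - {x} \<subseteq> T - {x}" using Cons.prems by auto
    consider y where "y \<in> T" "y < x" "y \<in> U" | y where "y \<in> T" "y < x" "y \<notin> U"
      | "c + 1 < x" "card T < length (x # F)" | "T - {x} \<in> Gc n x F" using Cons.prems by auto
    then show ?case
    proof cases
      case (2 y)
      then have "card U < card T" "c < y" using Cons.prems fin Gc_sub[OF Cons.prems(1)]
        by (auto intro!: psubset_card_mono)
      then show ?thesis using U 2 Cons.prems by auto
    next case 4 then show ?thesis using Cons.IH[OF 4 sub] U Cons.prems by auto
    qed (use U Cons.prems in auto)
  qed auto
qed

lemma sorted_wrt_Cons_ge: "sorted_wrt (<) (x # F) \<Longrightarrow> set (x # F) \<subseteq> {c<..n} \<Longrightarrow> set F \<subseteq> {x<..n} \<and> sorted_wrt (<) F \<and> c < x \<and> x \<le> n"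
  by auto

lemma length_sorted: "sorted_wrt (<) F \<Longrightarrow> set F \<subseteq> {c<..n} \<Longrightarrow> length F \<le> n - (c::nat)"
  using card_mono[of "{c<..n}" "set F"] distinct_card[of F] strict_sorted_iff[of F] by simp

text \<open>The middle clause in \<open>Gc\<close> describes sets that can still be completed using
  the vertex \<open>c + 1\<close>, which lies before \<open>x\<close>; after that insertion the
  first clause applies.\<close>

lemma Gc_pure:
  assumes "sorted_wrt (<) F" "set F \<subseteq> {c<..n}" "T \<in> Gc n c F"
  shows "\<exists>B\<in>Gc n c F. T \<subseteq> B \<and> card B = length F" using assms
proof (induction F arbitrary: c T)
  case (Cons x F)
  note F = sorted_wrt_Cons_ge[OF Cons.prems(1,2)]
  have T: "T \<subseteq> {c<..n}" and cT: "card T \<le> length (x # F)" using Gc_sub Gc_card Cons.prems by blast+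
  have fin: "finite T" using T finite_subset by blast
  have len: "length (x # F) \<le> card {c<..n}" using length_sorted[OF Cons.prems(1,2)] by simp
  have case1: "\<exists>B\<in>Gc n c (x # F). U \<subseteq> B \<and> card B = length (x # F)"
    if U: "U \<subseteq> {c<..n}" "card U \<le> length (x # F)" "y \<in> U" "y < x" for U y
  proof -
    obtain B where "U \<subseteq> B" "B \<subseteq> {c<..n}" "card B = length (x # F)"
      using exists_subset_between[OF U(2) len U(1)] by auto
    then show ?thesis using U by (intro bexI[of _ B]) auto
  qed
  consider y where "y \<in> T" "y < x" | "c + 1 < x" "card T < length (x # F)" | "T - {x} \<in> Gc n x F"
    using Cons.prems by auto
  then show ?case
  proof cases
    case (1 y) then show ?thesis using case1[OF T cT] by blast
  next case 2 have "card (insert (c + 1) T) \<le> length (x # F)" using 2 fin by (simp add: card_insert_if)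
    then show ?thesis using case1[of "insert (c + 1) T" "c + 1"] T 2 F by auto
  next case 3
    obtain B where B: "B \<in> Gc n x F" "T - {x} \<subseteq> B" "card B = length F" using Cons.IH[OF _ _ 3] F by blast
    have Bs: "B \<subseteq> {x<..n}" using Gc_sub B by blast
    then have "finite B" using finite_subset by blast
    have "x \<notin> B" using Bs by auto
    then have "insert x B \<in> Gc n c (x # F)" using B Bs F \<open>finite B\<close> by auto
    then show ?thesis using B \<open>finite B\<close> \<open>x \<notin> B\<close> by (intro bexI[of _ "insert x B"]) auto
  qed
qed auto

lemma Gc_shift:
  assumes "B \<in> Gc n c F" "card B = length F" "t \<in> B" "y \<notin> B" "c < y" "y < t"
  shows "insert y (B - {t}) \<in> Gc n c F" using assms
proof (induction F arbitrary: c B)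
  case (Cons x F) have B: "B \<subseteq> {c<..n}" using Gc_sub Cons.prems by blast
  then have fin: "finite B" using finite_subset by blast
  have cd: "card (insert y (B - {t})) = length (x # F)" using card_exchange[of B t y] Cons.prems fin by simp
  have sub: "insert y (B - {t}) \<subseteq> {c<..n}" using B Cons.prems by auto
  consider z where "z \<in> B" "z < x" | "B - {x} \<in> Gc n x F" using Cons.prems by auto
  then show ?case
  proof cases
    case (1 z)
    then have "\<exists>z\<in>insert y (B - {t}). z < x" using Cons.prems by (cases "z = t") auto
    then show ?thesis using sub cd by simp
  next case 2 have xB: "x \<in> B" using Gc_card[OF 2] Cons.prems(2) by (cases "x \<in> B") auto
    show ?thesis
    proof (cases "y < x")
      case True then show ?thesis using sub cd by auto
    next case False
      then have y: "x < y" using xB Cons.prems by (cases "x = y") auto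
      have "insert y (B - {x} - {t}) \<in> Gc n x F" by (rule Cons.IH[OF 2]) (use xB Cons.prems fin y in auto)
      moreover have "insert y (B - {x} - {t}) = insert y (B - {t}) - {x}" using y by auto
      ultimately show ?thesis using sub cd by simp
    qed
  qed
qed auto

lemma (in glue_cone) Gc:
  assumes F: "sorted_wrt (<) F" "set F \<subseteq> {c<..n}"
  shows "P (Gc n c F) (length F)"
proof (rule shifted[where V = "{c<..n}" and p = int])
  fix T assume "T \<in> Gc n c F"
  then show "\<exists>B\<in>Gc n c F. T \<subseteq> B \<and> card B = length F" by (rule Gc_pure[OF F])
qed (auto simp: Gc_cplx Gc_card intro: Gc_shift dest: Gc_sub)

text \<open>Facets are strictly above \<open>F\<close>, while the last \<open>length F\<close>
  vertices form the lexicographically smallest set of that size. Serves to refute purity in one case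
  of the transfer.\<close>

lemma Gc_last:
  assumes "sorted_wrt (<) F" "set F \<subseteq> {c<..n}"
  shows "{n - length F<..n} \<notin> Gc n c F" using assms
proof (induction F arbitrary: c)
  case (Cons x F)
  note F = sorted_wrt_Cons_ge[OF Cons.prems]
  have len: "length F \<le> n - x" using length_sorted F by blast
  have len': "length F < n" using len F by linarith
  show ?case
  proof
    assume "{n - length (x # F)<..n} \<in> Gc n c (x # F)"
    then have "{n - length (x # F)<..n} - {x} \<in> Gc n x F" (is "?A \<in> _") using F len len' by auto
    moreover from this have "card ?A \<le> length F" by (rule Gc_card)
    then have "x \<in> {n - length (x # F)<..n}" using len' by (cases "x \<in> {n - length (x # F)<..n}") auto
    then have "x = n - length F" using len by auto
    then have "?A = {n - length F<..n}" using len' by auto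
    ultimately show False using Cons.IH[of x] F by simp
  qed
qed auto

lemma Gc_lt: "T \<subseteq> {c<..n} \<Longrightarrow> card T < length (x # F) \<Longrightarrow> c + 1 < x \<Longrightarrow> T \<in> Gc n c (x # F)" by simp

text \<open>\<open>P0\<close> is a strong form that can be assembled, \<open>P1\<close> a weak form
  that can be taken apart, and \<open>strong\<close> links them. In \<open>convglue\<close>
  Mayer--Vietoris is read backwards, \<open>star\<close> recovers the base of a cone from the
  complex it is attached to, and \<open>facets\<close> records that small facets obstruct
  depth.\<close>

locale glue_conv = P0: glue_cone P0 n for P0 :: "nat set set \<Rightarrow> nat \<Rightarrow> bool" and n +
  fixes P1 :: "nat set set \<Rightarrow> nat \<Rightarrow> bool"
  assumes strong: "cplx n A \<Longrightarrow> P0 A d \<Longrightarrow> P1 A d"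
    and convglue: "cplx n A \<Longrightarrow> cplx n B \<Longrightarrow> P1 A (Suc d) \<Longrightarrow> P1 B (Suc d) \<Longrightarrow> P1 (A \<union> B) (Suc d) \<Longrightarrow> P1 (A \<inter> B) d"
    and star: "cplx n A \<Longrightarrow> cplx n Z \<Longrightarrow> Z \<subseteq> A \<Longrightarrow> c \<in> {1..n} \<Longrightarrow> (\<And>T. T \<in> A \<Longrightarrow> c \<notin> T) \<Longrightarrow>
      P1 A (Suc d) \<Longrightarrow> P1 (A \<union> cone c Z) (Suc d) \<Longrightarrow> P1 Z d"
    and facets: "cplx n A \<Longrightarrow> P1 A d \<Longrightarrow> T \<in> A \<Longrightarrow> card T < d \<Longrightarrow> \<exists>y. y \<notin> T \<and> insert y T \<in> A"
begin

text \<open>For the intersections of \<open>Dc\<close> and \<open>Gc\<close> the properties \<open>P1\<close> and \<open>P2\<close> agree: the gluing rules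
  reduce both to the same property of a smaller intersection, or the complex is not pure, or it is
  glued from shifted complexes.\<close>

theorem transfer_lexseg:
  assumes P2: "glue_cone P2 n"
    and v: "sorted_wrt (<) v" "set v \<subseteq> {c..n}" and F: "sorted_wrt (<) F" "set F \<subseteq> {c<..n}"
    and len: "length v = Suc (length F)" and c: "1 \<le> c"
    and P1X: "P1 {T \<in> Dc n v. T - {c} \<in> Gc n c F \<and> card T \<le> length F} (length F)"
  shows "P2 {T \<in> Dc n v. T - {c} \<in> Gc n c F \<and> card T \<le> length F} (length F)"
proof -
  interpret P2: glue_cone P2 n by fact
  show ?thesis using v F len c P1X
  proof (induction F arbitrary: v c)
    case Nil then show ?case by (simp add: P2.void)
  next case (Cons x F)
    note v = Cons.prems(1,2) and F = Cons.prems(3,4) and len = Cons.prems(5) and c = Cons.prems(6)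
    obtain b v' where bv: "v = b # v'" "length v' = Suc (length F)" using len by (cases v) auto
    note x = sorted_wrt_Cons_ge[OF F]
    have b: "c \<le> b" "b \<le> n" "1 \<le> b" and v': "sorted_wrt (<) v'" "set v' \<subseteq> {b<..n}" "set v' \<subseteq> {1..n}"
      using v bv c by auto
    define \<rho> where "\<rho> = length F"
    define X where "X = {T \<in> Dc n v. T - {c} \<in> Gc n c (x # F) \<and> card T \<le> length (x # F)}"
    define Y where "Y = {T \<in> Dc n v'. card T \<le> \<rho>}"
    have P1X: "P1 X (Suc \<rho>)" using Cons.prems(7) unfolding X_def \<rho>_def by simp
    have cDv: "cplx n (Dc n v)" by (rule Dc_cplx) (use v c in auto)
    have cDv': "cplx n (Dc n v')" by (rule Dc_cplx) (use v' in auto)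
    have cY: "cplx n Y" unfolding Y_def by (rule cplx_skel[OF cDv'])
    have Db: "T \<subseteq> {b<..n}" if "T \<in> Dc n v'" for T by (rule Dc_gt[of T n v' b]) (use that v' in auto)
    have Yb: "T \<subseteq> {b<..n}" if "T \<in> Y" for T using Db that by (simp add: Y_def)
    have Ycone: "P0 (cone b Y) (Suc \<rho>) \<and> P2 (cone b Y) (Suc \<rho>) \<and> P2 Y \<rho>"
    proof -
      have "P0 Y \<rho>" "P2 Y \<rho>" unfolding Y_def by (rule P0.Dc_skel P2.Dc_skel; use v' bv \<rho>_def in auto)+
      moreover have "b \<notin> T \<and> card T \<le> \<rho>" if "T \<in> Y" for T using Yb[OF that] that Y_def by auto
      ultimately show ?thesis using P0.cone[OF cY] P2.cone[OF cY] b by auto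
    qed
    have Gx: "P0 (Gc n c (x # F)) (Suc \<rho>)" "P2 (Gc n c (x # F)) (Suc \<rho>)"
      using P0.Gc[OF F] P2.Gc[OF F] by (simp_all add: \<rho>_def)
    have Gcone: "P0 (cone x (Gc n x F)) (Suc \<rho>) \<and> P2 (cone x (Gc n x F)) (Suc \<rho>)"
    proof -
      have "P0 (Gc n x F) \<rho>" "P2 (Gc n x F) \<rho>" using P0.Gc P2.Gc x \<rho>_def by blast+
      moreover have "x \<notin> T \<and> card T \<le> \<rho>" if "T \<in> Gc n x F" for T
        using Gc_sub[OF that] Gc_card[OF that] \<rho>_def by auto
      moreover have "x \<in> {1..n}" using x c by auto
      ultimately show ?thesis using P0.cone[OF Gc_cplx] P2.cone[OF Gc_cplx] by auto
    qed
    have x1: "x \<in> {1..n}" using x c by auto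
    have b1: "b \<in> {1..n}" using b by auto
    note cGx = cplx_cone[OF Gc_cplx x1, of x F] and cYc = cplx_cone[OF cY b1]
    show ?case
    proof (cases "b + length v \<le> n")
      case False
      then have "Dc n v = {}" by (simp add: bv)
      then show ?thesis by (simp add: P2.void)
    next case True have Dv: "T \<in> Dc n v \<longleftrightarrow> T \<subseteq> {b..n} \<and> (b \<in> T \<longrightarrow> T - {b} \<in> Dc n v')" for T
        using True by (simp add: bv)
      have Dsub: "T \<in> Dc n v" if "T \<subseteq> {b<..n}" for T using that by (auto simp: Dv)
      have IH: "P2 {T \<in> Dc n v'. T - {x} \<in> Gc n x F \<and> card T \<le> \<rho>} \<rho>"
        if "set v' \<subseteq> {x..n}" "P1 {T \<in> Dc n v'. T - {x} \<in> Gc n x F \<and> card T \<le> \<rho>} \<rho>"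
        using Cons.IH[OF v'(1) that(1), unfolded \<rho>_def[symmetric]] that(2) x x1 bv \<rho>_def by auto
      have cX: "cplx n X"
      proof (rule cplxI)
        fix T U assume T: "T \<in> X" and U: "U \<subseteq> T"
        then have "U - {c} \<subseteq> T - {c}" by auto
        moreover have "card U \<le> card T" using T U cplx_fin[OF cDv] by (intro card_mono) (auto simp: X_def)
        ultimately show "U \<in> X" using T U cplx_down[OF cDv] cplx_down[OF Gc_cplx] unfolding X_def
          by (metis (no_types, lifting) mem_Collect_eq order_trans)
      qed (use cplx_sub[OF cDv] in \<open>auto simp: X_def\<close>)
      \<comment> \<open>\<open>P1\<close> excludes facets of size at most \<open>\<rho>\<close>, and
        no face has size above \<open>Suc \<rho>\<close>; so \<open>X\<close> is pure.\<close>
      have ext: "\<exists>B\<in>X. T \<subseteq> B \<and> card B = Suc \<rho>" if "T \<in> X" for T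
      proof (rule pure_extend)
        show "card T \<le> Suc \<rho>" using that by (simp add: X_def \<rho>_def)
      qed (use facets[OF cX P1X] cplx_fin[OF cX] that in blast)+
      have goal: "P2 X (Suc \<rho>) \<Longrightarrow> ?thesis" unfolding X_def \<rho>_def by simp
      show ?thesis
      proof (cases "b = c")
        \<comment> \<open>The apex is the first entry of \<open>v\<close>: faces through
          \<open>c\<close> are governed by the rest of \<open>v\<close>, so \<open>X\<close> is
          \<open>Gc\<close> with a cone over a smaller complex attached.\<close>
        case bc: True
        define Z where "Z = {T \<in> Dc n v'. T \<in> Gc n c (x # F) \<and> card T \<le> \<rho>}"
        have cZ: "cplx n Z"
        proof -
          have "Z = Dc n v' \<inter> {T \<in> Gc n c (x # F). card T \<le> \<rho>}" unfolding Z_def by auto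
          then show ?thesis using cplx_Int[OF cDv' cplx_skel[OF Gc_cplx]] by metis
        qed
        have Gn: "c \<notin> T" if "T \<in> Gc n c (x # F)" for T using Gc_sub[OF that] by auto
        have XZ: "X = Gc n c (x # F) \<union> cone c Z"
        proof (intro equalityI subsetI)
          fix T assume T: "T \<in> X"
          show "T \<in> Gc n c (x # F) \<union> cone c Z"
          proof (cases "c \<in> T")
            case True have "finite T" using cplx_fin[OF cX T] .
            then have "card (T - {c}) \<le> \<rho>" using T True by (auto simp: X_def \<rho>_def)
            moreover have "T - {c} \<in> Dc n v'" using T True by (simp add: X_def Dv bc)
            ultimately show ?thesis using T unfolding cone_def Z_def X_def by blast
          next case False
            then have "T - {c} = T" by auto
            then show ?thesis using T unfolding X_def by (metis (no_types, lifting) UnI1 mem_Collect_eq)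
          qed
        next
          fix T assume T: "T \<in> Gc n c (x # F) \<union> cone c Z"
          show "T \<in> X"
          proof (cases "T \<in> Gc n c (x # F)")
            case True
            then have "T - {c} = T" using Gn by blast
            then show ?thesis using True Dsub[of T] Gc_sub[OF True] Gc_card[OF True] bc unfolding X_def
              by (metis (no_types, lifting) mem_Collect_eq)
          next case False
            then have Z: "T - {c} \<in> Z" using T by (auto simp: cone_def)
            then have s: "T - {c} \<subseteq> {c<..n}" using Gc_sub unfolding Z_def by blast
            then have "finite T" using finite_subset[of "T - {c}" "{c<..n}"] by auto
            then have "card T \<le> Suc (card (T - {c}))" by (metis card_Diff1_le card_Suc_Diff1 le_SucI order_refl Diff_empty Diff_insert0)
            then have "card T \<le> Suc \<rho>" using Z by (auto simp: Z_def)
            moreover have "T \<subseteq> {c..n}" using s b bc by (auto dest: subsetD)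
            moreover have "T \<in> Dc n v" using Z s calculation bc by (auto simp: Dv Z_def)
            ultimately show ?thesis using Z by (auto simp: X_def Z_def \<rho>_def)
          qed
        qed
        have "P1 Z \<rho>"
        proof (rule star[OF Gc_cplx cZ])
          show "Z \<subseteq> Gc n c (x # F)" by (auto simp: Z_def)
          show "c \<in> {1..n}" using b bc by auto
          show "P1 (Gc n c (x # F)) (Suc \<rho>)" using strong[OF Gc_cplx] Gx by blast
          show "P1 (Gc n c (x # F) \<union> cone c Z) (Suc \<rho>)" using P1X XZ by simp
        qed (use Gn in auto)
        have "P2 Z \<rho>"
        proof (cases "c + 1 < x")
          \<comment> \<open>The vertex \<open>c + 1\<close> is available before \<open>x\<close>, so
            every small enough set beyond \<open>c\<close> extends to one above
            \<open>x # F\<close>; hence \<open>Z\<close> is a skeleton of \<open>Dc\<close>, which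
            is shifted.\<close>
          case True have "T \<in> Gc n c (x # F)" if "T \<in> Dc n v'" "card T \<le> \<rho>" for T
            by (rule Gc_lt[OF _ _ True]) (use Db[OF that(1)] bc that(2) \<rho>_def in auto)
          then have "Z = Y" unfolding Z_def Y_def by blast
          then show ?thesis using Ycone by simp
        next case False
          \<comment> \<open>Here \<open>x\<close> follows \<open>c\<close> immediately and takes
            over as apex in the induction hypothesis.\<close>
          then have xc: "x = c + 1" using x by simp
          have "Z = {T \<in> Dc n v'. T - {x} \<in> Gc n x F \<and> card T \<le> \<rho>}"
          proof -
            have "T \<in> Gc n c (x # F) \<longleftrightarrow> T - {x} \<in> Gc n x F" if "T \<in> Dc n v'" "card T \<le> \<rho>" for T
              using Db[OF that(1)] that(2) bc xc by (auto simp: \<rho>_def)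
            then show ?thesis unfolding Z_def by blast
          qed
          moreover have "set v' \<subseteq> {x..n}" using v' bc xc by auto
          ultimately show ?thesis using IH \<open>P1 Z \<rho>\<close> by simp
        qed
        have "P2 (Gc n c (x # F) \<union> cone c Z) (Suc \<rho>)"
        proof (rule P2.glue[OF Gc_cplx cplx_cone[OF cZ] Gx(2)])
          show cn: "c \<in> {1..n}" using b bc by auto
          show "P2 (cone c Z) (Suc \<rho>)" by (rule P2.cone[OF cZ cn _ \<open>P2 Z \<rho>\<close>]) (use Gn in \<open>auto simp: Z_def\<close>)
          have "Gc n c (x # F) \<inter> cone c Z = Z"
            using Gn unfolding cone_def Z_def by (intro equalityI subsetI) (metis (no_types, lifting) Diff_empty
                Diff_insert0 IntE mem_Collect_eq, metis (no_types, lifting) Diff_empty Diff_insert0 IntI mem_Collect_eq)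
          then show "P2 (Gc n c (x # F) \<inter> cone c Z) \<rho>" using \<open>P2 Z \<rho>\<close> by simp
        qed
        then show ?thesis using XZ goal by simp
      next case False
        then have bc: "c < b" using b by simp
        have cT: "T - {c} = T" if "T \<in> Dc n v" for T using that bc by (auto simp: Dv)
        have X: "X = {T \<in> Dc n v. T \<in> Gc n c (x # F)}"
        proof -
          have "T - {c} \<in> Gc n c (x # F) \<and> card T \<le> length (x # F) \<longleftrightarrow> T \<in> Gc n c (x # F)"
            if "T \<in> Dc n v" for T using cT[OF that] Gc_card[of T n c "x # F"] by metis
          then show ?thesis unfolding X_def by blast
        qed
        show ?thesis
        proof (cases "X = {}")
          case True then show ?thesis using goal P2.void by simp
        next case Xne: False have face: "T \<subseteq> {b..n}" "(\<exists>y\<in>T. y < x) \<or> T - {x} \<in> Gc n x F \<and> x \<in> T"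
            if "T \<in> X" "card T = Suc \<rho>" for T
          proof -
            show "T \<subseteq> {b..n}" using that by (simp add: X Dv)
            have "x \<in> T" if "T - {x} \<in> Gc n x F"
              using Gc_card[OF that] \<open>card T = Suc \<rho>\<close> by (cases "x \<in> T") (auto simp: \<rho>_def)
            then show "(\<exists>y\<in>T. y < x) \<or> T - {x} \<in> Gc n x F \<and> x \<in> T" using that by (auto simp: X \<rho>_def)
          qed
          obtain T0 where T0: "T0 \<in> X" "card T0 = Suc \<rho>" using Xne ext by blast
          \<comment> \<open>A face of full size has all its elements from \<open>b\<close> on, and
            to lie above \<open>x # F\<close> it must start at \<open>x\<close> or before.\<close>
          have bx: "b \<le> x" using face[OF T0] by force
          have small: "T \<in> X" if "T \<subseteq> {b<..n}" "card T \<le> \<rho>" "c + 1 < x" for T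
            using that Dsub[OF that(1)] bc by (auto simp: X \<rho>_def)
          show ?thesis
          proof (cases "b = x")
            case bx: True have facex: "b \<in> T \<and> T - {b} \<in> Gc n b F" if "T \<in> X" "card T = Suc \<rho>" for T
              using face[OF that] bx by force
            show ?thesis
            proof (cases "c + 1 < b")
              case True have l: "\<rho> \<le> n - b" using length_sorted[of F x n] x bx \<rho>_def by simp
              \<comment> \<open>The last \<open>\<rho>\<close> vertices form a face whose only
                possible facet adds \<open>b\<close>; but they are not above the rest of
                \<open>F\<close>, so \<open>X\<close> would fail to be pure.\<close>
              have "{n - \<rho><..n} \<in> X" by (rule small) (use True bx l b in auto)
              then obtain B where B: "B \<in> X" "{n - \<rho><..n} \<subseteq> B" "card B = Suc \<rho>" using ext by blast
              have "finite B" using cplx_fin[OF cX] B by blast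
              then have "card (B - {b}) = \<rho>" using B facex by simp
              moreover have "{n - \<rho><..n} \<subseteq> B - {b}" using B l b by auto
              moreover have "card {n - \<rho><..n} = \<rho>" using l by auto
              ultimately have "B - {b} = {n - \<rho><..n}" using \<open>finite B\<close> by (metis card_subset_eq finite_Diff)
              then show ?thesis using facex[OF B(1,3)] Gc_last[of F b n] x bx \<rho>_def by simp
            next case False
              then have bc1: "b = c + 1" using bc by simp
              have "X = cone b (Gc n b F)"
              proof (intro equalityI subsetI)
                fix T assume "T \<in> X"
                then show "T \<in> cone b (Gc n b F)" using bx bc1 by (auto simp: X cone_def)
              next
                fix T assume T: "T \<in> cone b (Gc n b F)"
                then have "T - {b} \<in> Gc n b F" by (simp add: cone_def)
                then obtain U where U: "U \<in> Gc n b F" "T - {b} \<subseteq> U" "card U = length F"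
                  using Gc_pure[of F b n] x bx by blast
                have Ub: "U \<subseteq> {b<..n}" using Gc_sub U by blast
                have "U - {b} = U" using Ub by auto
                then have "U \<in> X" using U Ub Dsub[OF Ub] bx bc1 by (auto simp: X)
                then obtain B where B: "B \<in> X" "U \<subseteq> B" "card B = Suc \<rho>" using ext by blast
                then have "T \<subseteq> B" using U facex by blast
                then show "T \<in> X" using cplx_down[OF cX B(1)] by blast
              qed
              then show ?thesis using goal Gcone bx by simp
            qed
          next case False
            then have bx: "b < x" using bx by simp
            have cx: "c + 1 < x" using bc bx by simp
            have Ysub: "T \<in> X" if "T \<in> cone b Y" for T
            proof -
              have T: "T - {b} \<in> Y" using that by (simp add: cone_def)
              have s: "T \<subseteq> {b..n}" using Yb[OF T] b by auto
              have fin: "finite (T - {b})" using cplx_fin[OF cY T] .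
              show ?thesis
              proof (cases "b \<in> T")
                case True
                have "card T = Suc (card (T - {b}))" using True fin by (metis card.remove finite_insert insert_Diff)
                then have "card T \<le> Suc \<rho>" using T by (simp add: Y_def)
                then have "T \<in> Gc n c (x # F)" using s bc bx True by (auto simp: \<rho>_def)
                then show ?thesis using s T by (auto simp: X Dv Y_def)
              next case False
                then have "T - {b} = T" by simp
                then show ?thesis using small[of T] Yb[OF T] T cx by (simp add: Y_def)
              qed
            qed
            have inY: "T - {b} \<in> Y" if "T \<in> X" "b \<in> T" for T
            proof -
              have "finite T" using cplx_fin[OF cX] that by blast
              then show ?thesis using that Gc_card[of T n c "x # F"] by (auto simp: X Dv Y_def \<rho>_def)
            qed
            show ?thesis
            proof (cases "x = b + 1")
              \<comment> \<open>Without a gap between \<open>b\<close> and \<open>x\<close> the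
                complex is glued from two cones over shifted complexes, and their intersection is
                the smaller instance with apex \<open>x\<close>.\<close>
              case xb: True have XY: "X = cone b Y \<union> cone x (Gc n x F)"
              proof (intro equalityI subsetI)
                fix T assume T: "T \<in> X"
                show "T \<in> cone b Y \<union> cone x (Gc n x F)"
                proof (cases "b \<in> T")
                  case True then show ?thesis using inY[OF T] by (simp add: cone_def)
                next case False
                  obtain B where B: "B \<in> X" "T \<subseteq> B" "card B = Suc \<rho>" using ext T by blast
                  show ?thesis
                  proof (cases "b \<in> B")
                    case True
                    then have "B - {b} \<in> Y" using inY B by blast
                    moreover have "T \<subseteq> B - {b}" "T - {b} = T" using False B by auto
                    ultimately show ?thesis using cplx_down[OF cY] by (auto simp: cone_def)
                  next case bB: False
                    have "B - {x} \<in> Gc n x F" using face[OF B(1,3)] bB xb by (force simp: le_less)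
                    moreover have "T - {x} \<subseteq> B - {x}" using B by auto
                    ultimately show ?thesis using cplx_down[OF Gc_cplx] by (auto simp: cone_def)
                  qed
                qed
              next
                fix T assume T: "T \<in> cone b Y \<union> cone x (Gc n x F)"
                show "T \<in> X"
                proof (cases "T \<in> cone b Y")
                  case True then show ?thesis by (rule Ysub)
                next case False
                  then have G: "T - {x} \<in> Gc n x F" using T by (auto simp: cone_def)
                  have s: "T - {x} \<subseteq> {x<..n}" using Gc_sub[OF G] .
                  then have "finite T" using finite_subset[of "T - {x}" "{x<..n}"] by auto
                  then have "card T \<le> Suc (card (T - {x}))" by (metis card_Diff1_le card_Suc_Diff1 le_SucI order_refl Diff_empty Diff_insert0)
                  then have "card T \<le> Suc \<rho>" using Gc_card[OF G] by (simp add: \<rho>_def)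
                  moreover have s': "T \<subseteq> {b<..n}" using s bx x by (auto dest: subsetD)
                  ultimately show ?thesis using G Dsub[OF s'] bc by (auto simp: X \<rho>_def)
                qed
              qed
              have "P1 (cone b Y \<inter> cone x (Gc n x F)) \<rho>"
                by (rule convglue[OF cYc cGx]) (use strong[OF cYc] strong[OF cGx] Ycone Gcone P1X XY in auto)
              moreover have I: "cone b Y \<inter> cone x (Gc n x F) = {T \<in> Dc n v'. T - {x} \<in> Gc n x F \<and> card T \<le> \<rho>}"
              proof -
                have "T \<in> cone b Y \<and> b \<notin> T \<longleftrightarrow> T \<in> Y" for T
                proof -
                  have "b \<notin> T" if "T \<in> Y" using Yb[OF that] by auto
                  then show ?thesis by (auto simp: cone_def)
                qed
                moreover have "b \<notin> T" if "T \<in> cone x (Gc n x F)" for T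
                  using that Gc_sub[of "T - {x}" n x F] bx by (auto simp: cone_def)
                ultimately have "cone b Y \<inter> cone x (Gc n x F) = Y \<inter> cone x (Gc n x F)" by blast
                then show ?thesis by (auto simp: Y_def cone_def)
              qed
              moreover have "set v' \<subseteq> {x..n}" using v' xb by auto
              ultimately have "P2 (cone b Y \<inter> cone x (Gc n x F)) \<rho>" using IH by simp
              then have "P2 X (Suc \<rho>)" unfolding XY by (intro P2.glue[OF cYc cGx]) (use Ycone Gcone in auto)
              then show ?thesis by (rule goal)
            next case False
              \<comment> \<open>With a gap, the two pieces are glued along the skeleton
                \<open>Y\<close>, and everything in sight is shifted or a cone over a shifted
                complex.\<close>
              then have xb: "b + 1 < x" using bx by simp
              have Fb: "set (x # F) \<subseteq> {b<..n}" using x bx by auto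
              have Gb: "T \<in> Gc n b (x # F) \<longleftrightarrow> T \<in> Gc n c (x # F)" if "T \<subseteq> {b<..n}" for T using that xb bc by auto
              have XY: "X = cone b Y \<union> Gc n b (x # F)"
              proof (intro equalityI subsetI)
                fix T assume T: "T \<in> X"
                show "T \<in> cone b Y \<union> Gc n b (x # F)"
                proof (cases "b \<in> T")
                  case True then show ?thesis using inY[OF T] by (simp add: cone_def)
                next case False
                  then have "T \<subseteq> {b<..n}" using T by (force simp: X Dv le_less)
                  then show ?thesis using T Gb unfolding X by blast
                qed
              next
                fix T assume "T \<in> cone b Y \<union> Gc n b (x # F)"
                then show "T \<in> X" using Ysub Gb[OF Gc_sub] Dsub[OF Gc_sub] unfolding X by blast
              qed
              have "cone b Y \<inter> Gc n b (x # F) = Y"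
              proof (intro equalityI subsetI)
                fix T assume T: "T \<in> cone b Y \<inter> Gc n b (x # F)"
                then have "b \<notin> T" using Gc_sub[of T n b "x # F"] by auto
                then show "T \<in> Y" using T by (auto simp: cone_def)
              next
                fix T assume T: "T \<in> Y"
                then have "b \<notin> T" using Yb by fastforce
                moreover have "T \<in> Gc n b (x # F)" by (rule Gc_lt[OF Yb[OF T] _ xb]) (use T in \<open>auto simp: Y_def \<rho>_def\<close>)
                ultimately show "T \<in> cone b Y \<inter> Gc n b (x # F)" using T by (simp add: cone_def)
              qed
              then have "P2 X (Suc \<rho>)" unfolding XY
                by (intro P2.glue[OF cYc Gc_cplx]) (use Ycone P2.Gc[OF F(1) Fb] \<rho>_def in auto)
              then show ?thesis by (rule goal)
            qed
          qed
        qed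
      qed
    qed
  qed
qed

end

section \<open>Monomial submodules of the polynomial ring\<close>

abbreviation lookup where "lookup \<equiv> Poly_Mapping.lookup"
abbreviation keys where "keys \<equiv> Poly_Mapping.keys"
abbreviation single where "single \<equiv> Poly_Mapping.single"

definition ev :: "nat \<Rightarrow> mon" where "ev v = single v 1"

definition pmon :: "mon \<Rightarrow> 'k::field pol" where "pmon m = single m 1"

definition Xp :: "nat \<Rightarrow> 'k::field pol \<Rightarrow> 'k pol" where "Xp v p = pmon (ev v) * p"

definition SP :: "mon set \<Rightarrow> 'k::field pol set" where "SP A = {p. keys p \<subseteq> A}"

definition Gp :: "int \<Rightarrow> 'k::field pol set" where "Gp d = {p. \<forall>m\<in>keys p. int (mdeg m) = d}"

definition restr :: "mon set \<Rightarrow> 'k::field pol \<Rightarrow> 'k pol" where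
  "restr A p = Abs_poly_mapping (\<lambda>m. if m \<in> A then lookup p m else 0)"

lemma lookup_restr: "lookup (restr A p) m = (if m \<in> A then lookup p m else 0)"
proof -
  have "finite {m. (if m \<in> A then lookup p m else 0) \<noteq> 0}"
    by (rule finite_subset[OF _ finite_lookup[of p]]) auto
  then show ?thesis unfolding restr_def by (simp add: lookup_Abs_poly_mapping)
qed

lemma keys_restr: "keys (restr A p) = keys p \<inter> A" by (auto simp: in_keys_iff lookup_restr split: if_splits)

lemma restr_add: "restr A (p + q) = restr A p + restr A q"
  by (rule poly_mapping_eqI) (simp add: lookup_restr lookup_add)

lemma restr_uminus: "restr A (- p) = - restr A p" by (rule poly_mapping_eqI) (simp add: lookup_restr)

lemma restr_diff: "restr A (p - q) = restr A p - restr A q"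
  by (rule poly_mapping_eqI) (simp add: lookup_restr lookup_minus)

lemma restr_id: "keys p \<subseteq> A \<Longrightarrow> restr A p = p" by (rule poly_mapping_eqI) (auto simp: lookup_restr in_keys_iff)

lemma keys_diff': "keys (p - q) \<subseteq> keys p \<union> keys (q :: 'a \<Rightarrow>\<^sub>0 'b::ab_group_add)"
  by (auto simp: in_keys_iff lookup_minus)

lemma keys_uminus': "keys (- q) = keys (q :: 'a \<Rightarrow>\<^sub>0 'b::ab_group_add)" by (auto simp: in_keys_iff)

lemma poly_eq_sum: "p = (\<Sum>m\<in>keys p. single m (lookup p m))" for p :: "'k::field pol" by (rule poly_mapping_eqI)
    (auto simp: lookup_sum lookup_single when_def in_keys_iff if_distrib sum.delta' cong: if_cong)

lemma lookup_single_times: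
  fixes p :: "'k::field pol"
  shows "lookup (single a c * p) (a + m) = c * lookup p m"
proof -
  have "single a c * p = (\<Sum>m\<in>keys p. single (a + m) (c * lookup p m))"
    by (subst (1) poly_eq_sum[of p]) (simp add: sum_distrib_left mult_single)
  then have "lookup (single a c * p) (a + m) = (\<Sum>m'\<in>keys p. if m' = m then c * lookup p m' else 0)"
    by (simp add: lookup_sum lookup_single when_def)
  then show ?thesis by (auto simp: in_keys_iff sum.delta')
qed

lemma keys_pmon_times: "keys (pmon a * p) = (+) a ` keys p"
proof -
  have "keys (pmon a * p) \<subseteq> (+) a ` keys p"
    using keys_mult[of "pmon a" p] by (auto simp: pmon_def split: if_splits)
  moreover have "a + m \<in> keys (pmon a * p)" if "m \<in> keys p" for m
    using that lookup_single_times[of a 1 p m] by (simp add: in_keys_iff pmon_def)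
  ultimately show ?thesis by auto
qed

lemma keys_pmon [simp]: "keys (pmon m) = {m}" by (simp add: pmon_def)

lemma pmon_times: "pmon a * pmon b = pmon (a + b)" by (simp add: pmon_def mult_single)

lemma keys_Xp: "keys (Xp v p) = (+) (ev v) ` keys p" by (simp add: Xp_def keys_pmon_times)

lemma keys_plus_mon: "keys (a + b) = keys a \<union> keys (b :: mon)" by (auto simp: in_keys_iff lookup_add)

lemma keys_ev_add: "keys (ev v + m) = insert v (keys m)" by (simp add: keys_plus_mon ev_def)

lemma keys_ev [simp]: "keys (ev v) = {v}" by (simp add: ev_def)

lemma mdeg_sup: "finite A \<Longrightarrow> keys m \<subseteq> A \<Longrightarrow> mdeg m = (\<Sum>i\<in>A. lookup m i)"
  unfolding mdeg_def by (rule sum.mono_neutral_left) (auto simp: in_keys_iff)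

lemma mdeg_add: "mdeg (a + b) = mdeg a + mdeg b"
  using mdeg_sup[of "keys a \<union> keys b" a] mdeg_sup[of "keys a \<union> keys b" b]
    mdeg_sup[of "keys a \<union> keys b" "a + b"] by (simp add: keys_plus_mon lookup_add sum.distrib)

lemma mdeg_ev: "mdeg (ev v) = 1" by (simp add: mdeg_def ev_def)

lemma mdeg_0 [simp]: "mdeg 0 = 0" by (simp add: mdeg_def)

lemma mdeg_0_iff: "mdeg m = 0 \<longleftrightarrow> m = 0" by (auto simp: mdeg_def in_keys_iff poly_mapping_eq_iff fun_eq_iff)

lemma ev_divides: "v \<in> keys m \<Longrightarrow> \<exists>m'. m = ev v + (m' :: mon)"
proof -
  assume "v \<in> keys m"
  then have "m = ev v + (m - ev v)"
    by (intro poly_mapping_eqI) (auto simp: ev_def lookup_add lookup_minus lookup_single when_def in_keys_iff)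
  then show ?thesis by blast
qed

text \<open>Monomials not divisible by the variable are discarded; the division is exact under the
  hypothesis of \<open>Xp_divX\<close>.\<close>

definition divX :: "nat \<Rightarrow> 'k::field pol \<Rightarrow> 'k pol" where
  "divX v p = Poly_Mapping.map_key ((+) (ev v)) p"

lemma lookup_divX: "lookup (divX v p) m = lookup p (ev v + m)"
proof -
  have "inj ((+) (ev v))" by (simp add: inj_on_def)
  then show ?thesis unfolding divX_def by (simp add: map_key.rep_eq)
qed

lemma lookup_Xp: "lookup (Xp v p) (ev v + m) = lookup p m" by (simp add: Xp_def pmon_def lookup_single_times)

lemma divX_Xp: "divX v (Xp v p) = p" by (rule poly_mapping_eqI) (simp add: lookup_divX lookup_Xp)

lemma Xp_divX: assumes "\<And>m. m \<in> keys p \<Longrightarrow> v \<in> keys m" shows "Xp v (divX v p) = p"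
proof (rule poly_mapping_eqI)
  fix m
  show "lookup (Xp v (divX v p)) m = lookup p m"
  proof (cases "v \<in> keys m")
    case True
    then obtain m' where "m = ev v + m'" using ev_divides by blast
    then show ?thesis by (simp add: lookup_Xp lookup_divX)
  next case False
    then have "m \<notin> keys (Xp v (divX v p))" by (auto simp: keys_Xp keys_ev_add)
    then show ?thesis using False assms[of m] by (auto simp: in_keys_iff)
  qed
qed

lemma keys_divX: "m \<in> keys (divX v p) \<longleftrightarrow> ev v + m \<in> keys p" by (simp add: in_keys_iff lookup_divX)

lemma Xp_0_iff: "Xp v p = 0 \<longleftrightarrow> p = 0" using divX_Xp[of v p] by (auto simp: Xp_def divX_def map_key_zero)

lemma Gp_divX: "p \<in> Gp d \<Longrightarrow> divX v p \<in> Gp (d - 1)"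
proof -
  assume p: "p \<in> Gp d"
  have "int (mdeg m) = d - 1" if "m \<in> keys (divX v p)" for m
  proof -
    have "int (mdeg (ev v + m)) = d" using p that by (simp add: Gp_def keys_divX)
    then show ?thesis by (simp add: mdeg_add mdeg_ev)
  qed
  then show ?thesis by (simp add: Gp_def)
qed

lemma SP_mono: "A \<subseteq> B \<Longrightarrow> SP A \<subseteq> SP B" by (auto simp: SP_def)

lemma restr_SP: "p \<in> SP B \<Longrightarrow> restr A p \<in> SP (A \<inter> B)"
  and restr_Gp: "p \<in> Gp d \<Longrightarrow> restr A p \<in> Gp d" by (auto simp: SP_def Gp_def keys_restr)

lemma SP_add: "p \<in> SP A \<Longrightarrow> q \<in> SP A \<Longrightarrow> p + q \<in> SP A"
  and SP_diff: "p \<in> SP A \<Longrightarrow> q \<in> SP A \<Longrightarrow> p - q \<in> SP A"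
  and SP_0: "0 \<in> SP A" unfolding SP_def using keys_add[of p q] keys_diff'[of p q] by auto

lemma diff_restr: "p - restr A p \<in> SP (keys p - A)"
  by (auto simp: SP_def in_keys_iff lookup_minus lookup_restr split: if_splits)

lemma kmod_Xp: "kmod Xp (Gp :: int \<Rightarrow> 'k::field pol set)"
proof
  fix a b :: "'k pol" and v w d
  show "Xp v (a + b) = Xp v a + Xp v b" by (simp add: Xp_def algebra_simps)
  show "Xp v (Xp w a) = Xp w (Xp v a)" by (simp add: Xp_def algebra_simps)
  show "0 \<in> Gp d" by (simp add: Gp_def)
  show "a \<in> Gp d \<Longrightarrow> b \<in> Gp d \<Longrightarrow> a - b \<in> Gp d" using keys_diff'[of a b] by (auto simp: Gp_def)
  show "a \<in> Gp d \<Longrightarrow> Xp v a \<in> Gp (d + 1)" by (auto simp: Gp_def keys_Xp mdeg_add mdeg_ev)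
qed

interpretation Xp: kmod Xp "Gp :: int \<Rightarrow> 'k::field pol set" by (rule kmod_Xp)

lemma kmod_Xp_UNIV: "kmod Xp (\<lambda>_. UNIV :: 'k::field pol set)" by unfold_locales (auto simp: Xp.X_add Xp.X_comm)

text \<open>Membership of a monomial in a squarefree monomial ideal depends on its support alone, so
  ideals become families of sets: \<open>MI n (- \<Delta>)\<close> is the Stanley--Reisner ideal of
  \<open>\<Delta>\<close>.\<close>

definition MS :: "nat \<Rightarrow> nat set set \<Rightarrow> mon set" where
  "MS n P = {m. keys m \<subseteq> {1..n} \<and> keys m \<in> P}"

abbreviation MI :: "nat \<Rightarrow> nat set set \<Rightarrow> 'k::field pol set" where "MI n P \<equiv> SP (MS n P)"
abbreviation Sn :: "nat \<Rightarrow> 'k::field pol set" where "Sn n \<equiv> MI n UNIV"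

definition up :: "nat \<Rightarrow> nat set set \<Rightarrow> bool" where
  "up n P \<longleftrightarrow> (\<forall>A B. A \<in> P \<longrightarrow> A \<subseteq> B \<longrightarrow> B \<subseteq> {1..n} \<longrightarrow> B \<in> P)"

lemma upD: "up n P \<Longrightarrow> A \<in> P \<Longrightarrow> A \<subseteq> B \<Longrightarrow> B \<subseteq> {1..n} \<Longrightarrow> B \<in> P" by (auto simp: up_def)

lemma up_Un: "up n P \<Longrightarrow> up n Q \<Longrightarrow> up n (P \<union> Q)" and up_Int: "up n P \<Longrightarrow> up n Q \<Longrightarrow> up n (P \<inter> Q)"
  and up_UNIV: "up n UNIV" and up_empty: "up n {}" unfolding up_def by blast+

lemma Sn_carrier: "Sn n = carrier (poly_ring n)" by (auto simp: SP_def MS_def poly_ring_def)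

lemma MI_Int: "MI n (P \<inter> Q) = MI n P \<inter> MI n Q" by (auto simp: SP_def MS_def)

lemma MI_mono: "P \<subseteq> Q \<Longrightarrow> MI n P \<subseteq> MI n Q" by (rule SP_mono) (auto simp: MS_def)

lemma MI_empty: "MI n {} = {0}" by (auto simp: SP_def MS_def)

lemma MI_split:
  assumes "p \<in> MI n (P \<union> Q)" obtains a b where "p = a + b" "a \<in> MI n P" "b \<in> MI n Q"
    "\<And>d. p \<in> Gp d \<Longrightarrow> a \<in> Gp d" "\<And>d. p \<in> Gp d \<Longrightarrow> b \<in> Gp d"
proof (rule that)
  let ?a = "restr (MS n P) p"
  show "p = ?a + (p - ?a)" by simp
  show "?a \<in> MI n P" by (simp add: SP_def keys_restr)
  show "p - ?a \<in> MI n Q" using diff_restr[of p "MS n P"] assms by (auto simp: SP_def MS_def)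
  show a: "p \<in> Gp d \<Longrightarrow> ?a \<in> Gp d" for d by (rule restr_Gp)
  show "p \<in> Gp d \<Longrightarrow> p - ?a \<in> Gp d" for d using a Xp.G_diff by blast
qed

lemma MI_times: "up n P \<Longrightarrow> p \<in> Sn n \<Longrightarrow> q \<in> MI n P \<Longrightarrow> p * q \<in> MI n P"
proof -
  assume P: "up n P" and p: "p \<in> Sn n" and q: "q \<in> MI n P"
  have "m \<in> MS n P" if "m \<in> keys (p * q)" for m
  proof -
    have "m \<in> {a + b | a b. a \<in> keys p \<and> b \<in> keys q}" using that keys_mult[of p q] by (rule rev_subsetD)
    then obtain a b where ab: "m = a + b" "a \<in> keys p" "b \<in> keys q" by blast
    then show ?thesis using upD[OF P, of "keys b" "keys a \<union> keys b"] p q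
      by (auto simp: SP_def MS_def keys_plus_mon)
  qed
  then show ?thesis by (auto simp: SP_def)
qed

lemma ksub_MI: "up n P \<Longrightarrow> set vs \<subseteq> {1..n} \<Longrightarrow> ksub Xp vs (MI n P)" unfolding ksub_def
proof (intro conjI ballI)
  fix v p assume "up n P" "set vs \<subseteq> {1..n}" "v \<in> set vs" "p \<in> MI n P"
  moreover from this have "pmon (ev v) \<in> Sn n" by (auto simp: SP_def MS_def)
  ultimately show "Xp v p \<in> MI n P" unfolding Xp_def by (intro MI_times)
qed (rule SP_0, rule SP_diff)

lemma mem_SP_pmon: "pmon m \<in> SP A \<longleftrightarrow> m \<in> A" by (simp add: SP_def)

lemma MI_neg: "d < 0 \<Longrightarrow> N \<inter> Gp d \<subseteq> {0}" by (auto simp: Gp_def intro!: poly_mapping_eqI)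

lemma Hz_triv:
  assumes "ksub X vs N" "kmod X G" shows "Hz X G vs N N j t"
proof (rule HzI)
  interpret kmod X G by fact
  fix c assume "kch G vs N j t c"
  then show "\<exists>g. kch G vs N (Suc j) t g \<and> (\<forall>l. c l - kd X vs g l \<in> N)"
    using kch_0[OF assms(1), of vs "Suc j" t] by (intro exI[of _ "\<lambda>l. 0"]) (simp add: kd_0, simp add: kch_def)
qed

section \<open>Koszul homology of monomial subquotients\<close>

text \<open>The argument \<open>ty\<close> fixes the coefficient field, which the families of sets
  do not determine.\<close>

abbreviation Hm :: "'k::field itself \<Rightarrow> nat \<Rightarrow> nat list \<Rightarrow> nat set set \<Rightarrow> nat set set \<Rightarrow> nat \<Rightarrow> int \<Rightarrow> bool" where
  "Hm ty n vs P Q j t \<equiv> Hz Xp Gp vs (MI n P :: 'k pol set) (MI n Q) j t"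

text \<open>Second isomorphism theorem: separating monomials shows that
  \<open>MI n (P \<union> Q)\<close> is the sum of the two submodules, and
  \<open>MI n (P \<inter> Q)\<close> is their intersection.\<close>

lemma Hm_second_iso:
  fixes ty :: "'k::field itself"
  assumes up: "up n P" "up n Q" and vs: "set vs \<subseteq> {1..n}"
  shows "Hm ty n vs P (P \<inter> Q) j t \<longleftrightarrow> Hm ty n vs (P \<union> Q) Q j t"
proof -
  have *: "Hz Xp Gp vs (MI n P :: 'k pol set) (MI n (P \<inter> Q)) j t
    \<longleftrightarrow> Hz Xp Gp vs (MI n (P \<union> Q) :: 'k pol set) (MI n Q) j (t + 0)"
  proof (rule Hz_iso[where \<phi> = id, OF kmod_Xp kmod_Xp])
    show "ksub Xp vs (MI n P)" "ksub Xp vs (MI n (P \<union> Q))" "ksub Xp vs (MI n Q)"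
      using up vs by (auto intro: ksub_MI up_Un)
    show "x \<in> MI n P \<Longrightarrow> x \<in> Gp d \<Longrightarrow> id x \<in> MI n (P \<union> Q) \<inter> Gp (d + 0)" for x :: "'k pol" and d
      using MI_mono[of P "P \<union> Q" n] by auto
    show "\<exists>x. x \<in> MI n P \<and> x \<in> Gp d \<and> y - id x \<in> MI n Q"
      if y: "y \<in> MI n (P \<union> Q)" "y \<in> Gp (d + 0)" for y :: "'k pol" and d
    proof -
      obtain a b where "y = a + b" "a \<in> MI n P" "b \<in> MI n Q" "\<And>d. y \<in> Gp d \<Longrightarrow> a \<in> Gp d"
        using MI_split[OF y(1)] by metis
      then show ?thesis using y by (intro exI[of _ a]) auto
    qed
  qed (auto simp: MI_Int)
  then show ?thesis by simp
qed

text \<open>Multiplication by a variable is injective on polynomials, so only supports matter: it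
  maps \<open>P\<close> into \<open>P'\<close>, reaches everything modulo \<open>Q'\<close>, and
  pulls \<open>Q'\<close> back to \<open>Q\<close>. Cones and multiples by a variable are compared
  in this way.\<close>

lemma Hm_Xp_iso:
  fixes ty :: "'k::field itself"
  assumes up: "up n P" "up n Q" "up n P'" "up n Q'" and vs: "set vs \<subseteq> {1..n}" and c: "c \<in> {1..n}"
    and 1: "\<And>A. A \<subseteq> {1..n} \<Longrightarrow> A \<in> P \<Longrightarrow> insert c A \<in> P'"
    and 2: "\<And>A. A \<subseteq> {1..n} \<Longrightarrow> A \<in> P' \<Longrightarrow> A \<notin> Q' \<Longrightarrow> c \<in> A \<and> A - {c} \<in> P"
    and 3: "\<And>A. A \<subseteq> {1..n} \<Longrightarrow> A \<in> P \<Longrightarrow> insert c A \<in> Q' \<longleftrightarrow> A \<in> Q"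
    and Q: "Q \<subseteq> P"
  shows "Hm ty n vs P Q j t \<longleftrightarrow> Hm ty n vs P' Q' j (t + 1)"
proof (rule Hz_iso[where \<phi> = "Xp c", OF kmod_Xp kmod_Xp])
  show "ksub Xp vs (MI n P)" "ksub Xp vs (MI n P')" "ksub Xp vs (MI n Q')" using up vs by (auto intro: ksub_MI)
  show "Xp c (x + y) = Xp c x + Xp c y" for x y :: "'k pol" by (rule Xp.X_add)
  show "Xp c (Xp v x) = Xp v (Xp c x)" for v and x :: "'k pol" by (rule Xp.X_comm)
  show "Xp c x \<in> MI n P' \<inter> Gp (d + 1)" if "x \<in> MI n P" "x \<in> Gp d" for x :: "'k pol" and d
  proof -
    have "ev c + m \<in> MS n P'" if "m \<in> keys x" for m
    proof -
      have "keys m \<subseteq> {1..n}" "keys m \<in> P" using that \<open>x \<in> MI n P\<close> by (auto simp: SP_def MS_def)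
      then show ?thesis using 1[of "keys m"] c by (auto simp: MS_def keys_ev_add)
    qed
    then show ?thesis using that(2) Xp.G_X[of x d c] by (auto simp: SP_def keys_Xp)
  qed
  show "\<exists>x. x \<in> MI n P \<and> x \<in> Gp d \<and> y - Xp c x \<in> MI n Q'"
    if y: "y \<in> MI n P'" "y \<in> Gp (d + 1)" for y :: "'k pol" and d
  proof -
    let ?b = "restr (MS n Q') y"
    let ?a = "y - ?b"
    have a: "?a \<in> SP (keys y - MS n Q')" by (rule diff_restr)
    have ky: "m \<in> MS n P'" if "m \<in> keys y" for m using y that by (auto simp: SP_def)
    have cm: "c \<in> keys m \<and> keys m - {c} \<in> P" if "m \<in> keys ?a" for m
    proof -
      have "m \<in> keys y" "m \<notin> MS n Q'" using that a by (auto simp: SP_def)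
      then show ?thesis using 2[of "keys m"] ky by (auto simp: MS_def)
    qed
    have "Xp c (divX c ?a) = ?a" by (rule Xp_divX) (use cm in blast)
    moreover have "m \<in> MS n P" if m: "m \<in> keys (divX c ?a)" for m
    proof -
      have k: "ev c + m \<in> keys ?a" using m by (simp add: keys_divX)
      then have "ev c + m \<in> keys y" using a by (auto simp: SP_def)
      then have sub: "keys m \<subseteq> {1..n}" using ky[of "ev c + m"] by (auto simp: MS_def keys_ev_add)
      have "insert c (keys m) - {c} \<in> P" using cm[OF k] by (simp add: keys_ev_add)
      then have "keys m \<in> P" using upD[OF up(1), of "insert c (keys m) - {c}" "keys m"] sub by auto
      then show ?thesis using sub by (simp add: MS_def)
    qed
    then have "divX c ?a \<in> MI n P" by (auto simp: SP_def)
    moreover have "?a \<in> Gp (d + 1)" using y(2) restr_Gp Xp.G_diff by blast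
    then have "divX c ?a \<in> Gp d" using Gp_divX[of ?a "d + 1" c] by simp
    moreover have "y - ?a \<in> MI n Q'" by (simp add: SP_def keys_restr)
    ultimately show ?thesis by metis
  qed
  show "Xp c x \<in> MI n Q' \<longleftrightarrow> x \<in> MI n Q" if x: "x \<in> MI n P" for x :: "'k pol"
  proof -
    have "ev c + m \<in> MS n Q' \<longleftrightarrow> m \<in> MS n Q" if "m \<in> keys x" for m
      using that x 3[of "keys m"] c by (auto simp: SP_def MS_def keys_ev_add)
    then show ?thesis by (auto simp: SP_def keys_Xp)
  qed
qed

text \<open>Multiplication by a variable is null-homotopic, so homology survives the passage to \<open>z/x\<^sub>c z\<close>.\<close>

lemma Hm_mod_var:
  fixes ty :: "'k::field itself"
  assumes up: "up n P" and vs: "set vs \<subseteq> {1..n}" and c: "c \<in> set vs"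
    and Q: "Q = {A. c \<in> A \<and> A - {c} \<in> P}"
    and H: "Hm ty n vs P Q j t"
  shows "Hm ty n vs P {} j t" unfolding MI_empty
proof (rule HzI)
  have s: "ksub Xp vs (MI n P :: 'k pol set)" by (rule ksub_MI[OF up vs])
  have s0: "ksub Xp vs {0}" by (auto simp: ksub_def Xp.X_0)
  fix b :: "bool list \<Rightarrow> 'k pol" assume b: "kch Gp vs (MI n P) j t b" and db: "\<And>l. kd Xp vs b l \<in> {0}"
  have "kd Xp vs b l \<in> MI n Q" for l using db[of l] by (simp add: SP_0)
  with b H obtain g where g: "kch Gp vs (MI n P) (Suc j) t g" "\<And>l. b l - kd Xp vs g l \<in> MI n Q"
    using HzD by blast
  let ?d = "\<lambda>l. b l - kd Xp vs g l"
  have d: "kch Gp vs (MI n P) j t ?d" by (rule Xp.kch_diff[OF b Xp.kch_kd[OF g(1) s] s])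
  let ?y = "\<lambda>l. divX c (?d l)"
  \<comment> \<open>What remains of the cycle is divisible by the variable, and the quotient is
    again a cycle because multiplication by a variable is injective.\<close>
  have y: "Xp c (?y l) = ?d l" for l by (rule Xp_divX) (use g(2)[of l] Q in \<open>auto simp: SP_def MS_def\<close>)
  have yP: "?y l \<in> MI n P" for l
  proof -
    have "m \<in> MS n P" if m: "m \<in> keys (?y l)" for m
    proof -
      have "ev c + m \<in> MS n Q" using m g(2)[of l] by (auto simp: keys_divX SP_def)
      then have "insert c (keys m) - {c} \<in> P" "keys m \<subseteq> {1..n}" using Q by (auto simp: MS_def keys_ev_add)
      then show ?thesis using upD[OF up, of "insert c (keys m) - {c}" "keys m"] by (auto simp: MS_def)
    qed
    then show ?thesis by (auto simp: SP_def)
  qed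
  have "kch Gp vs (MI n P) j (t - 1) ?y" unfolding kch_def
  proof (intro allI conjI impI)
    fix l
    have "?d l \<in> Gp (t - int j)" using d by (auto simp: kch_def)
    then have "?y l \<in> Gp (t - 1 - int j)" using Gp_divX[of "?d l" "t - int j" c] by (simp add: algebra_simps)
    then show "?y l \<in> MI n P \<inter> Gp (t - 1 - int j)" using yP by blast
    assume "?y l \<noteq> 0"
    then have "?d l \<noteq> 0" by (auto simp: divX_def map_key_zero)
    then show "length l = length vs" "count_list l True = j" using d unfolding kch_def by blast+
  qed
  moreover have "kd Xp vs ?y l \<in> {0}" for l
  proof -
    have "Xp c (kd Xp vs ?y l) = kd Xp vs ?d l" using Xp.kd_X[of vs c ?y l] y by simp
    also have "\<dots> = 0" using db by (simp add: Xp.kd_diff Xp.kd_kd)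
    finally show ?thesis by (simp add: Xp_0_iff)
  qed
  ultimately obtain h where h: "kch Gp vs (MI n P) (Suc j) (t - 1 + 1) h" "\<And>l. Xp c (?y l) - kd Xp vs h l \<in> {0}"
    using Xp.X_boundary[OF s s0 c] by blast
  have "kch Gp vs (MI n P) (Suc j) t (\<lambda>l. g l + h l)" using Xp.kch_add[OF g(1) _ s] h(1) by simp
  moreover have "b l - kd Xp vs (\<lambda>l. g l + h l) l \<in> {0}" for l
    using h(2)[of l] y[of l] by (simp add: Xp.kd_add algebra_simps)
  ultimately show "\<exists>g. kch Gp vs (MI n P) (Suc j) t g \<and> (\<forall>l. b l - kd Xp vs g l \<in> {0})" by blast
qed

subsection \<open>Acyclicity of the polynomial ring\<close>

abbreviation Fl :: "nat list \<Rightarrow> bool list" where "Fl vs \<equiv> replicate (length vs) False"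

lemma kch_0_Fl: "kch G vs N 0 t c \<Longrightarrow> c l \<noteq> 0 \<Longrightarrow> l = Fl vs"
proof -
  assume "kch G vs N 0 t c" "c l \<noteq> 0"
  then have l: "length l = length vs" "count_list l True = 0" unfolding kch_def by blast+
  then have "True \<notin> set l" by (simp add: count_list_0_iff)
  then have "x = False" if "x \<in> set l" for x using that by (cases x) auto
  then show ?thesis using l(1) replicate_length_same[of l False] by metis
qed

lemma kch_0I: "y \<in> N \<Longrightarrow> y \<in> G t \<Longrightarrow> 0 \<in> N \<Longrightarrow> (\<And>d. 0 \<in> G d) \<Longrightarrow> kch G vs N 0 t (\<lambda>l. if l = Fl vs then y else 0)"
proof -
  have "count_list (replicate m False) True = 0" for m by (induction m) auto
  then show "y \<in> N \<Longrightarrow> y \<in> G t \<Longrightarrow> 0 \<in> N \<Longrightarrow> (\<And>d. 0 \<in> G d) \<Longrightarrow> kch G vs N 0 t (\<lambda>l. if l = Fl vs then y else 0)"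
    by (auto simp: kch_def)
qed

text \<open>Monomial form of the fact that homology in index 0 is the module modulo its multiples by
  the variables.\<close>

lemma kd1_keys:
  assumes "kch Gp vs (SP A) (Suc 0) t g" "m \<in> keys (kd Xp vs g l)"
  shows "\<exists>v\<in>set vs. \<exists>a\<in>A. m = ev v + a" using assms
proof (induction vs arbitrary: g l t)
  case (Cons v vs)
  have g0: "kch Gp vs (SP A) (Suc 0) t (\<lambda>k. g (False # k))" and g1: "kch Gp vs (SP A) 0 (t - 1) (\<lambda>k. g (True # k))"
    using Cons.prems(1) by (auto simp: Xp.kch_Cons)
  have z: "kd Xp vs (\<lambda>k. g (True # k)) k = 0" for k by (rule Xp.kd_kch_0[OF g1])
  obtain k where k: "l = False # k" and m: "m \<in> keys (kd Xp vs (\<lambda>k. g (False # k)) k + Xp v (g (True # k)))"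
    using Cons.prems(2) z by (cases l) (auto split: if_splits)
  show ?case
  proof (cases "m \<in> keys (kd Xp vs (\<lambda>k. g (False # k)) k)")
    case True then show ?thesis using Cons.IH[OF g0] by auto
  next case False
    then have "m \<in> keys (Xp v (g (True # k)))"
      using m keys_add[of "kd Xp vs (\<lambda>k. g (False # k)) k" "Xp v (g (True # k))"] by blast
    then obtain a where "m = ev v + a" "a \<in> keys (g (True # k))" by (auto simp: keys_Xp)
    moreover have "g (True # k) \<in> SP A" using g1 by (auto simp: kch_def)
    ultimately show ?thesis by (auto simp: SP_def)
  qed
qed auto

text \<open>Each monomial is charged to the first listed variable dividing it.\<close>

lemma boundary_of_vars:
  fixes y :: "'k::field pol"
  assumes "set vs \<subseteq> {1..n}" "y \<in> Sn n" "y \<in> Gp t" "\<And>m. m \<in> keys y \<Longrightarrow> keys m \<inter> set vs \<noteq> {}"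
  shows "\<exists>g. kch Gp vs (Sn n) (Suc 0) t g \<and> kd Xp vs g = (\<lambda>l. if l = Fl vs then y else 0)" using assms
proof (induction vs arbitrary: y)
  case Nil
  then have "keys y = {}" by fastforce
  then have "y = 0" by simp
  moreover have "kch Gp [] (Sn n) (Suc 0) t (\<lambda>l. 0 :: 'k pol)" by (auto simp: kch_def SP_0 Xp.G_0)
  ultimately show ?case by (intro exI[of _ "\<lambda>l. 0"]) (auto simp: fun_eq_iff)
next case (Cons v vs)
  let ?a = "restr {m. v \<in> keys m} y"
  let ?b = "y - ?a"
  have s: "ksub Xp vs (Sn n :: 'k pol set)" using Cons.prems(1) by (intro ksub_MI up_UNIV) auto
  have b: "?b \<in> SP (keys y - {m. v \<in> keys m})" by (rule diff_restr)
  have bS: "?b \<in> Sn n" using b Cons.prems(2) by (auto simp: SP_def)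
  have aG: "?a \<in> Gp t" by (rule restr_Gp[OF Cons.prems(3)])
  then have bG: "?b \<in> Gp t" using Cons.prems(3) Xp.G_diff by blast
  have "\<exists>g. kch Gp vs (Sn n) (Suc 0) t g \<and> kd Xp vs g = (\<lambda>l. if l = Fl vs then ?b else 0)"
  proof (rule Cons.IH[OF _ bS bG])
    fix m assume "m \<in> keys ?b"
    then have "m \<in> keys y" "v \<notin> keys m" using b by (auto simp: SP_def)
    then show "keys m \<inter> set vs \<noteq> {}" using Cons.prems(4)[of m] by auto
  qed (use Cons.prems in auto)
  then obtain g where g: "kch Gp vs (Sn n) (Suc 0) t g" "kd Xp vs g = (\<lambda>l. if l = Fl vs then ?b else 0)" by blast
  let ?a' = "divX v ?a"
  have Xa: "Xp v ?a' = ?a" by (rule Xp_divX) (auto simp: keys_restr)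
  have "m \<in> MS n UNIV" if "m \<in> keys ?a'" for m
  proof -
    have "ev v + m \<in> keys y" using that by (auto simp: keys_divX keys_restr)
    then have "ev v + m \<in> MS n UNIV" using Cons.prems(2) by (auto simp: SP_def)
    then show ?thesis by (auto simp: MS_def keys_ev_add)
  qed
  then have a'S: "?a' \<in> Sn n" by (auto simp: SP_def)
  have a'G: "?a' \<in> Gp (t - 1)" by (rule Gp_divX[OF aG])
  define h where "h = (\<lambda>l. case l of [] \<Rightarrow> 0 | b # k \<Rightarrow> if b then (if k = Fl vs then ?a' else 0) else g k)"
  have h1: "kch Gp vs (Sn n) 0 (t - 1) (\<lambda>k. h (True # k))"
    unfolding h_def by (simp add: kch_0I[where G = Gp and N = "Sn n", OF a'S a'G SP_0 Xp.G_0])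
  have "kch Gp (v # vs) (Sn n) (Suc 0) t h" using h1 g(1) by (auto simp: Xp.kch_Cons SP_0 h_def)
  moreover have "kd Xp (v # vs) h l = (if l = Fl (v # vs) then y else 0)" for l
    using Xp.kd_kch_0[OF h1] g(2) Xa by (auto simp: h_def Xp.X_0 split: list.split)
  ultimately show ?case by (intro exI[of _ h]) auto
qed

lemma Hz_free_aux:
  assumes "distinct vs" "set vs \<subseteq> {1..n}" "0 < j"
  shows "Hz Xp Gp vs (Sn n :: 'k::field pol set) {0} j t" using assms
proof (induction vs arbitrary: j t)
  case Nil have "ksub Xp [] (Sn n :: 'k pol set)" by (intro ksub_MI up_UNIV) simp
  then show ?case using Nil by (intro Xp.Hz_above) (auto simp: ksub_def)
next case (Cons v vs j t) have s: "ksub Xp vs (Sn n :: 'k pol set)" "ksub Xp (v # vs) (Sn n :: 'k pol set)"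
    using Cons.prems by (auto intro!: ksub_MI up_UNIV)
  obtain i where j: "j = Suc i" using Cons.prems by (cases j) auto
  have "\<exists>g. kch Gp (v # vs) (Sn n) (Suc j) t g \<and> (\<forall>l. c l - kd Xp (v # vs) g l \<in> {0})"
    if c: "kch Gp (v # vs) (Sn n) j t c" and dc: "\<And>l. kd Xp (v # vs) c l \<in> {0}"
    for c :: "bool list \<Rightarrow> 'k pol"
  proof -
    let ?c0 = "\<lambda>k. c (False # k)" and ?c1 = "\<lambda>k. c (True # k)"
    have c0: "kch Gp vs (Sn n) j t ?c0" and c1: "kch Gp vs (Sn n) i (t - 1) ?c1" and cN: "c [] = 0"
      using c j by (auto simp: Xp.kch_Cons)
    have d0: "kd Xp vs ?c0 k + Xp v (?c1 k) = 0" for k using dc[of "False # k"] by simp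
    have d1: "kd Xp vs ?c1 k = 0" for k using dc[of "True # k"] by simp
    have "\<exists>g. kch Gp vs (Sn n) (Suc i) (t - 1) g \<and> (\<forall>l. ?c1 l - kd Xp vs g l \<in> {0})"
    proof (cases "0 < i")
      case True have "Hz Xp Gp vs (Sn n :: 'k pol set) {0} i (t - 1)" using Cons True by simp
      then show ?thesis using HzD[OF _ c1] d1 by blast
    next case False
      then have i: "i = 0" by simp
      let ?y = "?c1 (Fl vs)"
      have y: "?y \<in> Sn n" "?y \<in> Gp (t - 1)" using c1 i unfolding kch_def by auto
      \<comment> \<open>Homology of the remaining variables does not vanish in index 0. Instead,
        distinctness makes \<open>v\<close> a nonzerodivisor modulo them: a monomial that is
        divisible by one of them after multiplication by \<open>v\<close> was so before.\<close>
      have "keys m \<inter> set vs \<noteq> {}" if m: "m \<in> keys ?y" for m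
      proof -
        have "Xp v ?y = - kd Xp vs ?c0 (Fl vs)" using d0[of "Fl vs"] by (simp add: eq_neg_iff_add_eq_0 add.commute)
        then have "ev v + m \<in> keys (kd Xp vs ?c0 (Fl vs))" using m by (metis keys_Xp keys_uminus' imageI)
        then obtain w a where "w \<in> set vs" "ev v + m = ev w + a"
          using kd1_keys[of vs "MS n UNIV" t ?c0 "ev v + m" "Fl vs"] c0 j i by auto
        then have "w \<in> insert v (keys m)" using keys_ev_add[of w a] keys_ev_add[of v m] by auto
        then show ?thesis using \<open>w \<in> set vs\<close> Cons.prems by auto
      qed
      then obtain g where g: "kch Gp vs (Sn n) (Suc 0) (t - 1) g" "kd Xp vs g = (\<lambda>l. if l = Fl vs then ?y else 0)"
        using boundary_of_vars[of vs n ?y "t - 1"] y Cons.prems by auto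
      have "?c1 l - kd Xp vs g l \<in> {0}" for l using kch_0_Fl[of Gp vs "Sn n" "t - 1" ?c1 l] c1 i g(2) by auto
      then show ?thesis using g(1) i by auto
    qed
    then obtain g1 where g1: "kch Gp vs (Sn n) (Suc i) (t - 1) g1" "\<And>l. ?c1 l = kd Xp vs g1 l" by auto
    have "kch Gp vs (Sn n) j t (\<lambda>k. Xp v (g1 k))" using Xp.kch_X[OF g1(1) s(2), of v] j by simp
    then have e: "kch Gp vs (Sn n) j t (\<lambda>k. ?c0 k + Xp v (g1 k))" by (rule Xp.kch_add[OF c0 _ s(1)])
    have "kd Xp vs (\<lambda>k. ?c0 k + Xp v (g1 k)) k \<in> {0}" for k
      using d0[of k] g1(2)[of k] by (simp add: Xp.kd_add Xp.kd_X)
    moreover have "Hz Xp Gp vs (Sn n :: 'k pol set) {0} j t" using Cons by simp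
    ultimately obtain g0 where g0: "kch Gp vs (Sn n) (Suc j) t g0" "\<And>l. ?c0 l + Xp v (g1 l) - kd Xp vs g0 l \<in> {0}"
      using HzD[OF _ e] by blast
    define g where "g = (\<lambda>l. case l of [] \<Rightarrow> 0 | b # k \<Rightarrow> if b then - g1 k else g0 k)"
    have "kch Gp (v # vs) (Sn n) (Suc j) t g"
      using g0(1) Xp.kch_uminus[OF g1(1) s(1)] j by (auto simp: Xp.kch_Cons g_def SP_0)
    moreover have "c l - kd Xp (v # vs) g l \<in> {0}" for l
    proof (cases l)
      case Nil then show ?thesis by (simp add: cN)
    next case (Cons b k) then show ?thesis using g0(2)[of k] g1(2)[of k]
        by (cases b) (auto simp: g_def Xp.kd_uminus Xp.X_uminus algebra_simps)
    qed
    ultimately show ?thesis by blast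
  qed
  then show ?case unfolding Hz_def by blast
qed

text \<open>The Koszul complex on all variables resolves the residue field, so its homology sits in
  index 0 and degree 0; the side condition keeps away from that spot.\<close>

lemma Hz_free:
  assumes vs: "distinct vs" "set vs = {1..n}" and t: "0 < j \<or> 0 < t"
  shows "Hz Xp Gp vs (Sn n :: 'k::field pol set) {0} j t"
proof (cases "0 < j")
  case True then show ?thesis using Hz_free_aux vs by blast
next case False
  then have j: "j = 0" and t: "0 < t" using t by auto
  show ?thesis
  proof (rule HzI)
    fix c :: "bool list \<Rightarrow> 'k pol" assume c: "kch Gp vs (Sn n) j t c"
    let ?y = "c (Fl vs)"
    have y: "?y \<in> Sn n" "?y \<in> Gp t" using c j unfolding kch_def by auto
    have "keys m \<inter> set vs \<noteq> {}" if "m \<in> keys ?y" for m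
    proof -
      have "int (mdeg m) = t" "keys m \<subseteq> {1..n}" using y that by (auto simp: Gp_def SP_def MS_def)
      then have "m \<noteq> 0" using t by auto
      then have "keys m \<noteq> {}" using poly_mapping_eqI[of m 0] by (auto simp: in_keys_iff)
      then show ?thesis using Int_absorb2[OF \<open>keys m \<subseteq> {1..n}\<close>] vs(2) by metis
    qed
    then obtain g where g: "kch Gp vs (Sn n) (Suc 0) t g" "kd Xp vs g = (\<lambda>l. if l = Fl vs then ?y else 0)"
      using boundary_of_vars[of vs n ?y t] y vs by auto
    have "c l - kd Xp vs g l \<in> {0}" for l using kch_0_Fl[of Gp vs "Sn n" t c l] c j g(2) by auto
    then show "\<exists>g. kch Gp vs (Sn n) (Suc j) t g \<and> (\<forall>l. c l - kd Xp vs g l \<in> {0})" using g(1) j by auto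
  qed
qed

section \<open>Regularity of the dual ideal and Koszul depth\<close>

text \<open>\<open>MI n (du n X)\<close> is the Stanley--Reisner ideal of the Alexander dual of
  \<open>X\<close>.\<close>

definition du :: "nat \<Rightarrow> nat set set \<Rightarrow> nat set set" where
  "du n X = {A. {1..n} - A \<in> X}"

text \<open>For \<open>d \<le> n\<close>, the dual ideal has Castelnuovo--Mumford regularity at most
  \<open>n - d\<close>.\<close>

definition Reg :: "'k::field itself \<Rightarrow> nat \<Rightarrow> nat set set \<Rightarrow> nat \<Rightarrow> bool" where
  "Reg ty n X d \<longleftrightarrow> (\<forall>vs j t. distinct vs \<and> set vs = {1..n} \<and> int j + int n - int d < t \<longrightarrow>
     Hm ty n vs (du n X) {} j t)"

text \<open>Depth at least \<open>d\<close> of the Stanley--Reisner ring, by depth sensitivity of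
  Koszul homology. All orderings of the variables are included because \<open>H0_vanish\<close>
  chooses its own.\<close>

definition Dep :: "'k::field itself \<Rightarrow> nat \<Rightarrow> nat set set \<Rightarrow> nat \<Rightarrow> bool" where
  "Dep ty n X d \<longleftrightarrow> (\<forall>vs j t. distinct vs \<and> set vs = {1..n} \<and> n < j + d \<longrightarrow>
     Hm ty n vs UNIV (- X) j t)"

lemma up_du: "cplx n X \<Longrightarrow> up n (du n X)" unfolding up_def du_def by (auto elim: cplx_down)

lemma up_compl: "cplx n X \<Longrightarrow> up n (- X)" unfolding up_def by (auto dest: cplx_down)

lemma du_Un: "du n (A \<union> B) = du n A \<union> du n B" and du_Int: "du n (A \<inter> B) = du n A \<inter> du n B"
  by (auto simp: du_def)

lemma Hm_ext:
  assumes "Q \<subseteq> R" "R \<subseteq> P" "up n P" "up n Q" "up n R" "set vs \<subseteq> {1..n}"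
    "Hm ty n vs R Q j t" "Hm ty n vs P R j t"
  shows "Hm ty n vs P Q j t"
  by (rule Xp.Hz_ext[of _ "MI n R"]) (use assms in \<open>auto intro: ksub_MI simp: MI_mono\<close>)

lemma Hm_sub:
  assumes "Q \<subseteq> R" "R \<subseteq> P" "up n P" "up n Q" "up n R" "set vs \<subseteq> {1..n}"
    "Hm ty n vs P Q j t" "Hm ty n vs P R (Suc j) t"
  shows "Hm ty n vs R Q j t"
  by (rule Xp.Hz_sub[of _ _ "MI n P"]) (use assms in \<open>auto intro: ksub_MI simp: MI_mono\<close>)

lemma Hm_quot:
  assumes "Q \<subseteq> R" "R \<subseteq> P" "up n P" "up n Q" "up n R" "set vs \<subseteq> {1..n}"
    "Hm ty n vs P Q j t" "j > 0 \<Longrightarrow> Hm ty n vs R Q (j - 1) t"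
  shows "Hm ty n vs P R j t"
  by (rule Xp.Hz_quot[of "MI n Q"]) (use assms in \<open>auto intro: ksub_MI simp: MI_mono\<close>)

lemma lookup_xmon: "finite A \<Longrightarrow> lookup (xmon A) i = (if i \<in> A then 1 else 0)"
  unfolding xmon_def by (simp add: lookup_sum lookup_single when_def)

lemma keys_xmon: "finite A \<Longrightarrow> keys (xmon A) = A" by (auto simp: in_keys_iff lookup_xmon split: if_splits)

lemma mdeg_xmon: "finite A \<Longrightarrow> mdeg (xmon A) = card A" by (simp add: mdeg_def keys_xmon lookup_xmon)

lemma MI_cong: "(\<And>A. A \<subseteq> {1..n} \<Longrightarrow> A \<in> P \<longleftrightarrow> A \<in> Q) \<Longrightarrow> MI n P = MI n Q" by (auto simp: SP_def MS_def)

text \<open>No face of \<open>Z\<close> contains \<open>c\<close>, so the ideal dual to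
  \<open>Z\<close> is the variable of \<open>c\<close> times the ideal dual to the cone.\<close>

lemma du_cone:
  fixes ty :: "'k::field itself"
  assumes Z: "cplx n Z" "c \<in> {1..n}" "\<And>T. T \<in> Z \<Longrightarrow> c \<notin> T" and vs: "set vs = {1..n}"
  shows "Hm ty n vs (du n (cone c Z)) {} j t \<longleftrightarrow> Hm ty n vs (du n Z) {} j (t + 1)"
proof (rule Hm_Xp_iso[OF up_du[OF cplx_cone[OF Z(1,2)]] up_empty up_du[OF Z(1)] up_empty _ Z(2)])
  fix A :: "nat set" assume A: "A \<subseteq> {1..n}"
  have e: "{1..n} - A - {c} = {1..n} - insert c A" by auto
  show "A \<in> du n (cone c Z) \<Longrightarrow> insert c A \<in> du n Z" by (simp add: du_def cone_def e)
  assume "A \<in> du n Z"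
  moreover from this have "c \<in> A" using Z(2) Z(3)[of "{1..n} - A"] by (auto simp: du_def)
  moreover have "{1..n} - (A - {c}) - {c} = {1..n} - A" using \<open>c \<in> A\<close> by auto
  ultimately show "c \<in> A \<and> A - {c} \<in> du n (cone c Z)" by (simp add: du_def cone_def)
qed (use vs in auto)

text \<open>The dual ideal is generated by the product of all variables, hence free of rank one with
  generator in degree \<open>n\<close>; it is reached by multiplying with one variable at a
  time.\<close>

lemma Reg_base:
  fixes ty :: "'k::field itself"
  shows "Reg ty n {{}} 0" unfolding Reg_def
proof (intro allI impI)
  fix vs and j :: nat and t :: int
  assume a: "distinct vs \<and> set vs = {1..n} \<and> int j + int n - int 0 < t"
  have up: "up n {A. {1..k} \<subseteq> A}" for k by (auto simp: up_def)
  have "Hm ty n vs {A. {1..k} \<subseteq> A} {} j t" if "int j + int k < t" "k \<le> n" for k t using that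
  proof (induction k arbitrary: t)
    case 0 have "Hm ty n vs UNIV {} j t" unfolding MI_empty by (rule Hz_free) (use a 0 in auto)
    moreover have "{A. {1..0::nat} \<subseteq> A} = UNIV" by auto
    ultimately show ?case by simp
  next case (Suc k) have "Hm ty n vs {A. {1..k} \<subseteq> A} {} j (t - 1)" using Suc by simp
    moreover have "Hm ty n vs {A. {1..k} \<subseteq> A} {} j (t - 1) \<longleftrightarrow> Hm ty n vs {A. {1..Suc k} \<subseteq> A} {} j (t - 1 + 1)"
      by (rule Hm_Xp_iso[where c = "Suc k", OF up up_empty up up_empty])
        (use a Suc.prems in \<open>auto simp: atLeastAtMostSuc_conv\<close>)
    ultimately show ?case by simp
  qed
  from this[of n t] a have "Hm ty n vs {A. {1..n} \<subseteq> A} {} j t" by simp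
  moreover have "MI n (du n {{}}) = (MI n {A. {1..n} \<subseteq> A} :: 'k pol set)" by (rule MI_cong) (auto simp: du_def)
  ultimately show "Hm ty n vs (du n {{}}) {} j t" by simp
qed

text \<open>Duals turn unions of complexes into sums of ideals and intersections into intersections.
  The dual of \<open>A \<inter> B\<close> may have regularity one higher, since Mayer--Vietoris uses
  it in index \<open>j - 1\<close>.\<close>

lemma Reg_glue_cone: "glue_cone (Reg ty n) n" for ty :: "'k::field itself"
proof
  show "Reg ty n {} d" for d
  proof -
    have "ksub Xp vs ({0} :: 'k pol set)" for vs by (auto simp: ksub_def Xp.X_0)
    then have "Hz Xp Gp vs ({0} :: 'k pol set) {0} j t" for vs j t using Hz_triv[OF _ kmod_Xp] by blast
    then show ?thesis by (simp add: Reg_def du_def MI_empty)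
  qed
  show "Reg ty n {{}} 0" by (rule Reg_base)
  fix A B :: "nat set set" and d
  assume c: "cplx n A" "cplx n B" and A: "Reg ty n A (Suc d)" and B: "Reg ty n B (Suc d)"
    and I: "Reg ty n (A \<inter> B) d"
  note u = up_du[OF c(1)] up_du[OF c(2)] up_empty up_Un up_Int
  show "Reg ty n (A \<union> B) (Suc d)" unfolding Reg_def
  proof (intro allI impI)
    fix vs and j :: nat and t :: int
    assume a: "distinct vs \<and> set vs = {1..n} \<and> int j + int n - int (Suc d) < t"
    then have vs: "set vs \<subseteq> {1..n}" by simp
    have hA: "Hm ty n vs (du n A) {} j t" and hB: "Hm ty n vs (du n B) {} j t"
      using a A B unfolding Reg_def by blast+
    have hI: "Hm ty n vs (du n A \<inter> du n B) {} (j - 1) t" if "0 < j"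
      using a that I unfolding Reg_def du_Int by auto
    have "Hm ty n vs (du n A) (du n A \<inter> du n B) j t" by (rule Hm_quot[of "{}"]) (use vs hA hI u in auto)
    then have 1: "Hm ty n vs (du n A \<union> du n B) (du n B) j t" using Hm_second_iso[OF u(1,2) vs] by blast
    show "Hm ty n vs (du n (A \<union> B)) {} j t" unfolding du_Un
      by (rule Hm_ext[of "{}" "du n B"]) (use vs hB u 1 in auto)
  qed
next
  fix Z c d
  assume Z: "cplx n Z" "c \<in> {1..n}" "\<And>T. T \<in> Z \<Longrightarrow> c \<notin> T \<and> card T \<le> d" and P: "Reg ty n Z d"
  show "Reg ty n (cone c Z) (Suc d)" unfolding Reg_def
  proof (intro allI impI)
    fix vs and j :: nat and t :: int
    assume a: "distinct vs \<and> set vs = {1..n} \<and> int j + int n - int (Suc d) < t"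
    then have "Hm ty n vs (du n Z) {} j (t + 1)" using P unfolding Reg_def by auto
    then show "Hm ty n vs (du n (cone c Z)) {} j t" using du_cone[OF Z(1,2), of vs j t] Z(3) a by auto
  qed
qed

lemma Reg_glue_conv: "glue_conv (Reg ty n) n (Reg ty n)" for ty :: "'k::field itself"
proof (intro glue_conv.intro Reg_glue_cone glue_conv_axioms.intro)
  fix A B :: "nat set set" and d
  assume c: "cplx n A" "cplx n B" and A: "Reg ty n A (Suc d)" and B: "Reg ty n B (Suc d)"
    and U: "Reg ty n (A \<union> B) (Suc d)"
  note u = up_du[OF c(1)] up_du[OF c(2)] up_empty up_Un up_Int
  show "Reg ty n (A \<inter> B) d" unfolding Reg_def
  proof (intro allI impI)
    fix vs and j :: nat and t :: int
    assume a: "distinct vs \<and> set vs = {1..n} \<and> int j + int n - int d < t"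
    then have vs: "set vs \<subseteq> {1..n}" by simp
    have hU: "Hm ty n vs (du n A \<union> du n B) {} (Suc j) t" and hB: "Hm ty n vs (du n B) {} j t"
      and hA: "Hm ty n vs (du n A) {} j t" using a A B U unfolding Reg_def du_Un[symmetric] by auto
    have "Hm ty n vs (du n A \<union> du n B) (du n B) (Suc j) t" by (rule Hm_quot[of "{}"]) (use vs hU hB u in auto)
    then have 1: "Hm ty n vs (du n A) (du n A \<inter> du n B) (Suc j) t" using Hm_second_iso[OF u(1,2) vs] by blast
    show "Hm ty n vs (du n (A \<inter> B)) {} j t" unfolding du_Int
      by (rule Hm_sub[of "{}" _ "du n A"]) (use vs hA u 1 in auto)
  qed
next
  fix G Z :: "nat set set" and c d
  assume cG: "cplx n G" and cZ: "cplx n Z" and ZG: "Z \<subseteq> G" and c: "c \<in> {1..n}"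
    and cn: "\<And>T. T \<in> G \<Longrightarrow> c \<notin> T" and G: "Reg ty n G (Suc d)" and U: "Reg ty n (G \<union> cone c Z) (Suc d)"
  let ?P = "du n (cone c Z)"
  note u = up_du[OF cG] up_du[OF cplx_cone[OF cZ c]] up_empty up_Un up_Int
  have I: "?P \<inter> du n G = du n Z"
  proof -
    have "T \<in> cone c Z \<and> T \<in> G \<longleftrightarrow> T \<in> Z" for T using cn[of T] ZG unfolding cone_def by (cases "c \<in> T") auto
    then show ?thesis unfolding du_def by blast
  qed
  show "Reg ty n Z d" unfolding Reg_def
  proof (intro allI impI)
    fix vs and j :: nat and t :: int
    assume a: "distinct vs \<and> set vs = {1..n} \<and> int j + int n - int d < t"
    then have vs: "set vs \<subseteq> {1..n}" by simp
    have hU: "Hm ty n vs (?P \<union> du n G) {} j (t - 1)" using a U unfolding Reg_def du_Un by (simp add: Un_commute)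
    have hG: "Hm ty n vs (du n G) {} (j - 1) (t - 1)" if "0 < j" using a G that unfolding Reg_def by auto
    have "Hm ty n vs (?P \<union> du n G) (du n G) j (t - 1)" by (rule Hm_quot[of "{}"]) (use vs hU hG u in auto)
    then have "Hm ty n vs ?P (du n Z) j (t - 1)" using Hm_second_iso[OF u(2,1) vs] I by metis
    \<comment> \<open>The ideal dual to \<open>Z\<close> is the variable times \<open>?P\<close>, so
      the vanishing just found concerns \<open>?P\<close> modulo that multiple, and
      \<open>Hm_mod_var\<close> returns to \<open>?P\<close>.\<close>
    moreover have "MI n (du n Z) = (MI n {A. c \<in> A \<and> A - {c} \<in> ?P} :: 'k pol set)"
    proof (rule MI_cong)
      fix A assume "A \<subseteq> {1..n}"
      have "{1..n} - (A - {c}) - {c} = {1..n} - A" if "c \<in> A" using that by auto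
      moreover have "c \<in> A" if "{1..n} - A \<in> Z" using cn[of "{1..n} - A"] that ZG c by blast
      ultimately show "A \<in> du n Z \<longleftrightarrow> A \<in> {A. c \<in> A \<and> A - {c} \<in> ?P}"
        unfolding du_def cone_def mem_Collect_eq by metis
    qed
    ultimately have "Hm ty n vs ?P {A. c \<in> A \<and> A - {c} \<in> ?P} j (t - 1)" by simp
    then have "Hm ty n vs ?P {} j (t - 1)" by (intro Hm_mod_var[OF u(2) vs, of c]) (use a c in auto)
    then show "Hm ty n vs (du n Z) {} j t" using du_cone[OF cZ c, of vs j "t - 1"] cn ZG a by auto
  qed
next
  fix A T d
  assume A: "cplx n A" "Reg ty n A d" "T \<in> A" "card T < d"
  have T: "T \<subseteq> {1..n}" by (rule cplx_sub[OF A(1,3)])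
  then have fin: "finite T" using finite_subset by blast
  let ?W = "{1..n} - T"
  have cW: "card ?W = n - card T" "card T \<le> n" using T card_mono[of "{1..n}" T] by (auto simp: card_Diff_subset[OF fin])
  let ?vs = "[1..<Suc n]"
  have vs: "distinct ?vs \<and> set ?vs = {1..n}" by auto
  \<comment> \<open>The complement of \<open>T\<close> gives an element of the dual ideal in degree
    above \<open>n - d\<close>. Vanishing in index 0 makes it a variable times another member, whose
    support has complement \<open>insert v T\<close>.\<close>
  let ?y = "pmon (xmon ?W) :: 'k pol"
  have y: "?y \<in> MI n (du n A)"
  proof -
    have "{1..n} - ?W = T" using T by auto
    then show ?thesis using A by (simp add: mem_SP_pmon MS_def keys_xmon du_def)
  qed
  have "?y \<in> Gp (int (card ?W))" by (simp add: Gp_def mdeg_xmon)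
  then have k: "kch Gp ?vs (MI n (du n A)) 0 (int (card ?W)) (\<lambda>l. if l = Fl ?vs then ?y else 0)"
    by (intro kch_0I y SP_0 Xp.G_0)
  have "int 0 + int n - int d < int (card ?W)" using cW A(4) by simp
  then have "Hm ty n ?vs (du n A) {} 0 (int (card ?W))" using A(2) vs unfolding Reg_def by blast
  then obtain g where g: "kch Gp ?vs (MI n (du n A)) (Suc 0) (int (card ?W)) g"
    "\<And>l. (if l = Fl ?vs then ?y else 0) - kd Xp ?vs g l \<in> {0}"
    unfolding MI_empty by (rule HzD[OF _ k]) (use Xp.kd_kch_0[OF k] in auto)
  have "kd Xp ?vs g (Fl ?vs) = ?y" using g(2)[of "Fl ?vs"] by simp
  then have "xmon ?W \<in> keys (kd Xp ?vs g (Fl ?vs))" by simp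
  from kd1_keys[OF g(1) this] obtain v a where v: "a \<in> MS n (du n A)" "xmon ?W = ev v + a" by blast
  have "?W = insert v (keys a)" using arg_cong[OF v(2), of keys] by (simp add: keys_xmon keys_ev_add)
  moreover have "v \<notin> keys a"
  proof -
    have "v \<in> ?W" using calculation by blast
    then have "lookup (xmon ?W) v = 1" by (simp add: lookup_xmon)
    then have "lookup a v = 0" using v(2) by (simp add: lookup_add ev_def)
    then show ?thesis by (simp add: in_keys_iff)
  qed
  ultimately have "{1..n} - keys a = insert v T" "v \<notin> T" using T by auto
  then show "\<exists>y. y \<notin> T \<and> insert y T \<in> A" using v(1) by (auto simp: MS_def du_def)
qed simp

subsection \<open>Koszul depth\<close>

text \<open>Once the variables of \<open>T\<close> are discarded, \<open>y\<close> sits in the socle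
  for the other \<open>n - card T\<close> variables, that is in top Koszul homology, whose index
  already exceeds \<open>n - d\<close>. An elementary form of the fact that no associated prime has
  dimension below the depth.\<close>

lemma H0_vanish:
  fixes N K :: "'k::field pol set"
  assumes s: "\<And>vs. set vs \<subseteq> {1..n} \<Longrightarrow> ksub Xp vs N \<and> ksub Xp vs K"
    and H: "\<And>vs j t. distinct vs \<Longrightarrow> set vs = {1..n} \<Longrightarrow> n < j + d \<Longrightarrow> Hz Xp Gp vs N K j t"
    and T: "T \<subseteq> {1..n}" "card T < d" and y: "y \<in> N" "y \<in> Gp e"
    and X: "\<And>v. v \<in> {1..n} - T \<Longrightarrow> Xp v y \<in> K"
  shows "y \<in> K"
proof -
  have fin: "finite T" using T finite_subset by blast
  obtain ts where ts: "set ts = T" "distinct ts" using finite_distinct_list[OF fin] by blast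
  obtain ws where ws: "set ws = {1..n} - T" "distinct ws" using finite_distinct_list[of "{1..n} - T"] by blast
  have len: "length ws = n - card T" using distinct_card[OF ws(2)] ws(1) T(1) fin by (simp add: card_Diff_subset)
  have d: "distinct (ts @ ws)" "set (ts @ ws) = {1..n}" using ts ws T by auto
  have cT: "card T \<le> n" using card_mono[OF _ T(1)] by simp
  have low: "N \<inter> Gp e = {0}" if "e < 0" for e
    using MI_neg[OF that, of N] s[of "[]"] Xp.G_0[of e] by (auto simp: ksub_def)
  have sd: "ksub Xp (ts @ ws) N" "ksub Xp (ts @ ws) K" using s[of "ts @ ws"] d by auto
  have "n < length ws + d" using len cT T by linarith
  then have "Hz Xp Gp (ts @ ws) N K (length ws) t" for t by (rule H[OF d])
  then have "Hz Xp Gp ws N K (length ws) t" for t by (rule Xp.Hz_drop_list[OF sd]) (rule low)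
  then show ?thesis by (rule Xp.Hz_top[of _ _ _ "e + int (length ws)"]) (use s[of ws] ws y X in auto)
qed

lemma Dep_conv:
  fixes ty :: "'k::field itself"
  assumes P0: "glue_cone P0 n" and strong: "\<And>A d. cplx n A \<Longrightarrow> P0 A d \<Longrightarrow> Dep ty n A d"
  shows "glue_conv P0 n (Dep ty n)"
proof (intro glue_conv.intro P0 glue_conv_axioms.intro)
  fix A B :: "nat set set" and d
  assume c: "cplx n A" "cplx n B" and A: "Dep ty n A (Suc d)" and B: "Dep ty n B (Suc d)"
    and U: "Dep ty n (A \<union> B) (Suc d)"
  note u = up_compl[OF c(1)] up_compl[OF c(2)] up_UNIV up_Un up_Int
  show "Dep ty n (A \<inter> B) d" unfolding Dep_def
  proof (intro allI impI)
    fix vs and j :: nat and t :: int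
    assume a: "distinct vs \<and> set vs = {1..n} \<and> n < j + d"
    then have vs: "set vs \<subseteq> {1..n}" by simp
    have 1: "Hm ty n vs (- A \<union> - B) (- B) i t" if "n < i + Suc d" for i
    proof -
      have 1: "Hm ty n vs UNIV (- A \<inter> - B) i t" "Hm ty n vs UNIV (- A) (Suc i) t"
        using a that A U unfolding Dep_def Compl_Un by auto
      have "Hm ty n vs (- A) (- A \<inter> - B) i t" by (rule Hm_sub[of _ _ UNIV]) (use vs u 1 in auto)
      then show ?thesis using Hm_second_iso[OF u(1,2) vs] by blast
    qed
    show "Hm ty n vs UNIV (- (A \<inter> B)) j t" unfolding Compl_Int
      by (rule Hm_quot[of "- B"]) (use vs u 1[of "j - 1"] a B in \<open>auto simp: Dep_def\<close>)
  qed
next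
  fix G Z :: "nat set set" and c d
  assume cG: "cplx n G" and cZ: "cplx n Z" and ZG: "Z \<subseteq> G" and c: "c \<in> {1..n}"
    and cn: "\<And>T. T \<in> G \<Longrightarrow> c \<notin> T" and G: "Dep ty n G (Suc d)" and U: "Dep ty n (G \<union> cone c Z) (Suc d)"
  note cc = cplx_cone[OF cZ c]
  note u = up_compl[OF cG] up_compl[OF cZ] up_compl[OF cc] up_compl[OF cplx_Un[OF cG cc]] up_UNIV
  have ins: "insert c A \<in> cone c Z \<longleftrightarrow> A \<in> cone c Z" for A by (simp add: cone_def)
  have Zc: "c \<in> A" if "A \<in> cone c Z" "A \<notin> Z" for A using that by (cases "c \<in> A") (auto simp: cone_def)
  have Zc': "c \<in> A" if "A \<in> cone c Z" "A \<notin> G" for A using Zc[of A] that ZG by blast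
  have cZs: "Z \<subseteq> cone c Z"
  proof
    fix T assume "T \<in> Z"
    then have "T - {c} = T" using cn ZG by auto
    then show "T \<in> cone c Z" using \<open>T \<in> Z\<close> by (simp add: cone_def)
  qed
  show "Dep ty n Z d" unfolding Dep_def
  proof (intro allI impI)
    fix vs and j :: nat and t :: int
    assume a: "distinct vs \<and> set vs = {1..n} \<and> n < j + d"
    then have vs: "set vs \<subseteq> {1..n}" by simp
    \<comment> \<open>Multiplication by the variable of \<open>c\<close> identifies the ring of the
      cone with the ideal of \<open>G\<close> modulo that of \<open>G \<union> cone c Z\<close>,
      since faces of the cone outside \<open>G\<close> contain \<open>c\<close>.\<close>
    have 1: "Hm ty n vs UNIV (- cone c Z) i t" if i: "n < i + Suc d" for i t
    proof -
      have 1: "Hm ty n vs UNIV (- (G \<union> cone c Z)) i (t + 1)" "Hm ty n vs UNIV (- G) (Suc i) (t + 1)"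
        using a i G U unfolding Dep_def by auto
      have "Hm ty n vs (- G) (- (G \<union> cone c Z)) i (t + 1)" by (rule Hm_sub[of _ _ UNIV]) (use vs u 1 in auto)
      moreover have "Hm ty n vs UNIV (- cone c Z) i t \<longleftrightarrow> Hm ty n vs (- G) (- (G \<union> cone c Z)) i (t + 1)"
        by (rule Hm_Xp_iso[OF u(5,3,1,4) vs c]) (use cn ins Zc' in auto)
      ultimately show ?thesis by blast
    qed
    \<comment> \<open>It also identifies the ring of the cone with the ideal of \<open>Z\<close>
      modulo that of the cone; the ring of \<open>Z\<close> is then a quotient with both other terms
      controlled.\<close>
    have 2: "Hm ty n vs (- Z) (- cone c Z) i t" if i: "n < i + Suc d" for i
    proof -
      have "Hm ty n vs UNIV (- cone c Z) i (t - 1) \<longleftrightarrow> Hm ty n vs (- Z) (- cone c Z) i (t - 1 + 1)"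
      proof (rule Hm_Xp_iso[OF u(5,3,2,3) vs c])
        show "insert c A \<in> - Z" for A using cn ZG by auto
      qed (use ins Zc in auto)
      then show ?thesis using 1[OF i] by simp
    qed
    show "Hm ty n vs UNIV (- Z) j t"
      by (rule Hm_quot[of "- cone c Z"]) (use vs u 1[of j] 2[of "j - 1"] a cZs in auto)
  qed
next
  fix A T d
  assume A: "cplx n A" "Dep ty n A d" "T \<in> A" "card T < d"
  have T: "T \<subseteq> {1..n}" by (rule cplx_sub[OF A(1,3)])
  then have fin: "finite T" using finite_subset by blast
  show "\<exists>y. y \<notin> T \<and> insert y T \<in> A"
  proof (rule ccontr)
    assume no: "\<not> (\<exists>y. y \<notin> T \<and> insert y T \<in> A)"
    \<comment> \<open>The monomial of a facet is killed by all variables outside it, so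
      \<open>H0_vanish\<close> would place it in the ideal.\<close>
    let ?y = "pmon (xmon T) :: 'k pol"
    have "?y \<in> MI n (- A)"
    proof (rule H0_vanish[of n "Sn n" "MI n (- A)" d T ?y "int (card T)"])
      show "Hz Xp Gp vs (Sn n) (MI n (- A) :: 'k pol set) j t" if "distinct vs" "set vs = {1..n}" "n < j + d"
        for vs j t using A(2) that unfolding Dep_def by blast
      show "?y \<in> Gp (int (card T))" using fin by (simp add: Gp_def mdeg_xmon)
      show "?y \<in> Sn n" using fin T by (simp add: mem_SP_pmon MS_def keys_xmon)
      show "Xp v ?y \<in> MI n (- A)" if "v \<in> {1..n} - T" for v
        using that no T fin by (auto simp: SP_def MS_def keys_Xp keys_ev_add keys_xmon)
    qed (use ksub_MI up_UNIV up_compl[OF A(1)] T A(4) in auto)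
    then show False using A(3) fin by (simp add: mem_SP_pmon MS_def keys_xmon)
  qed
qed (rule strong)

section \<open>Weakly regular sequences\<close>

definition pm :: "nat \<Rightarrow> 'k::field pol set \<Rightarrow> bool" where
  "pm n N \<longleftrightarrow> 0 \<in> N \<and> (\<forall>x\<in>N. \<forall>y\<in>N. x - y \<in> N) \<and> (\<forall>p\<in>Sn n. \<forall>y\<in>N. p * y \<in> N)"

definition padd :: "'k::field pol set \<Rightarrow> 'k pol \<Rightarrow> 'k pol set \<Rightarrow> 'k pol set" where
  "padd N f K = {k + f * y | k y. k \<in> K \<and> y \<in> N}"

text \<open>Weak regularity: the quotient may become zero, as it does for the void complex.
  Properness is added in \<open>pres.regular_iff\<close>, where the regular sequences of the
  definition appear.\<close>

primrec wreg :: "'k::field pol list \<Rightarrow> 'k pol set \<Rightarrow> 'k pol set \<Rightarrow> bool" where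
  "wreg [] N K \<longleftrightarrow> True"
| "wreg (f # fs) N K \<longleftrightarrow> (\<forall>y\<in>N. f * y \<in> K \<longrightarrow> y \<in> K) \<and> wreg fs N (padd N f K)"

lemma pm_0: "pm n N \<Longrightarrow> 0 \<in> N" and pm_diff: "pm n N \<Longrightarrow> x \<in> N \<Longrightarrow> y \<in> N \<Longrightarrow> x - y \<in> N"
  and pm_times: "pm n N \<Longrightarrow> p \<in> Sn n \<Longrightarrow> y \<in> N \<Longrightarrow> p * y \<in> N" by (auto simp: pm_def)

lemma pm_uminus: "pm n N \<Longrightarrow> y \<in> N \<Longrightarrow> - y \<in> N" using pm_diff[of n N 0 y] pm_0 by auto

lemma pm_add: "pm n N \<Longrightarrow> x \<in> N \<Longrightarrow> y \<in> N \<Longrightarrow> x + y \<in> N" using pm_diff[of n N x "- y"] pm_uminus by auto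

lemma pm_sum: "pm n N \<Longrightarrow> (\<And>i. i \<in> I \<Longrightarrow> f i \<in> N) \<Longrightarrow> (\<Sum>i\<in>I. f i) \<in> N"
  by (induction I rule: infinite_finite_induct) (auto simp: pm_0 pm_add)

lemma pm_poly:
  assumes "pm n N" "\<And>m. m \<in> keys p \<Longrightarrow> single m (lookup p m) \<in> N" shows "p \<in> N"
  using pm_sum[of n N "keys p" "\<lambda>m. single m (lookup p m)"] assms by (simp flip: poly_eq_sum)

lemma pm_MI: "up n P \<Longrightarrow> pm n (MI n P)" unfolding pm_def by (auto intro: SP_0 SP_diff MI_times)

lemma pm_Sn: "pm n (Sn n)" by (rule pm_MI[OF up_UNIV])

lemma pm_ksub: "pm n N \<Longrightarrow> set vs \<subseteq> {1..n} \<Longrightarrow> ksub Xp vs N"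
proof -
  assume N: "pm n N" and vs: "set vs \<subseteq> {1..n}"
  have "Xp v y \<in> N" if "v \<in> set vs" "y \<in> N" for v y
  proof -
    have "pmon (ev v) \<in> Sn n" using that vs by (auto simp: mem_SP_pmon MS_def)
    then show ?thesis unfolding Xp_def by (rule pm_times[OF N _ that(2)])
  qed
  then show ?thesis using pm_0[OF N] pm_diff[OF N] by (auto simp: ksub_def)
qed

lemma Sn_times: "p \<in> Sn n \<Longrightarrow> q \<in> Sn n \<Longrightarrow> p * q \<in> Sn n" by (rule pm_times[OF pm_Sn])

lemma pm_padd:
  assumes N: "pm n N" and K: "pm n K"
  shows "pm n (padd N f K)" unfolding pm_def
proof (intro conjI ballI)
  show "0 \<in> padd N f K" using pm_0[OF N] pm_0[OF K] by (auto simp: padd_def intro!: exI[of _ 0])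
next
  fix x y assume "x \<in> padd N f K" "y \<in> padd N f K"
  then obtain k a l b where xy: "x = k + f * a" "k \<in> K" "a \<in> N" "y = l + f * b" "l \<in> K" "b \<in> N"
    by (auto simp: padd_def)
  then have "x - y = (k - l) + f * (a - b)" by (simp add: algebra_simps)
  moreover have "k - l \<in> K" "a - b \<in> N" using xy pm_diff N K by blast+
  ultimately show "x - y \<in> padd N f K" by (auto simp: padd_def)
next
  fix p y :: "mon \<Rightarrow>\<^sub>0 'a" assume p: "p \<in> Sn n" and "y \<in> padd N f K"
  then obtain k a where y: "y = k + f * a" "k \<in> K" "a \<in> N" by (auto simp: padd_def)
  then have "p * y = p * k + f * (p * a)" by (simp add: algebra_simps)
  moreover have "p * k \<in> K" "p * a \<in> N" using y p pm_times N K by blast+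
  ultimately show "p * y \<in> padd N f K" by (auto simp: padd_def)
qed

lemma padd_sub: "0 \<in> N \<Longrightarrow> K \<subseteq> padd N f K"
proof
  fix k assume "0 \<in> N" "k \<in> K"
  moreover have "k = k + f * 0" by simp
  ultimately show "k \<in> padd N f K" unfolding padd_def by blast
qed

lemma padd_mult: "0 \<in> K \<Longrightarrow> y \<in> N \<Longrightarrow> f * y \<in> padd N f K"
proof -
  assume "0 \<in> K" "y \<in> N"
  moreover have "f * y = 0 + f * y" by simp
  ultimately show "f * y \<in> padd N f K" unfolding padd_def by blast
qed

lemma padd_le: "pm n N \<Longrightarrow> K \<subseteq> N \<Longrightarrow> f \<in> Sn n \<Longrightarrow> padd N f K \<subseteq> N" unfolding padd_def by (auto intro: pm_add pm_times)

lemma padd_mono: "K \<subseteq> L \<Longrightarrow> padd N f K \<subseteq> padd N f L" unfolding padd_def by auto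

abbreviation "paddl N \<equiv> foldl (\<lambda>K f. padd N f K)"

lemma wreg_append: "wreg (fs @ gs) N K \<longleftrightarrow> wreg fs N K \<and> wreg gs N (paddl N K fs)"
  by (induction fs arbitrary: K) auto

lemma wreg_triv: "pm n N \<Longrightarrow> set fs \<subseteq> Sn n \<Longrightarrow> wreg fs N N"
proof (induction fs)
  case (Cons f fs)
  have "padd N f N = N" using padd_le[OF Cons.prems(1), of N f] padd_sub[of N N f] pm_0 Cons.prems by auto
  then show ?case using Cons by auto
qed auto

text \<open>Regularity depends on the quotient only: the hypotheses make \<open>N'\<close> modulo
  \<open>K'\<close> the same as \<open>N\<close> modulo \<open>N \<inter> K'\<close>.\<close>

lemma wreg_iso:
  assumes "pm n N" "pm n K'" "N \<subseteq> N'" "\<And>x. x \<in> N' \<Longrightarrow> \<exists>y\<in>N. x - y \<in> K'" "set fs \<subseteq> Sn n"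
  shows "wreg fs N' K' \<longleftrightarrow> wreg fs N (N \<inter> K')" using assms
proof (induction fs arbitrary: K')
  case (Cons f fs)
  note N = Cons.prems(1) and K = Cons.prems(2) and sub = Cons.prems(3) and ex = Cons.prems(4)
  have f: "f \<in> Sn n" using Cons.prems by simp
  have 1: "(\<forall>y\<in>N'. f * y \<in> K' \<longrightarrow> y \<in> K') \<longleftrightarrow> (\<forall>y\<in>N. f * y \<in> N \<inter> K' \<longrightarrow> y \<in> N \<inter> K')"
  proof
    assume "\<forall>y\<in>N'. f * y \<in> K' \<longrightarrow> y \<in> K'"
    then show "\<forall>y\<in>N. f * y \<in> N \<inter> K' \<longrightarrow> y \<in> N \<inter> K'" using sub by blast
  next
    assume r: "\<forall>y\<in>N. f * y \<in> N \<inter> K' \<longrightarrow> y \<in> N \<inter> K'"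
    show "\<forall>y\<in>N'. f * y \<in> K' \<longrightarrow> y \<in> K'"
    proof (intro ballI impI)
      fix y assume y: "y \<in> N'" "f * y \<in> K'"
      obtain z where z: "z \<in> N" "y - z \<in> K'" using ex[OF y(1)] by blast
      have "f * y - f * (y - z) \<in> K'" using pm_diff[OF K y(2) pm_times[OF K f z(2)]] .
      then have "f * z \<in> K'" by (simp add: algebra_simps)
      then have "z \<in> K'" using r z pm_times[OF N f z(1)] by blast
      then have "(y - z) + z \<in> K'" using pm_add[OF K z(2)] by blast
      then show "y \<in> K'" by simp
    qed
  qed
  have 2: "padd N f (N \<inter> K') = N \<inter> padd N' f K'"
  proof (intro equalityI subsetI)
    fix x assume "x \<in> padd N f (N \<inter> K')"
    then obtain k y where x: "x = k + f * y" "k \<in> N" "k \<in> K'" "y \<in> N" by (auto simp: padd_def)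
    then have "x \<in> N" using pm_add[OF N] pm_times[OF N f] by blast
    moreover have "x \<in> padd N' f K'" using x sub by (auto simp: padd_def)
    ultimately show "x \<in> N \<inter> padd N' f K'" by blast
  next
    fix x assume "x \<in> N \<inter> padd N' f K'"
    then obtain k y where x: "x \<in> N" "x = k + f * y" "k \<in> K'" "y \<in> N'" by (auto simp: padd_def)
    obtain z where z: "z \<in> N" "y - z \<in> K'" using ex[OF x(4)] by blast
    have "k + f * (y - z) \<in> K'" by (rule pm_add[OF K x(3) pm_times[OF K f z(2)]])
    moreover have "x - f * z \<in> N" by (rule pm_diff[OF N x(1) pm_times[OF N f z(1)]])
    moreover have "k + f * (y - z) = x - f * z" using x by (simp add: algebra_simps)
    ultimately have "x - f * z \<in> N \<inter> K'" by simp
    moreover have "x = (x - f * z) + f * z" by simp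
    ultimately show "x \<in> padd N f (N \<inter> K')" using z(1) unfolding padd_def by blast
  qed
  have 3: "\<exists>y\<in>N. x - y \<in> padd N' f K'" if x: "x \<in> N'" for x
  proof -
    have "0 \<in> N'" using pm_0[OF N] sub by blast
    then show ?thesis using ex[OF x] padd_sub[of N' K' f] by blast
  qed
  have 4: "pm n (padd N' f K')"
  proof -
    have "padd N' f K' = padd N f K'"
    proof (intro equalityI subsetI)
      fix x assume "x \<in> padd N' f K'"
      then obtain k y where x: "x = k + f * y" "k \<in> K'" "y \<in> N'" by (auto simp: padd_def)
      obtain z where z: "z \<in> N" "y - z \<in> K'" using ex[OF x(3)] by blast
      have "k + f * (y - z) \<in> K'" by (rule pm_add[OF K x(2) pm_times[OF K f z(2)]])
      moreover have "x = (k + f * (y - z)) + f * z" using x by (simp add: algebra_simps)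
      ultimately show "x \<in> padd N f K'" using z unfolding padd_def by blast
    next
      fix x assume "x \<in> padd N f K'"
      then show "x \<in> padd N' f K'" using sub unfolding padd_def by blast
    qed
    then show ?thesis using pm_padd[OF N K] by simp
  qed
  show ?case using Cons.IH[OF N 4 sub 3] Cons.prems(5) 1 2 by simp
qed auto

lemma wreg_ext:
  assumes "pm n N" "pm n L" "pm n K" "K \<subseteq> L" "L \<subseteq> N" "set fs \<subseteq> Sn n" "wreg fs L K" "wreg fs N L"
  shows "wreg fs N K" using assms
proof (induction fs arbitrary: K L)
  case (Cons f fs)
  note N = Cons.prems(1) and L = Cons.prems(2) and K = Cons.prems(3) and KL = Cons.prems(4) and LN = Cons.prems(5)
  have f: "f \<in> Sn n" "set fs \<subseteq> Sn n" using Cons.prems by auto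
  have rL: "y \<in> K" if "y \<in> L" "f * y \<in> K" for y using Cons.prems(7) that by simp
  have rN: "y \<in> L" if "y \<in> N" "f * y \<in> L" for y using Cons.prems(8) that by simp
  have "y \<in> K" if "y \<in> N" "f * y \<in> K" for y using rN[of y] rL[of y] that KL by blast
  moreover have "wreg fs N (padd N f K)"
  proof (rule Cons.IH[OF N])
    show pL: "pm n (padd N f L)" and pK: "pm n (padd N f K)" using pm_padd N L K by blast+
    show "padd N f K \<subseteq> padd N f L" by (rule padd_mono[OF KL])
    show "padd N f L \<subseteq> N" by (rule padd_le[OF N LN f(1)])
    \<comment> \<open>Regularity of \<open>f\<close> on \<open>N/L\<close> keeps the sequence exact
      after dividing by \<open>f\<close>: a multiple of \<open>f\<close> lying in \<open>L\<close>
      is the multiple of an element of \<open>L\<close>.\<close>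
    have "L \<inter> padd N f K = padd L f K"
    proof (intro equalityI subsetI)
      fix x assume "x \<in> L \<inter> padd N f K"
      then obtain k y where x: "x \<in> L" "x = k + f * y" "k \<in> K" "y \<in> N" by (auto simp: padd_def)
      then have "f * y = x - k" by simp
      then have "f * y \<in> L" using pm_diff[OF L x(1)] x(3) KL by auto
      then have "y \<in> L" by (rule rN[OF x(4)])
      then show "x \<in> padd L f K" using x by (auto simp: padd_def)
    next
      fix x assume "x \<in> padd L f K"
      then have "x \<in> L" using padd_le[OF L KL f(1)] by blast
      moreover have "x \<in> padd N f K" using \<open>x \<in> padd L f K\<close> LN unfolding padd_def by blast
      ultimately show "x \<in> L \<inter> padd N f K" by blast
    qed
    moreover have "wreg fs (padd N f L) (padd N f K) \<longleftrightarrow> wreg fs L (L \<inter> padd N f K)"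
    proof (rule wreg_iso[OF L pK _ _ f(2)])
      show "L \<subseteq> padd N f L" using padd_sub pm_0[OF N] by blast
      fix x assume "x \<in> padd N f L"
      then obtain l y where x: "x = l + f * y" "l \<in> L" "y \<in> N" by (auto simp: padd_def)
      then have "x - l = 0 + f * y" by simp
      then have "x - l \<in> padd N f K" using pm_0[OF K] x(3) unfolding padd_def by blast
      then show "\<exists>y\<in>L. x - y \<in> padd N f K" using x by blast
    qed
    ultimately show "wreg fs (padd N f L) (padd N f K)" using Cons.prems(7) by simp
    show "wreg fs N (padd N f L)" using Cons.prems(8) by simp
  qed (rule f(2))
  ultimately show ?case by auto
qed auto

text \<open>The depth lemma with a fixed sequence. After the common part is divided out,
  \<open>L/K\<close> still embeds into \<open>N/K\<close>, and the last element inherits injectivity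
  from there.\<close>

lemma wreg_sub:
  assumes "pm n N" "pm n L" "pm n K" "K \<subseteq> L" "L \<subseteq> N" "set fs \<subseteq> Sn n" "f \<in> Sn n"
    "wreg (fs @ [f]) N K" "wreg fs N L"
  shows "wreg (fs @ [f]) L K" using assms
proof (induction fs arbitrary: K L)
  case Nil then show ?case by auto
next case (Cons g fs)
  note N = Cons.prems(1) and L = Cons.prems(2) and K = Cons.prems(3) and KL = Cons.prems(4) and LN = Cons.prems(5)
  have g: "g \<in> Sn n" "set fs \<subseteq> Sn n" using Cons.prems by auto
  have rN: "y \<in> L" if "y \<in> N" "g * y \<in> L" for y using Cons.prems(9) that by simp
  have pL: "pm n (padd N g L)" and pK: "pm n (padd N g K)" using pm_padd N L K by blast+
  have "wreg (fs @ [f]) (padd N g L) (padd N g K)"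
    by (rule Cons.IH[OF N pL pK padd_mono[OF KL] padd_le[OF N LN g(1)] g(2) Cons.prems(7)])
      (use Cons.prems in auto)
  moreover have "wreg (fs @ [f]) (padd N g L) (padd N g K) \<longleftrightarrow> wreg (fs @ [f]) L (L \<inter> padd N g K)"
  proof (rule wreg_iso[OF L pK])
    show "L \<subseteq> padd N g L" using padd_sub pm_0[OF N] by blast
    fix x assume "x \<in> padd N g L"
    then obtain l y where x: "x = l + g * y" "l \<in> L" "y \<in> N" by (auto simp: padd_def)
    then have "x - l = 0 + g * y" by simp
    then have "x - l \<in> padd N g K" using pm_0[OF K] x(3) unfolding padd_def by blast
    then show "\<exists>y\<in>L. x - y \<in> padd N g K" using x by blast
  qed (use Cons.prems in auto)
  moreover have "L \<inter> padd N g K = padd L g K"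
  proof (intro equalityI subsetI)
    fix x assume "x \<in> L \<inter> padd N g K"
    then obtain k y where x: "x \<in> L" "x = k + g * y" "k \<in> K" "y \<in> N" by (auto simp: padd_def)
    then have "g * y = x - k" by simp
    then have "g * y \<in> L" using pm_diff[OF L x(1)] x(3) KL by auto
    then have "y \<in> L" by (rule rN[OF x(4)])
    then show "x \<in> padd L g K" using x by (auto simp: padd_def)
  next
    fix x assume "x \<in> padd L g K"
    then have "x \<in> L" using padd_le[OF L KL g(1)] by blast
    moreover have "x \<in> padd N g K" using \<open>x \<in> padd L g K\<close> LN unfolding padd_def by blast
    ultimately show "x \<in> L \<inter> padd N g K" by blast
  qed
  ultimately show ?case using Cons.prems(8) LN by auto
qed

section \<open>Graded submodules\<close>

definition hc :: "int \<Rightarrow> 'k::field pol \<Rightarrow> 'k pol" where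
  "hc d = restr {m. int (mdeg m) = d}"

definition gr :: "'k::field pol set \<Rightarrow> bool" where
  "gr N \<longleftrightarrow> (\<forall>p\<in>N. \<forall>d. hc d p \<in> N)"

lemma hc_add: "hc d (p + q) = hc d p + hc d q" and hc_diff: "hc d (p - q) = hc d p - hc d q"
  by (simp_all add: hc_def restr_add restr_diff)

lemma hc_uminus: "hc d (- p) = - hc d p" by (simp add: hc_def restr_uminus)

lemma hc_0: "hc d 0 = 0" by (rule poly_mapping_eqI) (simp add: hc_def lookup_restr)

lemma hc_Gp: "hc d p \<in> Gp d" by (simp add: Gp_def hc_def keys_restr)

lemma hc_id: "p \<in> Gp d \<Longrightarrow> hc d p = p" unfolding hc_def by (rule restr_id) (auto simp: Gp_def)

lemma hc_other: "p \<in> Gp d \<Longrightarrow> e \<noteq> d \<Longrightarrow> hc e p = 0"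
  by (rule poly_mapping_eqI) (auto simp: hc_def lookup_restr Gp_def in_keys_iff)

lemma hc_sum: "p = (\<Sum>d\<in>(\<lambda>m. int (mdeg m)) ` keys p. hc d p)"
proof (rule poly_mapping_eqI)
  fix m
  show "lookup p m = lookup (\<Sum>d\<in>(\<lambda>m. int (mdeg m)) ` keys p. hc d p) m" by (cases "m \<in> keys p")
      (auto simp: lookup_sum hc_def lookup_restr in_keys_iff sum.delta' intro!: sum.neutral)
qed

lemma gr_MI: "gr (MI n P)" by (auto simp: gr_def SP_def hc_def keys_restr)

lemma Gp_times: "f \<in> Gp e \<Longrightarrow> p \<in> Gp d \<Longrightarrow> f * p \<in> Gp (e + d)"
  unfolding Gp_def using keys_mult[of f p] by (fastforce simp: mdeg_add)

lemma hc_times: assumes f: "f \<in> Gp e" shows "hc d (f * p) = f * hc (d - e) p"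
proof -
  let ?D = "(\<lambda>m. int (mdeg m)) ` keys p"
  have "hc d (f * p) = hc d (\<Sum>i\<in>?D. f * hc i p)"
    using hc_sum[of p] by (metis (no_types, lifting) sum.cong sum_distrib_left)
  also have "\<dots> = (\<Sum>i\<in>?D. hc d (f * hc i p))"
    by (induction rule: finite_induct[OF finite_imageI[OF finite_keys[of p], of "\<lambda>m. int (mdeg m)"]])
      (auto simp: hc_0 hc_add)
  also have "\<dots> = (\<Sum>i\<in>?D. if i = d - e then f * hc (d - e) p else 0)"
  proof (rule sum.cong[OF refl])
    fix i
    have "f * hc i p \<in> Gp (e + i)" by (rule Gp_times[OF f hc_Gp])
    then show "hc d (f * hc i p) = (if i = d - e then f * hc (d - e) p else 0)"
      using hc_id[of "f * hc i p" "e + i"] hc_other[of "f * hc i p" "e + i" d] by auto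
  qed
  also have "\<dots> = f * hc (d - e) p"
  proof (cases "d - e \<in> ?D")
    case True then show ?thesis by simp
  next case False have "hc (d - e) p = 0"
    proof (rule poly_mapping_eqI)
      fix m
      have "m \<notin> keys p" if "int (mdeg m) = d - e" using False that by (metis imageI)
      then show "lookup (hc (d - e) p) m = lookup 0 m" by (auto simp: hc_def lookup_restr in_keys_iff)
    qed
    then show ?thesis using False by simp
  qed
  finally show ?thesis .
qed

lemma gr_padd: "gr N \<Longrightarrow> gr K \<Longrightarrow> f \<in> Gp e \<Longrightarrow> gr (padd N f K)"
  unfolding gr_def padd_def by (fastforce simp: hc_add hc_times)

lemma Xp_Gp1: "pmon (ev c) \<in> Gp 1" by (simp add: Gp_def mdeg_ev)

lemma hc_Xp: "hc d (Xp v p) = Xp v (hc (d - 1) p)" unfolding Xp_def by (rule hc_times[OF Xp_Gp1])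

text \<open>Krull intersection in graded form: a component of degree \<open>d\<close> receives
  nothing from a multiple of the power \<open>d + 1\<close> of a variable.\<close>

lemma xpow_descent:
  fixes K :: "'k::field pol set"
  assumes K: "pm n K" "gr K" and y: "\<And>m. \<exists>z. y - pmon (ev c) ^ m * z \<in> K"
  shows "y \<in> K"
proof -
  have xm: "pmon (ev c) ^ m \<in> (Gp (int m) :: 'k pol set)" for m
  proof (induction m)
    case 0 show ?case by (simp add: Gp_def)
  next case (Suc m) then show ?case using Gp_times[OF Xp_Gp1[of c] Suc] by simp
  qed
  have "hc d y \<in> K" for d
  proof -
    obtain z where z: "y - pmon (ev c) ^ (Suc (nat d)) * z \<in> K" using y by blast
    then have "hc d (y - pmon (ev c) ^ (Suc (nat d)) * z) \<in> K" using K by (auto simp: gr_def)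
    moreover have "hc d (pmon (ev c) ^ (Suc (nat d)) * z) = pmon (ev c) ^ (Suc (nat d)) * hc (d - int (Suc (nat d))) z"
      by (rule hc_times[OF xm])
    moreover have "hc (d - int (Suc (nat d))) z = 0" by (rule poly_mapping_eqI) (auto simp: hc_def lookup_restr)
    ultimately show ?thesis by (simp add: hc_diff)
  qed
  then have "(\<Sum>d\<in>(\<lambda>m. int (mdeg m)) ` keys y. hc d y) \<in> K" by (intro pm_sum[OF K(1)])
  then show ?thesis using hc_sum[of y] by simp
qed

text \<open>Homogeneous regular sequences can be reordered: a regular variable \<open>x\<close>
  followed by \<open>fs\<close> may be moved behind \<open>fs\<close>.\<close>

lemma wreg_lift_var:
  fixes N K :: "'k::field pol set"
  assumes "pm n N" "pm n K" "gr N" "gr K" "K \<subseteq> N"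
    and "\<And>y. y \<in> N \<Longrightarrow> x * y \<in> K \<Longrightarrow> y \<in> K" and x: "x = pmon (ev c)" "c \<in> {1..n}"
    and "\<And>f. f \<in> set fs \<Longrightarrow> f \<in> Sn n \<and> (\<exists>e. f \<in> Gp e)"
    and "wreg fs N (padd N x K)"
  shows "wreg fs N K \<and> (\<forall>y\<in>N. x * y \<in> paddl N K fs \<longrightarrow> y \<in> paddl N K fs)" using assms(1-6,9,10)
proof (induction fs arbitrary: K)
  case (Cons f fs)
  note N = Cons.prems(1) and K = Cons.prems(2) and grN = Cons.prems(3) and grK = Cons.prems(4)
    and KN = Cons.prems(5) and xr = Cons.prems(6)
  have xS: "x \<in> Sn n" using x by (simp add: mem_SP_pmon MS_def)
  obtain e where f: "f \<in> Sn n" "f \<in> Gp e" using Cons.prems(7) by auto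
  have fr: "z \<in> padd N x K" if "z \<in> N" "f * z \<in> padd N x K" for z using Cons.prems(8) that by simp
  have Kx: "K \<subseteq> padd N x K" using padd_sub pm_0[OF N] by blast
  have fK: "y \<in> K" if y: "y \<in> N" "f * y \<in> K" for y
  proof (rule xpow_descent[OF K grK])
    \<comment> \<open>Repeated division: if \<open>f\<close> kills \<open>z\<close> modulo
      \<open>K\<close>, then \<open>z\<close> is a multiple of \<open>x\<close> modulo
      \<open>K\<close>, and regularity of \<open>x\<close> shows that the cofactor is again killed
      by \<open>f\<close>.\<close>
    have "\<exists>z\<in>N. y - x ^ m * z \<in> K \<and> f * z \<in> K" for m
    proof (induction m)
      case 0 show ?case using y pm_0[OF K] by (intro bexI[of _ y]) auto
    next case (Suc m)
      then obtain z where z: "z \<in> N" "y - x ^ m * z \<in> K" "f * z \<in> K" by blast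
      have "z \<in> padd N x K" by (rule fr[OF z(1)]) (use z Kx in blast)
      then obtain k w where w: "z = k + x * w" "k \<in> K" "w \<in> N" by (auto simp: padd_def)
      have xmS: "x ^ m \<in> Sn n" by (induction m) (auto simp: Sn_times[OF xS], simp add: SP_def MS_def)
      have "f * z - f * k \<in> K" by (rule pm_diff[OF K z(3) pm_times[OF K f(1) w(2)]])
      then have "x * (f * w) \<in> K" using w by (simp add: algebra_simps)
      then have "f * w \<in> K" by (rule xr[OF pm_times[OF N f(1) w(3)]])
      moreover have "(y - x ^ m * z) + x ^ m * k \<in> K" by (rule pm_add[OF K z(2) pm_times[OF K xmS w(2)]])
      moreover have "(y - x ^ m * z) + x ^ m * k = y - x ^ Suc m * w" using w by (simp add: algebra_simps)
      ultimately show ?case using w(3) by auto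
    qed
    then show "\<exists>z. y - pmon (ev c) ^ m * z \<in> K" for m using x by blast
  qed
  have xf: "y \<in> padd N f K" if y: "y \<in> N" "x * y \<in> padd N f K" for y
  proof -
    obtain k w where w: "x * y = k + f * w" "k \<in> K" "w \<in> N" using y(2) by (auto simp: padd_def)
    have "f * w = - k + x * y" using w by simp
    then have "f * w \<in> padd N x K" using pm_uminus[OF K w(2)] y(1) unfolding padd_def by blast
    then obtain l z where z: "w = l + x * z" "l \<in> K" "z \<in> N" using fr[OF w(3)] by (auto simp: padd_def)
    have "x * (y - f * z) = k + f * l" using w z by (simp add: algebra_simps)
    moreover have "k + f * l \<in> K" by (rule pm_add[OF K w(2) pm_times[OF K f(1) z(2)]])
    ultimately have "y - f * z \<in> K" using xr[OF pm_diff[OF N y(1) pm_times[OF N f(1) z(3)]]] by simp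
    moreover have "y = (y - f * z) + f * z" by simp
    ultimately show ?thesis using z(3) unfolding padd_def by blast
  qed
  have comm1: "padd N f (padd N x K) \<subseteq> padd N x (padd N f K)" for f x
  proof
    fix y assume "y \<in> padd N f (padd N x K)"
    then obtain k a b where y: "y = (k + x * a) + f * b" "k \<in> K" "a \<in> N" "b \<in> N" unfolding padd_def by blast
    then have "y = (k + f * b) + x * a" by (simp add: algebra_simps)
    then show "y \<in> padd N x (padd N f K)" unfolding padd_def using y by blast
  qed
  have comm: "padd N f (padd N x K) = padd N x (padd N f K)" using comm1 by blast
  have "wreg fs N (padd N f K) \<and> (\<forall>y\<in>N. x * y \<in> paddl N (padd N f K) fs
      \<longrightarrow> y \<in> paddl N (padd N f K) fs)"
    by (rule Cons.IH[OF N pm_padd[OF N K] grN gr_padd[OF grN grK f(2)] padd_le[OF N KN f(1)]])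
      (use xf Cons.prems(7,8) comm in auto)
  then show ?case using fK by simp
qed auto

section \<open>Elementary symmetric polynomials as a universal regular sequence\<close>

definition esym :: "nat set \<Rightarrow> nat \<Rightarrow> 'k::field pol" where
  "esym V i = (\<Sum>A\<in>{A. A \<subseteq> V \<and> card A = i}. pmon (xmon A))"

definition thetas :: "nat \<Rightarrow> nat \<Rightarrow> 'k::field pol list" where
  "thetas n d = map (esym {1..n}) [1..<Suc d]"

definition Th :: "'k::field itself \<Rightarrow> nat \<Rightarrow> nat set set \<Rightarrow> nat \<Rightarrow> bool" where
  "Th ty n X d \<longleftrightarrow> wreg (thetas n d :: 'k pol list) (Sn n) (MI n (- X))"

lemma keys_esym: "finite V \<Longrightarrow> m \<in> keys (esym V i) \<Longrightarrow> \<exists>A. A \<subseteq> V \<and> card A = i \<and> m = xmon A"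
proof -
  assume "m \<in> keys (esym V i :: mon \<Rightarrow>\<^sub>0 'a)"
  then have "m \<in> (\<Union>A\<in>{A. A \<subseteq> V \<and> card A = i}. keys (pmon (xmon A) :: mon \<Rightarrow>\<^sub>0 'a))"
    unfolding esym_def by (rule subsetD[OF keys_sum])
  then show ?thesis by auto
qed

lemma esym_Sn: "esym {1..n} i \<in> (Sn n :: 'k::field pol set)"
proof -
  have "m \<in> MS n UNIV" if mk: "m \<in> keys (esym {1..n} i :: 'k pol)" for m
  proof -
    obtain A where A: "A \<subseteq> {1..n}" "m = xmon A" using keys_esym[OF _ mk] by auto
    moreover have "finite A" using A finite_subset by blast
    ultimately show ?thesis by (simp add: MS_def keys_xmon)
  qed
  then show ?thesis by (auto simp: SP_def)
qed

lemma esym_Gp: "finite V \<Longrightarrow> esym V i \<in> Gp (int i)"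
proof -
  assume V: "finite V"
  have "int (mdeg m) = int i" if m: "m \<in> keys (esym V i :: mon \<Rightarrow>\<^sub>0 'a)" for m
  proof -
    obtain A where A: "A \<subseteq> V" "card A = i" "m = xmon A" using keys_esym[OF V m] by blast
    then show ?thesis using mdeg_xmon[OF finite_subset[OF A(1) V]] by simp
  qed
  then show ?thesis by (simp add: Gp_def)
qed

lemma esym_0: "finite V \<Longrightarrow> esym V 0 = 1"
proof -
  assume "finite V"
  then have "A = {}" if "A \<subseteq> V" "card A = 0" for A using that finite_subset[OF that(1)] by auto
  then have "{A. A \<subseteq> V \<and> card A = 0} = {{}}" by auto
  then show ?thesis by (simp add: esym_def xmon_def pmon_def)
qed

lemma esym_insert:
  assumes V: "finite V" "c \<notin> V"
  shows "esym (insert c V) (Suc i) = esym V (Suc i) + pmon (ev c) * esym V i"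
proof -
  let ?S = "\<lambda>V i. {A. A \<subseteq> V \<and> card A = i}"
  have fin: "finite (?S V i)" for i using V by simp
  have fS: "finite A" if "A \<in> ?S V i" for A i using that V finite_subset by blast
  have "?S (insert c V) (Suc i) = ?S V (Suc i) \<union> insert c ` ?S V i"
  proof (intro equalityI subsetI)
    fix A assume A: "A \<in> ?S (insert c V) (Suc i)"
    then have finA: "finite A" using V finite_subset by (metis finite_insert mem_Collect_eq)
    show "A \<in> ?S V (Suc i) \<union> insert c ` ?S V i"
    proof (cases "c \<in> A")
      case True
      then have "A = insert c (A - {c})" "A - {c} \<in> ?S V i" using A finA by auto
      then show ?thesis by blast
    qed (use A in auto)
  next
    fix A assume A: "A \<in> ?S V (Suc i) \<union> insert c ` ?S V i"
    then show "A \<in> ?S (insert c V) (Suc i)"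
    proof
      assume "A \<in> insert c ` ?S V i"
      then obtain B where B: "A = insert c B" "B \<in> ?S V i" by blast
      have "c \<notin> B" using V B(2) by blast
      moreover have "finite B" by (rule fS[OF B(2)])
      ultimately show ?thesis using B by auto
    qed auto
  qed
  moreover have "?S V (Suc i) \<inter> insert c ` ?S V i = {}" using V by auto
  moreover have inj: "inj_on (insert c) (?S V i)"
  proof (rule inj_onI)
    fix A B assume "A \<in> ?S V i" "B \<in> ?S V i" "insert c A = insert c B"
    moreover from this have "c \<notin> A" "c \<notin> B" using V by auto
    ultimately show "A = B" by (simp add: insert_ident)
  qed
  moreover have "pmon (xmon (insert c A)) = pmon (ev c) * (pmon (xmon A) :: mon \<Rightarrow>\<^sub>0 'a)" if "A \<in> ?S V i" for A
  proof -
    have "c \<notin> A" using that V by blast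
    moreover have "finite A" by (rule fS[OF that])
    ultimately show ?thesis by (simp add: xmon_def pmon_times ev_def)
  qed
  ultimately have "esym (insert c V) (Suc i) = (\<Sum>A\<in>?S V (Suc i). pmon (xmon A))
      + (\<Sum>A\<in>?S V i. pmon (ev c) * (pmon (xmon A) :: mon \<Rightarrow>\<^sub>0 'a))"
    unfolding esym_def by (simp add: sum.union_disjoint fin sum.reindex)
  then show ?thesis by (simp add: esym_def sum_distrib_left)
qed

lemma foldl_padd:
  assumes N: "pm n N" and K: "pm n K" "K \<subseteq> N" and fs: "set fs \<subseteq> Sn n"
  shows "pm n (paddl N K fs)" "K \<subseteq> paddl N K fs"
    "f \<in> set fs \<Longrightarrow> y \<in> N \<Longrightarrow> f * y \<in> paddl N K fs"
    "paddl N K fs \<subseteq> N"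
proof -
  have "pm n (paddl N K fs) \<and> K \<subseteq> paddl N K fs \<and>
    (\<forall>f\<in>set fs. \<forall>y\<in>N. f * y \<in> paddl N K fs) \<and> paddl N K fs \<subseteq> N" using K fs
  proof (induction fs arbitrary: K)
    case (Cons g fs) have IH: "pm n (paddl N (padd N g K) fs) \<and> padd N g K \<subseteq> paddl N (padd N g K) fs \<and>
      (\<forall>f\<in>set fs. \<forall>y\<in>N. f * y \<in> paddl N (padd N g K) fs) \<and>
      paddl N (padd N g K) fs \<subseteq> N" by (rule Cons.IH) (use Cons.prems pm_padd[OF N] padd_le[OF N] in auto)
    moreover have "K \<subseteq> padd N g K" using padd_sub pm_0[OF N] by blast
    moreover have "g * y \<in> padd N g K" if "y \<in> N" for y by (rule padd_mult[OF pm_0[OF Cons.prems(1)] that])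
    ultimately show ?case by auto
  qed auto
  then show "pm n (paddl N K fs)" "K \<subseteq> paddl N K fs"
    "f \<in> set fs \<Longrightarrow> y \<in> N \<Longrightarrow> f * y \<in> paddl N K fs"
    "paddl N K fs \<subseteq> N" by blast+
qed

lemma thetas_Suc: "thetas n (Suc d) = thetas n d @ [esym {1..n} (Suc d)]" by (simp add: thetas_def)

lemma thetas_mem: "f \<in> set (thetas n d) \<longleftrightarrow> (\<exists>i. 1 \<le> i \<and> i \<le> d \<and> f = esym {1..n} i)"
  unfolding thetas_def by (auto simp del: upt_Suc)

lemma length_thetas: "length (thetas n d) = d" by (simp add: thetas_def del: upt_Suc)

lemma thetas_set: "set (thetas n d) \<subseteq> Sn n" using esym_Sn by (auto simp: thetas_mem)

text \<open>On a cone with apex \<open>c\<close> over a complex with faces of size at most \<open>d\<close>, modulo the first \<open>d\<close>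
  elementary symmetric polynomials the next one is, up to sign, the power \<open>x\<^sub>c\<^sup>d\<^sup>+\<^sup>1\<close>.\<close>

lemma Th_cone:
  fixes ty :: "'k::field itself"
  assumes Z: "cplx n Z" and c: "c \<in> {1..n}" and cZ: "\<And>T. T \<in> Z \<Longrightarrow> c \<notin> T \<and> card T \<le> d" and T: "Th ty n Z d"
  shows "Th ty n (cone c Z) (Suc d)"
proof -
  let ?N = "Sn n :: 'k pol set" and ?K = "MI n (- cone c Z) :: 'k pol set"
  let ?fs = "thetas n d :: 'k pol list"
  let ?J = "foldl (\<lambda>K f. padd ?N f K) ?K ?fs"
  define x where "x = (pmon (ev c) :: 'k pol)"
  have K: "pm n ?K" by (rule pm_MI[OF up_compl[OF cplx_cone[OF Z c]]])
  have KN: "?K \<subseteq> ?N" by (rule MI_mono) simp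
  have ins: "insert c A \<in> cone c Z \<longleftrightarrow> A \<in> cone c Z" for A by (simp add: cone_def)
  have xS: "x \<in> ?N" using c by (simp add: x_def mem_SP_pmon MS_def)
  have xr: "y \<in> ?K" if "y \<in> ?N" "x * y \<in> ?K" for y
  proof -
    have "ev c + m \<in> MS n (- cone c Z)" if "m \<in> keys y" for m
      using that \<open>x * y \<in> ?K\<close> unfolding x_def by (auto simp: SP_def keys_pmon_times)
    then show ?thesis by (auto simp: SP_def MS_def keys_ev_add ins)
  qed
  \<comment> \<open>Cutting the cone by its apex leaves the ring of \<open>Z\<close>, on which the
    first \<open>d\<close> polynomials are regular; \<open>wreg_lift_var\<close> then puts them in
    front of the apex.\<close>
  have KZ: "padd ?N x ?K = MI n (- Z)"
  proof (intro equalityI subsetI)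
    fix y assume "y \<in> padd ?N x ?K"
    then obtain k w where y: "y = k + x * w" "k \<in> ?K" "w \<in> ?N" by (auto simp: padd_def)
    have "Z \<subseteq> cone c Z"
    proof
      fix T assume "T \<in> Z"
      then have "T - {c} = T" using cZ by auto
      then show "T \<in> cone c Z" using \<open>T \<in> Z\<close> by (simp add: cone_def)
    qed
    then have "k \<in> MI n (- Z)" using y(2) MI_mono[of "- cone c Z" "- Z" n] by blast
    moreover have "x * w \<in> MI n (- Z)"
    proof -
      have "ev c + m \<in> MS n (- Z)" if "m \<in> keys w" for m
      proof -
        have "keys m \<subseteq> {1..n}" using that y(3) by (auto simp: SP_def MS_def)
        moreover have "insert c (keys m) \<notin> Z" using cZ by blast
        ultimately show ?thesis using c by (simp add: MS_def keys_ev_add)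
      qed
      then show ?thesis unfolding x_def by (auto simp: SP_def keys_pmon_times)
    qed
    ultimately show "y \<in> MI n (- Z)" unfolding y(1) by (rule SP_add)
  next
    fix y :: "'k pol" assume y: "y \<in> MI n (- Z)"
    let ?a = "restr {m. c \<in> keys m} y"
    have "Xp c (divX c ?a) = ?a" by (rule Xp_divX) (auto simp: keys_restr)
    then have a: "?a = x * divX c ?a" by (simp add: x_def Xp_def)
    have "divX c ?a \<in> ?N"
    proof -
      have "m \<in> MS n UNIV" if "m \<in> keys (divX c ?a)" for m
      proof -
        have "ev c + m \<in> keys y" using that by (simp add: keys_divX keys_restr)
        then have "ev c + m \<in> MS n (- Z)" using y by (auto simp: SP_def)
        then show ?thesis by (simp add: MS_def keys_ev_add)
      qed
      then show ?thesis by (auto simp: SP_def)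
    qed
    moreover have "y - ?a \<in> ?K"
    proof -
      have "m \<in> MS n (- cone c Z)" if "m \<in> keys (y - ?a)" for m
      proof -
        have "m \<in> keys y" "c \<notin> keys m" using that diff_restr[of y "{m. c \<in> keys m}"] by (auto simp: SP_def)
        then show ?thesis using y by (auto simp: SP_def MS_def cone_def)
      qed
      then show ?thesis by (auto simp: SP_def)
    qed
    moreover have "y = (y - ?a) + x * divX c ?a" using a by simp
    ultimately show "y \<in> padd ?N x ?K" unfolding padd_def by blast
  qed
  have fsS: "set ?fs \<subseteq> Sn n" by (rule thetas_set)
  have "wreg ?fs ?N ?K \<and> (\<forall>y\<in>?N. x * y \<in> ?J \<longrightarrow> y \<in> ?J)"
  proof (rule wreg_lift_var[OF pm_Sn K gr_MI gr_MI KN xr x_def c])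
    show "wreg ?fs ?N (padd ?N x ?K)" using T KZ by (simp add: Th_def)
    show "f \<in> Sn n \<and> (\<exists>e. f \<in> Gp e)" if "f \<in> set ?fs" for f
    proof -
      obtain i where "f = esym {1..n} i" using \<open>f \<in> set ?fs\<close> by (auto simp: thetas_mem)
      then show ?thesis using esym_Sn esym_Gp[of "{1..n}" i] by blast
    qed
  qed
  then have w: "wreg ?fs ?N ?K" and xJ: "\<And>y. y \<in> ?N \<Longrightarrow> x * y \<in> ?J \<Longrightarrow> y \<in> ?J" by blast+
  note J = foldl_padd[OF pm_Sn K KN fsS]
  let ?E = "esym ({1..n} - {c})"
  have e: "esym {1..n} (Suc i) = ?E (Suc i) + x * ?E i" for i
    using esym_insert[of "{1..n} - {c}" c i] c by (simp add: insert_absorb x_def)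
  have ES: "?E i \<in> ?N" for i
  proof -
    have "m \<in> MS n UNIV" if mk: "m \<in> keys (?E i :: 'k pol)" for m
    proof -
      obtain A where A: "A \<subseteq> {1..n} - {c}" "m = xmon A" using keys_esym[OF _ mk] by auto
      moreover have "finite A" using A finite_subset by blast
      ultimately show ?thesis by (auto simp: MS_def keys_xmon)
    qed
    then show ?thesis by (auto simp: SP_def)
  qed
  have "y \<in> ?J" if y: "y \<in> ?N" "esym {1..n} (Suc d) * y \<in> ?J" for y
  proof -
    \<comment> \<open>Each of the first \<open>d\<close> polynomials vanishes in the quotient and
      has the form \<open>?E (Suc i) + x * ?E i\<close>; recursively, the symmetric polynomials of
      the other variables become powers of \<open>- x\<close>.\<close>
    have 1: "?E i * y - (- x) ^ i * y \<in> ?J" if "i \<le> d" for i using that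
    proof (induction i)
      case 0 show ?case using pm_0[OF J(1)] by (simp add: esym_0)
    next case (Suc i) have "esym {1..n} (Suc i) \<in> set ?fs"
        unfolding thetas_mem using Suc.prems by (intro exI[of _ "Suc i"]) simp
      then have "esym {1..n} (Suc i) * y \<in> ?J" by (rule J(3)[OF _ y(1)])
      moreover have "x * (?E i * y - (- x) ^ i * y) \<in> ?J" using pm_times[OF J(1) xS] Suc by simp
      ultimately have "esym {1..n} (Suc i) * y - x * (?E i * y - (- x) ^ i * y) \<in> ?J" by (rule pm_diff[OF J(1)])
      then show ?case by (simp add: e algebra_simps)
    qed
    \<comment> \<open>The size bound enters here: no face of \<open>Z\<close> has
      \<open>d + 1\<close> vertices, so every monomial of this polynomial is a nonface of the
      cone.\<close>
    have "?E (Suc d) \<in> ?K"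
    proof -
      have "m \<in> MS n (- cone c Z)" if mk: "m \<in> keys (?E (Suc d) :: 'k pol)" for m
      proof -
        obtain A where A: "A \<subseteq> {1..n} - {c}" "card A = Suc d" "m = xmon A" using keys_esym[OF _ mk] by auto
        have "finite A" using A finite_subset by blast
        moreover have "A - {c} = A" using A by auto
        ultimately show ?thesis using A cZ[of A] by (auto simp: MS_def keys_xmon cone_def)
      qed
      then show ?thesis by (auto simp: SP_def)
    qed
    then have "y * ?E (Suc d) \<in> ?J" using J(2) pm_times[OF K y(1)] by blast
    from pm_diff[OF J(1) y(2) this] have "x * (?E d * y) \<in> ?J" by (simp add: e algebra_simps)
    from pm_diff[OF J(1) this pm_times[OF J(1) xS 1[of d]]]
    have "x * ((- x) ^ d * y) \<in> ?J" by (simp add: algebra_simps)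
    moreover have xpow: "(- x) ^ i * y \<in> ?N" for i
    proof (induction i)
      case (Suc i) have "- (x * ((- x) ^ i * y)) \<in> ?N" by (rule pm_uminus[OF pm_Sn Sn_times[OF xS Suc]])
      then show ?case by (simp add: algebra_simps)
    qed (use y in simp)
    ultimately have "(- x) ^ d * y \<in> ?J" using xJ by blast
    moreover have "(- x) ^ i * y \<in> ?J \<Longrightarrow> y \<in> ?J" for i
    proof (induction i)
      case (Suc i) have "- ((- x) ^ Suc i * y) \<in> ?J" by (rule pm_uminus[OF J(1) Suc.prems])
      then have "x * ((- x) ^ i * y) \<in> ?J" by (simp add: algebra_simps)
      then show ?case using xJ[OF xpow] Suc.IH by blast
    qed simp
    ultimately show ?thesis by blast
  qed
  then show ?thesis using w unfolding Th_def thetas_Suc wreg_append by simp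
qed

text \<open>The ring of \<open>A \<union> B\<close> is an extension of the ring of \<open>A\<close>
  by the ideal of \<open>A\<close> modulo the intersection of the two ideals. That term is the
  kernel of the map from the ring of \<open>B\<close> to the ring of \<open>A \<inter> B\<close>, so
  the depth lemma applies to it.\<close>

lemma Th_glue_cone: "glue_cone (Th ty n) n" for ty :: "'k::field itself"
proof
  show "Th ty n {} d" for d using wreg_triv[OF pm_Sn thetas_set] by (simp add: Th_def)
  show "Th ty n {{}} 0" by (simp add: Th_def thetas_def)
  fix A B :: "nat set set" and d
  assume c: "cplx n A" "cplx n B" and A: "Th ty n A (Suc d)" and B: "Th ty n B (Suc d)"
    and I: "Th ty n (A \<inter> B) d"
  let ?N = "Sn n :: 'k pol set" and ?fs = "thetas n d :: 'k pol list"
  let ?A = "MI n (- A) :: 'k pol set" and ?B = "MI n (- B) :: 'k pol set"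
  let ?U = "MI n (- A \<union> - B) :: 'k pol set"
  let ?I = "MI n (- A \<inter> - B) :: 'k pol set"
  note pA = pm_MI[OF up_compl[OF c(1)]] and pB = pm_MI[OF up_compl[OF c(2)]]
    and pU = pm_MI[OF up_Un[OF up_compl[OF c(1)] up_compl[OF c(2)]]]
    and pI = pm_MI[OF up_Int[OF up_compl[OF c(1)] up_compl[OF c(2)]]]
  have wU: "wreg (thetas n (Suc d)) ?U ?B" unfolding thetas_Suc
  proof (rule wreg_sub[OF pm_Sn pU pB])
    show "wreg (?fs @ [esym {1..n} (Suc d)]) ?N ?B" using B unfolding Th_def thetas_Suc .
    show "wreg ?fs ?N ?U" using I unfolding Th_def Compl_Int .
  qed (auto intro!: MI_mono thetas_set esym_Sn)
  have "wreg (thetas n (Suc d)) ?U ?B \<longleftrightarrow> wreg (thetas n (Suc d)) ?A (?A \<inter> ?B)"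
  proof (rule wreg_iso[OF pA pB _ _ thetas_set])
    show "?A \<subseteq> ?U" by (rule MI_mono) simp
    fix x assume "x \<in> ?U"
    then obtain a b where "x = a + b" "a \<in> ?A" "b \<in> ?B" using MI_split by metis
    then show "\<exists>y\<in>?A. x - y \<in> ?B" by (intro bexI[of _ a]) auto
  qed
  with wU have wA: "wreg (thetas n (Suc d)) ?A ?I" by (simp add: MI_Int)
  have "wreg (thetas n (Suc d)) ?N ?I"
  proof (rule wreg_ext[OF pm_Sn pA pI _ _ thetas_set wA])
    show "wreg (thetas n (Suc d)) ?N ?A" using A unfolding Th_def .
  qed (auto intro!: MI_mono)
  then show "Th ty n (A \<union> B) (Suc d)" unfolding Th_def Compl_Un .
qed (rule Th_cone)

section \<open>Regular sequences and Koszul homology\<close>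

lemma kd_times: "kd Xp vs (\<lambda>l. p * c l) l = p * kd Xp vs c l"
proof (induction vs arbitrary: c l)
  case (Cons v vs) then show ?case by (auto simp: Xp_def algebra_simps split: list.split)
qed simp

text \<open>Each nonconstant monomial of \<open>f\<close> acts through one of its variables, and
  variables are null-homotopic. Degrees are dropped because \<open>f\<close> need not be
  homogeneous.\<close>

lemma ideal_boundary:
  fixes N K :: "'k::field pol set"
  assumes N: "pm n N" and K: "pm n K" and vs: "set vs = {1..n}"
    and f: "f \<in> Sn n" "0 \<notin> keys f"
    and c: "kch (\<lambda>_. UNIV) vs N j t c" and dc: "\<And>l. kd Xp vs c l \<in> K"
  shows "\<exists>g. kch (\<lambda>_. UNIV) vs N (Suc j) t g \<and> (\<forall>l. f * c l - kd Xp vs g l \<in> K)"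
proof -
  interpret U: kmod Xp "\<lambda>_. UNIV :: 'k pol set" by (rule kmod_Xp_UNIV)
  have sN: "ksub Xp vs N" and sK: "ksub Xp vs K" using pm_ksub N K vs by blast+
  have 1: "\<exists>g. kch (\<lambda>_. UNIV) vs N (Suc j) t g \<and> (\<forall>l. single m a * c l - kd Xp vs g l \<in> K)"
    if m: "keys m \<subseteq> {1..n}" "m \<noteq> 0" for m a
  proof -
    obtain v where v: "v \<in> keys m" using m(2) poly_mapping_eqI[of m 0] by (auto simp: in_keys_iff)
    then obtain m' where m': "m = ev v + m'" using ev_divides by blast
    have p: "single m' a \<in> Sn n" using m(1) m' by (auto simp: SP_def MS_def keys_ev_add)
    have "v \<in> set vs" using v m vs by auto
    from U.X_boundary[OF sN sK this c dc]
    obtain g where g: "kch (\<lambda>_. UNIV) vs N (Suc j) (t + 1) g" "\<And>l. Xp v (c l) - kd Xp vs g l \<in> K" by blast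
    have "kch (\<lambda>_. UNIV) vs N (Suc j) t (\<lambda>l. single m' a * g l)"
      using g(1) pm_times[OF N p] by (auto simp: kch_def)
    moreover have "single m a * c l - kd Xp vs (\<lambda>l. single m' a * g l) l \<in> K" for l
    proof -
      have "single m a = single m' a * pmon (ev v)" by (simp add: m' pmon_def mult_single add.commute)
      then have "single m a * c l - single m' a * kd Xp vs g l = single m' a * (Xp v (c l) - kd Xp vs g l)"
        by (simp add: Xp_def algebra_simps)
      then show ?thesis using pm_times[OF K p g(2)[of l]] by (simp only: kd_times)
    qed
    ultimately show ?thesis by blast
  qed
  have "\<exists>g. kch (\<lambda>_. UNIV) vs N (Suc j) t g \<and> (\<forall>l. (\<Sum>m\<in>S. single m (lookup f m)) * c l - kd Xp vs g l \<in> K)"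
    if "finite S" "S \<subseteq> keys f" for S using that
  proof (induction S)
    case empty show ?case using U.kch_0[OF sN] pm_0[OF K] by (intro exI[of _ "\<lambda>l. 0"]) (auto simp: U.kd_0)
  next case (insert m S)
    then obtain g where g: "kch (\<lambda>_. UNIV) vs N (Suc j) t g"
      "\<And>l. (\<Sum>m\<in>S. single m (lookup f m)) * c l - kd Xp vs g l \<in> K" by auto
    have "keys m \<subseteq> {1..n}" "m \<noteq> 0" using insert.prems f by (auto simp: SP_def MS_def)
    then obtain h where h: "kch (\<lambda>_. UNIV) vs N (Suc j) t h"
      "\<And>l. single m (lookup f m) * c l - kd Xp vs h l \<in> K" using 1 by blast
    have "kch (\<lambda>_. UNIV) vs N (Suc j) t (\<lambda>l. h l + g l)" by (rule U.kch_add[OF h(1) g(1) sN])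
    moreover have "(\<Sum>m\<in>insert m S. single m (lookup f m)) * c l - kd Xp vs (\<lambda>l. h l + g l) l \<in> K" for l
      using pm_add[OF K h(2)[of l] g(2)[of l]] insert.hyps by (simp add: U.kd_add algebra_simps)
    ultimately show ?case by blast
  qed
  from this[of "keys f"] show ?thesis using poly_eq_sum[of f] by simp
qed

text \<open>As \<open>f\<close> acts as zero on homology, the connecting map sends index
  \<open>j + 1\<close> of the quotient by \<open>f\<close> onto index \<open>j\<close>. Each element
  of the sequence raises the index by one, until it exceeds the number of variables.\<close>

lemma wreg_Hz:
  fixes N K :: "'k::field pol set"
  assumes "pm n N" "pm n K" "K \<subseteq> N" "set fs \<subseteq> Sn n" "\<And>f. f \<in> set fs \<Longrightarrow> 0 \<notin> keys f"
    "wreg fs N K" "distinct vs" "set vs = {1..n}" "n < j + length fs"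
  shows "Hz Xp (\<lambda>_. UNIV) vs N K j t" using assms
proof (induction fs arbitrary: K j)
  case Nil have "length vs = n" using distinct_card[of vs] Nil by simp
  then show ?case using Nil by (intro kmod.Hz_above[OF kmod_Xp_UNIV]) (auto intro!: pm_ksub)
next case (Cons f fs)
  interpret U: kmod Xp "\<lambda>_. UNIV :: 'k pol set" by (rule kmod_Xp_UNIV)
  note N = Cons.prems(1) and K = Cons.prems(2) and KN = Cons.prems(3) and vs = Cons.prems(7,8)
  have f: "f \<in> Sn n" "0 \<notin> keys f" and fr: "\<And>y. y \<in> N \<Longrightarrow> f * y \<in> K \<Longrightarrow> y \<in> K" using Cons.prems by auto
  have sN: "ksub Xp vs N" and sK: "ksub Xp vs K" using pm_ksub N K vs by blast+
  let ?L = "padd N f K"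
  have L: "pm n ?L" by (rule pm_padd[OF N K])
  have H: "Hz Xp (\<lambda>_. UNIV) vs N ?L (Suc j) t"
    by (rule Cons.IH[OF N L padd_le[OF N KN f(1)]]) (use Cons.prems in auto)
  show ?case
  proof (rule HzI)
    fix c assume c: "kch (\<lambda>_. UNIV) vs N j t c" and dc: "\<And>l. kd Xp vs c l \<in> K"
    obtain g where g: "kch (\<lambda>_. UNIV) vs N (Suc j) t g" "\<And>l. f * c l - kd Xp vs g l \<in> K"
      using ideal_boundary[OF N K vs(2) f c dc] by blast
    have "kd Xp vs g l \<in> ?L" for l
    proof -
      have "c l \<in> N" using c by (simp add: kch_def)
      moreover have "- (f * c l - kd Xp vs g l) \<in> K" by (rule pm_uminus[OF K g(2)])
      moreover have "kd Xp vs g l = - (f * c l - kd Xp vs g l) + f * c l" by simp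
      ultimately show ?thesis unfolding padd_def by blast
    qed
    then obtain h where h: "kch (\<lambda>_. UNIV) vs N (Suc (Suc j)) t h" "\<And>l. g l - kd Xp vs h l \<in> ?L"
      using HzD[OF H g(1)] by blast
    have hN: "kd Xp vs h l \<in> N" for l by (rule kd_mem[OF sN]) (use h(1) in \<open>auto simp: kch_def\<close>)
    \<comment> \<open>The cofactor of \<open>f\<close> is chosen to be zero wherever the coefficient
      is, so that it forms a chain again.\<close>
    have "\<exists>w. w \<in> N \<and> g l - kd Xp vs h l - f * w \<in> K \<and> (w \<noteq> 0 \<longrightarrow> g l - kd Xp vs h l \<noteq> 0)" for l
    proof (cases "g l - kd Xp vs h l = 0")
      case True then show ?thesis using pm_0 N K by (intro exI[of _ 0]) auto
    next case False
      obtain k w where "g l - kd Xp vs h l = k + f * w" "k \<in> K" "w \<in> N" using h(2)[of l] by (auto simp: padd_def)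
      then show ?thesis using False by (intro exI[of _ w]) auto
    qed
    then obtain w where w: "\<And>l. w l \<in> N" "\<And>l. g l - kd Xp vs h l - f * w l \<in> K"
      "\<And>l. w l \<noteq> 0 \<Longrightarrow> g l - kd Xp vs h l \<noteq> 0" by metis
    have "kch (\<lambda>_. UNIV) vs N (Suc j) t (\<lambda>l. g l - kd Xp vs h l)"
      by (rule U.kch_diff[OF g(1) U.kch_kd[OF h(1) sN] sN])
    then have wk: "kch (\<lambda>_. UNIV) vs N (Suc j) t w" using w unfolding kch_def by blast
    have wN: "kd Xp vs w l \<in> N" for l by (rule kd_mem[OF sN]) (rule w(1))
    have "c l - kd Xp vs w l \<in> K" for l
    proof (rule fr)
      have "c l \<in> N" using c by (simp add: kch_def)
      then show "c l - kd Xp vs w l \<in> N" using pm_diff[OF N] wN by blast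
      have "kd Xp vs (\<lambda>l. g l - kd Xp vs h l - f * w l) l \<in> K" by (rule kd_mem[OF sK]) (rule w(2))
      then have "kd Xp vs g l - f * kd Xp vs w l \<in> K" by (simp add: U.kd_diff U.kd_kd kd_times)
      from pm_add[OF K g(2)[of l] this] show "f * (c l - kd Xp vs w l) \<in> K" by (simp add: algebra_simps)
    qed
    then show "\<exists>g. kch (\<lambda>_. UNIV) vs N (Suc j) t g \<and> (\<forall>l. c l - kd Xp vs g l \<in> K)" using wk by blast
  qed
qed

text \<open>The homogeneous component of a bounding chain bounds a homogeneous cycle, so
  inhomogeneous regular sequences have consequences for graded homology.\<close>

lemma Hz_graded:
  fixes N K :: "'k::field pol set"
  assumes H: "Hz Xp (\<lambda>_. UNIV) vs N K j t" and N: "gr N" and K: "gr K"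
  shows "Hz Xp Gp vs N K j t"
proof (rule HzI)
  fix c assume c: "kch Gp vs N j t c" and dc: "\<And>l. kd Xp vs c l \<in> K"
  have "kch (\<lambda>_. UNIV) vs N j t c" using c by (auto simp: kch_def)
  then obtain g where g: "kch (\<lambda>_. UNIV) vs N (Suc j) t g" "\<And>l. c l - kd Xp vs g l \<in> K"
    using HzD[OF H] dc by blast
  let ?g = "\<lambda>l. hc (t - int (Suc j)) (g l)"
  have "kch Gp vs N (Suc j) t ?g" unfolding kch_def
  proof (intro allI conjI impI)
    show "?g l \<in> N \<inter> Gp (t - int (Suc j))" for l using g(1) N hc_Gp by (auto simp: kch_def gr_def)
    fix l assume "?g l \<noteq> 0"
    then have "g l \<noteq> 0" by (auto simp: hc_0)
    then show "length l = length vs" "count_list l True = Suc j" using g(1) unfolding kch_def by blast+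
  qed
  moreover have kh: "kd Xp ws (\<lambda>l. hc (e - 1) (g l)) l = hc e (kd Xp ws g l)" for e l ws and g :: "bool list \<Rightarrow> 'k pol"
    by (induction ws arbitrary: g l) (auto simp: hc_0 hc_add hc_Xp hc_uminus split: list.split)
  have e1: "t - int j - 1 = t - int (Suc j)" by simp
  have "kd Xp vs ?g l = hc (t - int j) (kd Xp vs g l)" for l using kh[of vs "t - int j" g l] unfolding e1 .
  moreover have "c l = hc (t - int j) (c l)" for l using c hc_id[of "c l" "t - int j"] by (simp add: kch_def)
  ultimately have "c l - kd Xp vs ?g l = hc (t - int j) (c l - kd Xp vs g l)" for l unfolding hc_diff by metis
  then have "c l - kd Xp vs ?g l \<in> K" for l using g(2)[of l] K by (simp add: gr_def)
  then show "\<exists>g. kch Gp vs N (Suc j) t g \<and> (\<forall>l. c l - kd Xp vs g l \<in> K)"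
    using \<open>kch Gp vs N (Suc j) t ?g\<close> by blast
qed

lemma Th_Dep: "cplx n A \<Longrightarrow> Th ty n A d \<Longrightarrow> Dep ty n A d" for ty :: "'k::field itself" unfolding Dep_def
proof (intro allI impI)
  fix vs and j :: nat and t :: int
  assume A: "cplx n A" "Th ty n A d" and a: "distinct vs \<and> set vs = {1..n} \<and> n < j + d"
  have k: "0 \<notin> keys f" if fs: "f \<in> set (thetas n d :: 'k pol list)" for f
  proof
    assume "0 \<in> keys f"
    moreover obtain i where i: "f = esym {1..n} i" "1 \<le> i" using fs by (auto simp: thetas_mem)
    ultimately have "int (mdeg 0) = int i" using esym_Gp[of "{1..n}" i] by (force simp: Gp_def)
    then show False using i by simp
  qed
  show "Hm ty n vs UNIV (- A) j t"
  proof (rule Hz_graded[OF wreg_Hz[OF pm_Sn pm_MI[OF up_compl[OF A(1)]] _ thetas_set[of n d] k]])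
    show "wreg (thetas n d) (Sn n) (MI n (- A) :: 'k pol set)" using A(2) by (simp add: Th_def)
  qed (use a in \<open>auto intro!: MI_mono gr_MI simp: length_thetas\<close>)
qed

lemma Dep_glue_conv: "glue_conv (Th ty n) n (Dep ty n)" by (rule Dep_conv[OF Th_glue_cone Th_Dep])

section \<open>Linear resolutions\<close>

definition XF :: "nat \<Rightarrow> (nat \<Rightarrow> 'k::field pol) \<Rightarrow> (nat \<Rightarrow> 'k pol)" where
  "XF v f = (\<lambda>i. Xp v (f i))"

text \<open>Internal degrees of a free module with all generators in degree \<open>c\<close>, whence
  the shift.\<close>

definition GF :: "int \<Rightarrow> int \<Rightarrow> (nat \<Rightarrow> 'k::field pol) set" where
  "GF c d = {f. \<forall>i. f i \<in> Gp (d - c)}"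

definition FN :: "nat \<Rightarrow> nat \<Rightarrow> (nat \<Rightarrow> 'k::field pol) set" where
  "FN n L = {f. (\<forall>i<L. f i \<in> Sn n) \<and> (\<forall>i\<ge>L. f i = 0)}"

definition pF :: "int \<Rightarrow> (nat \<Rightarrow> 'k::field pol) \<Rightarrow> (nat \<Rightarrow> 'k pol)" where
  "pF d f = (\<lambda>i. hc d (f i))"

text \<open>Places an ideal among tuples, so that the start of a resolution has the same form as its
  later steps.\<close>

definition emb :: "'k::field pol \<Rightarrow> (nat \<Rightarrow> 'k pol)" where
  "emb y = (\<lambda>i. if i = 0 then y else 0)"

definition fsub :: "nat \<Rightarrow> (nat \<Rightarrow> 'k::field pol) set \<Rightarrow> bool" where
  "fsub n N \<longleftrightarrow> 0 \<in> N \<and> (\<forall>f\<in>N. \<forall>g\<in>N. f - g \<in> N) \<and> (\<forall>p\<in>Sn n. \<forall>f\<in>N. (\<lambda>i. p * f i) \<in> N) \<and>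
     (\<forall>f\<in>N. \<forall>d. pF d f \<in> N)"

lemma kmod_XF: "kmod XF (GF c :: int \<Rightarrow> (nat \<Rightarrow> 'k::field pol) set)"
proof
  fix a b :: "nat \<Rightarrow> 'k pol" and v w d
  show "XF v (a + b) = XF v a + XF v b" by (rule ext) (simp add: XF_def Xp.X_add)
  show "XF v (XF w a) = XF w (XF v a)" by (simp add: XF_def Xp.X_comm)
  show "0 \<in> GF c d" by (simp add: GF_def Xp.G_0)
  show "a \<in> GF c d \<Longrightarrow> b \<in> GF c d \<Longrightarrow> a - b \<in> GF c d" by (simp add: GF_def Xp.G_diff)
  show "XF v a \<in> GF c (d + 1)" if "a \<in> GF c d"
  proof -
    have "Xp v (a i) \<in> Gp (d - c + 1)" for i using that by (intro Xp.G_X) (simp add: GF_def)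
    moreover have "d - c + 1 = d + 1 - c" by simp
    ultimately show ?thesis by (simp add: GF_def XF_def)
  qed
qed

lemma kd_XF: "kd XF vs c l i = kd Xp vs (\<lambda>l. c l i) l"
  by (induction vs arbitrary: c l) (auto simp: XF_def fun_Compl_def split: list.split)

lemma FN_times: "p \<in> Sn n \<Longrightarrow> f \<in> FN n L \<Longrightarrow> (\<lambda>i. p * f i) \<in> FN n L" by (auto simp: FN_def intro: Sn_times)

lemma fsub_FN: "fsub n (FN n L)" unfolding fsub_def
  using gr_MI[of n UNIV] by (auto simp: FN_def pF_def gr_def hc_0 SP_0 intro: SP_diff Sn_times)

lemma fsub_0: "fsub n N \<Longrightarrow> 0 \<in> N" and fsub_diff: "fsub n N \<Longrightarrow> f \<in> N \<Longrightarrow> g \<in> N \<Longrightarrow> f - g \<in> N"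
  and fsub_times: "fsub n N \<Longrightarrow> p \<in> Sn n \<Longrightarrow> f \<in> N \<Longrightarrow> (\<lambda>i. p * f i) \<in> N"
  and fsub_pF: "fsub n N \<Longrightarrow> f \<in> N \<Longrightarrow> pF d f \<in> N" unfolding fsub_def by blast+

lemma fsub_add: "fsub n N \<Longrightarrow> f \<in> N \<Longrightarrow> g \<in> N \<Longrightarrow> f + g \<in> N"
  using fsub_diff[of n N f "0 - g"] fsub_diff[of n N 0 g] fsub_0[of n N] by simp

lemma fsub_sum: "fsub n N \<Longrightarrow> (\<And>i. i \<in> I \<Longrightarrow> f i \<in> N) \<Longrightarrow> (\<Sum>i\<in>I. f i) \<in> N"
  by (induction I rule: infinite_finite_induct) (auto simp: fsub_0 fsub_add)

lemma ev_Sn: "v \<in> {1..n} \<Longrightarrow> pmon (ev v) \<in> Sn n" by (simp add: mem_SP_pmon MS_def)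

lemma fsub_ksub: "fsub n N \<Longrightarrow> set vs \<subseteq> {1..n} \<Longrightarrow> ksub XF vs N" unfolding ksub_def XF_def Xp_def
  by (auto simp: fsub_0 fsub_diff intro!: fsub_times[of n N] ev_Sn)

lemma ksub_XF_0: "ksub XF vs {0}" by (auto simp: ksub_def XF_def Xp.X_0 fun_eq_iff)

lemma Hz_FN:
  assumes vs: "distinct vs" "set vs = {1..n}" and t: "0 < j \<or> c < t"
  shows "Hz XF (GF c) vs (FN n L :: (nat \<Rightarrow> 'k::field pol) set) {0} j t"
proof (rule HzI)
  fix b :: "bool list \<Rightarrow> nat \<Rightarrow> 'k pol"
  assume b: "kch (GF c) vs (FN n L) j t b" and db: "\<And>l. kd XF vs b l \<in> {0}"
  have "\<exists>g. kch Gp vs (Sn n) (Suc j) (t - c) g \<and> (\<forall>l. b l i - kd Xp vs g l \<in> {0})" if i: "i < L" for i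
  proof -
    have "kch Gp vs (Sn n) j (t - c) (\<lambda>l. b l i)" unfolding kch_def
    proof (intro allI conjI impI)
      fix l
      have "b l \<in> FN n L" "b l \<in> GF c (t - int j)" using b by (auto simp: kch_def)
      then have "b l i \<in> Sn n" "b l i \<in> Gp (t - int j - c)" using i by (auto simp: FN_def GF_def)
      then show "b l i \<in> Sn n \<inter> Gp (t - c - int j)" by (simp add: algebra_simps)
      assume "b l i \<noteq> 0"
      then have "b l \<noteq> 0" by auto
      then show "length l = length vs" "count_list l True = j" using b unfolding kch_def by blast+
    qed
    moreover have "kd Xp vs (\<lambda>l. b l i) l \<in> {0}" for l using db[of l] kd_XF[of vs b l i] by simp
    moreover have "Hz Xp Gp vs (Sn n :: 'k pol set) {0} j (t - c)" by (rule Hz_free[OF vs]) (use t in auto)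
    ultimately show ?thesis using HzD by blast
  qed
  then obtain g where g: "\<And>i. i < L \<Longrightarrow> kch Gp vs (Sn n) (Suc j) (t - c) (g i)"
    "\<And>i l. i < L \<Longrightarrow> b l i = kd Xp vs (g i) l" by (metis right_minus_eq singletonD)
  define h where "h = (\<lambda>l i. if i < L then g i l else 0)"
  have "kch (GF c) vs (FN n L) (Suc j) t h" unfolding kch_def
  proof (intro allI conjI impI)
    fix l
    have "g i l \<in> Sn n \<and> g i l \<in> Gp (t - int (Suc j) - c)" if "i < L" for i
      using g(1)[OF that] by (simp add: kch_def algebra_simps)
    then show "h l \<in> FN n L \<inter> GF c (t - int (Suc j))" unfolding h_def FN_def GF_def using Xp.G_0 by auto
    assume "h l \<noteq> 0"
    then obtain i where "i < L" "g i l \<noteq> 0" unfolding h_def by (auto simp: fun_eq_iff split: if_splits)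
    then show "length l = length vs" "count_list l True = Suc j" using g(1) unfolding kch_def by blast+
  qed
  moreover have "b l - kd XF vs h l \<in> {0}" for l
  proof -
    have "b l i = kd XF vs h l i" for i
    proof (cases "i < L")
      case True then show ?thesis using g(2)[OF True, of l] unfolding kd_XF h_def by simp
    next case False
      then have "b l i = 0" using b by (auto simp: kch_def FN_def)
      then show ?thesis using False unfolding kd_XF h_def by (simp add: Xp.kd_0)
    qed
    then show ?thesis by (auto simp: fun_eq_iff)
  qed
  ultimately show "\<exists>g. kch (GF c) vs (FN n L) (Suc j) t g \<and> (\<forall>l. b l - kd XF vs g l \<in> {0})" by blast
qed

lemma FN_decomp:
  fixes f :: "nat \<Rightarrow> 'k::field pol"
  assumes "f \<in> FN n L"
  obtains D where "finite D" "f = (\<Sum>a\<in>D. pF a f)" "\<And>a. a \<notin> D \<Longrightarrow> pF a f = 0"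
proof
  let ?d = "\<lambda>m. int (mdeg m)"
  let ?D = "\<Union>i<L. ?d ` keys (f i)"
  show "finite ?D" by simp
  show z: "pF a f = 0" if "a \<notin> ?D" for a
  proof (rule ext)
    fix i
    show "pF a f i = 0 i"
    proof (cases "i < L")
      case True have "m \<notin> keys (f i)" if "?d m = a" for m using True \<open>a \<notin> ?D\<close> that by auto
      then have "hc a (f i) = 0" by (intro poly_mapping_eqI) (auto simp: hc_def lookup_restr in_keys_iff)
      then show ?thesis by (simp add: pF_def)
    next case False then show ?thesis using assms by (simp add: FN_def pF_def hc_0)
    qed
  qed
  show "f = (\<Sum>a\<in>?D. pF a f)"
  proof (rule ext)
    fix i
    have app: "(\<Sum>a\<in>S. pF a f) i = (\<Sum>a\<in>S. hc a (f i))" for S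
      by (induction S rule: infinite_finite_induct) (auto simp: pF_def)
    show "f i = (\<Sum>a\<in>?D. pF a f) i"
    proof (cases "i < L")
      case True have "(\<Sum>a\<in>?D. hc a (f i)) = (\<Sum>a\<in>?d ` keys (f i). hc a (f i))"
      proof (rule sum.mono_neutral_right)
        show "\<forall>a\<in>?D - ?d ` keys (f i). hc a (f i) = 0"
        proof
          fix a assume "a \<in> ?D - ?d ` keys (f i)"
          then have "m \<notin> keys (f i)" if "?d m = a" for m using that by auto
          then show "hc a (f i) = 0" by (intro poly_mapping_eqI) (auto simp: hc_def lookup_restr in_keys_iff)
        qed
      qed (use True in auto)
      then show ?thesis using hc_sum[of "f i"] app by simp
    next case False
      then have "f i = 0" using assms by (simp add: FN_def)
      then show ?thesis by (simp add: app hc_0)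
    qed
  qed
qed

lemma pF_GF: "pF (d - c) f \<in> GF c d" by (simp add: pF_def GF_def hc_Gp)

lemma GF_pF: "f \<in> GF c d \<Longrightarrow> pF a f = (if a = d - c then f else 0)"
proof -
  assume f: "f \<in> GF c d"
  have "hc a (f i) = (if a = d - c then f i else 0)" for i
    using f hc_id[of "f i" "d - c"] hc_other[of "f i" "d - c" a] by (auto simp: GF_def)
  then show ?thesis by (auto simp: pF_def fun_eq_iff)
qed

lemma pF_add: "pF a (f + g) = pF a f + pF a g" by (rule ext) (simp add: pF_def hc_add)

lemma pF_0: "pF a 0 = 0" by (rule ext) (simp add: pF_def hc_0)

lemma pF_sum: "pF a (\<Sum>i\<in>I. f i) = (\<Sum>i\<in>I. pF a (f i))"
  by (induction I rule: infinite_finite_induct) (simp_all add: pF_0 pF_add del: plus_fun_apply zero_fun_apply)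

text \<open>A degree preserving map commutes with taking components. \<open>pF\<close> counts
  polynomial degrees, so internal degree \<open>d\<close> appears as \<open>d - c\<close> on one
  side and as \<open>d - c'\<close> on the other.\<close>

lemma hom_pF:
  fixes \<phi> :: "(nat \<Rightarrow> 'k::field pol) \<Rightarrow> (nat \<Rightarrow> 'k pol)"
  assumes add: "\<And>f g. f \<in> FN n L \<Longrightarrow> g \<in> FN n L \<Longrightarrow> \<phi> (f + g) = \<phi> f + \<phi> g"
    and deg: "\<And>f d. f \<in> FN n L \<Longrightarrow> f \<in> GF c d \<Longrightarrow> \<phi> f \<in> GF c' d"
    and f: "f \<in> FN n L"
  shows "\<phi> (pF (d - c) f) = pF (d - c') (\<phi> f)"
proof -
  obtain D where D: "finite D" "f = (\<Sum>a\<in>D. pF a f)" "\<And>a. a \<notin> D \<Longrightarrow> pF a f = 0" using FN_decomp[OF f] by metis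
  have p: "pF a f \<in> FN n L" for a by (rule fsub_pF[OF fsub_FN f])
  have 0: "\<phi> 0 = 0" using add[of 0 0] fsub_0[OF fsub_FN] by auto
  have "\<phi> (\<Sum>a\<in>S. pF a f) = (\<Sum>a\<in>S. \<phi> (pF a f))" for S
  proof (induction S rule: infinite_finite_induct)
    case (insert x S) have "(\<Sum>a\<in>S. pF a f) \<in> FN n L" by (rule fsub_sum[OF fsub_FN p])
    then show ?case using insert by (simp add: add p del: plus_fun_apply)
  qed (simp_all add: 0 del: zero_fun_apply)
  then have "\<phi> f = (\<Sum>a\<in>D. \<phi> (pF a f))" using D(2) by metis
  then have "pF (d - c') (\<phi> f) = (\<Sum>a\<in>D. pF (d - c') (\<phi> (pF a f)))" by (simp add: pF_sum)
  also have "\<dots> = (\<Sum>a\<in>D. if a = d - c then \<phi> (pF (d - c) f) else 0)"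
  proof (rule sum.cong[OF refl])
    fix a
    have "pF a f \<in> GF c (a + c)" using pF_GF[of "a + c" c f] by simp
    then have "\<phi> (pF a f) \<in> GF c' (a + c)" by (rule deg[OF p])
    then show "pF (d - c') (\<phi> (pF a f)) = (if a = d - c then \<phi> (pF (d - c) f) else 0)"
      using GF_pF[of "\<phi> (pF a f)" c' "a + c" "d - c'"] by auto
  qed
  also have "\<dots> = \<phi> (pF (d - c) f)" using D(1) D(3)[of "d - c"] 0 by auto
  finally show ?thesis by simp
qed

section \<open>Graded free covers and dimension shifting\<close>

locale free_cover =
  fixes n L :: nat and c c' :: int and \<phi> :: "(nat \<Rightarrow> 'k::field pol) \<Rightarrow> (nat \<Rightarrow> 'k pol)"
    and N :: "(nat \<Rightarrow> 'k pol) set"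
  assumes add: "\<And>f g. f \<in> FN n L \<Longrightarrow> g \<in> FN n L \<Longrightarrow> \<phi> (f + g) = \<phi> f + \<phi> g"
    and deg: "\<And>f d. f \<in> FN n L \<Longrightarrow> f \<in> GF c d \<Longrightarrow> \<phi> f \<in> GF c' d"
    and scal: "\<And>p f. p \<in> Sn n \<Longrightarrow> f \<in> FN n L \<Longrightarrow> \<phi> (\<lambda>i. p * f i) = (\<lambda>i. p * \<phi> f i)"
    and im: "\<phi> ` FN n L = N"
begin

definition Z :: "(nat \<Rightarrow> 'k pol) set" where "Z = {f \<in> FN n L. \<phi> f = 0}"

lemma phi_0: "\<phi> 0 = 0" using add[of 0 0] fsub_0[OF fsub_FN] by auto

lemma phi_diff: "f \<in> FN n L \<Longrightarrow> g \<in> FN n L \<Longrightarrow> \<phi> (f - g) = \<phi> f - \<phi> g"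
proof -
  assume f: "f \<in> FN n L" "g \<in> FN n L"
  have "\<phi> ((f - g) + g) = \<phi> (f - g) + \<phi> g" by (rule add[OF fsub_diff[OF fsub_FN f] f(2)])
  then show ?thesis by (metis add_diff_cancel_right' diff_add_cancel)
qed

lemma fsub_Z: "fsub n Z" unfolding fsub_def
proof (intro conjI ballI allI)
  show "0 \<in> Z" by (simp add: Z_def phi_0 fsub_0[OF fsub_FN])
  show "f - g \<in> Z" if "f \<in> Z" "g \<in> Z" for f g
    using that fsub_diff[OF fsub_FN] phi_diff[of f g] unfolding Z_def by auto
  show "(\<lambda>i. p * f i) \<in> Z" if "p \<in> Sn n" "f \<in> Z" for p f using that FN_times by (auto simp: Z_def scal)
  show "pF d f \<in> Z" if f: "f \<in> Z" for f d
  proof -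
    have fF: "f \<in> FN n L" "\<phi> f = 0" using f by (simp_all add: Z_def)
    have "\<phi> (pF (d + c - c) f) = pF (d + c - c') (\<phi> f)" by (rule hom_pF[OF add deg fF(1)])
    then show ?thesis using fF fsub_pF[OF fsub_FN fF(1)] by (simp add: Z_def pF_0)
  qed
qed

lemma fsub_N: "fsub n N" unfolding fsub_def im[symmetric]
proof (intro conjI ballI allI)
  show "0 \<in> \<phi> ` FN n L" using phi_0 fsub_0[OF fsub_FN] by (metis imageI)
  show "f - g \<in> \<phi> ` FN n L" if fg: "f \<in> \<phi> ` FN n L" "g \<in> \<phi> ` FN n L" for f g
  proof -
    obtain f' g' where h: "f' \<in> FN n L" "f = \<phi> f'" "g' \<in> FN n L" "g = \<phi> g'" using fg by blast
    then have "f - g = \<phi> (f' - g')" using phi_diff by simp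
    moreover have "f' - g' \<in> FN n L" by (rule fsub_diff[OF fsub_FN h(1,3)])
    ultimately show ?thesis by blast
  qed
  show "(\<lambda>i. p * f i) \<in> \<phi> ` FN n L" if p: "p \<in> Sn n" "f \<in> \<phi> ` FN n L" for p f
  proof -
    obtain f' where h: "f' \<in> FN n L" "f = \<phi> f'" using p by blast
    then have "(\<lambda>i. p * f i) = \<phi> (\<lambda>i. p * f' i)" using scal[OF p(1)] by simp
    then show ?thesis using FN_times[OF p(1) h(1)] by blast
  qed
  show "pF d f \<in> \<phi> ` FN n L" if f: "f \<in> \<phi> ` FN n L" for f d
  proof -
    obtain g where g: "g \<in> FN n L" "f = \<phi> g" using f by blast
    have "\<phi> (pF (d + c' - c) g) = pF (d + c' - c') (\<phi> g)" by (rule hom_pF[OF add deg g(1)])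
    then have "pF d f = \<phi> (pF (d + c' - c) g)" using g(2) by simp
    then show ?thesis using fsub_pF[OF fsub_FN g(1)] by blast
  qed
qed

lemma cover_iso:
  assumes vs: "set vs \<subseteq> {1..n}"
  shows "Hz XF (GF c) vs (FN n L) Z j t \<longleftrightarrow> Hz XF (GF c') vs N {0} j t"
proof -
  have "Hz XF (GF c) vs (FN n L) Z j t \<longleftrightarrow> Hz XF (GF c') vs N {0} j (t + 0)"
  proof (rule Hz_iso[where \<phi> = \<phi>, OF kmod_XF kmod_XF])
    show "ksub XF vs (FN n L)" "ksub XF vs N" using fsub_ksub fsub_FN fsub_N vs by blast+
    show "ksub XF vs {0}" by (rule ksub_XF_0)
    show "\<phi> (XF v x) = XF v (\<phi> x)" if "v \<in> set vs" "x \<in> FN n L" for v x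
      unfolding XF_def Xp_def using scal[OF ev_Sn that(2), of v] that(1) vs by auto
    show "\<phi> x \<in> N \<inter> GF c' (d + 0)" if "x \<in> FN n L" "x \<in> GF c d" for x d using deg[OF that] that im by auto
    show "\<exists>x. x \<in> FN n L \<and> x \<in> GF c d \<and> y - \<phi> x \<in> {0}" if y: "y \<in> N" "y \<in> GF c' (d + 0)" for y d
    proof -
      obtain x where x: "x \<in> FN n L" "y = \<phi> x" using y im by blast
      have "\<phi> (pF (d - c) x) = pF (d - c') y" unfolding x(2) by (rule hom_pF[OF add deg x(1)])
      also have "\<dots> = y" using GF_pF[OF y(2)] by simp
      finally show ?thesis using pF_GF[of d c x] fsub_pF[OF fsub_FN x(1)] by auto
    qed
    show "\<phi> x \<in> {0} \<longleftrightarrow> x \<in> Z" if "x \<in> FN n L" for x using that by (simp add: Z_def)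
  qed (rule add)
  then show ?thesis by simp
qed

lemma cover_sub: "Z \<subseteq> FN n L" by (auto simp: Z_def)

text \<open>Dimension shifting: a free module generated in degree \<open>c\<close> has homology only
  in index 0 and degree \<open>c\<close>, which the side condition avoids; elsewhere homology of the
  image is that of the kernel one index lower.\<close>

lemma cover_image:
  assumes vs: "distinct vs" "set vs = {1..n}" and t: "0 < j \<or> c < t"
    and H: "0 < j \<Longrightarrow> Hz XF (GF c) vs Z {0} (j - 1) t"
  shows "Hz XF (GF c') vs N {0} j t"
proof -
  have v: "set vs \<subseteq> {1..n}" using vs by simp
  have "Hz XF (GF c) vs (FN n L) Z j t"
  proof (rule kmod.Hz_quot[OF kmod_XF])
    show "{0} \<subseteq> Z" using fsub_0[OF fsub_Z] by simp
    show "Hz XF (GF c) vs (FN n L) {0} j t" by (rule Hz_FN[OF vs t])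
  qed (use H cover_sub fsub_ksub[OF fsub_FN v] fsub_ksub[OF fsub_Z v] ksub_XF_0 in auto)
  then show ?thesis using cover_iso[OF v] by blast
qed

lemma cover_kernel:
  assumes vs: "distinct vs" "set vs = {1..n}" and t: "0 < j \<or> c < t"
    and H: "Hz XF (GF c') vs N {0} (Suc j) t"
  shows "Hz XF (GF c) vs Z {0} j t"
proof -
  have v: "set vs \<subseteq> {1..n}" using vs by simp
  show ?thesis
  proof (rule kmod.Hz_sub[OF kmod_XF])
    show "{0} \<subseteq> Z" using fsub_0[OF fsub_Z] by simp
    show "Hz XF (GF c) vs (FN n L) {0} j t" by (rule Hz_FN[OF vs t])
    show "Hz XF (GF c) vs (FN n L) Z (Suc j) t" using H cover_iso[OF v] by blast
  qed (use H cover_sub fsub_ksub[OF fsub_FN v] fsub_ksub[OF fsub_Z v] ksub_XF_0 in auto)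
qed

end

lemma emb_iso:
  fixes J :: "'k::field pol set"
  assumes J: "pm n J" and vs: "set vs \<subseteq> {1..n}"
  shows "Hz Xp Gp vs J {0} j t \<longleftrightarrow> Hz XF (GF 0) vs (emb ` J) {0} j t"
proof -
  have e: "emb (x - y) = emb x - emb y" "emb (Xp v x) = XF v (emb x)" "emb x \<in> GF 0 d \<longleftrightarrow> x \<in> Gp d"
    "emb x = 0 \<longleftrightarrow> x = 0" "emb (x + y) = emb x + emb y" for x y :: "'k pol" and v d
    using Xp.G_0 by (auto simp: emb_def XF_def GF_def Xp.X_0 fun_eq_iff)
  have s: "ksub Xp vs J" by (rule pm_ksub[OF J vs])
  have "Hz Xp Gp vs J {0} j t \<longleftrightarrow> Hz XF (GF 0) vs (emb ` J) {0} j (t + 0)"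
  proof (rule Hz_iso[where \<phi> = emb, OF kmod_Xp kmod_XF s _ ksub_XF_0])
    show "ksub XF vs (emb ` J)" unfolding ksub_def
    proof (intro conjI ballI)
      show "0 \<in> emb ` J" using e(4)[of 0] ksub_0[OF s] by (metis imageI)
      show "x - y \<in> emb ` J" if "x \<in> emb ` J" "y \<in> emb ` J" for x y
        using that ksub_diff[OF s] e(1) by (metis (no_types, lifting) image_iff)
      show "XF v x \<in> emb ` J" if "v \<in> set vs" "x \<in> emb ` J" for v x
        using that ksub_X[OF s that(1)] e(2) by (metis (no_types, lifting) image_iff)
    qed
    show "\<exists>x. x \<in> J \<and> x \<in> Gp d \<and> y - emb x \<in> {0}" if "y \<in> emb ` J" "y \<in> GF 0 (d + 0)" for y d
      using that e(3) by auto
  qed (use e in auto)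
  then show ?thesis by simp
qed

lemma ring_simps:
  "carrier (free_mod n a) = FN n (length a)" "zero (free_mod n a) = 0"
  "x \<oplus>\<^bsub>free_mod n a\<^esub> y = x + y" "p \<odot>\<^bsub>free_mod n a\<^esub> x = (\<lambda>i. p * x i)"
  by (auto simp: free_mod_def FN_def Sn_carrier fun_eq_iff)

lemma free_comp_const:
  fixes d :: int
  assumes "set a \<subseteq> {c}"
  shows "free_comp n a d = (FN n (length a) \<inter> GF c d :: (nat \<Rightarrow> 'k::field pol) set)"
proof -
  have 1: "a ! i = c" if "i < length a" for i using assms nth_mem[OF that] by blast
  have 2: "p \<in> poly_comp n d \<longleftrightarrow> p \<in> Sn n \<and> p \<in> Gp d" for p :: "'k pol" and d
    by (auto simp: poly_comp_def Gp_def Sn_carrier)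
  show ?thesis unfolding free_comp_def ring_simps FN_def GF_def
  proof (intro equalityI subsetI)
    fix x :: "nat \<Rightarrow> 'k pol"
    assume x: "x \<in> {f \<in> {f. (\<forall>i<length a. f i \<in> Sn n) \<and> (\<forall>i\<ge>length a. f i = 0)}. \<forall>i<length a. f i \<in> poly_comp n (d - a ! i)}"
    have "x i \<in> Gp (d - c)" for i using x 1 2 by (cases "i < length a") (auto simp: Xp.G_0)
    then show "x \<in> {f. (\<forall>i<length a. f i \<in> Sn n) \<and> (\<forall>i\<ge>length a. f i = 0)} \<inter> {f. \<forall>i. f i \<in> Gp (d - c)}"
      using x by blast
  qed (use 1 2 in auto)
qed

text \<open>Shifting along the resolution trades index \<open>j\<close> of the ideal for index 0 of
  its \<open>j\<close>-th syzygy module, which is generated in degree \<open>e + j\<close>.\<close>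

lemma linear_imp_Hz:
  fixes J :: "'k::field pol set"
  assumes J: "pm n J" and lin: "has_linear_resolution n e J"
    and vs: "distinct vs" "set vs = {1..n}" and t: "int j + int e < t"
  shows "Hz Xp Gp vs J {0} j t"
proof -
  obtain a \<epsilon> \<delta> where res: "graded_free_resolution n ((ring_mod n)\<lparr>carrier := J\<rparr>) (\<lambda>c. J \<inter> poly_comp n c) a \<epsilon> \<delta>"
    and a: "\<And>i. set (a i) \<subseteq> {int (e + i)}"
    using lin unfolding has_linear_resolution_def minimal_graded_free_resolution_def by blast
  let ?F = "\<lambda>i. FN n (length (a i)) :: (nat \<Rightarrow> 'k pol) set"
  \<comment> \<open>Augmentation and differentials are numbered uniformly: \<open>M i\<close> is the
    image of the \<open>i\<close>-th map and lies in a free module generated in degree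
    \<open>c i\<close>; for \<open>i = 0\<close> that is the embedded polynomial ring, in degree
    0.\<close>
  define \<phi> where "\<phi> i = (case i of 0 \<Rightarrow> emb \<circ> \<epsilon> | Suc k \<Rightarrow> \<delta> k)" for i
  define M where "M i = \<phi> i ` ?F i" for i
  define c where "c i = (case i of 0 \<Rightarrow> 0 | Suc k \<Rightarrow> int (e + k))" for i :: nat
  note fc = free_comp_const[OF a]
  have \<epsilon>: "\<epsilon> \<in> graded_hom (poly_ring n) (free_mod n (a 0)) (free_comp n (a 0)) ((ring_mod n)\<lparr>carrier := J\<rparr>) (\<lambda>c. J \<inter> poly_comp n c)"
    and \<epsilon>J: "\<epsilon> ` ?F 0 = J"
    and \<delta>: "\<And>i. \<delta> i \<in> graded_hom (poly_ring n) (free_mod n (a (Suc i))) (free_comp n (a (Suc i)))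
                   (free_mod n (a i)) (free_comp n (a i))"
    and k0: "\<delta> 0 ` ?F 1 = {f \<in> ?F 0. \<epsilon> f = 0}"
    and ks: "\<And>i. \<delta> (Suc i) ` ?F (Suc (Suc i)) = {f \<in> ?F (Suc i). \<delta> i f = 0}"
    using res unfolding graded_free_resolution_def a_kernel_def' ring_simps by (auto simp: ring_mod_def ring_simps)
  have cov: "free_cover n (length (a i)) (int (e + i)) (c i) (\<phi> i) (M i)" for i
  proof (cases i)
    case 0 have h: "\<And>x y. x \<in> ?F 0 \<Longrightarrow> y \<in> ?F 0 \<Longrightarrow> \<epsilon> (x + y) = \<epsilon> x + \<epsilon> y"
      "\<And>p x. p \<in> Sn n \<Longrightarrow> x \<in> ?F 0 \<Longrightarrow> \<epsilon> (\<lambda>i. p * x i) = p * \<epsilon> x"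
      "\<And>x d. x \<in> ?F 0 \<Longrightarrow> x \<in> GF (int (e + 0)) d \<Longrightarrow> \<epsilon> x \<in> Gp d"
    proof -
      have \<epsilon>': "\<epsilon> \<in> mod_hom (poly_ring n) (free_mod n (a 0)) ((ring_mod n)\<lparr>carrier := J\<rparr>)"
        and im: "\<And>d. \<epsilon> ` (?F 0 \<inter> GF (int (e + 0)) d) \<subseteq> J \<inter> poly_comp n d"
        using \<epsilon> unfolding graded_hom_def fc by blast+
      show "\<And>x y. x \<in> ?F 0 \<Longrightarrow> y \<in> ?F 0 \<Longrightarrow> \<epsilon> (x + y) = \<epsilon> x + \<epsilon> y"
        "\<And>p x. p \<in> Sn n \<Longrightarrow> x \<in> ?F 0 \<Longrightarrow> \<epsilon> (\<lambda>i. p * x i) = p * \<epsilon> x"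
        using \<epsilon>' unfolding mod_hom_def ring_simps by (auto simp: ring_mod_def Sn_carrier)
      show "\<epsilon> x \<in> Gp d" if "x \<in> ?F 0" "x \<in> GF (int (e + 0)) d" for x d
      proof -
        have "\<epsilon> x \<in> poly_comp n d" using im[of d] that by blast
        then show ?thesis by (simp add: poly_comp_def Gp_def)
      qed
    qed
    show ?thesis
    proof
      show "\<phi> i (f + g) = \<phi> i f + \<phi> i g" if "f \<in> ?F i" "g \<in> ?F i" for f g
        using h(1)[of f g] that 0 by (auto simp: \<phi>_def emb_def fun_eq_iff)
      show "\<phi> i f \<in> GF (c i) d" if "f \<in> ?F i" "f \<in> GF (int (e + i)) d" for f d
        using h(3)[of f d] that 0 Xp.G_0 by (auto simp: \<phi>_def emb_def c_def GF_def)
      show "\<phi> i (\<lambda>i. p * f i) = (\<lambda>k. p * \<phi> i f k)" if "p \<in> Sn n" "f \<in> ?F i" for p f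
        using h(2)[of p f] that 0 by (auto simp: \<phi>_def emb_def fun_eq_iff)
    qed (simp add: M_def)
  next case (Suc k) have h: "\<And>x y. x \<in> ?F i \<Longrightarrow> y \<in> ?F i \<Longrightarrow> \<delta> k (x + y) = \<delta> k x + \<delta> k y"
      "\<And>p x. p \<in> Sn n \<Longrightarrow> x \<in> ?F i \<Longrightarrow> \<delta> k (\<lambda>i. p * x i) = (\<lambda>i. p * \<delta> k x i)"
      "\<And>x d. x \<in> ?F i \<Longrightarrow> x \<in> GF (int (e + i)) d \<Longrightarrow> \<delta> k x \<in> GF (int (e + k)) d"
    proof -
      have \<delta>': "\<delta> k \<in> mod_hom (poly_ring n) (free_mod n (a i)) (free_mod n (a k))"
        and im: "\<And>d. \<delta> k ` (?F i \<inter> GF (int (e + i)) d) \<subseteq> ?F k \<inter> GF (int (e + k)) d"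
        using \<delta>[of k] unfolding graded_hom_def fc Suc by blast+
      show "\<And>x y. x \<in> ?F i \<Longrightarrow> y \<in> ?F i \<Longrightarrow> \<delta> k (x + y) = \<delta> k x + \<delta> k y"
        "\<And>p x. p \<in> Sn n \<Longrightarrow> x \<in> ?F i \<Longrightarrow> \<delta> k (\<lambda>i. p * x i) = (\<lambda>i. p * \<delta> k x i)"
        using \<delta>' unfolding mod_hom_def ring_simps by (auto simp: Sn_carrier)
      show "\<delta> k x \<in> GF (int (e + k)) d" if "x \<in> ?F i" "x \<in> GF (int (e + i)) d" for x d
        using im[of d] that by blast
    qed
    show ?thesis by standard (use h Suc in \<open>auto simp: \<phi>_def c_def M_def\<close>)
  qed
  have Z: "free_cover.Z n (length (a i)) (\<phi> i) = M (Suc i)" for i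
  proof -
    have Zd: "free_cover.Z n (length (a i)) (\<phi> i) = {f \<in> ?F i. \<phi> i f = 0}" by (rule free_cover.Z_def[OF cov])
    show ?thesis
    proof (cases i)
    case 0 have "\<phi> 0 f = 0 \<longleftrightarrow> \<epsilon> f = 0" for f by (auto simp: \<phi>_def emb_def fun_eq_iff)
    then show ?thesis unfolding Zd using k0 0 by (simp add: M_def \<phi>_def One_nat_def)
  next case (Suc k) then show ?thesis unfolding Zd using ks[of k] by (simp add: M_def \<phi>_def)
    qed
  qed
  have "Hz XF (GF (c m)) vs (M m) {0} j t" if "int j + int (e + m) < t" for m j using that
  proof (induction j arbitrary: m)
    case 0 show ?case by (rule free_cover.cover_image[OF cov vs]) (use 0 in auto)
  next case (Suc j) have "Hz XF (GF (c (Suc m))) vs (M (Suc m)) {0} j t" by (rule Suc.IH) (use Suc.prems in simp)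
    then show ?case by (intro free_cover.cover_image[OF cov vs]) (auto simp: Z c_def)
  qed
  from this[of j 0] have "Hz XF (GF 0) vs (M 0) {0} j t" using t by (simp add: c_def)
  moreover have "M 0 = emb ` J" using \<epsilon>J unfolding M_def \<phi>_def by (auto simp flip: image_image)
  ultimately show ?thesis using emb_iso[OF J] vs by simp
qed

subsection \<open>Construction of a linear resolution\<close>

definition cov :: "nat \<Rightarrow> (nat \<Rightarrow> nat \<Rightarrow> 'k::field pol) \<Rightarrow> (nat \<Rightarrow> 'k pol) \<Rightarrow> nat \<Rightarrow> 'k pol" where
  "cov L m f = (\<lambda>i. \<Sum>k<L. f k * m k i)"

text \<open>Scalars act through constant polynomials; tuples become a vector space, from which
  minimal generators can be chosen as a basis.\<close>

definition ksc :: "'k::field \<Rightarrow> (nat \<Rightarrow> 'k pol) \<Rightarrow> nat \<Rightarrow> 'k pol" where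
  "ksc a f = (\<lambda>i. single 0 a * f i)"

interpretation kv: vector_space "ksc :: 'k::field \<Rightarrow> _"
  by standard (auto simp: ksc_def fun_eq_iff algebra_simps single_add mult_single mult.assoc[symmetric])

lemma single0_Sn: "single 0 a \<in> Sn n" by (auto simp: SP_def MS_def)

lemma cov_add: "cov L m (f + g) = cov L m f + cov L m g"
  by (rule ext) (simp add: cov_def algebra_simps sum.distrib)

lemma cov_times: "cov L m (\<lambda>i. p * f i) = (\<lambda>i. p * cov L m f i)"
  by (rule ext) (simp add: cov_def sum_distrib_left mult.assoc)

lemma cov_eq_sum: "cov L m f = (\<Sum>k<L. (\<lambda>i. f k * m k i))" by (rule ext) (induction L; simp add: cov_def)

lemma cov_mem: "fsub n N \<Longrightarrow> (\<And>k. k < L \<Longrightarrow> m k \<in> N) \<Longrightarrow> f \<in> FN n L \<Longrightarrow> cov L m f \<in> N"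
  unfolding cov_eq_sum by (rule fsub_sum) (auto simp: FN_def intro: fsub_times)

lemma cov_deg: "(\<And>k. k < L \<Longrightarrow> m k \<in> GF c e) \<Longrightarrow> f \<in> GF e d \<Longrightarrow> cov L m f \<in> GF c d"
proof -
  assume m: "\<And>k. k < L \<Longrightarrow> m k \<in> GF c e" and f: "f \<in> GF e d"
  have "f k * m k i \<in> Gp (d - c)" if "k < L" for k i
  proof -
    have "f k \<in> Gp (d - e)" "m k i \<in> Gp (e - c)" using f m[OF that] by (auto simp: GF_def)
    from Gp_times[OF this] show ?thesis by simp
  qed
  then have "(\<Sum>k\<in>S. f k * m k i) \<in> Gp (d - c)" if "S \<subseteq> {..<L}" for i S
    using that by (induction S rule: infinite_finite_induct) (auto simp: Xp.G_0 intro: Xp.G_add)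
  then show ?thesis by (auto simp: cov_def GF_def)
qed

lemma cov_cover:
  assumes "fsub n N" "\<And>k. k < L \<Longrightarrow> m k \<in> N \<inter> GF c e" "cov L m ` FN n L = N"
  shows "free_cover n L e c (cov L m) N"
  by standard (use assms in \<open>auto simp: cov_add cov_times intro: cov_deg\<close>)

lemma kd1_mem:
  assumes "kmod X G" "kch G vs N (Suc 0) t g" "0 \<in> W" "\<And>x y. x \<in> W \<Longrightarrow> y \<in> W \<Longrightarrow> x + y \<in> W"
    "\<And>v y. v \<in> set vs \<Longrightarrow> y \<in> N \<Longrightarrow> y \<in> G (t - 1) \<Longrightarrow> X v y \<in> W"
  shows "kd X vs g l \<in> W"
proof -
  interpret kmod X G by fact
  show ?thesis using assms(2-)
  proof (induction vs arbitrary: g l)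
    case (Cons v vs)
    have g0: "kch G vs N (Suc 0) t (\<lambda>k. g (False # k))" and g1: "kch G vs N 0 (t - 1) (\<lambda>k. g (True # k))"
      using Cons.prems(1) by (auto simp: kch_Cons)
    have "kd X vs (\<lambda>k. g (False # k)) k \<in> W" for k by (rule Cons.IH[OF g0]) (use Cons.prems in auto)
    moreover have "X v (g (True # k)) \<in> W" for k
      using g1 Cons.prems(4)[of v "g (True # k)"] by (auto simp: kch_def)
    moreover have "kd X vs (\<lambda>k. g (True # k)) k = 0" for k by (rule kd_kch_0[OF g1])
    ultimately show ?case using Cons.prems(2,3) by (auto split: list.split)
  qed (use assms in auto)
qed

lemma card_bounded_mons:
  assumes "finite T"
  shows "finite {m :: mon. keys m \<subseteq> T \<and> (\<forall>i. lookup m i \<le> E)}"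
    "card {m :: mon. keys m \<subseteq> T \<and> (\<forall>i. lookup m i \<le> E)} \<le> (E + 1) ^ card T"
proof -
  let ?M = "{m :: mon. keys m \<subseteq> T \<and> (\<forall>i. lookup m i \<le> E)}"
  let ?P = "T \<rightarrow>\<^sub>E {..E}"
  let ?f = "\<lambda>m :: mon. \<lambda>i. if i \<in> T then lookup m i else undefined"
  have fin: "finite ?P" by (intro finite_PiE assms) auto
  have sub: "?f ` ?M \<subseteq> ?P" by auto
  have inj: "inj_on ?f ?M"
  proof (rule inj_onI, rule poly_mapping_eqI)
    fix x y i assume xy: "x \<in> ?M" "y \<in> ?M" "?f x = ?f y"
    show "lookup x i = lookup y i"
    proof (cases "i \<in> T")
      case True then show ?thesis using fun_cong[OF xy(3), of i] by simp
    next case False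
      then have "i \<notin> keys x" "i \<notin> keys y" using xy(1,2) by auto
      then show ?thesis by (simp add: in_keys_iff)
    qed
  qed
  show "finite ?M" by (rule inj_on_finite[OF inj sub fin])
  have "card ?M \<le> card ?P" by (rule card_inj_on_le[OF inj sub fin])
  then show "card ?M \<le> (E + 1) ^ card T" by (simp add: card_PiE[OF assms] One_nat_def)
qed

lemma finite_mons: "finite {m. keys m \<subseteq> {1..n} \<and> int (mdeg m) = d}"
proof (rule finite_subset[OF _ card_bounded_mons(1)[of "{1..n}" "nat d"]])
  have "lookup m i \<le> nat d" if "int (mdeg m) = d" for m :: mon and i
  proof (cases "i \<in> keys m")
    case True
    then have "lookup m i \<le> mdeg m" unfolding mdeg_def by (rule member_le_sum) auto
    then show ?thesis using that by linarith
  qed (simp add: in_keys_iff)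
  then show "{m. keys m \<subseteq> {1..n} \<and> int (mdeg m) = d} \<subseteq> {m. keys m \<subseteq> {1..n} \<and> (\<forall>i. lookup m i \<le> nat d)}" by blast
qed simp

lemma homog_span:
  "(FN n L \<inter> GF c d :: (nat \<Rightarrow> 'k::field pol) set) \<subseteq> kv.span ((\<lambda>(i, m) k. if k = i then pmon m else 0) `
     ({..<L} \<times> {m. keys m \<subseteq> {1..n} \<and> int (mdeg m) = d - c}))" (is "_ \<subseteq> kv.span ?B")
proof
  fix f :: "nat \<Rightarrow> 'k pol" assume f: "f \<in> FN n L \<inter> GF c d"
  let ?u = "\<lambda>i m k. if k = i then pmon m else (0 :: 'k pol)"
  have app: "(\<Sum>i\<in>S. h i) k = (\<Sum>i\<in>S. h i k)" for h :: "'z \<Rightarrow> nat \<Rightarrow> 'k pol" and S k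
    by (induction S rule: infinite_finite_induct) auto
  have "f = (\<Sum>i<L. \<Sum>m\<in>keys (f i). ksc (lookup (f i) m) (?u i m))"
  proof (rule ext)
    fix k
    have "(\<Sum>m\<in>keys (f i). ksc (lookup (f i) m) (?u i m) k) = (if k = i then f k else 0)" for i
      using poly_eq_sum[of "f i"] by (auto simp: ksc_def pmon_def mult_single)
    then have "(\<Sum>i<L. \<Sum>m\<in>keys (f i). ksc (lookup (f i) m) (?u i m)) k = (\<Sum>i<L. if k = i then f k else 0)"
      by (simp add: app)
    also have "\<dots> = f k" using f by (auto simp: FN_def)
    finally show "f k = (\<Sum>i<L. \<Sum>m\<in>keys (f i). ksc (lookup (f i) m) (?u i m)) k" by simp
  qed
  also have "\<dots> \<in> kv.span ?B"
  proof (intro kv.span_sum kv.span_scale kv.span_base)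
    fix i m assume i: "i \<in> {..<L}" and m: "m \<in> keys (f i)"
    then have "keys m \<subseteq> {1..n}" "int (mdeg m) = d - c"
      using f by (auto simp: FN_def GF_def Gp_def SP_def MS_def)
    then show "?u i m \<in> ?B" using i by (intro image_eqI[of _ _ "(i, m)"]) auto
  qed
  finally show "f \<in> kv.span ?B" .
qed

lemma Gp_0_single: "p \<in> Gp 0 \<Longrightarrow> p = single 0 (lookup p 0)"
proof (rule poly_mapping_eqI)
  fix m assume "p \<in> Gp 0"
  then show "lookup p m = lookup (single 0 (lookup p 0)) m"
    by (cases "m = 0") (auto simp: Gp_def mdeg_0_iff in_keys_iff lookup_single when_def)
qed

text \<open>A basis of the lowest degree part serves as generators. Vanishing of homology in index 0
  above degree \<open>e\<close> makes it generate, and independence excludes relations with constant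
  coefficients, so the kernel starts one degree higher.\<close>

lemma linear_cover:
  fixes N :: "(nat \<Rightarrow> 'k::field pol) set"
  assumes N: "fsub n N" "N \<subseteq> FN n L0" and low: "\<And>t. t < e \<Longrightarrow> N \<inter> GF c t \<subseteq> {0}"
    and vs: "set vs = {1..n}" and H: "\<And>t. e < t \<Longrightarrow> Hz XF (GF c) vs N {0} 0 t"
  shows "\<exists>L m. (\<forall>k<L. m k \<in> N \<inter> GF c e) \<and> cov L m ` FN n L = N \<and>
    (\<forall>f\<in>FN n L. f \<in> GF e e \<longrightarrow> cov L m f = 0 \<longrightarrow> f = 0)"
proof -
  let ?V = "N \<inter> GF c e"
  obtain B where B: "B \<subseteq> ?V" "kv.independent B" "?V \<subseteq> kv.span B" using kv.maximal_independent_subset by blast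
  have finB: "finite B"
  proof -
    let ?C = "(\<lambda>(i, m) k. if k = i then pmon m else (0 :: 'k pol)) `
     ({..<L0} \<times> {m. keys m \<subseteq> {1..n} \<and> int (mdeg m) = e - c})"
    have "finite ?C" using finite_mons by auto
    moreover have "B \<subseteq> kv.span ?C" using B(1) N(2) homog_span[of n L0 c e] by blast
    ultimately show ?thesis using kv.independent_span_bound[OF _ B(2)] by blast
  qed
  obtain m where m: "bij_betw m {..<card B} B" using ex_bij_betw_nat_finite[OF finB] by (metis atLeast0LessThan)
  let ?L = "card B"
  have mB: "m k \<in> B" if "k < ?L" for k using bij_betwE[OF m] that by auto
  have mV: "m k \<in> ?V" if "k < ?L" for k using mB[OF that] B(1) by blast
  let ?W = "cov ?L m ` FN n ?L"
  have WN: "?W \<subseteq> N" using cov_mem[OF N(1), of ?L m] mV by auto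
  have W: "fsub n ?W"
  proof -
    have "free_cover n ?L e c (cov ?L m) ?W"
      by standard (use mV in \<open>auto simp: cov_add cov_times intro: cov_deg\<close>)
    then show ?thesis by (rule free_cover.fsub_N)
  qed
  have VW: "?V \<subseteq> ?W"
  proof
    fix y assume "y \<in> ?V"
    then have "y \<in> kv.span B" using B(3) by blast
    then obtain u where u: "y = (\<Sum>b\<in>B. ksc (u b) b)" unfolding kv.span_finite[OF finB] by blast
    also have "\<dots> = (\<Sum>k<?L. ksc (u (m k)) (m k))" by (rule sum.reindex_bij_betw[OF m, symmetric])
    also have "\<dots> = cov ?L m (\<lambda>k. if k < ?L then single 0 (u (m k)) else 0)"
      unfolding cov_eq_sum by (rule sum.cong) (auto simp: ksc_def)
    finally have y: "y = cov ?L m (\<lambda>k. if k < ?L then single 0 (u (m k)) else 0)" .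
    show "y \<in> ?W" unfolding y by (intro imageI) (simp add: FN_def single0_Sn)
  qed
  have hom: "y \<in> ?W" if "y \<in> N" "y \<in> GF c t" for y t using that
  proof (induction "nat (t - e)" arbitrary: y t rule: less_induct)
    case less
    consider "t < e" | "t = e" | "e < t" by linarith
    then show ?case
    proof cases
      case 1 then show ?thesis using low[of t] less.prems fsub_0[OF W] by blast
    next case 2 then show ?thesis using less.prems VW by blast
    next case 3
      interpret K: kmod XF "GF c :: int \<Rightarrow> (nat \<Rightarrow> 'k pol) set" by (rule kmod_XF)
      \<comment> \<open>An element of degree above \<open>e\<close>, seen as a 0-chain, is a
        boundary and hence a combination of variables times elements of degree one less.\<close>
      have k: "kch (GF c) vs N 0 t (\<lambda>l. if l = Fl vs then y else 0)"
        by (intro kch_0I less.prems K.G_0 fsub_0[OF N(1)])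
      obtain g where g: "kch (GF c) vs N (Suc 0) t g"
        "\<And>l. (if l = Fl vs then y else 0) - kd XF vs g l \<in> {0}"
        by (rule HzD[OF H[OF 3] k]) (use K.kd_kch_0[OF k] in auto)
      have "kd XF vs g (Fl vs) \<in> ?W"
      proof (rule kd1_mem[OF kmod_XF g(1)])
        show "XF v z \<in> ?W" if "v \<in> set vs" "z \<in> N" "z \<in> GF c (t - 1)" for v z
        proof -
          have "z \<in> ?W" by (rule less.hyps[OF _ that(2,3)]) (use 3 in simp)
          then show ?thesis using ksub_X[OF fsub_ksub[OF W, of vs]] that vs by simp
        qed
      qed (use fsub_0[OF W] fsub_add[OF W] in auto)
      moreover have "kd XF vs g (Fl vs) = y" using g(2)[of "Fl vs"] by simp
      ultimately show ?thesis by simp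
    qed
  qed
  have "N \<subseteq> ?W"
  proof
    fix y assume y: "y \<in> N"
    then obtain D where D: "finite D" "y = (\<Sum>a\<in>D. pF a y)" using FN_decomp[of y n L0] N(2) by (metis subsetD)
    have "pF a y \<in> ?W" for a by (rule hom[of _ "a + c"]) (use fsub_pF[OF N(1) y] pF_GF[of "a + c" c y] in auto)
    then have "(\<Sum>a\<in>D. pF a y) \<in> ?W" by (intro fsub_sum[OF W])
    then show "y \<in> ?W" using D(2) by simp
  qed
  moreover have "f = 0" if f: "f \<in> FN n ?L" "f \<in> GF e e" "cov ?L m f = 0" for f
  proof -
    have s: "f k = single 0 (lookup (f k) 0)" for k
      by (rule Gp_0_single) (use f(2) in \<open>auto simp: GF_def dest: spec[of _ k]\<close>)
    define u where "u b = lookup (f (inv_into {..<?L} m b)) 0" for b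
    have inv: "inv_into {..<?L} m (m k) = k" if "k < ?L" for k
      using m that by (simp add: bij_betw_def inv_into_f_f)
    have "(\<Sum>b\<in>B. ksc (u b) b) = (\<Sum>k<?L. ksc (u (m k)) (m k))" by (rule sum.reindex_bij_betw[OF m, symmetric])
    also have "\<dots> = cov ?L m f" unfolding cov_eq_sum
    proof (rule sum.cong[OF refl])
      fix k assume "k \<in> {..<?L}"
      then show "ksc (u (m k)) (m k) = (\<lambda>i. f k * m k i)" using s[of k] inv[of k] by (simp add: ksc_def u_def)
    qed
    finally have "(\<Sum>b\<in>B. ksc (u b) b) = 0" using f(3) by simp
    then have "u b = 0" if "b \<in> B" for b using B(2) finB that unfolding kv.dependent_finite[OF finB] by blast
    then have "lookup (f k) 0 = 0" if "k < ?L" for k using mB[OF that] inv[OF that] by (metis u_def)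
    then have "f k = 0" if "k < ?L" for k using s[of k] that by simp
    then show ?thesis using f(1) by (auto simp: FN_def fun_eq_iff not_less) (metis not_less)
  qed
  ultimately show ?thesis using mV WN by (intro exI[of _ ?L] exI[of _ m]) blast
qed

section \<open>Ideals as sets of polynomials\<close>

lemma ideal_of_pm: "pm n J \<Longrightarrow> J \<subseteq> Sn n \<Longrightarrow> ideal J (poly_ring n :: 'k::field pol ring)"
proof -
  assume J: "pm n J" "J \<subseteq> Sn n"
  interpret R: cring "poly_ring n :: 'k pol ring" by (rule cring_poly_ring)
  have add: "x \<oplus>\<^bsub>poly_ring n\<^esub> y = x + y" "x \<otimes>\<^bsub>poly_ring n\<^esub> y = x * y" "\<zero>\<^bsub>poly_ring n\<^esub> = 0" for x y :: "'k pol"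
    by (simp_all add: poly_ring_def)
  have inv: "\<ominus>\<^bsub>poly_ring n\<^esub> x = - x" if "x \<in> J" for x
  proof (rule R.minus_equality)
    show "- x \<oplus>\<^bsub>poly_ring n\<^esub> x = \<zero>\<^bsub>poly_ring n\<^esub>" by (simp add: add)
    show "x \<in> carrier (poly_ring n)" "- x \<in> carrier (poly_ring n)"
      using that J pm_uminus[OF J(1)] unfolding Sn_carrier[symmetric] by blast+
  qed
  show ?thesis
  proof (rule idealI[OF R.ring_axioms])
    show "subgroup J (add_monoid (poly_ring n))"
    proof (rule group.subgroupI[OF R.a_group])
      show "J \<subseteq> carrier (add_monoid (poly_ring n))" using J(2)[unfolded Sn_carrier] by simp
      show "J \<noteq> {}" using pm_0[OF J(1)] by blast
      show "inv\<^bsub>add_monoid (poly_ring n)\<^esub> a \<in> J" if "a \<in> J" for a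
        using inv[OF that] pm_uminus[OF J(1) that] by (simp add: a_inv_def)
      show "a \<otimes>\<^bsub>add_monoid (poly_ring n)\<^esub> b \<in> J" if "a \<in> J" "b \<in> J" for a b
        using pm_add[OF J(1) that] by (simp add: add)
    qed
    show "x \<otimes>\<^bsub>poly_ring n\<^esub> a \<in> J" "a \<otimes>\<^bsub>poly_ring n\<^esub> x \<in> J"
      if "a \<in> J" "x \<in> carrier (poly_ring n)" for a x
      using pm_times[OF J(1) _ that(1), of x] that(2)[folded Sn_carrier] by (simp_all add: add mult.commute)
  qed
qed

lemma pm_of_ideal:
  assumes "ideal J (poly_ring n :: 'k::field pol ring)"
  shows "pm n J" "J \<subseteq> Sn n"
proof -
  interpret R: cring "poly_ring n :: 'k pol ring" by (rule cring_poly_ring)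
  interpret ideal J "poly_ring n :: 'k pol ring" by fact
  have add: "x \<oplus>\<^bsub>poly_ring n\<^esub> y = x + y" "x \<otimes>\<^bsub>poly_ring n\<^esub> y = x * y" "\<zero>\<^bsub>poly_ring n\<^esub> = 0" for x y :: "'k pol"
    by (simp_all add: poly_ring_def)
  have t: "p * y \<in> J" if "p \<in> Sn n" "y \<in> J" for p y using I_l_closed[of y p] that by (simp add: add Sn_carrier)
  have "- 1 \<in> (Sn n :: 'k pol set)"
  proof -
    have "(1 :: 'k pol) \<in> Sn n" by (auto simp: SP_def MS_def)
    then show ?thesis using pm_uminus[OF pm_Sn] by blast
  qed
  then have m: "- y \<in> J" if "y \<in> J" for y using t[OF _ that] by fastforce
  have "x - y \<in> J" if "x \<in> J" "y \<in> J" for x y using a_closed[OF that(1) m[OF that(2)]] by (simp add: add)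
  moreover have "0 \<in> J" using zero_closed by (simp add: add)
  ultimately show "pm n J" using t by (auto simp: pm_def)
  show "J \<subseteq> Sn n" using a_subset unfolding Sn_carrier .
qed

lemma Idl_mem_sum:
  fixes A :: "'k::field pol set"
  assumes "A \<subseteq> Sn n" "\<And>i. i \<in> I \<Longrightarrow> p i \<in> Sn n" "\<And>i. i \<in> I \<Longrightarrow> a i \<in> A"
  shows "(\<Sum>i\<in>I. p i * a i) \<in> Idl\<^bsub>poly_ring n\<^esub> A"
proof -
  interpret R: cring "poly_ring n :: 'k pol ring" by (rule cring_poly_ring)
  have A: "A \<subseteq> carrier (poly_ring n)" using assms(1) unfolding Sn_carrier .
  note p = pm_of_ideal[OF R.genideal_ideal[OF A]]
  have "a i \<in> Idl\<^bsub>poly_ring n\<^esub> A" if "i \<in> I" for i using R.genideal_self[OF A] assms(3)[OF that] by blast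
  then show ?thesis by (intro pm_sum[OF p(1)] pm_times[OF p(1)] assms(2))
qed

lemma Idl_minimal:
  fixes A :: "'k::field pol set"
  assumes "pm n J" "J \<subseteq> Sn n" "A \<subseteq> J"
  shows "Idl\<^bsub>poly_ring n\<^esub> A \<subseteq> J"
proof -
  interpret R: cring "poly_ring n :: 'k pol ring" by (rule cring_poly_ring)
  show ?thesis by (rule R.genideal_minimal[OF ideal_of_pm[OF assms(1,2)] assms(3)])
qed

section \<open>Squarefree monomials and Stanley--Reisner ideals\<close>

lemma xmon_inj: "finite P \<Longrightarrow> finite Q \<Longrightarrow> xmon P = xmon Q \<longleftrightarrow> P = Q" using keys_xmon by metis

lemma sf_mon_eq: "sf_mon n d = xmon ` {W. W \<subseteq> {1..n} \<and> card W = d}"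
proof
  show "sf_mon n d \<subseteq> xmon ` {W. W \<subseteq> {1..n} \<and> card W = d}"
  proof
    fix m assume m: "m \<in> sf_mon n d"
    have k: "keys m \<subseteq> {1..n}" "\<And>i. lookup m i \<le> 1" "mdeg m = d" using m by (auto simp: sf_mon_def)
    have fin: "finite (keys m)" by simp
    have e: "m = xmon (keys m)"
    proof (rule poly_mapping_eqI)
      fix i show "lookup m i = lookup (xmon (keys m)) i"
        unfolding lookup_xmon[OF fin] using k(2)[of i] by (auto simp: in_keys_iff)
    qed
    then have "card (keys m) = d" using mdeg_xmon[OF fin] k(3) by simp
    then show "m \<in> xmon ` {W. W \<subseteq> {1..n} \<and> card W = d}" using e k(1) by blast
  qed
  show "xmon ` {W. W \<subseteq> {1..n} \<and> card W = d} \<subseteq> sf_mon n d"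
  proof clarify
    fix W :: "nat set" assume W: "W \<subseteq> {1..n}"
    then have "finite W" using finite_subset by blast
    then show "xmon W \<in> sf_mon n (card W)" using W by (simp add: sf_mon_def keys_xmon lookup_xmon mdeg_xmon)
  qed
qed

text \<open>For squarefree \<open>M\<close>, the complex whose Stanley--Reisner ideal is generated
  by \<open>M\<close>.\<close>

definition fc :: "nat \<Rightarrow> mon set \<Rightarrow> nat set set" where
  "fc n M = {T. T \<subseteq> {1..n} \<and> (\<forall>W\<subseteq>T. xmon W \<notin> M)}"

lemma fc_cplx: "cplx n (fc n M)" by (rule cplxI) (auto simp: fc_def)

lemma mon_ideal_MI:
  assumes M: "M \<subseteq> sf_mon n d"
  shows "mon_ideal n M = (MI n (- fc n M) :: 'k::field pol set)"
proof -
  let ?A = "(\<lambda>m. single m 1) ` M :: 'k pol set"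
  interpret R: cring "poly_ring n :: 'k pol ring" by (rule cring_poly_ring)
  have M': "\<exists>W. W \<subseteq> {1..n} \<and> m = xmon W" if "m \<in> M" for m using M that unfolding sf_mon_eq by blast
  have fin: "finite W" if "W \<subseteq> {1..n}" for W using that finite_subset by blast
  have AS: "?A \<subseteq> MI n (- fc n M)"
  proof clarify
    fix m assume m: "m \<in> M"
    then obtain W where W: "W \<subseteq> {1..n}" "m = xmon W" using M' by blast
    have "pmon m \<in> (MI n (- fc n M) :: 'k pol set)"
      unfolding mem_SP_pmon using W m keys_xmon[OF fin[OF W(1)]] by (auto simp: MS_def fc_def)
    then show "single m 1 \<in> (MI n (- fc n M) :: 'k pol set)" by (simp add: pmon_def)
  qed
  have sub: "MI n (- fc n M) \<subseteq> (Sn n :: 'k pol set)" by (rule MI_mono) simp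
  have pmI: "pm n (MI n (- fc n M) :: 'k pol set)" by (rule pm_MI[OF up_compl[OF fc_cplx]])
  have A': "?A \<subseteq> carrier (poly_ring n)" using AS sub unfolding Sn_carrier by blast
  note J = pm_of_ideal[OF R.genideal_ideal[OF A']]
  show ?thesis unfolding mon_ideal_def
  proof
    show "Idl\<^bsub>poly_ring n\<^esub> ?A \<subseteq> MI n (- fc n M)" by (rule Idl_minimal[OF pmI sub AS])
    show "MI n (- fc n M) \<subseteq> Idl\<^bsub>poly_ring n\<^esub> ?A"
    proof
      fix p assume p: "p \<in> (MI n (- fc n M) :: 'k pol set)"
      have "single m (lookup p m) \<in> Idl\<^bsub>poly_ring n\<^esub> ?A" if m: "m \<in> keys p" for m
      proof -
        have k: "keys m \<subseteq> {1..n}" "keys m \<notin> fc n M" using subsetD[OF p[unfolded SP_def mem_Collect_eq] m] by (auto simp: MS_def)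
        then obtain W where W: "W \<subseteq> keys m" "xmon W \<in> M" by (auto simp: fc_def)
        have fW: "finite W" using W(1) finite_keys finite_subset by blast
        have "xmon W + (m - xmon W) = m"
        proof (rule poly_mapping_eqI)
          fix i show "lookup (xmon W + (m - xmon W)) i = lookup m i"
            using W(1) by (auto simp: lookup_add lookup_minus lookup_xmon[OF fW] in_keys_iff subset_iff)
        qed
        then have e: "single m (lookup p m) = single (m - xmon W) (lookup p m) * single (xmon W) 1"
          by (simp add: mult_single add.commute)
        have "keys (m - xmon W) \<subseteq> keys m" by (auto simp: in_keys_iff lookup_minus)
        then have "single (m - xmon W) (lookup p m) \<in> (Sn n :: 'k pol set)"
          using k(1) by (auto simp: SP_def MS_def)
        moreover have "single (xmon W) 1 \<in> Idl\<^bsub>poly_ring n\<^esub> ?A" using R.genideal_self[OF A'] W(2) by blast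
        ultimately show ?thesis unfolding e by (rule pm_times[OF J(1)])
      qed
      then show "p \<in> Idl\<^bsub>poly_ring n\<^esub> ?A" by (rule pm_poly[OF J(1)])
    qed
  qed
qed

lemma mem_irrelevant: "p \<in> irrelevant_ideal n \<longleftrightarrow> p \<in> Sn n \<and> 0 \<notin> keys p"
  for p :: "'k::field pol"
proof -
  let ?M = "(\<lambda>i. single i 1) ` {1..n} :: mon set"
  have x: "single i 1 = xmon {i}" for i by (simp add: xmon_def)
  have M: "?M \<subseteq> sf_mon n 1" unfolding sf_mon_eq x by auto
  have k: "keys m \<notin> fc n ?M \<longleftrightarrow> m \<noteq> 0" if m: "keys m \<subseteq> {1..n}" for m
  proof
    assume "keys m \<notin> fc n ?M"
    then obtain W i where "W \<subseteq> keys m" "xmon W = xmon {i}" using m unfolding fc_def x by blast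
    moreover from this have "W = {i}" using xmon_inj[of W "{i}"] finite_subset[OF _ finite_keys] by blast
    ultimately show "m \<noteq> 0" by auto
  next
    assume "m \<noteq> 0"
    then obtain i where i: "i \<in> keys m" by (metis keys_eq_empty ex_in_conv)
    then have "xmon {i} \<in> ?M" using m unfolding x by blast
    then show "keys m \<notin> fc n ?M" using i unfolding fc_def by blast
  qed
  have "p \<in> MI n (- fc n ?M) \<longleftrightarrow> (\<forall>m\<in>keys p. keys m \<subseteq> {1..n} \<and> keys m \<notin> fc n ?M)" by (auto simp: SP_def MS_def)
  also have "\<dots> \<longleftrightarrow> (\<forall>m\<in>keys p. keys m \<subseteq> {1..n} \<and> m \<noteq> 0)" using k by blast
  also have "\<dots> \<longleftrightarrow> p \<in> Sn n \<and> 0 \<notin> keys p" by (auto simp: SP_def MS_def)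
  finally show ?thesis unfolding irrelevant_ideal_def mon_ideal_MI[OF M] .
qed

text \<open>The resolution is assembled from iterated covers. \<open>cover_kernel\<close> hands the
  vanishing of homology to the next kernel, and since that kernel starts one degree higher, the next
  cover is linear again.\<close>

lemma Hz_imp_linear:
  fixes J :: "'k::field pol set"
  assumes J: "pm n J" "J \<subseteq> Sn n" "gr J" and low: "\<And>t. t < int e \<Longrightarrow> J \<inter> Gp t \<subseteq> {0}"
    and H: "\<And>vs j t. distinct vs \<Longrightarrow> set vs = {1..n} \<Longrightarrow> int j + int e < t \<Longrightarrow> Hz Xp Gp vs J {0} j t"
  shows "has_linear_resolution n e J"
proof -
  let ?M = "(ring_mod n)\<lparr>carrier := J\<rparr>" and ?G = "\<lambda>c. J \<inter> poly_comp n c"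
  let ?vs = "[1..<Suc n]"
  have vs: "distinct ?vs" "set ?vs = {1..n}" by auto
  define cc where "cc i = (case i of 0 \<Rightarrow> 0 | Suc k \<Rightarrow> int (e + k))" for i :: nat
  \<comment> \<open>The invariant of the iteration: a graded submodule of a free module, zero below
    degree \<open>e + i\<close>, without homology beyond the linear strand.\<close>
  define St where "St i N \<longleftrightarrow> fsub n N \<and> (\<exists>L0. N \<subseteq> FN n L0) \<and> (\<forall>t<int (e + i). N \<inter> GF (cc i) t \<subseteq> {0}) \<and>
     (\<forall>j t. int j + int (e + i) < t \<longrightarrow> Hz XF (GF (cc i)) ?vs N {0} j t)" for i and N :: "(nat \<Rightarrow> 'k pol) set"
  define Cv where "Cv i N L m \<longleftrightarrow> (\<forall>k<L. m k \<in> N \<inter> GF (cc i) (int (e + i))) \<and> cov L m ` FN n L = N \<and>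
    (\<forall>f\<in>FN n L. f \<in> GF (int (e + i)) (int (e + i)) \<longrightarrow> cov L m f = 0 \<longrightarrow> f = 0)"
    for i and N :: "(nat \<Rightarrow> 'k pol) set" and L m
  define Zk where "Zk L m = {f \<in> FN n L. cov L m f = 0}" for L and m :: "nat \<Rightarrow> nat \<Rightarrow> 'k pol"
  have ex: "\<exists>L m. Cv i N L m" if stN: "St i N" for i N
  proof -
    have N: "fsub n N" "\<And>t. t < int (e + i) \<Longrightarrow> N \<inter> GF (cc i) t \<subseteq> {0}"
      "\<And>j t. int j + int (e + i) < t \<Longrightarrow> Hz XF (GF (cc i)) ?vs N {0} j t" using that unfolding St_def by blast+
    obtain L0 where "N \<subseteq> FN n L0" using stN unfolding St_def by blast
    from linear_cover[OF N(1) this N(2) vs(2)] N(3)[of 0] show ?thesis unfolding Cv_def by auto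
  qed
  have cover: "free_cover n L (int (e + i)) (cc i) (cov L m) N" if "St i N" "Cv i N L m" for i N L m
    by (rule cov_cover) (use that in \<open>auto simp: St_def Cv_def\<close>)
  have next_St: "St (Suc i) (Zk L m)" if N: "St i N" "Cv i N L m" for i N L m
  proof -
    interpret free_cover n L "int (e + i)" "cc i" "cov L m" N by (rule cover[OF N])
    have Z: "Z = Zk L m" by (simp add: Z_def Zk_def)
    have c: "cc (Suc i) = int (e + i)" by (simp add: cc_def)
    have "Zk L m \<inter> GF (cc (Suc i)) t \<subseteq> {0}" if t: "t < int (e + Suc i)" for t
    proof
      fix f assume f: "f \<in> Zk L m \<inter> GF (cc (Suc i)) t"
      show "f \<in> {0}"
      proof (cases "t = int (e + i)")
        case True then show ?thesis using f N(2) by (auto simp: Zk_def Cv_def c)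
      next case False
        then have "t - int (e + i) < 0" using t by simp
        then have "f k = 0" for k using MI_neg[of "t - int (e + i)" UNIV] f by (auto simp: GF_def c)
        then show ?thesis by (auto simp: fun_eq_iff)
      qed
    qed
    moreover have "Hz XF (GF (cc (Suc i))) ?vs (Zk L m) {0} j t" if "int j + int (e + Suc i) < t" for j t
      unfolding c Z[symmetric] by (rule cover_kernel[OF vs]) (use N(1) that in \<open>auto simp: St_def\<close>)
    ultimately show ?thesis using fsub_Z Z cover_sub by (auto simp: St_def)
  qed
  have St0: "St 0 (emb ` J)"
  proof -
    have e: "emb (x - y) = emb x - emb y" "emb (p * x) = (\<lambda>i. p * emb x i)" "emb 0 = 0"
      "pF d (emb x) = emb (hc d x)" "emb x \<in> GF 0 d \<longleftrightarrow> x \<in> Gp d" for x y p :: "'k pol" and d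
      using Xp.G_0 by (auto simp: emb_def pF_def GF_def fun_eq_iff hc_0)
    have "fsub n (emb ` J)" unfolding fsub_def
    proof (intro conjI ballI allI)
      show "0 \<in> emb ` J" using e(3) pm_0[OF J(1)] by (metis imageI)
      show "f - g \<in> emb ` J" if "f \<in> emb ` J" "g \<in> emb ` J" for f g
        using that pm_diff[OF J(1)] by (auto simp: e(1)[symmetric])
      show "(\<lambda>i. p * f i) \<in> emb ` J" if "p \<in> Sn n" "f \<in> emb ` J" for p f
        using that pm_times[OF J(1)] by (auto simp: e(2)[symmetric])
      show "pF d f \<in> emb ` J" if "f \<in> emb ` J" for f d using that J(3) by (auto simp: e(4) gr_def)
    qed
    moreover have "emb ` J \<subseteq> FN n 1" using J(2) by (auto simp: emb_def FN_def)
    moreover have "emb ` J \<inter> GF (cc 0) t \<subseteq> {0}" if "t < int (e + 0)" for t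
    proof
      fix f assume "f \<in> emb ` J \<inter> GF (cc 0) t"
      then obtain y where y: "y \<in> J" "f = emb y" "y \<in> Gp t" using e(5) by (auto simp: cc_def)
      then have "y = 0" using low[of t] that by auto
      then show "f \<in> {0}" using y e(3) by simp
    qed
    moreover have "Hz XF (GF (cc 0)) ?vs (emb ` J) {0} j t" if "int j + int (e + 0) < t" for j t
      using H[OF vs, of j t] that emb_iso[OF J(1), of ?vs j t] vs by (simp add: cc_def)
    ultimately show ?thesis unfolding St_def by blast
  qed
  \<comment> \<open>Covers are not unique, so module, number of generators and generators are
    selected together by dependent choice, each module being the kernel of the previous
    cover.\<close>
  have "\<exists>S. \<forall>i. (case S i of (N, L, m) \<Rightarrow> St i N \<and> Cv i N L m \<and> (i = 0 \<longrightarrow> N = emb ` J)) \<and>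
     (case S i of (N, L, m) \<Rightarrow> fst (S (Suc i)) = Zk L m)"
  proof -
    have "\<exists>S. \<forall>i. (\<lambda>i (N, L, m). St i N \<and> Cv i N L m \<and> (i = 0 \<longrightarrow> N = emb ` J)) i (S i) \<and>
       (\<lambda>i (N, L, m) x. fst x = Zk L m) i (S i) (S (Suc i))"
    proof (rule dependent_nat_choice)
      show "\<exists>x. case x of (N, L, m) \<Rightarrow> St 0 N \<and> Cv 0 N L m \<and> (0 = (0::nat) \<longrightarrow> N = emb ` J)"
        using St0 ex[OF St0] by auto
    next
      fix x i assume "case x of (N, L, m) \<Rightarrow> St i N \<and> Cv i N L m \<and> (i = 0 \<longrightarrow> N = emb ` J)"
      then obtain N L m where x: "x = (N, L, m)" "St i N" "Cv i N L m" by auto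
      have s: "St (Suc i) (Zk L m)" by (rule next_St[OF x(2,3)])
      then obtain L' m' where "Cv (Suc i) (Zk L m) L' m'" using ex by blast
      then show "\<exists>y. (case y of (N, L, m) \<Rightarrow> St (Suc i) N \<and> Cv (Suc i) N L m \<and> (Suc i = 0 \<longrightarrow> N = emb ` J)) \<and>
        (case x of (N, L, m) \<Rightarrow> \<lambda>x. fst x = Zk L m) y" using s x(1) by (intro exI[of _ "(Zk L m, L', m')"]) auto
    qed
    then show ?thesis by (simp only: case_prod_beta) 
  qed
  then obtain S where S0: "\<forall>i. (case S i of (N, L, m) \<Rightarrow> St i N \<and> Cv i N L m \<and> (i = 0 \<longrightarrow> N = emb ` J)) \<and>
     (case S i of (N, L, m) \<Rightarrow> fst (S (Suc i)) = Zk L m)" by (rule exE)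
  note S = S0[rule_format, THEN conjunct1] S0[rule_format, THEN conjunct2]
  define N where "N i = fst (S i)" for i
  define L where "L i = fst (snd (S i))" for i
  define m where "m i = snd (snd (S i))" for i
  have st: "St i (N i)" and cv: "Cv i (N i) (L i) (m i)" and N0: "N 0 = emb ` J" and NS: "N (Suc i) = Zk (L i) (m i)" for i
    using S[of i] S(1)[of 0] by (auto simp: N_def L_def m_def case_prod_beta)
  define a where "a i = replicate (L i) (int (e + i))" for i
  define \<phi> where "\<phi> i = cov (L i) (m i)" for i
  define \<epsilon> where "\<epsilon> f = \<phi> 0 f 0" for f
  have len: "length (a i) = L i" and aset: "set (a i) \<subseteq> {int (e + i)}" for i by (auto simp: a_def)
  note fc = free_comp_const[OF aset, unfolded len]
  interpret C: free_cover n "L i" "int (e + i)" "cc i" "\<phi> i" "N i" for i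
    unfolding \<phi>_def by (rule cover[OF st cv])
  have im: "\<phi> i ` FN n (L i) = N i" for i by (rule C.im)
  have \<phi>0: "\<phi> 0 f = emb (\<epsilon> f)" "\<epsilon> f \<in> J" if f: "f \<in> FN n (L 0)" for f
  proof -
    have "\<phi> 0 f \<in> emb ` J" using im[of 0] N0 f by blast
    then obtain y where "y \<in> J" "\<phi> 0 f = emb y" by blast
    then show "\<phi> 0 f = emb (\<epsilon> f)" "\<epsilon> f \<in> J" by (auto simp: \<epsilon>_def emb_def)
  qed
  have NF: "N (Suc i) \<subseteq> FN n (L i)" for i unfolding NS Zk_def by blast
  have eim: "\<epsilon> ` FN n (L 0) = J"
  proof (intro equalityI subsetI)
    fix y assume "y \<in> J"
    then have "emb y \<in> \<phi> 0 ` FN n (L 0)" using im[of 0] N0 by blast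
    then obtain f where f: "f \<in> FN n (L 0)" "emb y = \<phi> 0 f" by blast
    have "y = \<epsilon> f" using fun_cong[OF f(2), of 0] unfolding \<epsilon>_def emb_def by simp
    then show "y \<in> \<epsilon> ` FN n (L 0)" using f(1) by blast
  qed (use \<phi>0 in auto)
  have emb0: "emb y = 0 \<longleftrightarrow> y = 0" for y :: "'k pol" by (auto simp: emb_def fun_eq_iff)
  have ker0: "N 1 = {f \<in> FN n (L 0). \<epsilon> f = 0}"
    using NS[of 0] \<phi>0 emb0 unfolding Zk_def \<phi>_def[symmetric] by (auto simp: One_nat_def)
  have Kset: "{f \<in> FN n (L i). \<phi> i f = 0} = N (Suc i)" for i by (simp add: NS Zk_def \<phi>_def)
  have eps: "\<epsilon> \<in> graded_hom (poly_ring n) (free_mod n (a 0)) (free_comp n (a 0)) ?M ?G"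
    unfolding graded_hom_def mod_hom_def
  proof (intro CollectI conjI ballI allI)
    show "\<epsilon> \<in> carrier (free_mod n (a 0)) \<rightarrow> carrier ?M" using \<phi>0 by (simp add: ring_simps len)
    show "\<epsilon> (x \<oplus>\<^bsub>free_mod n (a 0)\<^esub> y) = \<epsilon> x \<oplus>\<^bsub>?M\<^esub> \<epsilon> y" for x y
      by (simp add: ring_simps ring_mod_def \<epsilon>_def \<phi>_def cov_add)
    show "\<epsilon> (r \<odot>\<^bsub>free_mod n (a 0)\<^esub> x) = r \<odot>\<^bsub>?M\<^esub> \<epsilon> x" for r x
      by (simp add: ring_simps ring_mod_def \<epsilon>_def \<phi>_def cov_times)
    show "\<epsilon> ` free_comp n (a 0) d \<subseteq> J \<inter> poly_comp n d" for d
    proof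
      fix y assume "y \<in> \<epsilon> ` free_comp n (a 0) d"
      then obtain f where f: "f \<in> FN n (L 0)" "f \<in> GF (int (e + 0)) d" "y = \<epsilon> f" using fc[of n 0 d] by auto
      have "\<phi> 0 f \<in> GF (cc 0) d" by (rule C.deg[OF f(1,2)])
      then have "\<epsilon> f \<in> Gp d" by (auto simp: \<epsilon>_def GF_def cc_def dest: spec[of _ 0])
      moreover have "\<epsilon> f \<in> J" by (rule \<phi>0(2)[OF f(1)])
      ultimately show "y \<in> J \<inter> poly_comp n d" using J(2) f(3) Sn_carrier[of n] by (auto simp: poly_comp_def Gp_def)
    qed
  qed
  have del: "\<phi> (Suc i) \<in> graded_hom (poly_ring n) (free_mod n (a (Suc i))) (free_comp n (a (Suc i)))
       (free_mod n (a i)) (free_comp n (a i))" for i unfolding graded_hom_def mod_hom_def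
  proof (intro CollectI conjI ballI allI)
    have m: "\<phi> (Suc i) f \<in> FN n (L i)" if "f \<in> FN n (L (Suc i))" for f
      using that im[of "Suc i"] NF[of i] by blast
    show "\<phi> (Suc i) \<in> carrier (free_mod n (a (Suc i))) \<rightarrow> carrier (free_mod n (a i))"
      using m by (simp add: ring_simps len)
    show "\<phi> (Suc i) (x \<oplus>\<^bsub>free_mod n (a (Suc i))\<^esub> y) = \<phi> (Suc i) x \<oplus>\<^bsub>free_mod n (a i)\<^esub> \<phi> (Suc i) y" for x y
      by (simp add: ring_simps \<phi>_def cov_add del: plus_fun_apply)
    show "\<phi> (Suc i) (r \<odot>\<^bsub>free_mod n (a (Suc i))\<^esub> x) = r \<odot>\<^bsub>free_mod n (a i)\<^esub> \<phi> (Suc i) x" for r x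
      by (simp add: ring_simps \<phi>_def cov_times)
    show "\<phi> (Suc i) ` free_comp n (a (Suc i)) d \<subseteq> free_comp n (a i) d" for d
      using C.deg[of _ "Suc i" d] m unfolding fc by (auto simp: cc_def)
  qed
  have zero: "\<zero>\<^bsub>?M\<^esub> = 0" "carrier ?M = J" by (simp_all add: ring_mod_def)
  have res: "graded_free_resolution n ?M ?G a \<epsilon> (\<lambda>i. \<phi> (Suc i))"
    unfolding graded_free_resolution_def a_kernel_def' ring_simps len zero
    using eps del eim ker0 im[of 1] im Kset by (auto simp: One_nat_def)
  have min: "\<phi> (Suc i) ` carrier (free_mod n (a (Suc i))) \<subseteq> set_smult (poly_ring n) (irrelevant_ideal n) (free_mod n (a i))" for i
  proof
    fix f assume "f \<in> \<phi> (Suc i) ` carrier (free_mod n (a (Suc i)))"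
    then have f: "f \<in> N (Suc i)" using im[of "Suc i"] by (simp add: ring_simps len)
    then have fF: "f \<in> FN n (L i)" using NF by blast
    \<comment> \<open>A constant term would belong to a component of internal degree
      \<open>e + i\<close>, but the kernel vanishes below \<open>e + Suc i\<close>.\<close>
    have fi: "f k \<in> irrelevant_ideal n" if k: "k < L i" for k
    proof -
      have fs: "fsub n (N (Suc i))" using st[of "Suc i"] by (simp add: St_def)
      have "pF 0 f \<in> GF (int (e + i)) (int (e + i))" using pF_GF[of "int (e + i)" "int (e + i)" f] by simp
      then have "pF 0 f \<in> N (Suc i) \<inter> GF (cc (Suc i)) (int (e + i))" using fsub_pF[OF fs f] by (simp add: cc_def)
      moreover have "int (e + i) < int (e + Suc i)" by simp
      ultimately have "pF 0 f = 0" using st[of "Suc i"] unfolding St_def by blast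
      then have "hc 0 (f k) = 0" by (metis pF_def zero_fun_apply)
      then have "lookup (hc 0 (f k)) 0 = 0" by simp
      then have "0 \<notin> keys (f k)" by (simp add: hc_def lookup_restr in_keys_iff)
      then show ?thesis using fF k by (simp add: mem_irrelevant FN_def)
    qed
    show "f \<in> set_smult (poly_ring n) (irrelevant_ideal n) (free_mod n (a i))"
      unfolding set_smult_def mod_span_def
    proof (rule InterI)
      fix W :: "(nat \<Rightarrow> 'k pol) set" assume "W \<in> {W. submodule W (poly_ring n) (free_mod n (a i)) \<and>
        {x \<odot>\<^bsub>free_mod n (a i)\<^esub> y |x y. x \<in> irrelevant_ideal n \<and> y \<in> carrier (free_mod n (a i))} \<subseteq> W}"
      then have W: "submodule W (poly_ring n) (free_mod n (a i))"
        and g: "\<And>x y. x \<in> irrelevant_ideal n \<Longrightarrow> y \<in> FN n (L i) \<Longrightarrow> (\<lambda>k. x * y k) \<in> W"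
        unfolding ring_simps len by blast+
      have W0: "0 \<in> W" and Wa: "\<And>x y. x \<in> W \<Longrightarrow> y \<in> W \<Longrightarrow> x + y \<in> W"
        using subgroup.one_closed[OF submodule.axioms(1)[OF W]] subgroup.m_closed[OF submodule.axioms(1)[OF W]]
        by (simp_all add: ring_simps)
      define u where "u k = (\<lambda>l. if l = k then 1 else (0 :: 'k pol))" for k :: nat
      have uF: "u k \<in> FN n (L i)" if "k < L i" for k using that by (auto simp: u_def FN_def SP_def MS_def)
      have sw: "(\<Sum>k<K. (\<lambda>l. f k * u k l)) \<in> W" if "K \<le> L i" for K using that
      proof (induction K)
        case (Suc K)
        then have K: "K < L i" and s: "(\<Sum>k<K. (\<lambda>l. f k * u k l)) \<in> W" by simp_all
        have "(\<lambda>l. f K * u K l) \<in> W" by (rule g[OF fi[OF K] uF[OF K]])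
        from Wa[OF s this] show ?case by (simp del: plus_fun_apply)
      qed (simp add: W0 del: zero_fun_apply)
      have eq: "(\<Sum>k<L i. (\<lambda>l. f k * u k l)) = f"
      proof (rule ext)
        fix l
        have "(\<Sum>k<K. (\<lambda>l. f k * u k l)) l = (\<Sum>k<K. if k = l then f k else 0)" for K
          by (induction K) (auto simp: u_def)
        then show "(\<Sum>k<L i. (\<lambda>l. f k * u k l)) l = f l" using fF by (auto simp: FN_def)
      qed
      from sw[OF order_refl] show "f \<in> W" unfolding eq .
    qed
  qed
  have "J = Idl\<^bsub>poly_ring n\<^esub> (J \<inter> poly_comp n (int e))"
  proof
    show "Idl\<^bsub>poly_ring n\<^esub> (J \<inter> poly_comp n (int e)) \<subseteq> J" by (rule Idl_minimal[OF J(1,2)]) blast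
    show "J \<subseteq> Idl\<^bsub>poly_ring n\<^esub> (J \<inter> poly_comp n (int e))"
    proof
      fix y assume "y \<in> J"
      then obtain f where f: "f \<in> FN n (L 0)" "y = \<epsilon> f" using eim by blast
      have "y = (\<Sum>k<L 0. f k * m 0 k 0)" by (simp add: f(2) \<epsilon>_def \<phi>_def cov_def)
      also have "\<dots> \<in> Idl\<^bsub>poly_ring n\<^esub> (J \<inter> poly_comp n (int e))"
      proof (rule Idl_mem_sum)
        show "J \<inter> poly_comp n (int e) \<subseteq> Sn n" using J(2) by blast
        fix k assume k: "k \<in> {..<L 0}"
        then show "f k \<in> Sn n" using f(1) by (simp add: FN_def)
        have "m 0 k \<in> N 0" "m 0 k \<in> GF (cc 0) (int (e + 0))" using cv[of 0] k by (auto simp: Cv_def)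
        then have "m 0 k 0 \<in> J" "m 0 k 0 \<in> Gp (int e)" using N0 by (auto simp: emb_def GF_def cc_def)
        then show "m 0 k 0 \<in> J \<inter> poly_comp n (int e)"
          using J(2) Sn_carrier[of n] by (auto simp: poly_comp_def Gp_def)
      qed
      finally show "y \<in> Idl\<^bsub>poly_ring n\<^esub> (J \<inter> poly_comp n (int e))" .
    qed
  qed
  moreover have "minimal_graded_free_resolution n ?M ?G a \<epsilon> (\<lambda>i. \<phi> (Suc i))"
    unfolding minimal_graded_free_resolution_def using res min by blast
  ultimately show ?thesis unfolding has_linear_resolution_def using aset by blast
qed

text \<open>Complements of faces have size at least \<open>n - d\<close>, so the dual ideal starts
  in degree \<open>n - d\<close>; for such an ideal, regularity \<open>n - d\<close> and a linear
  resolution amount to the same.\<close>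

theorem linear_iff_Reg:
  fixes ty :: "'k::field itself"
  assumes X: "cplx n X" and low: "\<And>T. T \<in> X \<Longrightarrow> card T \<le> d" and d: "d \<le> n"
  shows "has_linear_resolution n (n - d) (MI n (du n X) :: 'k pol set) \<longleftrightarrow> Reg ty n X d"
proof -
  let ?J = "MI n (du n X) :: 'k pol set"
  have J: "pm n ?J" by (rule pm_MI[OF up_du[OF X]])
  show ?thesis
  proof
    assume "has_linear_resolution n (n - d) ?J"
    from linear_imp_Hz[OF J this] show "Reg ty n X d" unfolding Reg_def MI_empty using d by auto
  next
    assume R: "Reg ty n X d"
    show "has_linear_resolution n (n - d) ?J"
    proof (rule Hz_imp_linear[OF J])
      show "?J \<subseteq> Sn n" by (rule MI_mono) simp
      show "gr ?J" by (rule gr_MI)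
      show "Hz Xp Gp vs ?J {0} j t" if "distinct vs" "set vs = {1..n}" "int j + int (n - d) < t" for vs j t
        using R that d unfolding Reg_def MI_empty by auto
      show "?J \<inter> Gp t \<subseteq> {0}" if t: "t < int (n - d)" for t
      proof
        fix p assume p: "p \<in> ?J \<inter> Gp t"
        have "m \<notin> keys p" for m
        proof
          assume m: "m \<in> keys p"
          then have a: "{1..n} - keys m \<in> X" "keys m \<subseteq> {1..n}" "int (mdeg m) = t"
            using p by (auto simp: SP_def MS_def du_def Gp_def)
          have "card (keys m) \<le> mdeg m"
            unfolding mdeg_def using sum_mono[of "keys m" "\<lambda>_. 1" "lookup m"] by (force simp: in_keys_iff)
          moreover have "card ({1..n} - keys m) = n - card (keys m)" using a(2) by (simp add: card_Diff_subset)
          moreover have "card ({1..n} - keys m) \<le> d" by (rule low[OF a(1)])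
          ultimately show False using t a(3) by linarith
        qed
        then show "p \<in> {0}" by (auto simp: poly_mapping_eq_iff fun_eq_iff in_keys_iff)
      qed
    qed
  qed
qed

section \<open>Krull dimension\<close>

lemma pm_one: "pm n N \<Longrightarrow> N \<subseteq> Sn n \<Longrightarrow> 1 \<in> N \<Longrightarrow> N = Sn n" using pm_times[of n N _ 1] by auto

lemma one_Sn: "(1 :: 'k::field pol) \<in> Sn n" by (auto simp: SP_def MS_def)

text \<open>Prime ideals as plain sets of polynomials. The correspondence of primes then dispenses
  with the cosets in which the dimension is defined.\<close>

definition prm :: "nat \<Rightarrow> 'k::field pol set \<Rightarrow> bool" where
  "prm n P \<longleftrightarrow> pm n P \<and> P \<subseteq> Sn n \<and> 1 \<notin> P \<and> (\<forall>a\<in>Sn n. \<forall>b\<in>Sn n. a * b \<in> P \<longrightarrow> a \<in> P \<or> b \<in> P)"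

lemma prm_pm: "prm n P \<Longrightarrow> pm n P" and prm_sub: "prm n P \<Longrightarrow> P \<subseteq> Sn n" and prm_1: "prm n P \<Longrightarrow> 1 \<notin> P"
  and prm_prime: "prm n P \<Longrightarrow> a \<in> Sn n \<Longrightarrow> b \<in> Sn n \<Longrightarrow> a * b \<in> P \<Longrightarrow> a \<in> P \<or> b \<in> P" by (auto simp: prm_def)

abbreviation coset :: "nat \<Rightarrow> 'k::field pol set \<Rightarrow> 'k pol \<Rightarrow> 'k pol set" where
  "coset n J a \<equiv> J +>\<^bsub>poly_ring n\<^esub> a"

lemma coset_alt: "coset n J a = (\<lambda>j. j + a) ` J" by (auto simp: a_r_coset_def' poly_ring_def)

lemma coset_eq:
  assumes "pm n J" shows "coset n J a = coset n J b \<longleftrightarrow> a - b \<in> J"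
proof
  assume "coset n J a = coset n J b"
  moreover have "a \<in> coset n J a" unfolding coset_alt using pm_0[OF assms] by (auto intro!: image_eqI[of _ _ 0])
  ultimately show "a - b \<in> J" unfolding coset_alt by auto
next
  assume ab: "a - b \<in> J"
  have "x + a \<in> (\<lambda>j. j + b) ` J" if "x \<in> J" for x
    using pm_add[OF assms that ab] by (auto intro!: image_eqI[of _ _ "x + (a - b)"])
  moreover have "x + b \<in> (\<lambda>j. j + a) ` J" if "x \<in> J" for x
    using pm_diff[OF assms that ab] by (auto intro!: image_eqI[of _ _ "x - (a - b)"])
  ultimately show "coset n J a = coset n J b" unfolding coset_alt by blast
qed

lemma quot_ring:
  fixes J :: "'k::field pol set"
  assumes J: "pm n J" "J \<subseteq> Sn n"
  shows "carrier (poly_ring n Quot J) = coset n J ` Sn n"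
    "\<And>a b. a \<in> Sn n \<Longrightarrow> b \<in> Sn n \<Longrightarrow> coset n J a \<otimes>\<^bsub>poly_ring n Quot J\<^esub> coset n J b = coset n J (a * b)"
    "\<And>a b. a \<in> Sn n \<Longrightarrow> b \<in> Sn n \<Longrightarrow> coset n J a \<oplus>\<^bsub>poly_ring n Quot J\<^esub> coset n J b = coset n J (a + b)"
    "cring (poly_ring n Quot J)"
proof -
  interpret R: cring "poly_ring n :: 'k pol ring" by (rule cring_poly_ring)
  interpret ideal J "poly_ring n :: 'k pol ring" by (rule ideal_of_pm[OF J])
  have add: "x \<oplus>\<^bsub>poly_ring n\<^esub> y = x + y" "x \<otimes>\<^bsub>poly_ring n\<^esub> y = x * y" for x y :: "'k pol"
    by (simp_all add: poly_ring_def)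
  show "carrier (poly_ring n Quot J) = coset n J ` Sn n" by (auto simp: FactRing_def A_RCOSETS_def' Sn_carrier)
  show "coset n J a \<otimes>\<^bsub>poly_ring n Quot J\<^esub> coset n J b = coset n J (a * b)" if "a \<in> Sn n" "b \<in> Sn n" for a b
    using rcoset_mult_add[of a b] that by (simp add: FactRing_def Sn_carrier add)
  show "coset n J a \<oplus>\<^bsub>poly_ring n Quot J\<^esub> coset n J b = coset n J (a + b)" if "a \<in> Sn n" "b \<in> Sn n" for a b
    using a_rcos_sum[of a b] that by (simp add: FactRing_def Sn_carrier add)
  show "cring (poly_ring n Quot J)" by (rule quotient_is_cring[OF cring_poly_ring])
qed

lemma prm_image:
  fixes J :: "'k::field pol set"
  assumes J: "pm n J" "J \<subseteq> Sn n" and P: "prm n P" "J \<subseteq> P"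
  shows "primeideal (coset n J ` P) (poly_ring n Quot J)"
proof -
  interpret R: cring "poly_ring n :: 'k pol ring" by (rule cring_poly_ring)
  have mem: "a \<in> P" if "coset n J a = coset n J p" "p \<in> P" for a p
    using that coset_eq[OF J(1), of a p] pm_add[OF prm_pm[OF P(1)], of "a - p" p] P(2) by auto
  have PS: "P \<subseteq> Sn n" by (rule prm_sub[OF P(1)])
  note Q = quot_ring[OF J]
  show ?thesis
  proof (rule primeidealI)
    show "ideal (coset n J ` P) (poly_ring n Quot J)"
      by (rule R.ring_ideal_imp_quot_ideal[OF ideal_of_pm[OF J] ideal_of_pm[OF prm_pm[OF P(1)] PS]])
    show "cring (poly_ring n Quot J)" by (rule Q(4))
    show "carrier (poly_ring n Quot J) \<noteq> coset n J ` P"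
    proof
      assume "carrier (poly_ring n Quot J) = coset n J ` P"
      then have "coset n J 1 \<in> coset n J ` P" unfolding Q(1) using one_Sn by blast
      then show False using mem prm_1[OF P(1)] by blast
    qed
    fix X Y assume "X \<in> carrier (poly_ring n Quot J)" "Y \<in> carrier (poly_ring n Quot J)"
      and XY: "X \<otimes>\<^bsub>poly_ring n Quot J\<^esub> Y \<in> coset n J ` P"
    then obtain a b where ab: "a \<in> Sn n" "b \<in> Sn n" "X = coset n J a" "Y = coset n J b" unfolding Q(1) by blast
    have "a * b \<in> P" using XY mem unfolding ab Q(2)[OF ab(1,2)] by blast
    then show "X \<in> coset n J ` P \<or> Y \<in> coset n J ` P" using prm_prime[OF P(1) ab(1,2)] ab(3,4) by blast
  qed
qed

lemma prm_preimage:
  fixes J :: "'k::field pol set"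
  assumes J: "pm n J" "J \<subseteq> Sn n" and P: "primeideal P (poly_ring n Quot J)"
  shows "prm n {a\<in>Sn n. coset n J a \<in> P}" "J \<subseteq> {a\<in>Sn n. coset n J a \<in> P}"
proof -
  let ?P = "{a\<in>Sn n. coset n J a \<in> P}"
  interpret P: primeideal P "poly_ring n Quot J" by fact
  note Q = quot_ring[OF J]
  have id: "ideal ?P (poly_ring n :: 'k pol ring)"
    using ring_hom_ring.ideal_vimage[OF ideal.rcos_ring_hom_ring[OF ideal_of_pm[OF J]] P.is_ideal]
    by (simp add: Sn_carrier)
  have z: "coset n J a = coset n J 0" if "a \<in> J" for a using coset_eq[OF J(1), of a 0] that by simp
  have z0: "(0 :: 'k pol) \<in> ?P" using pm_0[OF pm_of_ideal(1)[OF id]] by blast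
  show "J \<subseteq> ?P" using z z0 J(2) by auto
  show "prm n ?P" unfolding prm_def
  proof (intro conjI ballI impI)
    show "pm n ?P" by (rule pm_of_ideal(1)[OF id])
    show "1 \<notin> ?P"
    proof
      assume "1 \<in> ?P"
      then have "?P = Sn n" using pm_one[OF pm_of_ideal[OF id]] by blast
      then have "carrier (poly_ring n Quot J) \<subseteq> P" unfolding Q(1) by blast
      then show False using P.I_notcarr P.Icarr by blast
    qed
    fix a b :: "'k pol" assume ab: "a \<in> Sn n" "b \<in> Sn n" "a * b \<in> ?P"
    then have "coset n J a \<otimes>\<^bsub>poly_ring n Quot J\<^esub> coset n J b \<in> P" by (simp add: Q(2))
    then show "a \<in> ?P \<or> b \<in> ?P" using P.I_prime[of "coset n J a" "coset n J b"] ab(1,2) unfolding Q(1) by auto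
  qed auto
qed

lemma krull_ge:
  fixes J :: "'k::field pol set" and P :: "nat \<Rightarrow> 'k pol set"
  assumes J: "pm n J" "J \<subseteq> Sn n" and P: "\<And>i. i \<le> l \<Longrightarrow> prm n (P i) \<and> J \<subseteq> P i" "\<And>i. i < l \<Longrightarrow> P i \<subset> P (Suc i)"
  shows "enat l \<le> krull_dim (poly_ring n Quot J)" unfolding krull_dim_def
proof (rule Sup_upper, rule CollectI, intro exI conjI allI impI)
  show "enat l = enat l" ..
  show "primeideal (coset n J ` P i) (poly_ring n Quot J)" if "i \<le> l" for i
    using prm_image[OF J] P(1)[OF that] by blast
  show "coset n J ` P i \<subset> coset n J ` P (Suc i)" if i: "i < l" for i
  proof -
    obtain a where a: "a \<in> P (Suc i)" "a \<notin> P i" using P(2)[OF i] by blast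
    have "coset n J a \<notin> coset n J ` P i"
    proof
      assume "coset n J a \<in> coset n J ` P i"
      then obtain p where "p \<in> P i" "a - p \<in> J" using coset_eq[OF J(1)] by blast
      then show False using P(1)[of i] i a(2) pm_add[of n "P i" "a - p" p] by (auto simp: prm_def)
    qed
    then show ?thesis using P(2)[OF i] a(1) by blast
  qed
qed

lemma krull_le:
  fixes J :: "'k::field pol set"
  assumes J: "pm n J" "J \<subseteq> Sn n"
    and le: "\<And>l P. (\<And>i. i \<le> l \<Longrightarrow> prm n (P i) \<and> J \<subseteq> P i) \<Longrightarrow> (\<And>i. i < l \<Longrightarrow> P i \<subset> P (Suc i)) \<Longrightarrow> l \<le> d"
  shows "krull_dim (poly_ring n Quot J) \<le> enat d" unfolding krull_dim_def
proof (rule Sup_least, clarify)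
  fix l P assume P: "\<forall>i\<le>l. primeideal (P i) (poly_ring n Quot J)" "\<forall>i<l. P i \<subset> P (Suc i)"
  define P' where "P' i = {a\<in>Sn n. coset n J a \<in> P i}" for i
  have sub: "P i \<subseteq> coset n J ` Sn n" if "i \<le> l" for i
  proof -
    interpret primeideal "P i" "poly_ring n Quot J" using P(1) that by blast
    show ?thesis using Icarr quot_ring(1)[OF J] by blast
  qed
  have "l \<le> d"
  proof (rule le)
    show "prm n (P' i) \<and> J \<subseteq> P' i" if "i \<le> l" for i using prm_preimage[OF J] P(1) that unfolding P'_def by blast
    fix i assume i: "i < l"
    then have "P i \<subset> P (Suc i)" "P (Suc i) \<subseteq> coset n J ` Sn n" using P(2) sub[of "Suc i"] by auto
    then show "P' i \<subset> P' (Suc i)" unfolding P'_def by blast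
  qed
  then show "enat l \<le> enat d" by simp
qed

text \<open>The ideal generated by the variables outside \<open>T\<close>.\<close>

definition PT :: "nat \<Rightarrow> nat set \<Rightarrow> 'k::field pol set" where
  "PT n T = MI n {A. \<not> A \<subseteq> T}"

lemma PT_prime: "prm n (PT n T :: 'k::field pol set)" unfolding prm_def
proof (intro conjI ballI impI)
  have up: "up n {A. \<not> A \<subseteq> T}" by (auto simp: up_def)
  show pm: "pm n (PT n T :: 'k pol set)" unfolding PT_def by (rule pm_MI[OF up])
  show "(PT n T :: 'k pol set) \<subseteq> Sn n" unfolding PT_def by (rule MI_mono) simp
  show "(1 :: 'k pol) \<notin> PT n T" by (auto simp: PT_def SP_def MS_def)
  fix a b :: "'k pol" assume ab: "a \<in> Sn n" "b \<in> Sn n" "a * b \<in> PT n T"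
  \<comment> \<open>Dropping the monomials not supported in \<open>T\<close> is reduction modulo
    \<open>PT n T\<close>, and the reduced polynomials multiply in a domain.\<close>
  let ?r = "restr {m. keys m \<subseteq> T} :: 'k pol \<Rightarrow> _"
  have d: "p - ?r p \<in> PT n T" if "p \<in> Sn n" for p
    using diff_restr[of p "{m. keys m \<subseteq> T}"] that by (auto simp: PT_def SP_def MS_def)
  have rS: "?r p \<in> Sn n" if "p \<in> Sn n" for p using that by (auto simp: SP_def MS_def keys_restr)
  have "a * b - ?r a * ?r b = b * (a - ?r a) + ?r a * (b - ?r b)" by (simp add: algebra_simps)
  also have "\<dots> \<in> PT n T" by (intro pm_add[OF pm] pm_times[OF pm] d rS ab)
  finally have "?r a * ?r b \<in> PT n T" using pm_diff[OF pm ab(3), of "a * b - ?r a * ?r b"] by simp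
  moreover have "keys m \<subseteq> T" if m: "m \<in> keys (?r a * ?r b)" for m
  proof -
    obtain m1 m2 where "m = m1 + m2" "m1 \<in> keys (?r a)" "m2 \<in> keys (?r b)" using m keys_mult[of "?r a" "?r b"] by blast
    then show ?thesis by (auto simp: keys_restr keys_plus_mon)
  qed
  moreover have "\<not> keys m \<subseteq> T" if "m \<in> keys p" "p \<in> PT n T" for m p
    using that by (auto simp: PT_def SP_def MS_def)
  ultimately have "keys (?r a * ?r b) = {}" by blast
  then have "?r a = 0 \<or> ?r b = 0" by (metis keys_eq_empty mult_eq_0_iff)
  then show "a \<in> PT n T \<or> b \<in> PT n T" using d[OF ab(1)] d[OF ab(2)] by auto
qed

lemma krull_ge_card:
  fixes J :: "'k::field pol set"
  assumes J: "pm n J" "J \<subseteq> Sn n" and T: "T \<subseteq> {1..n}" "J \<subseteq> PT n T"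
  shows "enat (card T) \<le> krull_dim (poly_ring n Quot J)"
proof -
  have finT: "finite T" using T(1) finite_subset by blast
  obtain vs where vs: "set vs = T" "distinct vs" using finite_distinct_list[OF finT] by blast
  have len: "length vs = card T" using distinct_card[OF vs(2)] vs(1) by simp
  show ?thesis
  proof (rule krull_ge[OF J, where P = "\<lambda>i. PT n (set (drop i vs))"])
    fix i
    show "prm n (PT n (set (drop i vs)) :: 'k pol set) \<and> J \<subseteq> PT n (set (drop i vs))"
    proof
      have "(PT n T :: 'k pol set) \<subseteq> PT n (set (drop i vs))"
        unfolding PT_def by (rule MI_mono) (use set_drop_subset[of i vs] vs(1) in blast)
      then show "J \<subseteq> PT n (set (drop i vs))" using T(2) by blast
    qed (rule PT_prime)
    assume "i < card T"
    then have i: "i < length vs" using len by simp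
    have dr: "drop i vs = vs ! i # drop (Suc i) vs" by (rule Cons_nth_drop_Suc[OF i, symmetric])
    have ni: "vs ! i \<notin> set (drop (Suc i) vs)" using distinct_drop[OF vs(2), of i] unfolding dr by simp
    have in': "vs ! i \<in> {1..n}" using i vs(1) T(1) nth_mem by blast
    have "(PT n (set (drop i vs)) :: 'k pol set) \<subseteq> PT n (set (drop (Suc i) vs))"
      unfolding PT_def by (rule MI_mono) (auto simp: dr)
    moreover have "pmon (ev (vs ! i)) \<in> (PT n (set (drop (Suc i) vs)) :: 'k pol set)"
      "pmon (ev (vs ! i)) \<notin> (PT n (set (drop i vs)) :: 'k pol set)"
      using ni in' unfolding PT_def by (auto simp: SP_def MS_def dr)
    ultimately show "(PT n (set (drop i vs)) :: 'k pol set) \<subset> PT n (set (drop (Suc i) vs))" by blast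
  qed
qed

section \<open>Algebraic dependence by counting monomials\<close>

lemma linear_dependence:
  fixes f :: "'a \<Rightarrow> 'k::field pol"
  assumes "finite B" "finite A" "card B < card A" "\<And>a. a \<in> A \<Longrightarrow> keys (f a) \<subseteq> B"
  shows "\<exists>c. (\<exists>a\<in>A. c a \<noteq> 0) \<and> (\<Sum>a\<in>A. single 0 (c a) * f a) = 0" using assms
proof (induction B arbitrary: A f rule: finite_induct)
  case empty
  then have "f a = 0" if "a \<in> A" for a using that by auto
  moreover have "A \<noteq> {}" using empty.prems(2) by auto
  ultimately show ?case by (intro exI[of _ "\<lambda>_. 1"]) auto
next case (insert b B) have l1: "lookup (single 0 c * p) m = c * lookup p m" for c m and p :: "'k pol"
    using lookup_single_times[of 0 c p m] by simp
  show ?case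
  proof (cases "\<exists>a0\<in>A. lookup (f a0) b \<noteq> 0")
    case False
    then have "keys (f a) \<subseteq> B" if "a \<in> A" for a using insert.prems(3)[OF that] that by (auto simp: in_keys_iff)
    then show ?thesis using insert.IH[of A f] insert.prems insert.hyps by auto
  next case True
    then obtain a0 where a0: "a0 \<in> A" "lookup (f a0) b \<noteq> 0" by blast
    define r where "r a = lookup (f a) b / lookup (f a0) b" for a
    define g where "g a = f a - single 0 (r a) * f a0" for a
    have lg: "lookup (g a) m = lookup (f a) m - r a * lookup (f a0) m" for a m
      by (simp add: g_def lookup_minus l1)
    have "keys (g a) \<subseteq> B" if a: "a \<in> A - {a0}" for a
    proof
      fix m assume m: "m \<in> keys (g a)"
      then have "lookup (g a) m \<noteq> 0" by (simp add: in_keys_iff)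
      then have "m \<noteq> b" "m \<in> keys (f a) \<union> keys (f a0)" using a0(2) by (auto simp: lg r_def in_keys_iff)
      then show "m \<in> B" using insert.prems(3)[of a] insert.prems(3)[OF a0(1)] a by blast
    qed
    moreover have cA: "card B < card (A - {a0})" using insert.prems(2) insert.hyps a0(1) insert.prems(1) by (simp add: card_Diff_singleton)
    ultimately obtain c where c: "\<exists>a\<in>A - {a0}. c a \<noteq> 0" "(\<Sum>a\<in>A - {a0}. single 0 (c a) * g a) = 0"
      using insert.IH[of "A - {a0}" g, OF _ cA] insert.prems(1) by blast
    define c' where "c' a = (if a = a0 then - (\<Sum>a\<in>A - {a0}. c a * r a) else c a)" for a
    have "lookup (\<Sum>a\<in>A. single 0 (c' a) * f a) m = 0" for m
    proof -
      have "lookup (\<Sum>a\<in>A. single 0 (c' a) * f a) m = (\<Sum>a\<in>A. c' a * lookup (f a) m)" by (simp add: lookup_sum l1)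
      also have "\<dots> = c' a0 * lookup (f a0) m + (\<Sum>a\<in>A - {a0}. c' a * lookup (f a) m)"
        by (rule sum.remove[OF insert.prems(1) a0(1)])
      also have "(\<Sum>a\<in>A - {a0}. c' a * lookup (f a) m) = (\<Sum>a\<in>A - {a0}. c a * lookup (f a) m)"
        by (rule sum.cong) (auto simp: c'_def)
      also have "c' a0 * lookup (f a0) m = - (\<Sum>a\<in>A - {a0}. c a * (r a * lookup (f a0) m))"
        by (simp add: c'_def sum_distrib_right mult.assoc)
      also have "\<dots> + (\<Sum>a\<in>A - {a0}. c a * lookup (f a) m) = (\<Sum>a\<in>A - {a0}. c a * lookup (g a) m)"
        by (simp add: lg right_diff_distrib sum_subtractf)
      also have "\<dots> = lookup (\<Sum>a\<in>A - {a0}. single 0 (c a) * g a) m" by (simp add: lookup_sum l1)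
      finally show ?thesis unfolding c(2) by simp
    qed
    then have "(\<Sum>a\<in>A. single 0 (c' a) * f a) = 0" by (intro poly_mapping_eqI) simp
    moreover have "\<exists>a\<in>A. c' a \<noteq> 0" using c(1) by (auto simp: c'_def)
    ultimately show ?thesis by blast
  qed
qed

definition mpow :: "'k::field pol list \<Rightarrow> nat list \<Rightarrow> 'k pol" where
  "mpow fs \<alpha> = prod_list (map2 (^) fs \<alpha>)"

lemma mpow_Cons: "mpow (f # fs) (a # \<alpha>) = f ^ a * mpow fs \<alpha>" by (simp add: mpow_def)

lemma pow_keys:
  fixes f :: "'k::field pol"
  assumes "\<And>m. m \<in> keys f \<Longrightarrow> keys m \<subseteq> T \<and> (\<forall>i. lookup m i \<le> D)"
  shows "m \<in> keys (f ^ a) \<Longrightarrow> keys m \<subseteq> T \<and> (\<forall>i. lookup m i \<le> D * a)"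
proof (induction a arbitrary: m)
  case (Suc a)
  then obtain x y where xy: "m = x + y" "x \<in> keys f" "y \<in> keys (f ^ a)" using keys_mult[of f "f ^ a"] by auto
  have "lookup x i + lookup y i \<le> D + D * a" for i
    using assms[OF xy(2)] Suc.IH[OF xy(3)] by (intro add_mono) auto
  then show ?case using assms[OF xy(2)] Suc.IH[OF xy(3)] by (auto simp: xy(1) keys_plus_mon lookup_add)
qed auto

lemma mpow_keys:
  fixes fs :: "'k::field pol list"
  assumes "\<And>f m. f \<in> set fs \<Longrightarrow> m \<in> keys f \<Longrightarrow> keys m \<subseteq> T \<and> (\<forall>i. lookup m i \<le> D)"
    and "length \<alpha> = length fs" "\<And>a. a \<in> set \<alpha> \<Longrightarrow> a \<le> N"
  shows "m \<in> keys (mpow fs \<alpha>) \<Longrightarrow> keys m \<subseteq> T \<and> (\<forall>i. lookup m i \<le> D * N * length fs)" using assms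
proof (induction fs arbitrary: \<alpha> m)
  case Nil then show ?case by (simp add: mpow_def)
next case (Cons f fs)
  obtain a \<beta> where \<alpha>: "\<alpha> = a # \<beta>" using Cons.prems(3) by (cases \<alpha>) auto
  obtain x y where xy: "m = x + y" "x \<in> keys (f ^ a)" "y \<in> keys (mpow fs \<beta>)"
    using Cons.prems(1) keys_mult[of "f ^ a" "mpow fs \<beta>"] unfolding \<alpha> mpow_Cons by auto
  have 1: "keys x \<subseteq> T \<and> (\<forall>i. lookup x i \<le> D * a)" by (rule pow_keys[OF _ xy(2)]) (use Cons.prems(2) in auto)
  have 2: "keys y \<subseteq> T \<and> (\<forall>i. lookup y i \<le> D * N * length fs)"
    by (rule Cons.IH[OF xy(3)]) (use Cons.prems in \<open>auto simp: \<alpha>\<close>)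
  have "a \<le> N" using Cons.prems(4) \<alpha> by simp
  then have "D * a \<le> D * N" by simp
  then have "lookup x i + lookup y i \<le> D * N + D * N * length fs" for i
    using 1 2 by (meson add_mono order_trans)
  then show ?case using 1 2 by (auto simp: xy(1) keys_plus_mon lookup_add)
qed

text \<open>Products with exponents below \<open>N\<close> are counted by the power
  \<open>Suc (card T)\<close> of \<open>N\<close>, the monomials occurring in them by a constant
  times the power \<open>card T\<close>. For large \<open>N\<close> there must be a linear
  relation.\<close>

lemma algebraic_dependence:
  fixes fs :: "'k::field pol list"
  assumes T: "finite T" "\<And>f m. f \<in> set fs \<Longrightarrow> m \<in> keys f \<Longrightarrow> keys m \<subseteq> T" and len: "length fs = Suc (card T)"
  shows "\<exists>C c. finite C \<and> C \<noteq> {} \<and> (\<forall>\<alpha>\<in>C. length \<alpha> = length fs \<and> c \<alpha> \<noteq> 0) \<and> (\<Sum>\<alpha>\<in>C. single 0 (c \<alpha>) * mpow fs \<alpha>) = 0"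
proof -
  define E where "E = (\<lambda>(m, i). lookup m i) ` (\<Union>f\<in>set fs. (\<Union>m\<in>keys f. {m} \<times> keys m))"
  have finE: "finite (insert 0 E)" unfolding E_def by auto
  define D where "D = Max (insert 0 E)"
  have D: "lookup m i \<le> D" if "f \<in> set fs" "m \<in> keys f" for f m i
  proof (cases "i \<in> keys m")
    case True
    then have "lookup m i \<in> insert 0 E" unfolding E_def using that by force
    then show ?thesis unfolding D_def using Max_ge[OF finE] by blast
  qed (simp add: in_keys_iff)
  \<comment> \<open>\<open>M\<close> satisfies \<open>D * N * length fs + 1 \<le> M * N\<close>,
    which bounds the number of monomials by \<open>M ^ card T * N ^ card T\<close>; \<open>N\<close>
    is taken just above \<open>M ^ card T\<close>.\<close>
  define M where "M = D * Suc (card T) + 1"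
  define N where "N = M ^ card T + 1"
  let ?A = "{\<alpha>. set \<alpha> \<subseteq> {..<N} \<and> length \<alpha> = length fs}"
  let ?B = "{m :: mon. keys m \<subseteq> T \<and> (\<forall>i. lookup m i \<le> D * N * length fs)}"
  have A: "finite ?A" "card ?A = N ^ Suc (card T)"
    using finite_lists_length_eq[of "{..<N}"] card_lists_length_eq[of "{..<N}"] len by auto
  have "card ?B \<le> (D * N * length fs + 1) ^ card T" by (rule card_bounded_mons(2)[OF T(1)])
  also have "\<dots> \<le> (M * N) ^ card T"
  proof (rule power_mono)
    have "1 \<le> N" by (simp add: N_def)
    then show "D * N * length fs + 1 \<le> M * N" by (simp add: M_def len algebra_simps)
  qed simp
  also have "\<dots> = M ^ card T * N ^ card T" by (rule power_mult_distrib)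
  also have "\<dots> < N * N ^ card T" by (rule mult_strict_right_mono) (auto simp: N_def)
  finally have card: "card ?B < card ?A" by (simp add: A(2))
  have "\<exists>c. (\<exists>\<alpha>\<in>?A. c \<alpha> \<noteq> 0) \<and> (\<Sum>\<alpha>\<in>?A. single 0 (c \<alpha>) * mpow fs \<alpha>) = 0"
  proof (rule linear_dependence[OF card_bounded_mons(1)[OF T(1)] A(1) card])
    fix \<alpha> assume "\<alpha> \<in> ?A"
    then show "keys (mpow fs \<alpha>) \<subseteq> ?B"
      using mpow_keys[of fs T D \<alpha> N] T(2) D by (auto simp: subset_iff less_imp_le)
  qed
  then obtain c where c: "\<exists>\<alpha>\<in>?A. c \<alpha> \<noteq> 0" "(\<Sum>\<alpha>\<in>?A. single 0 (c \<alpha>) * mpow fs \<alpha>) = 0" by blast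
  let ?C = "{\<alpha>\<in>?A. c \<alpha> \<noteq> 0}"
  have "(\<Sum>\<alpha>\<in>?C. single 0 (c \<alpha>) * mpow fs \<alpha>) = (\<Sum>\<alpha>\<in>?A. single 0 (c \<alpha>) * mpow fs \<alpha>)"
    by (rule sum.mono_neutral_left) (use A(1) in auto)
  then have "finite ?C \<and> ?C \<noteq> {} \<and> (\<forall>\<alpha>\<in>?C. length \<alpha> = length fs \<and> c \<alpha> \<noteq> 0) \<and> (\<Sum>\<alpha>\<in>?C. single 0 (c \<alpha>) * mpow fs \<alpha>) = 0"
    using c finite_subset[OF _ A(1), of ?C] by auto
  then show ?thesis by blast
qed

lemma pow_Sn: "f \<in> Sn n \<Longrightarrow> f ^ a \<in> (Sn n :: 'k::field pol set)" by (induction a) (simp_all add: Sn_times one_Sn)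

lemma mpow_Sn: "set fs \<subseteq> Sn n \<Longrightarrow> mpow fs \<alpha> \<in> (Sn n :: 'k::field pol set)"
proof (induction fs arbitrary: \<alpha>)
  case (Cons f fs) show ?case
  proof (cases \<alpha>)
    case (Cons a \<beta>)
    show ?thesis unfolding Cons mpow_Cons by (rule Sn_times[OF pow_Sn]) (use Cons.prems Cons.IH in auto)
  qed (auto simp: mpow_def intro: one_Sn)
qed (auto simp: mpow_def intro: one_Sn)

lemma const_Sn: "single 0 c \<in> (Sn n :: 'k::field pol set)" by (auto simp: SP_def MS_def)

text \<open>Divide a relation by the least power of \<open>f\<^sub>0\<close> occurring in it: modulo \<open>P\<^sub>1\<close> it becomes a
  relation between the remaining elements.\<close>

lemma prime_chain_independent:
  fixes P :: "nat \<Rightarrow> 'k::field pol set"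
  assumes "\<And>i. i \<le> length fs \<Longrightarrow> prm n (P i)" "\<And>i. i < length fs \<Longrightarrow> P i \<subseteq> P (Suc i) \<and> fs ! i \<in> P (Suc i) \<and> fs ! i \<notin> P i"
    "finite C" "C \<noteq> {}" "\<And>\<alpha>. \<alpha> \<in> C \<Longrightarrow> length \<alpha> = length fs \<and> c \<alpha> \<noteq> 0"
  shows "(\<Sum>\<alpha>\<in>C. single 0 (c \<alpha>) * mpow fs \<alpha>) \<notin> P 0" using assms
proof (induction fs arbitrary: P C c)
  case Nil have p: "prm n (P 0)" using Nil.prems(1) by simp
  have C: "C = {[]}" using Nil.prems(4,5) by auto
  show ?case
  proof
    assume "(\<Sum>\<alpha>\<in>C. single 0 (c \<alpha>) * mpow [] \<alpha>) \<in> P 0"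
    then have "single 0 (c []) \<in> P 0" by (simp add: C mpow_def)
    then have "single 0 (inverse (c [])) * single 0 (c []) \<in> P 0" by (rule pm_times[OF prm_pm[OF p] const_Sn])
    moreover have "c [] \<noteq> 0" using Nil.prems(5) C by auto
    ultimately show False using prm_1[OF p] by (simp add: mult_single single_one)
  qed
next case (Cons f gs)
  have p0: "prm n (P 0)" and p1: "prm n (P 1)" using Cons.prems(1)[of 0] Cons.prems(1)[of 1] by auto
  have f: "P 0 \<subseteq> P 1" "f \<in> P 1" "f \<notin> P 0" using Cons.prems(2)[of 0] by (auto simp: One_nat_def)
  have gs: "set gs \<subseteq> Sn n"
  proof
    fix g assume "g \<in> set gs"
    then obtain i where i: "i < length gs" "gs ! i = g" by (auto simp: in_set_conv_nth)
    then have "g \<in> P (Suc (Suc i))" "prm n (P (Suc (Suc i)))" using Cons.prems(2)[of "Suc i"] Cons.prems(1)[of "Suc (Suc i)"] by auto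
    then show "g \<in> Sn n" using prm_sub by blast
  qed
  define a where "a = Min (hd ` C)"
  have a: "a \<in> hd ` C" "\<And>\<alpha>. \<alpha> \<in> C \<Longrightarrow> a \<le> hd \<alpha>" unfolding a_def using Cons.prems(3,4) by auto
  have len: "length \<alpha> = Suc (length gs)" if "\<alpha> \<in> C" for \<alpha> using Cons.prems(5)[OF that] by simp
  have dec: "\<alpha> = hd \<alpha> # tl \<alpha>" if "\<alpha> \<in> C" for \<alpha> using len[OF that] by (cases \<alpha>) auto
  let ?t = "\<lambda>\<alpha>. single 0 (c \<alpha>) * (f ^ (hd \<alpha> - a) * mpow gs (tl \<alpha>))"
  have fS: "f \<in> Sn n" using f(2) prm_sub[OF p1] by blast
  have tS: "?t \<alpha> \<in> Sn n" for \<alpha> by (intro Sn_times const_Sn pow_Sn mpow_Sn gs fS)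
  have "(\<Sum>\<alpha>\<in>C. single 0 (c \<alpha>) * mpow (f # gs) \<alpha>) = (\<Sum>\<alpha>\<in>C. f ^ a * ?t \<alpha>)"
  proof (rule sum.cong[OF refl])
    fix \<alpha> assume al: "\<alpha> \<in> C"
    have "mpow (f # gs) \<alpha> = f ^ hd \<alpha> * mpow gs (tl \<alpha>)" by (subst dec[OF al]) (rule mpow_Cons)
    also have "f ^ hd \<alpha> = f ^ a * f ^ (hd \<alpha> - a)" using a(2)[OF al] by (simp flip: power_add)
    finally show "single 0 (c \<alpha>) * mpow (f # gs) \<alpha> = f ^ a * ?t \<alpha>" by (simp add: ac_simps)
  qed
  then have eq: "(\<Sum>\<alpha>\<in>C. single 0 (c \<alpha>) * mpow (f # gs) \<alpha>) = f ^ a * (\<Sum>\<alpha>\<in>C. ?t \<alpha>)"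
    by (simp add: sum_distrib_left)
  have fa: "f ^ b \<notin> P 0" for b
  proof (induction b)
    case 0 then show ?case using prm_1[OF p0] by simp
  next case (Suc b) then show ?case using prm_prime[OF p0 fS pow_Sn[OF fS]] f(3) by auto
  qed
  have sS: "(\<Sum>\<alpha>\<in>C. ?t \<alpha>) \<in> Sn n" by (rule pm_sum[OF pm_Sn tS])
  show ?case
  proof
    assume "(\<Sum>\<alpha>\<in>C. single 0 (c \<alpha>) * mpow (f # gs) \<alpha>) \<in> P 0"
    then have "(\<Sum>\<alpha>\<in>C. ?t \<alpha>) \<in> P 1" unfolding eq using prm_prime[OF p0 pow_Sn[OF fS] sS] fa f(1) by blast
    moreover let ?C = "{\<alpha>\<in>C. hd \<alpha> = a}"
    have "(\<Sum>\<alpha>\<in>C. ?t \<alpha>) = (\<Sum>\<alpha>\<in>?C. ?t \<alpha>) + (\<Sum>\<alpha>\<in>C - ?C. ?t \<alpha>)"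
      using sum.subset_diff[of ?C C ?t] Cons.prems(3) by (simp add: add.commute)
    moreover have "(\<Sum>\<alpha>\<in>C - ?C. ?t \<alpha>) \<in> P 1"
    proof (rule pm_sum[OF prm_pm[OF p1]])
      fix \<alpha> assume "\<alpha> \<in> C - ?C"
      then have "hd \<alpha> - a = Suc (hd \<alpha> - a - 1)" using a(2)[of \<alpha>] by fastforce
      then have "?t \<alpha> = single 0 (c \<alpha>) * (f ^ (hd \<alpha> - a - 1) * mpow gs (tl \<alpha>)) * f"
        by (metis (no_types, lifting) mult.assoc mult.commute power_Suc)
      moreover have "single 0 (c \<alpha>) * (f ^ (hd \<alpha> - a - 1) * mpow gs (tl \<alpha>)) * f \<in> P 1"
        by (intro pm_times[OF prm_pm[OF p1] _ f(2)] Sn_times const_Sn pow_Sn mpow_Sn gs fS)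
      ultimately show "?t \<alpha> \<in> P 1" by (rule ssubst)
    qed
    ultimately have "(\<Sum>\<alpha>\<in>?C. ?t \<alpha>) \<in> P 1" using pm_diff[OF prm_pm[OF p1]] by (metis (no_types, lifting) add_diff_cancel_right')
    moreover have "(\<Sum>\<alpha>\<in>?C. ?t \<alpha>) = (\<Sum>\<beta>\<in>tl ` ?C. single 0 (c (a # \<beta>)) * mpow gs \<beta>)"
    proof (subst sum.reindex)
      show "inj_on tl ?C" using dec by (intro inj_onI) (metis (mono_tags, lifting) mem_Collect_eq)
      show "(\<Sum>\<alpha>\<in>?C. ?t \<alpha>) = sum ((\<lambda>\<beta>. single 0 (c (a # \<beta>)) * mpow gs \<beta>) \<circ> tl) ?C"
      proof (rule sum.cong[OF refl])
        fix \<alpha> assume "\<alpha> \<in> ?C"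
        then have "a # tl \<alpha> = \<alpha>" "hd \<alpha> = a" using dec[of \<alpha>] by auto
        then show "?t \<alpha> = ((\<lambda>\<beta>. single 0 (c (a # \<beta>)) * mpow gs \<beta>) \<circ> tl) \<alpha>" by simp
      qed
    qed
    moreover have "(\<Sum>\<beta>\<in>tl ` ?C. single 0 (c (a # \<beta>)) * mpow gs \<beta>) \<notin> P (Suc 0)"
    proof (rule Cons.IH[where P = "\<lambda>i. P (Suc i)"])
      show "prm n (P (Suc i))" if "i \<le> length gs" for i using Cons.prems(1)[of "Suc i"] that by simp
      show "P (Suc i) \<subseteq> P (Suc (Suc i)) \<and> gs ! i \<in> P (Suc (Suc i)) \<and> gs ! i \<notin> P (Suc i)" if "i < length gs" for i
        using Cons.prems(2)[of "Suc i"] that by simp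
      show "finite (tl ` ?C)" using Cons.prems(3) by simp
      show "tl ` ?C \<noteq> {}" using a(1) by auto
      show "length \<beta> = length gs \<and> c (a # \<beta>) \<noteq> 0" if be: "\<beta> \<in> tl ` ?C" for \<beta>
      proof -
        obtain \<alpha> where al: "\<alpha> \<in> C" "hd \<alpha> = a" "\<beta> = tl \<alpha>" using be by auto
        then show ?thesis using dec[OF al(1)] Cons.prems(5)[OF al(1)] by (metis length_Cons nat.inject)
      qed
    qed
    ultimately show False by (simp add: One_nat_def)
  qed
qed

text \<open>An element entering at each step may be taken, modulo \<open>PT n T\<close>, in the
  variables of \<open>T\<close>. More than \<open>card T\<close> of them satisfy a polynomial
  relation, whereas the chain of primes makes them independent.\<close>

lemma prime_chain_length:
  fixes P :: "nat \<Rightarrow> 'k::field pol set"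
  assumes P: "\<And>i. i \<le> l \<Longrightarrow> prm n (P i)" "\<And>i. i < l \<Longrightarrow> P i \<subset> P (Suc i)" and T: "finite T" "PT n T \<subseteq> P 0"
  shows "l \<le> card T"
proof (rule ccontr)
  assume "\<not> l \<le> card T"
  then have l: "card T < l" by simp
  have mono: "P 0 \<subseteq> P i" if "i \<le> l" for i using that
  proof (induction i)
    case (Suc i) then show ?case using P(2)[of i] by auto
  qed simp
  have "\<exists>g. i < l \<longrightarrow> g \<in> P (Suc i) \<and> g \<notin> P i \<and> (\<forall>m\<in>keys g. keys m \<subseteq> T)" for i
  proof (cases "i < l")
    case True
    then obtain f where f: "f \<in> P (Suc i)" "f \<notin> P i" using P(2) by blast
    let ?g = "restr {m. keys m \<subseteq> T} f"
    have "f \<in> Sn n" using f(1) prm_sub[OF P(1)[of "Suc i"]] True by auto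
    then have "f - ?g \<in> PT n T" using diff_restr[of f "{m. keys m \<subseteq> T}"] by (auto simp: PT_def SP_def MS_def)
    then have d: "f - ?g \<in> P i" "f - ?g \<in> P (Suc i)" using T(2) mono[of i] mono[of "Suc i"] True by auto
    have "?g \<in> P (Suc i)" using pm_diff[OF prm_pm f(1) d(2)] P(1)[of "Suc i"] True by simp
    moreover have "?g \<notin> P i" using pm_add[OF prm_pm d(1), of n ?g] P(1)[of i] True f(2) by auto
    moreover have "\<forall>m\<in>keys ?g. keys m \<subseteq> T" by (auto simp: keys_restr)
    ultimately show ?thesis by blast
  qed auto
  then obtain g where g: "\<And>i. i < l \<Longrightarrow> g i \<in> P (Suc i) \<and> g i \<notin> P i \<and> (\<forall>m\<in>keys (g i). keys m \<subseteq> T)" by metis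
  define fs where "fs = map g [0..<Suc (card T)]"
  have nth: "fs ! i = g i" if "i < Suc (card T)" for i unfolding fs_def using that nth_map_upt[of i "Suc (card T)" 0 g] by simp
  have lf: "length fs = Suc (card T)" by (simp add: fs_def)
  have fsT: "keys m \<subseteq> T" if f: "f \<in> set fs" "m \<in> keys f" for f m
  proof -
    obtain i where "i < Suc (card T)" "f = g i" using f(1) unfolding fs_def by (auto simp del: upt_Suc)
    then show ?thesis using g[of i] f(2) l by auto
  qed
  have "\<exists>C c. finite C \<and> C \<noteq> {} \<and> (\<forall>\<alpha>\<in>C. length \<alpha> = length fs \<and> c \<alpha> \<noteq> 0) \<and>
      (\<Sum>\<alpha>\<in>C. single 0 (c \<alpha>) * mpow fs \<alpha>) = 0" by (rule algebraic_dependence[OF T(1) _ lf]) (rule fsT)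
  then obtain C c where C: "finite C" "C \<noteq> {}" "\<forall>\<alpha>\<in>C. length \<alpha> = length fs \<and> c \<alpha> \<noteq> 0"
    "(\<Sum>\<alpha>\<in>C. single 0 (c \<alpha>) * mpow fs \<alpha>) = 0" by blast
  have "(\<Sum>\<alpha>\<in>C. single 0 (c \<alpha>) * mpow fs \<alpha>) \<notin> P 0"
  proof (rule prime_chain_independent[where n = n])
    show "prm n (P i)" if "i \<le> length fs" for i using P(1)[of i] that l by (simp add: lf)
    show "P i \<subseteq> P (Suc i) \<and> fs ! i \<in> P (Suc i) \<and> fs ! i \<notin> P i" if "i < length fs" for i
      using g[of i] P(2)[of i] nth[of i] that l by (auto simp: lf)
  qed (use C in auto)
  then show False unfolding C(4) using pm_0[OF prm_pm[OF P(1)[of 0]]] by simp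
qed

text \<open>A prime above \<open>J\<close> contains all variables outside some \<open>T\<close> of
  the family: otherwise a choice of one missing variable for each \<open>T\<close> yields a product
  that lies in \<open>J\<close> but not in the prime.\<close>

lemma krull_le_card:
  fixes J :: "'k::field pol set"
  assumes J: "pm n J" "J \<subseteq> Sn n" and F: "finite \<F>" "\<And>T. T \<in> \<F> \<Longrightarrow> T \<subseteq> {1..n} \<and> card T \<le> d"
    and sub: "MI n {A. \<forall>T\<in>\<F>. \<not> A \<subseteq> T} \<subseteq> J"
  shows "krull_dim (poly_ring n Quot J) \<le> enat d"
proof (rule krull_le[OF J])
  fix l and P :: "nat \<Rightarrow> 'k pol set"
  assume P: "\<And>i. i \<le> l \<Longrightarrow> prm n (P i) \<and> J \<subseteq> P i" "\<And>i. i < l \<Longrightarrow> P i \<subset> P (Suc i)"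
  have p: "prm n (P 0)" "J \<subseteq> P 0" using P(1)[of 0] by auto
  have "\<exists>T\<in>\<F>. \<forall>v\<in>{1..n} - T. pmon (ev v) \<in> P 0"
  proof (rule ccontr)
    assume "\<not> ?thesis"
    then obtain h where h: "\<And>T. T \<in> \<F> \<Longrightarrow> h T \<in> {1..n} - T \<and> pmon (ev (h T)) \<notin> P 0" by metis
    have *: "pmon (\<Sum>T\<in>\<G>. ev (h T)) \<in> Sn n - P 0 \<and> (\<forall>T\<in>\<G>. h T \<in> keys (\<Sum>T\<in>\<G>. ev (h T)))"
      if "finite \<G>" "\<G> \<subseteq> \<F>" for \<G> using that
    proof (induction \<G> rule: finite_induct)
      case empty have "pmon 0 = (1 :: 'k pol)" by (simp add: pmon_def single_one)
      then show ?case using prm_1[OF p(1)] one_Sn[of n] by simp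
    next case (insert T \<G>)
      have e: "pmon (\<Sum>T\<in>insert T \<G>. ev (h T)) = (pmon (ev (h T)) * pmon (\<Sum>T\<in>\<G>. ev (h T)) :: 'k pol)"
        using insert.hyps by (simp add: pmon_times)
      have S: "pmon (ev (h T)) \<in> (Sn n :: 'k pol set)" using h[of T] insert.prems by (auto simp: SP_def MS_def)
      have I: "pmon (\<Sum>T\<in>\<G>. ev (h T)) \<in> (Sn n - P 0 :: 'k pol set)" "\<forall>T\<in>\<G>. h T \<in> keys (\<Sum>T\<in>\<G>. ev (h T))"
        using insert by auto
      have "pmon (ev (h T)) * pmon (\<Sum>T\<in>\<G>. ev (h T)) \<in> (Sn n - P 0 :: 'k pol set)"
        using prm_prime[OF p(1) S] Sn_times[OF S] I(1) h[of T] insert.prems by blast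
      moreover have "h T' \<in> keys (\<Sum>T\<in>insert T \<G>. ev (h T))" if "T' \<in> insert T \<G>" for T'
        using that I(2) insert.hyps by (auto simp: keys_ev_add)
      ultimately show ?case unfolding e by blast
    qed
    let ?m = "\<Sum>T\<in>\<F>. ev (h T)"
    have m: "pmon ?m \<in> (Sn n - P 0 :: 'k pol set)" "\<forall>T\<in>\<F>. h T \<in> keys ?m" using *[OF F(1)] by auto
    then have "pmon ?m \<in> (MI n {A. \<forall>T\<in>\<F>. \<not> A \<subseteq> T} :: 'k pol set)" using h by (fastforce simp: SP_def MS_def)
    then show False using m(1) sub p(2) by blast
  qed
  then obtain T where T: "T \<in> \<F>" "\<And>v. v \<in> {1..n} - T \<Longrightarrow> pmon (ev v) \<in> P 0" by blast
  have "PT n T \<subseteq> P 0"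
  proof
    fix p' assume p': "p' \<in> (PT n T :: 'k pol set)"
    have "single m (lookup p' m) \<in> P 0" if m: "m \<in> keys p'" for m
    proof -
      obtain v where v: "v \<in> keys m" "v \<notin> T" "keys m \<subseteq> {1..n}" using subsetD[OF p'[unfolded PT_def SP_def mem_Collect_eq] m] by (auto simp: MS_def)
      obtain m' where m': "m = ev v + m'" using ev_divides[OF v(1)] by blast
      have "single m' (lookup p' m) * pmon (ev v) \<in> P 0"
        by (rule pm_times[OF prm_pm[OF p(1)] _ T(2)]) (use v m' in \<open>auto simp: SP_def MS_def keys_plus_mon\<close>)
      then show ?thesis by (simp add: pmon_def mult_single m' add.commute)
    qed
    then show "p' \<in> P 0" by (rule pm_poly[OF prm_pm[OF p(1)]])
  qed
  moreover have "finite T" "card T \<le> d" using F(2)[OF T(1)] finite_subset by auto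
  ultimately show "l \<le> d" using prime_chain_length[of l n P T] P by force
qed

section \<open>Subquotients of the polynomial ring\<close>

lemma mod_quot_props:
  assumes M: "Module.module R M" and B: "submodule B R M"
  shows "carrier (mod_quot M B) = (\<lambda>x. B +>\<^bsub>M\<^esub> x) ` carrier M"
    "\<And>x y. x \<in> carrier M \<Longrightarrow> y \<in> carrier M \<Longrightarrow> B +>\<^bsub>M\<^esub> (x \<oplus>\<^bsub>M\<^esub> y) = (B +>\<^bsub>M\<^esub> x) \<oplus>\<^bsub>mod_quot M B\<^esub> (B +>\<^bsub>M\<^esub> y)"
    "\<And>r x. r \<in> carrier R \<Longrightarrow> x \<in> carrier M \<Longrightarrow> B +>\<^bsub>M\<^esub> (r \<odot>\<^bsub>M\<^esub> x) = r \<odot>\<^bsub>mod_quot M B\<^esub> (B +>\<^bsub>M\<^esub> x)"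
    "\<And>x. x \<in> carrier M \<Longrightarrow> B +>\<^bsub>M\<^esub> x = \<zero>\<^bsub>mod_quot M B\<^esub> \<longleftrightarrow> x \<in> B"
proof -
  interpret M: Module.module R M by fact
  interpret B: submodule B R M by fact
  interpret B': abelian_subgroup B M
    by (rule abelian_subgroupI3) (auto simp: additive_subgroup_def B.subgroup_axioms Module.module.axioms(2)[OF M])
  show "carrier (mod_quot M B) = (\<lambda>x. B +>\<^bsub>M\<^esub> x) ` carrier M" by (auto simp: mod_quot_def A_RCOSETS_def')
  show "B +>\<^bsub>M\<^esub> (x \<oplus>\<^bsub>M\<^esub> y) = (B +>\<^bsub>M\<^esub> x) \<oplus>\<^bsub>mod_quot M B\<^esub> (B +>\<^bsub>M\<^esub> y)"
    if "x \<in> carrier M" "y \<in> carrier M" for x y using B'.a_rcos_sum[OF that] by (simp add: mod_quot_def)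
  show "B +>\<^bsub>M\<^esub> x = \<zero>\<^bsub>mod_quot M B\<^esub> \<longleftrightarrow> x \<in> B" if "x \<in> carrier M" for x
    using B'.a_rcos_self[OF that] B'.a_rcos_const[of x] by (auto simp: mod_quot_def)
  show "B +>\<^bsub>M\<^esub> (r \<odot>\<^bsub>M\<^esub> x) = r \<odot>\<^bsub>mod_quot M B\<^esub> (B +>\<^bsub>M\<^esub> x)" if rx: "r \<in> carrier R" "x \<in> carrier M" for r x
  proof -
    have "B +>\<^bsub>M\<^esub> (r \<odot>\<^bsub>M\<^esub> y) = B +>\<^bsub>M\<^esub> (r \<odot>\<^bsub>M\<^esub> x)" if y: "y \<in> B +>\<^bsub>M\<^esub> x" for y
    proof -
      obtain b where b: "b \<in> B" "y = b \<oplus>\<^bsub>M\<^esub> x" using y by (auto simp: a_r_coset_def')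
      then have "r \<odot>\<^bsub>M\<^esub> y = r \<odot>\<^bsub>M\<^esub> b \<oplus>\<^bsub>M\<^esub> r \<odot>\<^bsub>M\<^esub> x" using rx by (auto simp: M.smult_r_distr)
      then have "r \<odot>\<^bsub>M\<^esub> y \<in> B +>\<^bsub>M\<^esub> (r \<odot>\<^bsub>M\<^esub> x)" using B.smult_closed[OF rx(1) b(1)] by (auto simp: a_r_coset_def')
      then show ?thesis using M.M.a_repr_independence[OF _ _ B.subgroup_axioms] M.smult_closed[OF rx] by simp
    qed
    then have "(\<Union>y\<in>B +>\<^bsub>M\<^esub> x. B +>\<^bsub>M\<^esub> (r \<odot>\<^bsub>M\<^esub> y)) = B +>\<^bsub>M\<^esub> (r \<odot>\<^bsub>M\<^esub> x)"
      using B'.a_rcos_self[OF rx(2)] by (intro equalityI UN_least) blast+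
    then show ?thesis by (simp add: mod_quot_def)
  qed
qed

text \<open>\<open>Q\<close> is presented, via \<open>h\<close>, as the quotient \<open>N / K\<close> of two submodules of \<open>S\<close>.\<close>

locale pres =
  fixes n :: nat and Q :: "('k::field pol, 'b) module" and N K :: "'k pol set" and h :: "'k pol \<Rightarrow> 'b"
  assumes modQ: "Module.module (poly_ring n) Q" and N: "pm n N" and K: "pm n K" and NS: "N \<subseteq> Sn n" and KN: "K \<subseteq> N"
    and h_carrier: "carrier Q = h ` N"
    and h_add: "\<And>x y. x \<in> N \<Longrightarrow> y \<in> N \<Longrightarrow> h (x + y) = h x \<oplus>\<^bsub>Q\<^esub> h y"
    and h_smult: "\<And>r y. r \<in> Sn n \<Longrightarrow> y \<in> N \<Longrightarrow> h (r * y) = r \<odot>\<^bsub>Q\<^esub> h y"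
    and h_zero: "\<And>x. x \<in> N \<Longrightarrow> h x = \<zero>\<^bsub>Q\<^esub> \<longleftrightarrow> x \<in> K"
begin

sublocale Q: Module.module "poly_ring n" Q by (rule modQ)

lemma h_mem: "x \<in> N \<Longrightarrow> h x \<in> carrier Q" by (simp add: h_carrier)

lemma h_uminus: "x \<in> N \<Longrightarrow> h (- x) = \<ominus>\<^bsub>Q\<^esub> h x"
proof -
  assume x: "x \<in> N"
  have "h (- x) \<oplus>\<^bsub>Q\<^esub> h x = h 0" using h_add[OF pm_uminus[OF N x] x] by simp
  also have "\<dots> = \<zero>\<^bsub>Q\<^esub>" using h_zero[OF pm_0[OF N]] pm_0[OF K] by simp
  finally show ?thesis using Q.M.minus_equality[of "h (- x)" "h x"] h_mem x pm_uminus[OF N x] by simp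
qed

lemma h_eq:
  assumes x: "x \<in> N" and y: "y \<in> N" shows "h x = h y \<longleftrightarrow> x - y \<in> K"
proof -
  have "h (x - y) = h x \<ominus>\<^bsub>Q\<^esub> h y" using h_add[OF x pm_uminus[OF N y]] h_uminus[OF y] by (simp add: a_minus_def)
  moreover have "h x \<ominus>\<^bsub>Q\<^esub> h y = \<zero>\<^bsub>Q\<^esub> \<longleftrightarrow> h x = h y"
    using Q.M.r_neg[OF h_mem[OF y]] Q.M.add.inv_closed[OF h_mem[OF y]] h_mem[OF x] h_mem[OF y]
      Q.M.minus_equality[of "h x" "\<ominus>\<^bsub>Q\<^esub> h y"] Q.M.minus_minus[OF h_mem[OF y]] by (auto simp: a_minus_def)
  ultimately show ?thesis using h_zero[OF pm_diff[OF N x y]] by simp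
qed

lemma submodule_image:
  assumes L: "pm n L" "L \<subseteq> N" shows "submodule (h ` L) (poly_ring n) Q"
proof (rule Q.submoduleI)
  show "h ` L \<subseteq> carrier Q" using L(2) by (auto simp: h_carrier)
  show "\<zero>\<^bsub>Q\<^esub> \<in> h ` L" using h_zero[OF pm_0[OF N]] pm_0[OF K] imageI[OF pm_0[OF L(1)], of h] by simp
  show "\<ominus>\<^bsub>Q\<^esub> a \<in> h ` L" if a: "a \<in> h ` L" for a
  proof -
    obtain x where x: "a = h x" "x \<in> L" using a by blast
    then show ?thesis using h_uminus[of x] imageI[OF pm_uminus[OF L(1) x(2)], of h] L(2) by (simp add: subset_iff)
  qed
  show "a \<oplus>\<^bsub>Q\<^esub> b \<in> h ` L" if "a \<in> h ` L" "b \<in> h ` L" for a b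
  proof -
    obtain x y where "a = h x" "b = h y" "x \<in> L" "y \<in> L" using \<open>a \<in> h ` L\<close> \<open>b \<in> h ` L\<close> by blast
    then show ?thesis using h_add[of x y] imageI[OF pm_add[OF L(1), of x y], of h] L(2) by (simp add: subset_iff)
  qed
  show "a \<odot>\<^bsub>Q\<^esub> x \<in> h ` L" if "a \<in> carrier (poly_ring n)" "x \<in> h ` L" for a x
  proof -
    obtain y where "x = h y" "y \<in> L" using \<open>x \<in> h ` L\<close> by blast
    then show ?thesis using h_smult[of a y] imageI[OF pm_times[OF L(1), of a y], of h] L(2) that(1)
      by (simp add: Sn_carrier subset_iff)
  qed
qed

text \<open>Trades submodules of \<open>Q\<close> for submodules of the polynomial ring between
  \<open>K\<close> and \<open>N\<close>.\<close>

definition vi :: "'b set \<Rightarrow> 'k pol set" where "vi B = {x \<in> N. h x \<in> B}"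

lemma vi_image: "L \<subseteq> N \<Longrightarrow> K \<subseteq> L \<Longrightarrow> pm n L \<Longrightarrow> vi (h ` L) = L"
proof -
  assume L: "L \<subseteq> N" "K \<subseteq> L" "pm n L"
  have "x \<in> L" if x: "x \<in> N" "h x = h y" "y \<in> L" for x y
    using h_eq[of x y] that L pm_add[OF L(3), of "x - y" y] by auto
  then show ?thesis using L(1) by (auto simp: vi_def)
qed

lemma image_vi: "B \<subseteq> carrier Q \<Longrightarrow> h ` vi B = B" by (auto simp: vi_def h_carrier)

lemma submodule_sub: "submodule B (poly_ring n) Q \<Longrightarrow> B \<subseteq> carrier Q"
  by (metis (no_types, lifting) partial_object.select_convs(1) submodule_def subgroup.subset)

lemma vi_pm:
  assumes B: "submodule B (poly_ring n) Q" shows "pm n (vi B)" "K \<subseteq> vi B" "vi B \<subseteq> N"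
proof -
  interpret B: submodule B "poly_ring n" Q by fact
  have z: "\<zero>\<^bsub>Q\<^esub> \<in> B" and add: "\<And>x y. x \<in> B \<Longrightarrow> y \<in> B \<Longrightarrow> x \<oplus>\<^bsub>Q\<^esub> y \<in> B" using B.one_closed B.m_closed by auto
  show KB: "K \<subseteq> vi B"
  proof
    fix x assume x: "x \<in> K"
    then have "x \<in> N" using KN by blast
    then show "x \<in> vi B" using h_zero[of x] x z by (simp add: vi_def)
  qed
  show "vi B \<subseteq> N" by (auto simp: vi_def)
  have t: "r * y \<in> vi B" if "r \<in> Sn n" "y \<in> vi B" for r y
    using that h_smult[of r y] pm_times[OF N, of r y] B.smult_closed[of r "h y"] by (auto simp: vi_def Sn_carrier)
  have m1: "- 1 \<in> (Sn n :: 'k pol set)" by (rule pm_uminus[OF pm_Sn one_Sn])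
  show "pm n (vi B)" unfolding pm_def
  proof (intro conjI ballI)
    show "0 \<in> vi B" using KB pm_0[OF K] by blast
    show "x - y \<in> vi B" if "x \<in> vi B" "y \<in> vi B" for x y
    proof -
      have "- y \<in> vi B" using t[OF m1 that(2)] by simp
      then have "h x \<oplus>\<^bsub>Q\<^esub> h (- y) \<in> B" "x \<in> N" "- y \<in> N" "y \<in> N" using that add by (auto simp: vi_def)
      then show ?thesis using h_add[of x "- y"] pm_diff[OF N, of x y] by (simp add: vi_def)
    qed
  qed (rule t)
qed

lemma pres_quot:
  assumes B: "submodule B (poly_ring n) Q"
  shows "pres n (mod_quot Q B) N (vi B) (\<lambda>x. B +>\<^bsub>Q\<^esub> h x)"
proof (rule pres.intro)
  note p = mod_quot_props[OF modQ B]
  show "Module.module (poly_ring n) (mod_quot Q B)" by (rule module_mod_quot[OF modQ B])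
  show "carrier (mod_quot Q B) = (\<lambda>x. B +>\<^bsub>Q\<^esub> h x) ` N" unfolding p(1) h_carrier by blast
  show "B +>\<^bsub>Q\<^esub> h (x + y) = (B +>\<^bsub>Q\<^esub> h x) \<oplus>\<^bsub>mod_quot Q B\<^esub> (B +>\<^bsub>Q\<^esub> h y)" if "x \<in> N" "y \<in> N" for x y
    unfolding h_add[OF that] by (rule p(2)[OF h_mem[OF that(1)] h_mem[OF that(2)]])
  show "B +>\<^bsub>Q\<^esub> h (r * y) = r \<odot>\<^bsub>mod_quot Q B\<^esub> (B +>\<^bsub>Q\<^esub> h y)" if "r \<in> Sn n" "y \<in> N" for r y
    unfolding h_smult[OF that] by (rule p(3)[OF _ h_mem[OF that(2)]]) (use that Sn_carrier in blast)
  show "B +>\<^bsub>Q\<^esub> h x = \<zero>\<^bsub>mod_quot Q B\<^esub> \<longleftrightarrow> x \<in> vi B" if "x \<in> N" for x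
    using p(4)[OF h_mem[OF that]] that by (simp add: vi_def)
qed (use vi_pm[OF B] N NS in auto)

lemma pres_sub:
  assumes B: "submodule B (poly_ring n) Q"
  shows "pres n (Q\<lparr>carrier := B\<rparr>) (vi B) K h"
proof (rule pres.intro)
  show "Module.module (poly_ring n) (Q\<lparr>carrier := B\<rparr>)" by (rule submodule.submodule_is_module[OF B modQ])
  show "carrier (Q\<lparr>carrier := B\<rparr>) = h ` vi B" using image_vi[OF submodule_sub[OF B]] by simp
qed (use vi_pm[OF B] K NS h_add h_smult h_zero in \<open>auto simp: vi_def\<close>)

lemma annihilator_pres: "annihilator (poly_ring n) Q = {r \<in> Sn n. \<forall>y\<in>N. r * y \<in> K}"
proof -
  have "r \<odot>\<^bsub>Q\<^esub> h y = \<zero>\<^bsub>Q\<^esub> \<longleftrightarrow> r * y \<in> K" if "r \<in> Sn n" "y \<in> N" for r y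
    using h_smult[OF that] h_zero[OF pm_times[OF N that]] by simp
  then show ?thesis unfolding annihilator_def h_carrier Sn_carrier[symmetric] by blast
qed

lemma annihilator_pm: "pm n (annihilator (poly_ring n) Q)" "annihilator (poly_ring n) Q \<subseteq> Sn n"
proof -
  show "annihilator (poly_ring n) Q \<subseteq> Sn n" unfolding annihilator_pres by blast
  show "pm n (annihilator (poly_ring n) Q)" unfolding annihilator_pres pm_def
  proof (intro conjI ballI CollectI)
    show "(0 :: 'k pol) \<in> Sn n" by (rule SP_0)
    show "0 * y \<in> K" for y using pm_0[OF K] by simp
    fix x y :: "'k pol" assume xy: "x \<in> {r \<in> Sn n. \<forall>y\<in>N. r * y \<in> K}" "y \<in> {r \<in> Sn n. \<forall>y\<in>N. r * y \<in> K}"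
    show "x - y \<in> Sn n" using pm_diff[OF pm_Sn] xy by blast
    show "(x - y) * z \<in> K" if "z \<in> N" for z using xy that pm_diff[OF K] by (simp add: left_diff_distrib)
  next
    fix p y :: "'k pol" assume py: "p \<in> Sn n" "y \<in> {r \<in> Sn n. \<forall>y\<in>N. r * y \<in> K}"
    show "p * y \<in> Sn n" using py Sn_times by blast
    show "p * y * z \<in> K" if "z \<in> N" for z using py that pm_times[OF K, of p "y * z"] by (simp add: mult.assoc)
  qed
qed

abbreviation padds :: "'k pol list \<Rightarrow> 'k pol set" where
  "padds fs \<equiv> paddl N K fs"

lemma padds_least:
  assumes "pm n L" "K \<subseteq> L" "\<And>f y. f \<in> set fs \<Longrightarrow> y \<in> N \<Longrightarrow> f * y \<in> L"
  shows "padds fs \<subseteq> L" using assms(3)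
proof (induction fs rule: rev_induct)
  case (snoc f fs)
  then have "padds fs \<subseteq> L" by simp
  then show ?case using pm_add[OF assms(1)] snoc.prems[of f] by (auto simp: padd_def)
qed (use assms(2) in simp)

lemma set_smult_pres:
  assumes fs: "set fs \<subseteq> Sn n"
  shows "set_smult (poly_ring n) (set fs) Q = h ` padds fs"
proof -
  note F = foldl_padd[OF N K KN fs]
  let ?X = "{x \<odot>\<^bsub>Q\<^esub> y | x y. x \<in> set fs \<and> y \<in> carrier Q}"
  have X: "?X = {h (f * y) | f y. f \<in> set fs \<and> y \<in> N}"
  proof -
    have "f \<odot>\<^bsub>Q\<^esub> h y = h (f * y)" if "f \<in> set fs" "y \<in> N" for f y using h_smult[of f y] fs that by auto
    then show ?thesis unfolding h_carrier by force
  qed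
  have a: "submodule (h ` padds fs) (poly_ring n) Q" by (rule submodule_image[OF F(1,4)])
  have b: "?X \<subseteq> h ` padds fs" unfolding X using F(3) by blast
  have c: "h ` padds fs \<subseteq> B" if B: "submodule B (poly_ring n) Q" "?X \<subseteq> B" for B
  proof -
    have "padds fs \<subseteq> vi B"
    proof (rule padds_least[OF vi_pm(1,2)[OF B(1)]])
      fix f y assume fy: "f \<in> set fs" "y \<in> N"
      then have "h (f * y) \<in> B" using B(2) unfolding X by blast
      then show "f * y \<in> vi B" using pm_times[OF N _ fy(2), of f] fy(1) fs by (auto simp: vi_def)
    qed
    then show ?thesis by (auto simp: vi_def)
  qed
  show ?thesis unfolding set_smult_def mod_span_def
  proof (rule equalityI)
    show "\<Inter>{B. submodule B (poly_ring n) Q \<and> ?X \<subseteq> B} \<subseteq> h ` padds fs"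
      by (rule Inter_lower, rule CollectI, rule conjI[OF a b])
    show "h ` padds fs \<subseteq> \<Inter>{B. submodule B (poly_ring n) Q \<and> ?X \<subseteq> B}"
      by (rule Inter_greatest, drule CollectD, elim conjE, rule c)
  qed
qed

lemma wreg_iff:
  "wreg fs N K \<longleftrightarrow> (\<forall>i<length fs. \<forall>y\<in>N. fs ! i * y \<in> padds (take i fs) \<longrightarrow> y \<in> padds (take i fs))"
proof (induction fs rule: rev_induct)
  case (snoc f fs)
  have "(\<forall>i<length (fs @ [f]). \<forall>y\<in>N. (fs @ [f]) ! i * y \<in> padds (take i (fs @ [f])) \<longrightarrow> y \<in> padds (take i (fs @ [f]))) \<longleftrightarrow>
    (\<forall>i<length fs. \<forall>y\<in>N. fs ! i * y \<in> padds (take i fs) \<longrightarrow> y \<in> padds (take i fs)) \<and>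
    (\<forall>y\<in>N. f * y \<in> padds fs \<longrightarrow> y \<in> padds fs)" by (auto simp: less_Suc_eq nth_append)
  then show ?case unfolding wreg_append snoc.IH by simp
qed simp

text \<open>The quotients in the definition, one for each initial part of the sequence, become
  growing submodules of \<open>N\<close>; properness of the last one is what distinguishes regular
  from weakly regular.\<close>

lemma regular_iff:
  "regular_sequence (poly_ring n) Q fs \<longleftrightarrow> set fs \<subseteq> Sn n \<and> wreg fs N K \<and> padds fs \<noteq> N"
proof (cases "set fs \<subseteq> Sn n")
  case fs: True
  let ?Q = "\<lambda>i. mod_quot Q (set_smult (poly_ring n) (set (take i fs)) Q)"
  have t: "set (take i fs) \<subseteq> Sn n" for i using fs set_take_subset by fast
  have "(\<forall>y\<in>carrier (?Q i).
        (fs ! i) \<odot>\<^bsub>?Q i\<^esub> y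
          = \<zero>\<^bsub>?Q i\<^esub>
        \<longrightarrow> y = \<zero>\<^bsub>?Q i\<^esub>) \<longleftrightarrow>
    (\<forall>y\<in>N. fs ! i * y \<in> padds (take i fs) \<longrightarrow> y \<in> padds (take i fs))" if i: "i < length fs" for i
  proof -
    note F = foldl_padd[OF N K KN t[of i]]
    let ?B = "h ` padds (take i fs)"
    interpret P: pres n "mod_quot Q ?B" N "vi ?B" "\<lambda>x. ?B +>\<^bsub>Q\<^esub> h x"
      by (rule pres_quot[OF submodule_image[OF F(1,4)]])
    have v: "vi ?B = padds (take i fs)" by (rule vi_image[OF F(4,2,1)])
    have f: "fs ! i \<in> Sn n" using fs i nth_mem by blast
    have e1: "(fs ! i) \<odot>\<^bsub>mod_quot Q ?B\<^esub> (?B +>\<^bsub>Q\<^esub> h y) = \<zero>\<^bsub>mod_quot Q ?B\<^esub> \<longleftrightarrow> fs ! i * y \<in> padds (take i fs)"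
      if y: "y \<in> N" for y using P.h_smult[OF f y] P.h_zero[OF pm_times[OF N f y]] unfolding v by simp
    have e2: "?B +>\<^bsub>Q\<^esub> h y = \<zero>\<^bsub>mod_quot Q ?B\<^esub> \<longleftrightarrow> y \<in> padds (take i fs)" if y: "y \<in> N" for y
      using P.h_zero[OF y] unfolding v .
    show ?thesis unfolding set_smult_pres[OF t] P.h_carrier by (simp add: e1 e2 cong: ball_cong_simp)
  qed
  moreover have "set_smult (poly_ring n) (set fs) Q \<noteq> carrier Q \<longleftrightarrow> padds fs \<noteq> N"
  proof -
    note F = foldl_padd[OF N K KN fs]
    have "h ` padds fs = h ` N \<longleftrightarrow> padds fs = N"
      using vi_image[OF F(4,2,1)] vi_image[OF subset_refl KN N] by metis
    then show ?thesis unfolding set_smult_pres[OF fs] h_carrier by simp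
  qed
  ultimately show ?thesis unfolding regular_sequence_def wreg_iff using fs by (simp add: Sn_carrier)
next case False then show ?thesis unfolding regular_sequence_def using Sn_carrier by blast
qed

end

lemma pres_ring: "pres n (ring_mod n) (Sn n :: 'k::field pol set) {0} id"
proof (rule pres.intro)
  show "Module.module (poly_ring n) (ring_mod n :: ('k pol, 'k pol) module)" by (rule module_ring_mod)
  show "pm n (Sn n :: 'k pol set)" by (rule pm_Sn)
  show "carrier (ring_mod n) = id ` (Sn n :: 'k pol set)" by (simp add: Sn_carrier ring_mod_def)
qed (auto simp: ring_mod_def pm_def SP_0)

lemma pres_quotient:
  assumes I: "pm n I" "I \<subseteq> (Sn n :: 'k::field pol set)"
  shows "pres n (mod_quot (ring_mod n) I) (Sn n) I (\<lambda>p. I +>\<^bsub>ring_mod n\<^esub> p)"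
proof -
  interpret R: pres n "ring_mod n" "Sn n :: 'k pol set" "{0}" id by (rule pres_ring)
  have s: "submodule I (poly_ring n) (ring_mod n)" using R.submodule_image[OF I] by simp
  have v: "R.vi I = I" using R.vi_image[OF I(2)] I(1) pm_0[OF I(1)] by simp
  show ?thesis using R.pres_quot[OF s] unfolding v by simp
qed

locale pres_graded = pres n Q "Sn n" I h for n Q h and I :: "'k::field pol set" +
  assumes grI: "gr I"
begin

lemma finsum_h:
  assumes "finite D" "\<And>d. d \<in> D \<Longrightarrow> p d \<in> Sn n"
  shows "(\<Oplus>\<^bsub>Q\<^esub>d\<in>D. h (p d)) = h (\<Sum>d\<in>D. p d)" using assms
proof (induction D rule: finite_induct)
  case empty then show ?case using h_zero[OF SP_0] pm_0[OF K] by simp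
next case (insert d D) have "(\<Oplus>\<^bsub>Q\<^esub>d\<in>insert d D. h (p d)) = h (p d) \<oplus>\<^bsub>Q\<^esub> (\<Oplus>\<^bsub>Q\<^esub>d\<in>D. h (p d))"
    by (rule Q.M.finsum_insert) (use insert h_mem in auto)
  also have "\<dots> = h (p d + (\<Sum>d\<in>D. p d))"
    using insert h_add[of "p d" "\<Sum>d\<in>D. p d"] pm_sum[OF pm_Sn, of D p] by auto
  finally show ?case using insert.hyps by simp
qed

text \<open>Homogeneous parts in the quotient lift to polynomials whose sum differs from
  \<open>x\<close> by an element of the graded ideal \<open>I\<close>.\<close>

lemma graded_vi:
  assumes "graded_submodule (poly_ring n) Q (\<lambda>d. h ` poly_comp n d) B"
  shows "gr (vi B)" unfolding gr_def
proof (intro ballI allI)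
  have B: "submodule B (poly_ring n) Q" using assms by (simp add: graded_submodule_def)
  fix x e assume x: "x \<in> vi B"
  then obtain D f where D: "finite D" "\<forall>d\<in>D. f d \<in> B \<inter> h ` poly_comp n d" "h x = (\<Oplus>\<^bsub>Q\<^esub>d\<in>D. f d)"
    using assms by (auto simp: graded_submodule_def vi_def)
  then have "\<forall>d\<in>D. \<exists>p. p \<in> poly_comp n d \<and> f d = h p" by blast
  then obtain p where p: "\<And>d. d \<in> D \<Longrightarrow> p d \<in> poly_comp n d \<and> f d = h (p d)" by metis
  have pS: "p d \<in> Sn n" "p d \<in> Gp d" if "d \<in> D" for d
    using p[OF that] unfolding Sn_carrier by (auto simp: poly_comp_def Gp_def)
  have "(\<Oplus>\<^bsub>Q\<^esub>d\<in>D. f d) = (\<Oplus>\<^bsub>Q\<^esub>d\<in>D. h (p d))" by (rule Q.M.finsum_cong') (use p pS h_mem in auto)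
  then have "h x = h (\<Sum>d\<in>D. p d)" using D(3) finsum_h[OF D(1) pS(1)] by simp
  moreover have xS: "x \<in> Sn n" using x by (simp add: vi_def)
  moreover have sS: "(\<Sum>d\<in>D. p d) \<in> Sn n" by (rule pm_sum[OF pm_Sn pS(1)])
  ultimately have "x - (\<Sum>d\<in>D. p d) \<in> I" using h_eq by blast
  then have "hc e (x - (\<Sum>d\<in>D. p d)) \<in> vi B" using grI vi_pm(2)[OF B] by (auto simp: gr_def)
  moreover have "hc e (\<Sum>d\<in>D. p d) \<in> vi B"
  proof -
    have "hc e (\<Sum>d\<in>D. p d) = (\<Sum>d\<in>D. hc e (p d))"
      using D(1) by (induction D rule: finite_induct) (simp_all add: hc_add hc_0)
    also have "\<dots> \<in> vi B"
    proof (rule pm_sum[OF vi_pm(1)[OF B]])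
      fix d assume d: "d \<in> D"
      have "p d \<in> vi B" using D(2) p[OF d] pS(1)[OF d] d by (auto simp: vi_def)
      then show "hc e (p d) \<in> vi B"
        using hc_id[OF pS(2)[OF d]] hc_other[OF pS(2)[OF d], of e] pm_0[OF vi_pm(1)[OF B]] by (cases "e = d") auto
    qed
    finally show ?thesis .
  qed
  ultimately show "hc e x \<in> vi B" using pm_add[OF vi_pm(1)[OF B], of "hc e (x - (\<Sum>d\<in>D. p d))" "hc e (\<Sum>d\<in>D. p d)"]
    by (simp add: hc_diff)
qed

lemma graded_image:
  assumes L: "pm n L" "L \<subseteq> Sn n" "gr L"
  shows "graded_submodule (poly_ring n) Q (\<lambda>d. h ` poly_comp n d) (h ` L)" unfolding graded_submodule_def
proof (intro conjI ballI)
  show "submodule (h ` L) (poly_ring n) Q" by (rule submodule_image[OF L(1,2)])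
  fix y assume "y \<in> h ` L"
  then obtain x where x: "x \<in> L" "y = h x" by blast
  let ?D = "(\<lambda>m. int (mdeg m)) ` keys x"
  have hL: "hc d x \<in> L" for d using L(3) x(1) by (simp add: gr_def)
  have "hc d x \<in> poly_comp n d" for d
    using hL[of d] L(2) hc_Gp[of d x] Sn_carrier[of n] by (auto simp: poly_comp_def Gp_def)
  moreover have "y = (\<Oplus>\<^bsub>Q\<^esub>d\<in>?D. h (hc d x))"
    using finsum_h[of ?D "\<lambda>d. hc d x"] hL L(2) hc_sum[of x] x(2) by (metis finite_imageI finite_keys subsetD)
  ultimately show "\<exists>D f. finite D \<and> (\<forall>d\<in>D. f d \<in> h ` L \<inter> h ` poly_comp n d) \<and> y = (\<Oplus>\<^bsub>Q\<^esub>d\<in>D. f d)"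
    using hL by (intro exI[of _ ?D] exI[of _ "\<lambda>d. h (hc d x)"]) auto
qed

end

lemma pres_graded_quotient:
  assumes I: "pm n I" "I \<subseteq> (Sn n :: 'k::field pol set)" "gr I"
  shows "pres_graded n (mod_quot (ring_mod n) I) (\<lambda>p. I +>\<^bsub>ring_mod n\<^esub> p) I"
  using pres_quotient[OF I(1,2)] I(3) by (simp add: pres_graded_def pres_graded_axioms_def)

lemma pres_dim_ge:
  assumes "pres n Q N K h" "annihilator (poly_ring n) Q \<subseteq> PT n T" "T \<subseteq> {1..n}"
  shows "enat (card T) \<le> mod_dim (poly_ring n) Q"
  unfolding mod_dim_def by (rule krull_ge_card[OF pres.annihilator_pm[OF assms(1)] assms(3,2)])

lemma pres_depth_Hz:
  assumes P: "pres n Q N K h" and d: "enat d \<le> depth (poly_ring n) (irrelevant_ideal n) Q" "0 < d"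
    and g: "gr N" "gr K" and vs: "distinct vs" "set vs = {1..n}" "n < j + d"
  shows "Hz Xp Gp vs N K j t"
proof -
  interpret pres n Q N K h by fact
  \<comment> \<open>The supremum defining depth is not known to be attained, but for positive
    \<open>d\<close> it reaches \<open>d\<close> only if some regular sequence is at least that
    long.\<close>
  have "\<exists>xs. set xs \<subseteq> irrelevant_ideal n \<and> regular_sequence (poly_ring n) Q xs \<and> d \<le> length xs"
  proof (rule ccontr)
    assume "\<not> ?thesis"
    then have "\<And>xs. set xs \<subseteq> irrelevant_ideal n \<Longrightarrow> regular_sequence (poly_ring n) Q xs \<Longrightarrow> length xs \<le> d - 1"
      using d(2) by fastforce
    then have "depth (poly_ring n) (irrelevant_ideal n) Q \<le> enat (d - 1)"
      unfolding depth_def by (intro Sup_least) auto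
    then show False using d order_trans[OF d(1)] by fastforce
  qed
  then obtain xs where xs: "set xs \<subseteq> irrelevant_ideal n" "regular_sequence (poly_ring n) Q xs" "d \<le> length xs" by blast
  have "Hz Xp (\<lambda>_. UNIV) vs N K j t"
    by (rule wreg_Hz[OF N K KN _ _ _ vs(1,2), of xs]) (use xs mem_irrelevant regular_iff vs(3) in auto)
  then show ?thesis by (rule Hz_graded[OF _ g])
qed

section \<open>Sequentially Cohen--Macaulay Stanley--Reisner rings\<close>

text \<open>Faces of size above \<open>d\<close> are kept, unlike in the pure skeleton; the ideals
  of these complexes are the steps of the filtration.\<close>

definition pg :: "nat set set \<Rightarrow> nat \<Rightarrow> nat set set" where
  "pg \<Delta> d = {T \<in> \<Delta>. \<exists>B\<in>\<Delta>. T \<subseteq> B \<and> d \<le> card B}"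

definition facet :: "nat set set \<Rightarrow> nat set \<Rightarrow> bool" where
  "facet \<Delta> T \<longleftrightarrow> T \<in> \<Delta> \<and> (\<forall>v. v \<notin> T \<longrightarrow> insert v T \<notin> \<Delta>)"

lemma pg_cplx: "cplx n \<Delta> \<Longrightarrow> cplx n (pg \<Delta> d)" by (rule cplxI) (auto simp: pg_def dest: cplx_sub cplx_down)

lemma pg_mono: "a \<le> b \<Longrightarrow> pg \<Delta> b \<subseteq> pg \<Delta> a" by (auto simp: pg_def intro: order_trans)

lemma card_le_n: "cplx n \<Delta> \<Longrightarrow> T \<in> \<Delta> \<Longrightarrow> card T \<le> n" using card_mono[of "{1..n}" T] cplx_sub[of n \<Delta> T] by simp

lemma facet_exists:
  assumes "cplx n \<Delta>" "T \<in> \<Delta>" shows "\<exists>B. facet \<Delta> B \<and> T \<subseteq> B"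
proof -
  have "\<forall>C. C \<in> \<Delta> \<and> T \<subseteq> C \<longrightarrow> card C < Suc n" using card_le_n[OF assms(1)] by (simp add: less_Suc_eq_le)
  then obtain B where B: "B \<in> \<Delta> \<and> T \<subseteq> B" "\<And>C. C \<in> \<Delta> \<and> T \<subseteq> C \<Longrightarrow> card C \<le> card B"
    using ex_has_greatest_nat[of "\<lambda>B. B \<in> \<Delta> \<and> T \<subseteq> B" T card "Suc n"] assms(2) by blast
  have "insert v B \<notin> \<Delta>" if "v \<notin> B" for v
    using B(2)[of "insert v B"] B(1) that cplx_fin[OF assms(1), of B] by auto
  then show ?thesis using B(1) by (auto simp: facet_def)
qed

text \<open>Every face lies in a facet, so the complex changes only where the bound passes the size
  of a facet.\<close>

lemma pg_eq:
  assumes "cplx n \<Delta>" "a \<le> b" "\<And>B. facet \<Delta> B \<Longrightarrow> a \<le> card B \<Longrightarrow> b \<le> card B"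
  shows "pg \<Delta> a = pg \<Delta> b"
proof
  show "pg \<Delta> a \<subseteq> pg \<Delta> b"
  proof
    fix T assume "T \<in> pg \<Delta> a"
    then obtain B where B: "T \<in> \<Delta>" "B \<in> \<Delta>" "T \<subseteq> B" "a \<le> card B" by (auto simp: pg_def)
    obtain C where C: "facet \<Delta> C" "B \<subseteq> C" using facet_exists[OF assms(1) B(2)] by blast
    have "C \<in> \<Delta>" using C(1) by (simp add: facet_def)
    then have "card B \<le> card C" using card_mono[OF cplx_fin[OF assms(1)] C(2)] by blast
    then have "b \<le> card C" using assms(3)[OF C(1)] B(4) by linarith
    then show "T \<in> pg \<Delta> b" using B C \<open>C \<in> \<Delta>\<close> by (auto simp: pg_def)
  qed
qed (rule pg_mono[OF assms(2)])

lemma facet_pg: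
  assumes "cplx n \<Delta>" "facet \<Delta> T"
  shows "T \<in> pg \<Delta> d \<longleftrightarrow> d \<le> card T"
proof -
  have "B = T" if B: "T \<subseteq> B" "B \<in> \<Delta>" for B
  proof (rule ccontr)
    assume "B \<noteq> T"
    then obtain v where "v \<in> B" "v \<notin> T" using B by blast
    then show False using assms cplx_down[OF assms(1) B(2), of "insert v T"] B(1) by (auto simp: facet_def)
  qed
  then show ?thesis using assms(2) by (auto simp: pg_def facet_def)
qed

context pres
begin

lemma pres_subquot:
  assumes B: "submodule B (poly_ring n) Q" and C: "submodule C (poly_ring n) Q" and BC: "B \<subseteq> C"
  shows "pres n (mod_quot (Q\<lparr>carrier := C\<rparr>) B) (vi C) (vi B) (\<lambda>x. B +>\<^bsub>Q\<lparr>carrier := C\<rparr>\<^esub> h x)"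
proof -
  interpret P: pres n "Q\<lparr>carrier := C\<rparr>" "vi C" K h by (rule pres_sub[OF C])
  have v: "vi B \<subseteq> vi C" using BC by (auto simp: vi_def)
  have "submodule (h ` vi B) (poly_ring n) (Q\<lparr>carrier := C\<rparr>)" by (rule P.submodule_image[OF vi_pm(1)[OF B] v])
  then have s: "submodule B (poly_ring n) (Q\<lparr>carrier := C\<rparr>)" using image_vi[OF submodule_sub[OF B]] by simp
  have "P.vi B = vi B" using BC unfolding P.vi_def unfolding vi_def by blast
  then show ?thesis using P.pres_quot[OF s] by simp
qed

end

lemma mono_of_step:
  fixes D :: "nat \<Rightarrow> 'a::order"
  assumes "\<And>i. Suc i < r \<Longrightarrow> D i < D (Suc i)" "i \<le> j" "j < r"
  shows "D i \<le> D j" using assms(2,3)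
proof (induction j rule: dec_induct)
  case (step j) then show ?case using assms(1)[of j] by (meson Suc_lessD less_imp_le order_trans)
qed simp

text \<open>The step of the filtration where the dimension reaches \<open>q\<close> is the ideal of the subcomplex
  generated by the faces of size at least \<open>q\<close>: the earlier quotients are killed by elements outside
  the prime of such a face, and the remaining quotient has depth at least \<open>q\<close>.\<close>

lemma seqCM_imp_Dep:
  fixes ty :: "'k::field itself"
  assumes cx: "cplx n \<Delta>" and S: "sequentially_CM_ideal n (MI n (- \<Delta>) :: 'k pol set)" and q: "0 < q"
  shows "Dep ty n (pg \<Delta> q) q"
proof -
  define I where "I = (MI n (- \<Delta>) :: 'k pol set)"
  have I: "pm n I" "I \<subseteq> Sn n" "gr I"
    unfolding I_def by (rule pm_MI[OF up_compl[OF cx]], rule MI_mono, simp, rule gr_MI)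
  let ?h = "\<lambda>p. I +>\<^bsub>ring_mod n\<^esub> p"
  define Q where "Q = mod_quot (ring_mod n) I"
  interpret M: pres_graded n Q ?h I unfolding Q_def by (rule pres_graded_quotient[OF I])
  let ?Q = "\<lambda>Nf i. mod_quot (Q\<lparr>carrier := Nf (Suc i)\<rparr>) (Nf i)"
  obtain r Nf where F0: "Nf 0 = {\<zero>\<^bsub>Q\<^esub>} \<and> Nf r = carrier Q \<and>
    (\<forall>i\<le>r. graded_submodule (poly_ring n) Q (\<lambda>d. ?h ` poly_comp n d) (Nf i)) \<and>
    (\<forall>i<r. Nf i \<subset> Nf (Suc i) \<and> cohen_macaulay (poly_ring n) (irrelevant_ideal n) (?Q Nf i)) \<and>
    (\<forall>i. Suc i < r \<longrightarrow> mod_dim (poly_ring n) (?Q Nf i) < mod_dim (poly_ring n) (?Q Nf (Suc i)))"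
    using S unfolding sequentially_CM_ideal_def sequentially_CM_def I_def[symmetric] Q_def[symmetric]
    by (elim exE) (rule that)
  have F: "Nf 0 = {\<zero>\<^bsub>Q\<^esub>}" "Nf r = carrier Q"
    "\<And>i. i \<le> r \<Longrightarrow> graded_submodule (poly_ring n) Q (\<lambda>d. ?h ` poly_comp n d) (Nf i)"
    "\<And>i. i < r \<Longrightarrow> Nf i \<subset> Nf (Suc i)"
    "\<And>i. i < r \<Longrightarrow> cohen_macaulay (poly_ring n) (irrelevant_ideal n) (?Q Nf i)"
    "\<And>i. Suc i < r \<Longrightarrow> mod_dim (poly_ring n) (?Q Nf i) < mod_dim (poly_ring n) (?Q Nf (Suc i))"
    using F0 by simp_all
  define L where "L i = M.vi (Nf i)" for i
  define D where "D i = mod_dim (poly_ring n) (?Q Nf i)" for i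
  have sub: "submodule (Nf i) (poly_ring n) Q" if "i \<le> r" for i
    using F(3)[OF that] by (simp add: graded_submodule_def)
  have L: "pm n (L i)" "I \<subseteq> L i" "L i \<subseteq> Sn n" "gr (L i)" if "i \<le> r" for i
    unfolding L_def using M.vi_pm[OF sub[OF that]] M.graded_vi[OF F(3)[OF that]] by auto
  have LS: "L i \<subseteq> L (Suc i)" if "i < r" for i unfolding L_def M.vi_def using F(4)[OF that] by blast
  have L0: "L 0 = I" unfolding L_def M.vi_def F(1) using M.h_zero I(2) by auto
  have Lr: "L r = Sn n" unfolding L_def M.vi_def F(2) using M.h_mem by auto
  have P: "\<exists>g. pres n (?Q Nf i) (L (Suc i)) (L i) g" if "i < r" for i
    unfolding L_def using M.pres_subquot[OF sub sub, of i "Suc i"] F(4)[OF that] that by auto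
  have Dmono: "D i \<le> D j" if "i \<le> j" "j < r" for i j
    by (rule mono_of_step[of r D]) (use F(6) that in \<open>auto simp: D_def\<close>)
  \<comment> \<open>The first step whose quotient has dimension at least \<open>q\<close>; the value
    \<open>r\<close> covers the case that there is none.\<close>
  define i0 where "i0 = (LEAST i. i = r \<or> enat q \<le> D i)"
  have i0: "i0 = r \<or> enat q \<le> D i0" unfolding i0_def by (rule LeastI[of _ r]) simp
  have i0r: "i0 \<le> r" unfolding i0_def by (rule Least_le) simp
  have lt: "i < r" "D i < enat q" if "i < i0" for i
    using not_less_Least[OF that[unfolded i0_def]] i0r that by auto
  have ge: "enat q \<le> D i" if "i0 \<le> i" "i < r" for i using i0 Dmono[OF that] that by auto
  have Lmono: "L i \<subseteq> L j" if "i \<le> j" "j \<le> r" for i j using that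
  proof (induction j rule: dec_induct)
    case (step j) then show ?case using LS[of j] by auto
  qed simp
  \<comment> \<open>Being Cohen--Macaulay, the quotients from \<open>i0\<close> on have depth at
    least \<open>q\<close>, and vanishing is passed up through extensions.\<close>
  have Hz: "Hz Xp Gp vs (L j) (L i0) k t" if j: "i0 \<le> j" "j \<le> r" and vs: "distinct vs" "set vs = {1..n}" "n < k + q" for vs j k t
    using j
  proof (induction j rule: dec_induct)
    case base show ?case by (rule Hz_triv[OF pm_ksub kmod_Xp]) (use L(1)[OF i0r] vs in auto)
  next case (step j) have j: "j < r" using step by simp
    obtain g where g: "pres n (?Q Nf j) (L (Suc j)) (L j) g" using P[OF j] by blast
    have "enat q \<le> depth (poly_ring n) (irrelevant_ideal n) (?Q Nf j)"
      using F(5)[OF j] ge[OF step.hyps(1) j] unfolding cohen_macaulay_def D_def by simp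
    then have H: "Hz Xp Gp vs (L (Suc j)) (L j) k t" by (rule pres_depth_Hz[OF g _ q]) (use L(4) j vs in auto)
    have ks: "ksub Xp vs (L i)" if "i \<le> r" for i by (rule pm_ksub[OF L(1)[OF that]]) (use vs in simp)
    show ?case by (rule Xp.Hz_ext[OF Lmono[OF step.hyps(1)] LS[OF j] ks step.IH H ks ks]) (use j step in auto)
  qed
  have LP: "L i \<subseteq> PT n B" if B: "B \<in> \<Delta>" "q \<le> card B" and "i \<le> i0" for B i using \<open>i \<le> i0\<close>
  proof (induction i)
    case 0 show ?case unfolding L0 I_def PT_def by (rule MI_mono) (use cplx_down[OF cx B(1)] in blast)
  next case (Suc i) have i: "i < i0" using Suc.prems by simp
    obtain g where g: "pres n (?Q Nf i) (L (Suc i)) (L i) g" using P[OF lt(1)[OF i]] by blast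
    have "\<not> annihilator (poly_ring n) (?Q Nf i) \<subseteq> PT n B"
    proof
      assume "annihilator (poly_ring n) (?Q Nf i) \<subseteq> PT n B"
      from pres_dim_ge[OF g this cplx_sub[OF cx B(1)]] have "enat (card B) \<le> D i" by (simp add: D_def)
      also have "\<dots> < enat q" by (rule lt(2)[OF i])
      finally show False using B(2) by simp
    qed
    then obtain a where a: "a \<in> Sn n" "\<forall>y\<in>L (Suc i). a * y \<in> L i" "a \<notin> PT n B"
      unfolding pres.annihilator_pres[OF g] by blast
    have "y \<in> PT n B" if y: "y \<in> L (Suc i)" for y
    proof -
      have "a * y \<in> PT n B" using a(2) y Suc.IH i by auto
      moreover have "y \<in> Sn n" using y L(3)[of "Suc i"] lt(1)[OF i] by auto
      ultimately show ?thesis using prm_prime[OF PT_prime a(1)] a(3) by blast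
    qed
    then show ?case by blast
  qed
  have key: "L i0 = MI n (- pg \<Delta> q)"
  proof
    show "L i0 \<subseteq> MI n (- pg \<Delta> q)"
    proof
      fix y assume y: "y \<in> L i0"
      have "m \<in> MS n (- pg \<Delta> q)" if m: "m \<in> keys y" for m
      proof -
        have "keys m \<subseteq> {1..n}" using L(3)[OF i0r] y m by (auto simp: SP_def MS_def)
        moreover have "keys m \<notin> pg \<Delta> q"
        proof
          assume "keys m \<in> pg \<Delta> q"
          then obtain B where B: "B \<in> \<Delta>" "q \<le> card B" "keys m \<subseteq> B" by (auto simp: pg_def)
          have "y \<in> PT n B" using LP[OF B(1,2) order_refl] y by blast
          then show False using m B(3) by (auto simp: PT_def SP_def MS_def)
        qed
        ultimately show ?thesis by (simp add: MS_def)
      qed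
      then show "y \<in> MI n (- pg \<Delta> q)" by (auto simp: SP_def)
    qed
    \<comment> \<open>Induction from large supports down: a face outside
      \<open>pg \<Delta> q\<close> has fewer than \<open>q\<close> vertices, and its monomial
      becomes a member after multiplication by any new variable, so \<open>H0_vanish\<close>
      applies.\<close>
    have mon: "pmon m \<in> L i0" if "keys m \<subseteq> {1..n}" "keys m \<notin> pg \<Delta> q" for m using that
    proof (induction "n - card (keys m)" arbitrary: m rule: less_induct)
      case less
      note L0' = L[OF i0r]
      show ?case
      proof (cases "keys m \<in> \<Delta>")
        case False
        then have "pmon m \<in> I" using less.prems(1) by (simp add: I_def mem_SP_pmon MS_def)
        then show ?thesis using L0'(2) by blast
      next case True
        then have c: "card (keys m) < q" using less.prems(2) by (auto simp: pg_def not_le[symmetric])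
        show ?thesis
        proof (rule H0_vanish[where T = "keys m" and n = n and d = q and N = "Sn n" and K = "L i0" and e = "int (mdeg m)"])
          show "ksub Xp vs (Sn n) \<and> ksub Xp vs (L i0)" if "set vs \<subseteq> {1..n}" for vs
            using pm_ksub[OF pm_Sn that] pm_ksub[OF L0'(1) that] by blast
          show "Hz Xp Gp vs (Sn n) (L i0) j t" if "distinct vs" "set vs = {1..n}" "n < j + q" for vs j t
            using Hz[OF i0r order_refl that] unfolding Lr .
          show "pmon m \<in> Sn n" using less.prems(1) by (simp add: mem_SP_pmon MS_def)
          show "pmon m \<in> Gp (int (mdeg m))" by (simp add: Gp_def)
          fix v assume v: "v \<in> {1..n} - keys m"
          have k: "keys (ev v + m) = insert v (keys m)" by (rule keys_ev_add)
          have "insert v (keys m) \<notin> pg \<Delta> q" using less.prems(2) True by (auto simp: pg_def)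
          moreover have "insert v (keys m) \<subseteq> {1..n}" using v less.prems(1) by blast
          moreover have "n - card (insert v (keys m)) < n - card (keys m)"
            using v card_mono[of "{1..n}" "insert v (keys m)"] less.prems(1) by simp
          ultimately have "pmon (ev v + m) \<in> L i0" using less.hyps[of "ev v + m"] by (simp add: k)
          then show "Xp v (pmon m) \<in> L i0" by (simp add: Xp_def pmon_times)
        qed (use less.prems(1) c in auto)
      qed
    qed
    show "MI n (- pg \<Delta> q) \<subseteq> L i0"
    proof
      fix y assume y: "y \<in> (MI n (- pg \<Delta> q) :: 'k pol set)"
      have "single m (lookup y m) \<in> L i0" if m: "m \<in> keys y" for m
      proof -
        have "single m (lookup y m) = single 0 (lookup y m) * pmon m" by (simp add: pmon_def mult_single)
        moreover have "pmon m \<in> L i0" using y m by (intro mon) (auto simp: SP_def MS_def)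
        ultimately show ?thesis using pm_times[OF L(1)[OF i0r] const_Sn] by simp
      qed
      then show "y \<in> L i0" by (rule pm_poly[OF L(1)[OF i0r]])
    qed
  qed
  show ?thesis unfolding Dep_def using Hz[OF i0r order_refl] unfolding Lr key by auto
qed

section \<open>From regular symmetric polynomials to the filtration\<close>

lemma Th_lower:
  fixes ty :: "'k::field itself"
  assumes "Th ty n X d" "e \<le> d" shows "Th ty n X e" using assms(2,1)
proof (induction d rule: dec_induct)
  case (step d) then show ?case unfolding Th_def thetas_Suc wreg_append by blast
qed simp

lemma pm_SP:
  assumes "\<And>m a. m \<in> A \<Longrightarrow> keys a \<subseteq> {1..n} \<Longrightarrow> a + m \<in> A"
  shows "pm n (SP A :: 'k::field pol set)" unfolding pm_def
proof (intro conjI ballI)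
  fix p y :: "'k pol" assume p: "p \<in> Sn n" "y \<in> SP A"
  have "m \<in> A" if m: "m \<in> keys (p * y)" for m
  proof -
    obtain a b where "m = a + b" "a \<in> keys p" "b \<in> keys y" using m keys_mult[of p y] by blast
    then show ?thesis using assms[of b a] p by (auto simp: SP_def MS_def)
  qed
  then show "p * y \<in> SP A" by (auto simp: SP_def)
qed (auto intro: SP_0 SP_diff)

lemma thetas_irrelevant: "set (thetas n d) \<subseteq> (irrelevant_ideal n :: 'k::field pol set)"
proof
  fix f :: "'k pol" assume f: "f \<in> set (thetas n d)"
  then obtain i where i: "1 \<le> i" "f = esym {1..n} i" unfolding thetas_mem by blast
  have "0 \<notin> keys f"
  proof
    assume "0 \<in> keys f"
    then obtain A where A: "A \<subseteq> {1..n}" "card A = i" "0 = xmon A" using keys_esym[of "{1..n}" 0 i] i(2) by auto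
    then have "finite A" using finite_subset by blast
    then have "A = {}" using keys_xmon[of A] A(3) by simp
    then show False using A(2) i(1) by simp
  qed
  then show "f \<in> irrelevant_ideal n" unfolding mem_irrelevant using f thetas_set by blast
qed

text \<open>The monomial of \<open>T\<close> is nonzero in the quotient and killed by all variables
  outside \<open>T\<close>, which bounds the depth by \<open>d\<close>; the symmetric polynomials
  bound it from below. The annihilator lies between the ideal of all facets of size \<open>d\<close>
  and the prime of one of them, which gives the dimension.\<close>

lemma CM_quotient:
  fixes ty :: "'k::field itself"
  assumes cx: "cplx n \<Delta>" and T: "facet \<Delta> T" "card T = d"
    and Th: "Th ty n (pg \<Delta> d) d" "Th ty n (pg \<Delta> (Suc d)) (Suc d)"
    and P: "pres n Q (MI n (- pg \<Delta> (Suc d)) :: 'k pol set) (MI n (- pg \<Delta> d)) h"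
  shows "depth (poly_ring n) (irrelevant_ideal n) Q = enat d" "mod_dim (poly_ring n) Q = enat d"
proof -
  define N where "N = (MI n (- pg \<Delta> (Suc d)) :: 'k pol set)"
  define K where "K = (MI n (- pg \<Delta> d) :: 'k pol set)"
  interpret P: pres n Q N K h unfolding N_def K_def by (rule P)
  have T1: "T \<subseteq> {1..n}" "finite T" using T(1) cplx_sub[OF cx] cplx_fin[OF cx] by (auto simp: facet_def)
  have Tpg: "T \<in> pg \<Delta> d" "T \<notin> pg \<Delta> (Suc d)" using facet_pg[OF cx T(1)] T(2) by auto
  have xT: "keys (xmon T) = T" by (rule keys_xmon[OF T1(2)])
  have TN: "pmon (xmon T) \<in> N" "pmon (xmon T) \<notin> K"
    using Tpg T1(1) by (auto simp: N_def K_def mem_SP_pmon MS_def xT)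
  have up: "up n (- pg \<Delta> e)" for e by (rule up_compl[OF pg_cplx[OF cx]])
  have wr: "wreg (thetas n d) N K"
  proof (cases d)
    case 0 then show ?thesis by (simp add: thetas_def One_nat_def)
  next case (Suc e) have 1: "wreg (thetas n e @ [esym {1..n} d]) (Sn n) K"
      using Th(1) unfolding Th_def K_def Suc thetas_Suc by simp
    have 2: "wreg (thetas n e) (Sn n) N" using Th_lower[OF Th(2), of e] Suc unfolding Th_def N_def by simp
    show ?thesis unfolding Suc thetas_Suc
      by (rule wreg_sub[OF pm_Sn P.N P.K P.KN P.NS thetas_set esym_Sn _ 2]) (use 1 Suc in simp)
  qed
  \<comment> \<open>Graded Nakayama: the symmetric polynomials have positive degree, so their
    multiples miss the monomial \<open>b\<close> of least degree that is nonzero in the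
    quotient.\<close>
  have ne: "P.padds (thetas n d) \<noteq> N"
  proof -
    let ?B = "\<lambda>m. m \<in> MS n (- pg \<Delta> (Suc d)) \<and> m \<notin> MS n (- pg \<Delta> d)"
    have "?B (xmon T)" using TN by (simp add: N_def K_def mem_SP_pmon)
    then obtain b where b: "?B b" "\<And>m. ?B m \<Longrightarrow> mdeg b \<le> mdeg m" using ex_has_least_nat[of ?B "xmon T" mdeg] by blast
    let ?A = "MS n (- pg \<Delta> d) \<union> {m. keys m \<subseteq> {1..n} \<and> mdeg b < mdeg m}"
    have "P.padds (thetas n d) \<subseteq> SP ?A"
    proof (rule P.padds_least)
      show "pm n (SP ?A :: 'k pol set)"
      proof (rule pm_SP)
        fix m a :: mon assume ma: "m \<in> ?A" "keys a \<subseteq> {1..n}"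
        have "keys a \<union> keys m \<in> - pg \<Delta> d" if "keys m \<in> - pg \<Delta> d" "keys m \<subseteq> {1..n}"
          by (rule upD[OF up that(1)]) (use that ma(2) in auto)
        then show "a + m \<in> ?A" using ma by (auto simp: MS_def keys_plus_mon mdeg_add)
      qed
      show "K \<subseteq> SP ?A" unfolding K_def by (rule SP_mono) blast
      fix f y :: "'k pol" assume fy: "f \<in> set (thetas n d)" "y \<in> N"
      have f: "f \<in> Sn n" "0 \<notin> keys f" using fy(1) thetas_irrelevant mem_irrelevant by blast+
      have "m \<in> ?A" if m: "m \<in> keys (f * y)" for m
      proof -
        obtain a c where ac: "m = a + c" "a \<in> keys f" "c \<in> keys y" using m keys_mult[of f y] by blast
        have "a \<noteq> 0" using ac(2) f(2) by blast
        then have "mdeg a \<noteq> 0" by (simp add: mdeg_0_iff)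
        then have a: "keys a \<subseteq> {1..n}" "mdeg a > 0" using ac(2) f(1) by (auto simp: SP_def MS_def)
        have c: "c \<in> MS n (- pg \<Delta> (Suc d))" using fy(2) ac(3) by (auto simp: N_def SP_def)
        show ?thesis
        proof (cases "c \<in> MS n (- pg \<Delta> d)")
          case True
          then show ?thesis using a(1) upD[OF up, of "keys c" d "keys m"] by (auto simp: MS_def ac(1) keys_plus_mon)
        next case False then show ?thesis using b(2)[of c] c a by (auto simp: ac(1) mdeg_add keys_plus_mon MS_def)
        qed
      qed
      then show "f * y \<in> SP ?A" by (auto simp: SP_def)
    qed
    moreover have "pmon b \<in> N" "pmon b \<notin> (SP ?A :: 'k pol set)" using b(1) by (auto simp: N_def mem_SP_pmon)
    ultimately show ?thesis by blast
  qed
  show "depth (poly_ring n) (irrelevant_ideal n) Q = enat d" unfolding depth_def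
  proof (rule order_antisym)
    show "enat d \<le> Sup {enat (length xs) |xs. set xs \<subseteq> irrelevant_ideal n \<and> regular_sequence (poly_ring n) Q xs}"
    proof (rule Sup_upper, rule CollectI, intro exI conjI)
      show "enat d = enat (length (thetas n d :: 'k pol list))" by (simp add: length_thetas)
      show "set (thetas n d) \<subseteq> irrelevant_ideal n" by (rule thetas_irrelevant)
      show "regular_sequence (poly_ring n) Q (thetas n d)" unfolding P.regular_iff using wr ne thetas_set by blast
    qed
    show "Sup {enat (length xs) |xs. set xs \<subseteq> irrelevant_ideal n \<and> regular_sequence (poly_ring n) Q xs} \<le> enat d"
    proof (rule Sup_least, clarify)
      fix xs assume xs: "set xs \<subseteq> irrelevant_ideal n" "regular_sequence (poly_ring n) Q xs"
      have "length xs \<le> d"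
      proof (rule ccontr)
        assume l: "\<not> length xs \<le> d"
        have "pmon (xmon T) \<in> K"
        proof (rule H0_vanish[where T = T and n = n and d = "length xs" and N = N and e = "int (mdeg (xmon T))"])
          show "ksub Xp vs N \<and> ksub Xp vs K" if "set vs \<subseteq> {1..n}" for vs
            using pm_ksub[OF P.N that] pm_ksub[OF P.K that] by blast
          show "Hz Xp Gp vs N K j t" if vs: "distinct vs" "set vs = {1..n}" "n < j + length xs" for vs j t
          proof (rule Hz_graded)
            show "Hz Xp (\<lambda>_. UNIV) vs N K j t"
              by (rule wreg_Hz[OF P.N P.K P.KN _ _ _ vs]) (use xs mem_irrelevant P.regular_iff in auto)
          qed (auto simp: N_def K_def intro: gr_MI)
          show "pmon (xmon T) \<in> Gp (int (mdeg (xmon T)))" by (simp add: Gp_def)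
          fix v assume v: "v \<in> {1..n} - T"
          have "keys (ev v + xmon T) = insert v T" by (simp add: keys_ev_add xT)
          moreover have "insert v T \<notin> pg \<Delta> d" using T(1) v by (auto simp: facet_def pg_def)
          ultimately show "Xp v (pmon (xmon T)) \<in> K" using v T1(1) by (simp add: Xp_def pmon_times K_def mem_SP_pmon MS_def)
        qed (use T1 T(2) l TN in auto)
        then show False using TN by blast
      qed
      then show "enat (length xs) \<le> enat d" by simp
    qed
  qed
  have "annihilator (poly_ring n) Q \<subseteq> PT n T"
  proof
    fix r assume "r \<in> annihilator (poly_ring n) Q"
    then have r: "r \<in> Sn n" "pmon (xmon T) * r \<in> K" unfolding P.annihilator_pres using TN(1) by (auto simp: mult.commute)
    have "\<not> keys m \<subseteq> T" if m: "m \<in> keys r" for m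
    proof
      assume mT: "keys m \<subseteq> T"
      have "xmon T + m \<in> keys (pmon (xmon T) * r)" using m by (simp add: keys_pmon_times)
      then have "keys (xmon T + m) \<notin> pg \<Delta> d" using r(2) by (auto simp: K_def SP_def MS_def)
      moreover have "keys (xmon T + m) = T" using mT by (auto simp: keys_plus_mon xT)
      ultimately show False using Tpg(1) by simp
    qed
    then show "r \<in> PT n T" using r(1) by (auto simp: PT_def SP_def MS_def)
  qed
  from pres_dim_ge[OF P.pres_axioms this T1(1)] have ge: "enat d \<le> mod_dim (poly_ring n) Q" by (simp add: T(2))
  let ?F = "{T. facet \<Delta> T \<and> card T = d}"
  have "krull_dim (poly_ring n Quot annihilator (poly_ring n) Q) \<le> enat d"
  proof (rule krull_le_card[OF P.annihilator_pm])
    show "T \<subseteq> {1..n} \<and> card T \<le> d" if "T \<in> ?F" for T using that cplx_sub[OF cx] by (auto simp: facet_def)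
    then have "?F \<subseteq> Pow {1..n}" by blast
    then show "finite ?F" using finite_subset by blast
    show "MI n {A. \<forall>T\<in>?F. \<not> A \<subseteq> T} \<subseteq> annihilator (poly_ring n) Q"
    proof
      fix r assume r: "r \<in> (MI n {A. \<forall>T\<in>?F. \<not> A \<subseteq> T} :: 'k pol set)"
      have rS: "r \<in> Sn n" using r MI_mono[of "{A. \<forall>T\<in>?F. \<not> A \<subseteq> T}" UNIV n] by auto
      \<comment> \<open>A facet containing the support of a monomial of the product would have size
        \<open>d\<close>, which \<open>r\<close> excludes, or more, which \<open>y\<close>
        excludes.\<close>
      have "r * y \<in> K" if y: "y \<in> N" for y
      proof -
        have "m \<in> MS n (- pg \<Delta> d)" if m: "m \<in> keys (r * y)" for m
        proof -
          obtain a b where ab: "m = a + b" "a \<in> keys r" "b \<in> keys y" using m keys_mult[of r y] by blast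
          have a: "keys a \<subseteq> {1..n}" "\<And>T. facet \<Delta> T \<Longrightarrow> card T = d \<Longrightarrow> \<not> keys a \<subseteq> T"
            using subsetD[OF r[unfolded SP_def mem_Collect_eq] ab(2)] by (auto simp: MS_def)
          have b: "keys b \<subseteq> {1..n}" "keys b \<notin> pg \<Delta> (Suc d)" using y ab(3) by (auto simp: N_def SP_def MS_def)
          have "keys m \<notin> pg \<Delta> d"
          proof
            assume "keys m \<in> pg \<Delta> d"
            then obtain B where B: "B \<in> \<Delta>" "keys m \<subseteq> B" "d \<le> card B" by (auto simp: pg_def)
            obtain C where C: "facet \<Delta> C" "B \<subseteq> C" using facet_exists[OF cx B(1)] by blast
            have C': "C \<in> \<Delta>" "finite C" using C(1) cplx_fin[OF cx] by (auto simp: facet_def)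
            have kc: "keys a \<subseteq> C" "keys b \<subseteq> C" using B(2) C(2) by (auto simp: ab(1) keys_plus_mon)
            have "d \<le> card C" using B(3) card_mono[OF C'(2) C(2)] by simp
            moreover have "card C \<noteq> d" using a(2)[OF C(1)] kc(1) by blast
            ultimately have "Suc d \<le> card C" by simp
            then have "keys b \<in> pg \<Delta> (Suc d)" using kc(2) C'(1) cplx_down[OF cx C'(1) kc(2)] by (auto simp: pg_def)
            then show False using b(2) by blast
          qed
          then show ?thesis using a(1) b(1) by (simp add: MS_def ab(1) keys_plus_mon)
        qed
        then show ?thesis by (auto simp: K_def SP_def)
      qed
      then show "r \<in> annihilator (poly_ring n) Q" unfolding P.annihilator_pres using rS by blast
    qed
  qed
  then show "mod_dim (poly_ring n) Q = enat d" using ge unfolding mod_dim_def by (rule order_antisym)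
qed

text \<open>Between consecutive facet sizes the complexes \<open>pg\<close> do not change, so the
  sizes in increasing order index submodules that grow strictly, with strictly growing dimensions of
  the quotients.\<close>

lemma Th_imp_seqCM:
  fixes ty :: "'k::field itself"
  assumes cx: "cplx n \<Delta>" and Th: "\<And>d. Th ty n (pg \<Delta> d) d"
  shows "sequentially_CM_ideal n (MI n (- \<Delta>) :: 'k pol set)"
proof -
  define I where "I = (MI n (- \<Delta>) :: 'k pol set)"
  have I: "pm n I" "I \<subseteq> Sn n" "gr I"
    unfolding I_def by (rule pm_MI[OF up_compl[OF cx]], rule MI_mono, simp, rule gr_MI)
  let ?h = "\<lambda>p. I +>\<^bsub>ring_mod n\<^esub> p"
  define Q where "Q = mod_quot (ring_mod n) I"
  interpret M: pres_graded n Q ?h I unfolding Q_def by (rule pres_graded_quotient[OF I])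
  define sz where "sz = card ` {B. facet \<Delta> B}"
  have "sz \<subseteq> {..n}" unfolding sz_def using card_le_n[OF cx] by (auto simp: facet_def)
  then have fsz: "finite sz" using finite_subset by blast
  define es where "es = sorted_list_of_set sz"
  define r where "r = length es"
  \<comment> \<open>The extra value \<open>Suc n\<close> exceeds all face sizes and makes the last
    complex void, so the filtration ends at the whole module.\<close>
  define a where "a i = (if i < r then es ! i else Suc n)" for i
  have set_es: "set es = sz" unfolding es_def using fsz by simp
  have less: "es ! i < es ! k" if "i < k" "k < r" for i k
    using sorted_wrt_nth_less[of "(<)" es i k] that by (simp add: es_def r_def)
  have idx: "\<exists>k<r. card B = es ! k" if "facet \<Delta> B" for B
    using that set_es unfolding sz_def r_def by (metis imageI in_set_conv_nth mem_Collect_eq)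
  have esn: "es ! i \<le> n" if "i < r" for i using \<open>sz \<subseteq> {..n}\<close> set_es nth_mem[of i es] that by (auto simp: r_def)
  define L where "L i = (MI n (- pg \<Delta> (a i)) :: 'k pol set)" for i
  have pg0: "pg \<Delta> (a 0) = \<Delta>"
  proof -
    have "a 0 \<le> card B" if B: "facet \<Delta> B" for B
    proof -
      obtain k where k: "k < r" "card B = es ! k" using idx[OF B] by blast
      then show ?thesis using less[of 0 k] by (cases "k = 0") (auto simp: a_def)
    qed
    then have "pg \<Delta> 0 = pg \<Delta> (a 0)" by (intro pg_eq[OF cx]) auto
    then show ?thesis by (auto simp: pg_def)
  qed
  have pgS: "pg \<Delta> (a (Suc i)) = pg \<Delta> (Suc (es ! i))" if i: "i < r" for i
  proof (rule pg_eq[OF cx, symmetric])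
    show "Suc (es ! i) \<le> a (Suc i)" using less[of i "Suc i"] esn[OF i] by (auto simp: a_def)
    fix B assume B: "facet \<Delta> B" "Suc (es ! i) \<le> card B"
    obtain k where k: "k < r" "card B = es ! k" using idx[OF B(1)] by blast
    have "i < k"
    proof (rule ccontr)
      assume "\<not> i < k"
      then consider "k = i" | "k < i" by linarith
      then show False using less[of k i] B(2) k(2) i by cases auto
    qed
    then show "a (Suc i) \<le> card B" using less[of "Suc i" k] k by (cases "k = Suc i") (auto simp: a_def)
  qed
  have pgr: "pg \<Delta> (a r) = {}" using card_le_n[OF cx] by (force simp: a_def pg_def)
  have L: "pm n (L i)" "L i \<subseteq> Sn n" "gr (L i)" "I \<subseteq> L i" for i
  proof -
    show "pm n (L i)" "gr (L i)" unfolding L_def by (auto intro: pm_MI up_compl pg_cplx cx gr_MI)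
    show "L i \<subseteq> Sn n" unfolding L_def by (rule MI_mono) simp
    show "I \<subseteq> L i" unfolding L_def I_def by (rule MI_mono) (auto simp: pg_def)
  qed
  have L0: "L 0 = I" by (simp add: L_def I_def pg0)
  have Lr: "L r = Sn n" by (simp add: L_def pgr)
  have sm: "submodule (?h ` L i) (poly_ring n) Q" for i by (rule M.submodule_image[OF L(1,2)])
  have vi: "M.vi (?h ` L i) = L i" for i by (rule M.vi_image[OF L(2,4,1)])
  let ?Q = "\<lambda>i. mod_quot (Q\<lparr>carrier := ?h ` L (Suc i)\<rparr>) (?h ` L i)"
  have step: "?h ` L i \<subset> ?h ` L (Suc i) \<and>
      depth (poly_ring n) (irrelevant_ideal n) (?Q i) = enat (es ! i) \<and>
      mod_dim (poly_ring n) (?Q i) = enat (es ! i)" if i: "i < r" for i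
  proof -
    let ?d = "es ! i"
    have "?d \<in> sz" using set_es nth_mem[of i es] i by (auto simp: r_def)
    then obtain T where T: "facet \<Delta> T" "card T = ?d" by (auto simp: sz_def)
    have La: "L i = MI n (- pg \<Delta> ?d)" "L (Suc i) = MI n (- pg \<Delta> (Suc ?d))"
      using i by (simp_all add: L_def a_def pgS[OF i, unfolded a_def])
    have sub: "L i \<subseteq> L (Suc i)" unfolding La by (rule MI_mono) (use pg_mono[of ?d "Suc ?d" \<Delta>] in auto)
    have fT: "finite T" "T \<subseteq> {1..n}" using T(1) cplx_fin[OF cx] cplx_sub[OF cx] by (auto simp: facet_def)
    have "pmon (xmon T) \<in> L (Suc i)" "pmon (xmon T) \<notin> L i"
      unfolding La mem_SP_pmon using fT facet_pg[OF cx T(1)] T(2) by (auto simp: MS_def keys_xmon)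
    then have "L i \<noteq> L (Suc i)" by blast
    then have "?h ` L i \<noteq> ?h ` L (Suc i)" using vi by metis
    then have 1: "?h ` L i \<subset> ?h ` L (Suc i)" using sub by blast
    have "?h ` L i \<subseteq> ?h ` L (Suc i)" using 1 by blast
    note P = M.pres_subquot[OF sm sm this, unfolded vi]
    define Qi where "Qi = ?Q i"
    define gi where "gi = (\<lambda>x. ?h ` L i +>\<^bsub>Q\<lparr>carrier := ?h ` L (Suc i)\<rparr>\<^esub> ?h x)"
    have "pres n Qi (L (Suc i)) (L i) gi" using P unfolding Qi_def gi_def .
    note C = CM_quotient[OF cx T Th Th this[unfolded La]]
    show ?thesis unfolding Qi_def[symmetric] by (intro conjI 1 C)
  qed
  have "sequentially_CM (poly_ring n) (irrelevant_ideal n) Q (\<lambda>d. ?h ` poly_comp n d)"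
    unfolding sequentially_CM_def
  proof (intro exI[of _ r] exI[of _ "\<lambda>i. ?h ` L i"] conjI allI impI)
    have "\<And>x. x \<in> I \<Longrightarrow> ?h x = \<zero>\<^bsub>Q\<^esub>" using M.h_zero I(2) by blast
    then show "?h ` L 0 = {\<zero>\<^bsub>Q\<^esub>}" unfolding L0 using pm_0[OF I(1)] by blast
    show "?h ` L r = carrier Q" unfolding Lr M.h_carrier ..
    show "graded_submodule (poly_ring n) Q (\<lambda>d. ?h ` poly_comp n d) (?h ` L i)" for i
      by (rule M.graded_image[OF L(1,2,3)])
    show "?h ` L i \<subset> ?h ` L (Suc i)"
      "cohen_macaulay (poly_ring n) (irrelevant_ideal n) (?Q i)" if "i < r" for i
      using step[OF that] by (simp_all add: cohen_macaulay_def)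
    show "mod_dim (poly_ring n) (?Q i)
        < mod_dim (poly_ring n) (?Q (Suc i))" if "Suc i < r" for i
      using step[of i] step[of "Suc i"] less[of i "Suc i"] that by simp
  qed
  then show ?thesis unfolding sequentially_CM_ideal_def Q_def I_def .
qed

lemma Th_simplex:
  fixes ty :: "'k::field itself"
  assumes F: "F \<subseteq> {1..n}"
  shows "Th ty n (Pow F) (card F)" "F \<noteq> {} \<Longrightarrow> Th ty n {T. T \<subset> F} (card F - 1)"
proof -
  interpret glue_cone "Th ty n" n by (rule Th_glue_cone)
  have fin: "finite F" using F finite_subset by blast
  show "Th ty n (Pow F) (card F)"
    by (rule shifted[where V = F and p = int]) (use F fin in \<open>auto simp: cplx_def card_mono inj_on_def\<close>)
  assume ne: "F \<noteq> {}"
  show "Th ty n {T. T \<subset> F} (card F - 1)"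
  proof (rule shifted[where V = F and p = int])
    fix T assume "T \<in> {T. T \<subset> F}"
    then have T: "T \<subset> F" by simp
    then show "card T \<le> card F - 1" using psubset_card_mono[OF fin T] by linarith
    obtain x where x: "x \<in> F" "x \<notin> T" using T by blast
    then show "\<exists>B\<in>{T. T \<subset> F}. T \<subseteq> B \<and> card B = card F - 1" using T fin by (intro bexI[of _ "F - {x}"]) auto
  qed (use F in \<open>auto simp: cplx_def inj_on_def\<close>)
qed

text \<open>A facet \<open>F\<close> with more than \<open>p\<close> vertices is a simplex attached
  along its boundary, and the boundary has depth \<open>card F - 1\<close>, enough for gluing. Depth
  \<open>p\<close> is thus decided on the faces of size at most \<open>p\<close>.\<close>

lemma Th_add_faces:
  fixes ty :: "'k::field itself"
  assumes "cplx n \<Delta>" "Th ty n {T \<in> \<Delta>. card T \<le> p} p"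
  shows "Th ty n \<Delta> p" using assms
proof (induction "card {T \<in> \<Delta>. p < card T}" arbitrary: \<Delta> rule: less_induct)
  case less
  note cx = less.prems(1)
  have "\<Delta> \<subseteq> Pow {1..n}" using cplx_sub[OF cx] by blast
  then have fin: "finite \<Delta>" using finite_subset by blast
  show ?case
  proof (cases "{T \<in> \<Delta>. p < card T} = {}")
    case True
    then have "{T \<in> \<Delta>. card T \<le> p} = \<Delta>" by (auto simp: not_less)
    then show ?thesis using less.prems(2) by simp
  next case False
    then obtain F0 where F0: "F0 \<in> \<Delta>" "p < card F0" by blast
    obtain F where F: "facet \<Delta> F" "F0 \<subseteq> F" using facet_exists[OF cx F0(1)] by blast
    have F\<Delta>: "F \<in> \<Delta>" using F(1) by (simp add: facet_def)
    have Fn: "F \<subseteq> {1..n}" "finite F" using cplx_sub[OF cx F\<Delta>] cplx_fin[OF cx F\<Delta>] .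
    have pF: "p < card F" using F0(2) card_mono[OF Fn(2) F(2)] by linarith
    have top: "B = F" if B: "B \<in> \<Delta>" "F \<subseteq> B" for B
    proof (rule ccontr)
      assume "B \<noteq> F"
      then obtain v where "v \<in> B" "v \<notin> F" using B(2) by blast
      then show False using F(1) cplx_down[OF cx B(1), of "insert v F"] B(2) by (auto simp: facet_def)
    qed
    let ?G = "\<Delta> - {F}"
    have cG: "cplx n ?G" using top cplx_sub[OF cx] cplx_down[OF cx] by (intro cplxI) blast+
    have IH: "Th ty n ?G p"
    proof (rule less.hyps[OF _ cG])
      show "card {T \<in> ?G. p < card T} < card {T \<in> \<Delta>. p < card T}"
        by (rule psubset_card_mono) (use fin F\<Delta> pF in auto)
      have "{T \<in> ?G. card T \<le> p} = {T \<in> \<Delta>. card T \<le> p}" using pF by auto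
      then show "Th ty n {T \<in> ?G. card T \<le> p} p" using less.prems(2) by simp
    qed
    interpret glue_cone "Th ty n" n by (rule Th_glue_cone)
    show ?thesis
    proof (cases p)
      case 0 then show ?thesis by (simp add: Th_def thetas_def One_nat_def)
    next case (Suc e) have "Th ty n (?G \<union> Pow F) (Suc e)"
      proof (rule glue[OF cG])
        show "cplx n (Pow F)" using Fn(1) by (auto simp: cplx_def)
        show "Th ty n ?G (Suc e)" using IH Suc by simp
        show "Th ty n (Pow F) (Suc e)" by (rule Th_lower[OF Th_simplex(1)[OF Fn(1)]]) (use pF Suc in simp)
        have "?G \<inter> Pow F = {T. T \<subset> F}" using cplx_down[OF cx F\<Delta>] by blast
        moreover have "Th ty n {T. T \<subset> F} e" by (rule Th_lower[OF Th_simplex(2)[OF Fn(1)]]) (use pF Suc in auto)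
        ultimately show "Th ty n (?G \<inter> Pow F) e" by simp
      qed
      moreover have "?G \<union> Pow F = \<Delta>" using F\<Delta> cplx_down[OF cx F\<Delta>] by blast
      ultimately show ?thesis using Suc by simp
    qed
  qed
qed

section \<open>Squarefree lexsegments\<close>

text \<open>The first index where the sets differ belongs to \<open>Q\<close>, so \<open>Q\<close>
  is the larger one, in agreement with the order on monomials.\<close>

definition slex :: "nat set \<Rightarrow> nat set \<Rightarrow> bool" where
  "slex P Q \<longleftrightarrow> (\<exists>k. k \<in> Q \<and> k \<notin> P \<and> (\<forall>i<k. i \<in> P \<longleftrightarrow> i \<in> Q))"

lemma xmon_less: "finite P \<Longrightarrow> finite Q \<Longrightarrow> xmon P < xmon Q \<longleftrightarrow> slex P Q"
  unfolding less_poly_mapping.rep_eq less_fun_def slex_def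
  by (rule arg_cong[of _ _ Ex]) (auto simp: lookup_xmon fun_eq_iff split: if_splits)

lemma slex_irrefl: "\<not> slex P P" by (auto simp: slex_def)

text \<open>Complementing swaps membership at the first difference; passing to the dual therefore
  reverses the order.\<close>

lemma slex_compl: "W \<subseteq> {1..n} \<Longrightarrow> W' \<subseteq> {1..n} \<Longrightarrow> slex ({1..n} - W') ({1..n} - W) \<longleftrightarrow> slex W W'"
proof -
  assume W: "W \<subseteq> {1..n}" "W' \<subseteq> {1..n}"
  have "(i \<in> {1..n} - W' \<longleftrightarrow> i \<in> {1..n} - W) \<longleftrightarrow> (i \<in> W \<longleftrightarrow> i \<in> W')" for i using W by blast
  moreover have "(k \<in> {1..n} - W \<and> k \<notin> {1..n} - W' \<and> R) \<longleftrightarrow> (k \<in> W' \<and> k \<notin> W \<and> R)" for k R using W by blast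
  ultimately show ?thesis unfolding slex_def by presburger
qed

lemma xmon_sf:
  assumes W: "W \<subseteq> {1..n}" shows "xmon W \<in> sf_mon n d \<longleftrightarrow> card W = d"
proof
  have fW: "finite W" using W finite_subset by blast
  {
    assume "xmon W \<in> sf_mon n d"
    then obtain W' where W': "W' \<subseteq> {1..n}" "card W' = d" "xmon W = xmon W'" unfolding sf_mon_eq by blast
    then have "finite W'" using finite_subset by blast
    then have "W = W'" using xmon_inj[OF fW, of W'] W'(3) by blast
    then show "card W = d" using W'(2) by simp
  }
  show "xmon W \<in> sf_mon n d" if "card W = d" unfolding sf_mon_eq using W that by blast
qed

lemma xmon_insert: "finite W \<Longrightarrow> i \<notin> W \<Longrightarrow> xmon W + single i 1 = xmon (insert i W)"
  by (simp add: xmon_def add.commute)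

text \<open>A set of size \<open>d + i\<close> is reached from a generator inside it by adding the
  missing elements one by one, so the iterated shadow consists of the nonfaces of that size.\<close>

lemma shad_iter:
  assumes M: "M \<subseteq> sf_mon n d"
  shows "(shad n ^^ i) M = xmon ` {S. S \<subseteq> {1..n} \<and> card S = d + i \<and> S \<notin> fc n M}"
proof -
  let ?N = "\<lambda>k. {S. S \<subseteq> {1..n} \<and> card S = k \<and> S \<notin> fc n M}"
  show ?thesis
  proof (induction i)
    case 0 have "M = xmon ` ?N d"
    proof
      show "M \<subseteq> xmon ` ?N d"
      proof
        fix m assume m: "m \<in> M"
        then obtain W where "W \<subseteq> {1..n}" "card W = d" "m = xmon W" using M unfolding sf_mon_eq by blast
        then show "m \<in> xmon ` ?N d" using m by (auto simp: fc_def)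
      qed
      show "xmon ` ?N d \<subseteq> M"
      proof clarify
        fix S assume S: "S \<subseteq> {1..n}" "S \<notin> fc n M" "d = card S"
        then obtain W where W: "W \<subseteq> S" "xmon W \<in> M" by (auto simp: fc_def)
        have "card W = card S" using xmon_sf[of W n d] W S M by auto
        then have "W = S" using card_subset_eq[of S W] W(1) S(1) finite_subset by blast
        then show "xmon S \<in> M" using W by simp
      qed
    qed
    then show ?case by simp
  next case (Suc i) have fin: "finite W" if "W \<subseteq> {1..n}" for W using that finite_subset by blast
    have "shad n ((shad n ^^ i) M) = xmon ` ?N (d + Suc i)" unfolding Suc.IH
    proof
      show "shad n (xmon ` ?N (d + i)) \<subseteq> xmon ` ?N (d + Suc i)"
      proof
        fix m assume "m \<in> shad n (xmon ` ?N (d + i))"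
        then obtain S k where S: "S \<subseteq> {1..n}" "card S = d + i" "S \<notin> fc n M" "m = xmon S + single k 1" "k \<in> {1..n}" "lookup (xmon S) k = 0"
          unfolding shad_def by blast
        have k: "k \<notin> S" using S(6) lookup_xmon[OF fin[OF S(1)]] by (simp split: if_splits)
        have "m = xmon (insert k S)" unfolding S(4) by (rule xmon_insert[OF fin[OF S(1)] k])
        moreover have "insert k S \<notin> fc n M" using S(3) cplx_down[OF fc_cplx, of "insert k S" n M S] by blast
        ultimately show "m \<in> xmon ` ?N (d + Suc i)" using S k fin[OF S(1)] by auto
      qed
      show "xmon ` ?N (d + Suc i) \<subseteq> shad n (xmon ` ?N (d + i))"
      proof clarify
        fix S assume S: "S \<subseteq> {1..n}" "card S = d + Suc i" "S \<notin> fc n M"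
        then obtain W where W: "W \<subseteq> S" "xmon W \<in> M" by (auto simp: fc_def)
        have "W \<subseteq> {1..n}" using W(1) S(1) by blast
        then have "card W = d" using xmon_sf[of W n d] W(2) M by auto
        then have "W \<noteq> S" using S(2) by auto
        then obtain k where k: "k \<in> S" "k \<notin> W" using W(1) by blast
        have "S - {k} \<subseteq> {1..n}" "card (S - {k}) = d + i" "S - {k} \<notin> fc n M"
          using S W k fin[OF S(1)] by (auto simp: fc_def)
        moreover have "xmon S = xmon (S - {k}) + single k 1"
          using xmon_insert[of "S - {k}" k] fin[OF S(1)] k(1) by (simp add: insert_absorb)
        moreover have "lookup (xmon (S - {k})) k = 0" using lookup_xmon[of "S - {k}"] fin[OF S(1)] by simp
        moreover have "k \<in> {1..n}" using k S(1) by blast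
        ultimately show "xmon S \<in> shad n (xmon ` ?N (d + i))" unfolding shad_def by blast
      qed
    qed
    then show ?case by simp
  qed
qed

lemma slex_total: "finite P \<Longrightarrow> finite Q \<Longrightarrow> slex P Q \<or> P = Q \<or> slex Q P"
  using xmon_less xmon_inj by (metis linorder_neqE)

lemma slex_trans: "finite P \<Longrightarrow> finite Q \<Longrightarrow> finite R \<Longrightarrow> slex P Q \<Longrightarrow> slex Q R \<Longrightarrow> slex P R"
  using xmon_less less_trans by metis

section \<open>Lexicographic meaning of the complexes\<close>

lemma Dc_slex:
  assumes "sorted_wrt (<) v" "W \<subseteq> {1..n}" "card W = length v"
  shows "W \<in> Dc n v \<longleftrightarrow> slex W (set v)" using assms
proof (induction v arbitrary: W)
  case Nil then show ?case using finite_subset by (auto simp: slex_def)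
next case (Cons b v) have fW: "finite W" using Cons.prems(2) finite_subset by blast
  have bv: "b < x" if "x \<in> set v" for x using Cons.prems(1) that by simp
  have sv: "sorted_wrt (<) v" using Cons.prems(1) by simp
  show ?case
  proof (cases "b \<in> W")
    case True have IH: "W - {b} \<in> Dc n v \<longleftrightarrow> slex (W - {b}) (set v)"
      by (rule Cons.IH[OF sv]) (use Cons.prems fW True in auto)
    \<comment> \<open>The size condition in \<open>Dc\<close> for the tail, whose first entry
      exceeds \<open>b\<close>, implies the one for the whole list.\<close>
    have len: "b + length (b # v) \<le> n" if "W - {b} \<in> Dc n v"
    proof (cases v)
      case Nil then show ?thesis using that by simp
    next case (Cons b' v')
      then have "b' + length v \<le> n" using that by (simp split: if_splits)
      moreover have "b < b'" using bv Cons by simp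
      ultimately show ?thesis by simp
    qed
    have sub: "W \<subseteq> {b..n}" if D: "W - {b} \<in> Dc n v"
    proof
      fix x assume x: "x \<in> W"
      show "x \<in> {b..n}"
      proof (cases "x = b")
        case True then show ?thesis using x Cons.prems(2) by auto
      next case False then show ?thesis using x subsetD[OF Dc_gt[OF D, of b] , of x] bv by auto
      qed
    qed
    have "slex W (set (b # v)) \<longleftrightarrow> slex (W - {b}) (set v)"
    proof
      assume "slex W (set (b # v))"
      then obtain k where k: "k \<in> set (b # v)" "k \<notin> W" "\<forall>i<k. i \<in> W \<longleftrightarrow> i \<in> set (b # v)" unfolding slex_def by blast
      have "k \<in> set v" using k True by auto
      moreover have "\<forall>i<k. i \<in> W - {b} \<longleftrightarrow> i \<in> set v" using k(3) bv by auto
      ultimately show "slex (W - {b}) (set v)" using k(2) unfolding slex_def by blast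
    next
      assume "slex (W - {b}) (set v)"
      then obtain k where k: "k \<in> set v" "k \<notin> W - {b}" "\<forall>i<k. i \<in> W - {b} \<longleftrightarrow> i \<in> set v" unfolding slex_def by blast
      have "k \<notin> W" using k bv by auto
      moreover have "\<forall>i<k. i \<in> W \<longleftrightarrow> i \<in> set (b # v)" using k(3) True by auto
      ultimately show "slex W (set (b # v))" using k(1) unfolding slex_def by auto
    qed
    then show ?thesis using IH len sub True by auto
  next case False have "slex W (set (b # v)) \<longleftrightarrow> W \<subseteq> {b..n}"
    proof
      assume "slex W (set (b # v))"
      then obtain k where k: "k \<in> set (b # v)" "k \<notin> W" "\<forall>i<k. i \<in> W \<longleftrightarrow> i \<in> set (b # v)" unfolding slex_def by blast
      have kb: "b \<le> k" using k(1) bv by (auto simp: less_imp_le)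
      have "b \<le> x" if "x \<in> W" for x
      proof (cases "x < k")
        case True then show ?thesis using k(3) that bv by (auto simp: less_imp_le)
      qed (use kb in simp)
      then show "W \<subseteq> {b..n}" using Cons.prems(2) by auto
    next
      assume "W \<subseteq> {b..n}"
      then have "\<forall>i<b. i \<in> W \<longleftrightarrow> i \<in> set (b # v)" using bv by force
      then show "slex W (set (b # v))" using False unfolding slex_def by auto
    qed
    moreover have "b + length (b # v) \<le> n" if W: "W \<subseteq> {b..n}"
    proof -
      have "W \<subseteq> {b<..n}" using W False by (auto simp: less_le)
      then have "card W \<le> n - b" using card_mono[of "{b<..n}" W] by simp
      then show ?thesis using Cons.prems(3) by simp
    qed
    ultimately show ?thesis using False by auto
  qed
qed

text \<open>Large faces are determined by their subsets of size \<open>length v\<close>. Needed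
  because the complex of the ideal is given through generators of that size.\<close>

lemma Dc_of_subsets:
  assumes "T \<subseteq> {1..n}" "length v \<le> card T" "\<And>W. W \<subseteq> T \<Longrightarrow> card W = length v \<Longrightarrow> W \<in> Dc n v"
  shows "T \<in> Dc n v" using assms
proof (induction v arbitrary: T)
  case Nil
  from Nil.prems(3)[of "{}"] show ?case by simp
next case (Cons b v) have fT: "finite T" using Cons.prems(1) finite_subset by blast
  obtain W0 where W0: "W0 \<subseteq> T" "card W0 = length (b # v)" using obtain_subset_with_card_n[OF Cons.prems(2)] by blast
  have W0D: "W0 \<in> Dc n (b # v)" by (rule Cons.prems(3)[OF W0])
  then have len: "b + length (b # v) \<le> n" by (auto split: if_splits)
  have sub: "T \<subseteq> {b..n}"
  proof
    fix t assume t: "t \<in> T"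
    show "t \<in> {b..n}"
    proof (cases "t \<in> W0")
      case True then show ?thesis using W0D len by auto
    next case False have f0: "finite W0" using W0(1) fT finite_subset by blast
      obtain w where w: "w \<in> W0" using W0(2) by fastforce
      have "insert t (W0 - {w}) \<in> Dc n (b # v)"
        by (rule Cons.prems(3)) (use t W0 card_exchange[OF f0 w False] in auto)
      then show ?thesis using len by auto
    qed
  qed
  have "T - {b} \<in> Dc n v" if b: "b \<in> T"
  proof (rule Cons.IH)
    show "T - {b} \<subseteq> {1..n}" "length v \<le> card (T - {b})" using Cons.prems(1,2) b fT by auto
    fix W assume W: "W \<subseteq> T - {b}" "card W = length v"
    then have fW: "finite W" "b \<notin> W" using fT finite_subset by blast+
    have "insert b W \<in> Dc n (b # v)" by (rule Cons.prems(3)) (use W b fW in auto)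
    then show "W \<in> Dc n v" using len fW(2) by simp
  qed
  then show ?case using len sub by simp
qed

lemma Gc_slex:
  assumes "sorted_wrt (<) F" "set F \<subseteq> {c<..n}" "W \<subseteq> {c<..n}" "card W = length F"
  shows "W \<in> Gc n c F \<longleftrightarrow> slex (set F) W" using assms
proof (induction F arbitrary: W c)
  case Nil
  then have "W = {}" using finite_subset[OF Nil.prems(3)] by simp
  then show ?case by (simp add: slex_def)
next case (Cons x F)
  note F = sorted_wrt_Cons_ge[OF Cons.prems(1,2)]
  have xF: "x < z" if "z \<in> set F" for z using Cons.prems(1) that by simp
  have fW: "finite W" using Cons.prems(3) finite_subset by blast
  have mem: "W \<in> Gc n c (x # F) \<longleftrightarrow> (\<exists>y\<in>W. y < x) \<or> W - {x} \<in> Gc n x F" using Cons.prems(3,4) by simp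
  show ?case
  proof (cases "\<exists>y\<in>W. y < x")
    case True
    define k where "k = Min W"
    have ne: "W \<noteq> {}" using True by blast
    have k: "k \<in> W" "\<And>y. y \<in> W \<Longrightarrow> k \<le> y" unfolding k_def using fW ne by auto
    then have kx: "k < x" using True by fastforce
    have "k \<notin> set (x # F)" using kx xF by fastforce
    moreover have "\<forall>i<k. i \<in> set (x # F) \<longleftrightarrow> i \<in> W" using kx xF k(2) by fastforce
    ultimately have "slex (set (x # F)) W" using k(1) unfolding slex_def by blast
    then show ?thesis using mem True by blast
  next case no: False show ?thesis
    proof (cases "x \<in> W")
      case True have IH: "W - {x} \<in> Gc n x F \<longleftrightarrow> slex (set F) (W - {x})"
      proof (rule Cons.IH)
        show "W - {x} \<subseteq> {x<..n}"
        proof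
          fix y assume y: "y \<in> W - {x}"
          then have "\<not> y < x" "y \<noteq> x" "y \<le> n" using no Cons.prems(3) by auto
          then show "y \<in> {x<..n}" by simp
        qed
        show "card (W - {x}) = length F" using Cons.prems(4) True fW by simp
      qed (use F in auto)
      have "slex (set (x # F)) W \<longleftrightarrow> slex (set F) (W - {x})"
      proof
        assume "slex (set (x # F)) W"
        then obtain k where k: "k \<in> W" "k \<notin> set (x # F)" "\<forall>i<k. i \<in> set (x # F) \<longleftrightarrow> i \<in> W" unfolding slex_def by blast
        have "\<forall>i<k. i \<in> set F \<longleftrightarrow> i \<in> W - {x}" using k(3) xF by auto
        then show "slex (set F) (W - {x})" using k(1,2) unfolding slex_def by auto
      next
        assume "slex (set F) (W - {x})"
        then obtain k where k: "k \<in> W - {x}" "k \<notin> set F" "\<forall>i<k. i \<in> set F \<longleftrightarrow> i \<in> W - {x}" unfolding slex_def by blast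
        have "\<forall>i<k. i \<in> set (x # F) \<longleftrightarrow> i \<in> W" using k(3) True by auto
        then show "slex (set (x # F)) W" using k(1,2) unfolding slex_def by auto
      qed
      then show ?thesis using mem no IH by blast
    next case False have "W - {x} \<notin> Gc n x F" using Gc_card[of "W - {x}" n x F] False Cons.prems(4) by auto
      moreover have "\<not> slex (set (x # F)) W"
      proof
        assume "slex (set (x # F)) W"
        then obtain k where k: "k \<in> W" "k \<notin> set (x # F)" "\<forall>i<k. i \<in> set (x # F) \<longleftrightarrow> i \<in> W" unfolding slex_def by blast
        have "x < k" using k(1,2) no by (metis linorder_neqE_nat list.set_intros(1))
        then show False using k(3) False by auto
      qed
      ultimately show ?thesis using mem no by blast
    qed
  qed
qed

text \<open>\<open>B\<^sub>0\<close> is the lexicographic successor of \<open>V\<close>: its \<open>s\<close>-th element moves up by one, the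
  following ones close up behind it.\<close>

lemma slex_next:
  assumes V: "V \<subseteq> {1..n}" "card V = q" and a: "a \<in> V" "card (V \<inter> {..<a}) + 1 = s" "s \<le> q"
    and tail: "V \<inter> {a<..} = {n - q + s + 1..n}" and e: "a + q - s + 1 \<le> n"
    and B0: "B0 = V \<inter> {..<a} \<union> {a<..a + q - s + 1}"
    and B: "B \<subseteq> {1..n}" "card B = q"
  shows "slex B V \<longleftrightarrow> \<not> slex B0 B"
proof -
  have fin: "finite V" "finite B" using V(1) B(1) finite_subset by blast+
  have f0: "finite B0" using fin by (simp add: B0)
  have c0: "card B0 = q"
  proof -
    have "card B0 = card (V \<inter> {..<a}) + card {a<..a + q - s + 1}"
      unfolding B0 by (rule card_Un_disjoint) (use fin in auto)
    then show ?thesis using a(2,3) by simp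
  qed
  show ?thesis
  proof
    assume "slex B V"
    then obtain k where k: "k \<in> V" "k \<notin> B" "\<And>i. i < k \<Longrightarrow> i \<in> B \<longleftrightarrow> i \<in> V" unfolding slex_def by blast
    show "\<not> slex B0 B"
    proof
      assume "slex B0 B"
      then obtain k' where k': "k' \<in> B" "k' \<notin> B0" "\<And>i. i < k' \<Longrightarrow> i \<in> B0 \<longleftrightarrow> i \<in> B" unfolding slex_def by blast
      consider "k < a" | "k = a" | "a < k" by linarith
      then show False
      proof cases
        case 1
        then have "k \<in> B0" using k(1) by (simp add: B0)
        then have "\<not> k < k'" using k'(3) k(2) by blast
        then have "k' < k" using k' k(2) by (metis linorder_neqE_nat)
        then show False using k(3)[of k'] k' 1 by (simp add: B0)
      \<comment> \<open>\<open>B\<close> agrees with \<open>V\<close> below \<open>a\<close> and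
        omits \<open>a\<close>; being above \<open>B0\<close> it would contain all of
        \<open>B0\<close> and one more element.\<close>
      next case 2 have "\<not> k' < a" using k'(1,2) k(3)[of k'] 2 by (auto simp: B0)
        moreover have "k' \<noteq> a" using k'(1) k(2) 2 by blast
        ultimately have "a + q - s + 1 < k'" using k'(2) by (auto simp: B0)
        then have "i < k'" if "i \<in> B0" for i using that a(3) by (auto simp: B0)
        then have "B0 \<subseteq> B" using k'(3) by blast
        then have "insert k' B0 \<subseteq> B" using k'(1) by simp
        then have "card (insert k' B0) \<le> card B" by (rule card_mono[OF fin(2)])
        then show False using k'(2) f0 c0 B(2) by simp
      \<comment> \<open>Beyond \<open>a\<close> the set \<open>V\<close> runs to the end, so
        \<open>B\<close>, which omits \<open>k\<close> there, has nothing to replace it by and is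
        too small.\<close>
      next case 3
        then have "k \<in> {n - q + s + 1..n}" using k(1) tail by blast
        then have "x \<in> V \<inter> {a<..}" if "k \<le> x" "x \<le> n" for x unfolding tail using that by simp
        then have "x \<in> V" if "k \<le> x" "x \<le> n" for x using that by blast
        then have "x \<in> V - {k}" if "x \<in> B" for x using that k(2,3) B(1) by (cases "x < k") auto
        then have "B \<subseteq> V - {k}" by blast
        then have "card B \<le> card (V - {k})" using fin by (intro card_mono) auto
        moreover have "card (V - {k}) < card V" by (rule psubset_card_mono) (use k(1) fin in auto)
        ultimately show False using B(2) V(2) by simp
      qed
    qed
  next
    assume "\<not> slex B0 B"
    then have "B = B0 \<or> slex B B0" using slex_total[OF fin(2) f0] by blast
    moreover have "slex B0 V" unfolding slex_def by (rule exI[of _ a]) (use a(1) in \<open>auto simp: B0\<close>)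
    ultimately show "slex B V" using slex_trans[OF fin(2) f0 fin(1)] by blast
  qed
qed

section \<open>The complex of a completely lexsegment ideal\<close>

locale sqlex =
  fixes n q :: nat and F V :: "nat set"
  assumes q: "2 \<le> q" and F: "F \<subseteq> {2..n}" "card F = q - 1" and V: "V \<subseteq> {2..n}" "card V = q"
    and completely: "completely_sf_lexseg n q (lexseg n q (xmon (insert 1 F)) (xmon V))"
begin

abbreviation "L \<equiv> lexseg n q (xmon (insert 1 F)) (xmon V)"
abbreviation "\<Delta> \<equiv> fc n L"
definition "vl = sorted_list_of_set V"
definition "fl = sorted_list_of_set F"

lemma finF: "finite F" and finV: "finite V" using F(1) V(1) finite_subset by auto

lemma vl: "sorted_wrt (<) vl" "set vl = V" "length vl = q" "set vl \<subseteq> {1..n}" using finV V by (auto simp: vl_def)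

lemma fl: "sorted_wrt (<) fl" "set fl = F" "length fl = q - 1" "set fl \<subseteq> {1<..n}"
  using finF F by (auto simp: fl_def)

lemma qn: "q < n" using card_mono[OF _ V(1)] V(2) q by simp

lemma fin: "W \<subseteq> {1..n} \<Longrightarrow> finite W" using finite_subset by blast

lemma F1: "1 \<notin> F" and V1: "1 \<notin> V" and F': "insert 1 F \<subseteq> {1..n}" and V': "V \<subseteq> {1..n}" using F(1) V(1) qn by auto

lemma card_U: "card (insert 1 F) = q" using F1 finF F(2) q by simp

lemma L_sf: "L \<subseteq> sf_mon n q" by (auto simp: lexseg_def)

lemma mem_L: "W \<subseteq> {1..n} \<Longrightarrow> xmon W \<in> L \<longleftrightarrow> card W = q \<and> \<not> slex (insert 1 F) W \<and> \<not> slex W V"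
  using xmon_sf[of W n q] xmon_less[of "insert 1 F" W] xmon_less[of W V] finF finV fin
  by (auto simp: lexseg_def not_less[symmetric])

lemma U_slex: "W \<subseteq> {1..n} \<Longrightarrow> slex (insert 1 F) W \<longleftrightarrow> 1 \<in> W \<and> slex F (W - {1})"
proof
  assume W: "W \<subseteq> {1..n}"
  {
    assume "slex (insert 1 F) W"
    then obtain k where k: "k \<in> W" "k \<notin> insert 1 F" "\<forall>i<k. i \<in> insert 1 F \<longleftrightarrow> i \<in> W" unfolding slex_def by blast
    have "1 < k" using k(1,2) W by fastforce
    then have "1 \<in> W" using k(3) by blast
    moreover have "\<forall>i<k. i \<in> F \<longleftrightarrow> i \<in> W - {1}" using k(3) F1 by auto
    ultimately show "1 \<in> W \<and> slex F (W - {1})" using k(1,2) unfolding slex_def by auto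
  }
  assume s: "1 \<in> W \<and> slex F (W - {1})"
  then obtain k where k: "k \<in> W - {1}" "k \<notin> F" "\<forall>i<k. i \<in> F \<longleftrightarrow> i \<in> W - {1}" unfolding slex_def by blast
  have "\<forall>i<k. i \<in> insert 1 F \<longleftrightarrow> i \<in> W" using k(3) s by auto
  then show "slex (insert 1 F) W" using k(1,2) unfolding slex_def by auto
qed

lemma V_nonface: "V \<subseteq> S \<Longrightarrow> S \<notin> \<Delta>" using mem_L[OF V'] U_slex[OF V'] V1 V(2) slex_irrefl by (auto simp: fc_def)

lemma not_slex_initial: "card W \<le> q' \<Longrightarrow> finite W \<Longrightarrow> W \<subseteq> {m..} \<Longrightarrow> \<not> slex {m..<m + q'} W"
proof
  assume W: "card W \<le> q'" "finite W" "W \<subseteq> {m..}" and "slex {m..<m + q'} W"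
  then obtain k where k: "k \<in> W" "k \<notin> {m..<m + q'}" "\<forall>i<k. i \<in> {m..<m + q'} \<longleftrightarrow> i \<in> W" unfolding slex_def by blast
  have "m + q' \<le> k" using k(1,2) W(3) by auto
  then have "i \<in> W" if "i \<in> {m..<m + q'}" for i using k(3) that by (metis atLeastLessThan_iff less_le_trans)
  then have "insert k {m..<m + q'} \<subseteq> W" using k(1) by blast
  then have "card (insert k {m..<m + q'}) \<le> card W" by (rule card_mono[OF W(2)])
  then show False using k(2) W(1) by simp
qed

text \<open>The set from 2 to \<open>q + 1\<close> is the largest one avoiding 1, so it lies between
  both ends of the lexsegment and is a generator. Higher shadows therefore contain the largest
  monomial of their degree.\<close>

lemma initial_nonface: "q < d \<Longrightarrow> d \<le> n \<Longrightarrow> {1..<1 + d} \<notin> \<Delta>"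
proof -
  assume d: "q < d" "d \<le> n"
  have W: "{2..<2 + q} \<subseteq> {1..n}" using d by auto
  have "xmon {2..<2 + q} \<in> L"
  proof -
    have "V \<subseteq> {2..}" using V(1) by auto
    then have "\<not> slex {2..<2 + q} V" using not_slex_initial[of V q 2] V(2) finV by blast
    then show ?thesis unfolding mem_L[OF W] U_slex[OF W] by simp
  qed
  moreover have "{2..<2 + q} \<subseteq> {1..<1 + d}" using d by auto
  ultimately show ?thesis unfolding fc_def by blast
qed

text \<open>In degrees above \<open>q\<close> the shadows are initial segments, so the faces form final segments.\<close>

lemma lower_faces:
  assumes d: "q < d" and S: "S \<in> \<Delta>" "card S = d" and S': "S' \<subseteq> {1..n}" "card S' = d" "slex S' S"
  shows "S' \<in> \<Delta>"
proof (rule ccontr)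
  assume nS': "S' \<notin> \<Delta>"
  have Sn: "S \<subseteq> {1..n}" using S(1) by (simp add: fc_def)
  have dn: "d \<le> n" using card_mono[OF _ S'(1)] S'(2) by simp
  let ?E = "xmon ` {S. S \<subseteq> {1..n} \<and> card S = d \<and> S \<notin> \<Delta>}"
  have E: "(shad n ^^ (d - q)) L = ?E" using shad_iter[OF L_sf, of "d - q"] d by simp
  have "sf_lexseg_set n d ?E"
    using completely d unfolding completely_sf_lexseg_def E[symmetric] by (metis le_add_diff_inverse less_imp_le)
  moreover have m: "xmon {1..<1 + d} \<in> ?E" using initial_nonface[OF d dn] dn by auto
  ultimately obtain u' v' where uv: "?E = lexseg n d u' v'" unfolding sf_lexseg_set_def by blast
  \<comment> \<open>The largest monomial of degree \<open>d\<close> is in the shadow, so the upper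
    end of that segment imposes nothing and only \<open>v'\<close> matters.\<close>
  have "xmon {1..<1 + d} \<le> u'" using m unfolding uv by (simp add: lexseg_def)
  moreover have "\<not> xmon {1..<1 + d} < xmon S"
    using not_slex_initial[of S d 1] S(2) Sn fin[OF Sn] xmon_less[of "{1..<1 + d}" S] by fastforce
  moreover have "xmon S' < xmon S" using S'(3) xmon_less fin[OF Sn] fin[OF S'(1)] by blast
  moreover have "v' \<le> xmon S'" using nS' S' unfolding lexseg_def uv[unfolded lexseg_def, symmetric] 
    using uv by (auto simp: lexseg_def)
  moreover have "xmon S \<in> sf_mon n d" using xmon_sf[OF Sn] S(2) by simp
  ultimately have "xmon S \<in> lexseg n d u' v'" unfolding lexseg_def by (auto intro: order_trans)
  then have "xmon S \<in> ?E" unfolding uv .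
  then show False using S(1) xmon_inj fin[OF Sn] fin by blast
qed

text \<open>A set of the same size that contains \<open>V\<close> and avoids 1 is below any set
  containing 1; by \<open>lower_faces\<close> it would be a face, although \<open>V\<close> is a
  nonface.\<close>

lemma large_no1:
  assumes S: "S \<in> \<Delta>" "q < card S" shows "1 \<notin> S"
proof
  assume 1: "1 \<in> S"
  have Sn: "S \<subseteq> {1..n}" using S(1) by (simp add: fc_def)
  show False
  proof (cases "card S \<le> n - 1")
    case True have "card V \<le> card S" "card S \<le> card {2..n}" using V(2) S(2) True by auto
    then obtain S' where S': "V \<subseteq> S'" "S' \<subseteq> {2..n}" "card S' = card S"
      using exists_subset_between[OF _ _ V(1), of "card S"] by auto
    have "slex S' S" unfolding slex_def
      by (rule exI[of _ 1]) (use 1 S'(2) Sn in \<open>auto simp: less_Suc_eq One_nat_def\<close>)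
    moreover have "S' \<subseteq> {1..n}" using S'(2) by auto
    ultimately have "S' \<in> \<Delta>" using lower_faces[OF S(2) S(1) refl _ S'(3)] by blast
    then show False using V_nonface[OF S'(1)] by blast
  next case False
    then have "S = {1..n}" using card_subset_eq[OF _ Sn] card_mono[OF _ Sn] by simp
    then show False using V_nonface[OF V'] S(1) by simp
  qed
qed

definition "D = Dc n vl"
definition "\<Gamma> = Gc n 1 fl"

lemma D_cplx: "cplx n D" unfolding D_def by (rule Dc_cplx) (use vl in auto)
lemma \<Gamma>_cplx: "cplx n \<Gamma>" unfolding \<Gamma>_def by (rule Gc_cplx)

lemma D1: "T \<in> D \<Longrightarrow> 1 \<notin> T"
proof -
  assume T: "T \<in> D"
  have "1 < z" if "z \<in> set vl" for z using that V(1) by (auto simp: vl(2))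
  from Dc_gt[OF T[unfolded D_def] this] show "1 \<notin> T" by auto
qed

lemma \<Gamma>_sub: "T \<in> \<Gamma> \<Longrightarrow> T \<subseteq> {1<..n}" and \<Gamma>_card: "T \<in> \<Gamma> \<Longrightarrow> card T \<le> q - 1"
  using Gc_sub Gc_card fl(3) unfolding \<Gamma>_def by metis+

lemma D_face: "T \<in> D \<Longrightarrow> T \<in> \<Delta>"
proof -
  assume T: "T \<in> D"
  have "xmon W \<notin> L" if W: "W \<subseteq> T" for W
  proof
    assume x: "xmon W \<in> L"
    have WD: "W \<in> D" by (rule cplx_down[OF D_cplx T W])
    then have Wn: "W \<subseteq> {1..n}" by (rule cplx_sub[OF D_cplx])
    then show False using x Dc_slex[OF vl(1) Wn] WD unfolding mem_L[OF Wn] by (simp add: vl D_def)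
  qed
  then show "T \<in> \<Delta>" using cplx_sub[OF D_cplx T] by (simp add: fc_def)
qed

lemma face_D:
  assumes T: "T \<in> \<Delta>" "q \<le> card T" "1 \<notin> T" shows "T \<in> D" unfolding D_def
proof (rule Dc_of_subsets)
  show Tn: "T \<subseteq> {1..n}" using T(1) by (simp add: fc_def)
  fix W assume W: "W \<subseteq> T" "card W = length vl"
  have Wn: "W \<subseteq> {1..n}" "1 \<notin> W" using W(1) Tn T(3) by auto
  have "xmon W \<notin> L" using T(1) W(1) by (simp add: fc_def)
  then show "W \<in> Dc n vl" using Dc_slex[OF vl(1) Wn(1)] W(2) U_slex[OF Wn(1)] Wn(2)
    unfolding mem_L[OF Wn(1)] by (auto simp: vl)
qed (use T vl in auto)

lemma U_\<Gamma>:
  assumes W: "W \<subseteq> {1..n}" "card W = q" "1 \<in> W"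
  shows "slex (insert 1 F) W \<longleftrightarrow> W - {1} \<in> \<Gamma>"
proof -
  have "W - {1} \<subseteq> {1<..n}" using W(1) by (auto simp: less_le)
  moreover have "card (W - {1}) = length fl" using W(2,3) fin[OF W(1)] fl(3) by simp
  ultimately show ?thesis using Gc_slex[OF fl(1,4)] U_slex[OF W(1)] W(3) unfolding \<Gamma>_def fl(2) by blast
qed

lemma cone_pure:
  assumes "T \<in> cone 1 \<Gamma>"
  shows "\<exists>B. T \<subseteq> B \<and> B \<subseteq> {1..n} \<and> card B = q \<and> 1 \<in> B \<and> B - {1} \<in> \<Gamma>"
proof -
  obtain B where B: "B \<in> \<Gamma>" "T - {1} \<subseteq> B" "card B = q - 1"
    using Gc_pure[OF fl(1,4), of "T - {1}"] assms unfolding cone_def \<Gamma>_def fl(3) by blast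
  have B1: "1 \<notin> B" "B \<subseteq> {1..n}" using \<Gamma>_sub[OF B(1)] by auto
  note B2 = fin[OF B1(2)]
  have "insert 1 B \<subseteq> {1..n}" "card (insert 1 B) = q" "insert 1 B - {1} = B" using B1 B2 B(3) q qn by auto
  then show ?thesis using B(1,2) by (intro exI[of _ "insert 1 B"]) auto
qed

lemma D_pure: "T \<in> D \<Longrightarrow> card T \<le> q \<Longrightarrow> \<exists>B\<in>D. T \<subseteq> B \<and> card B = q"
  by (rule pure_extend[OF _ cplx_fin[OF D_cplx]]) (use Dc_extend[OF vl(1)] vl(3) in \<open>auto simp: D_def\<close>)

lemma cone_face:
  assumes W: "W \<subseteq> {1..n}" "card W = q" "1 \<in> W"
  shows "W \<in> \<Delta> \<longleftrightarrow> W - {1} \<in> \<Gamma>"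
proof -
  have "W \<in> \<Delta> \<longleftrightarrow> xmon W \<notin> L"
  proof
    assume x: "xmon W \<notin> L"
    have "xmon W' \<notin> L" if W': "W' \<subseteq> W" for W'
    proof
      assume x': "xmon W' \<in> L"
      have "W' \<subseteq> {1..n}" using W' W(1) by blast
      then have "card W' = card W" using x' mem_L W(2) by simp
      then have "W' = W" using card_subset_eq[OF fin[OF W(1)] W'] by simp
      then show False using x x' by simp
    qed
    then show "W \<in> \<Delta>" using W(1) by (simp add: fc_def)
  qed (auto simp: fc_def)
  also have "\<dots> \<longleftrightarrow> slex (insert 1 F) W"
  proof -
    have "slex W V \<Longrightarrow> False"
    proof -
      assume "slex W V"
      then obtain k where k: "k \<in> V" "\<forall>i<k. i \<in> W \<longleftrightarrow> i \<in> V" unfolding slex_def by blast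
      have "1 < k" using k(1) V(1) by auto
      then show False using k(2) W(3) V1 by blast
    qed
    then show ?thesis using mem_L[OF W(1)] W(2) by blast
  qed
  also have "\<dots> \<longleftrightarrow> W - {1} \<in> \<Gamma>" by (rule U_\<Gamma>[OF W])
  finally show ?thesis .
qed

lemma pg_q: "pg \<Delta> q = D \<union> cone 1 \<Gamma>"
proof
  show "pg \<Delta> q \<subseteq> D \<union> cone 1 \<Gamma>"
  proof
    fix T assume "T \<in> pg \<Delta> q"
    then obtain B where B: "B \<in> \<Delta>" "T \<subseteq> B" "q \<le> card B" by (auto simp: pg_def)
    have Bn: "B \<subseteq> {1..n}" using B(1) by (simp add: fc_def)
    show "T \<in> D \<union> cone 1 \<Gamma>"
    proof (cases "1 \<in> B")
      case False then show ?thesis using cplx_down[OF D_cplx face_D[OF B(1,3) False] B(2)] by blast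
    next case True
      \<comment> \<open>Faces through 1 cannot be larger than \<open>q\<close>, so they are
        described by the generators alone.\<close>
      then have "card B = q" using large_no1[OF B(1)] B(3) by force
      then have "B - {1} \<in> \<Gamma>" using cone_face[OF Bn _ True] B(1) by blast
      moreover have "T - {1} \<subseteq> B - {1}" using B(2) by blast
      ultimately show ?thesis using cplx_down[OF \<Gamma>_cplx] by (auto simp: cone_def)
    qed
  qed
  show "D \<union> cone 1 \<Gamma> \<subseteq> pg \<Delta> q"
  proof
    fix T assume "T \<in> D \<union> cone 1 \<Gamma>"
    then consider "T \<in> D" | "T - {1} \<in> \<Gamma>" by (auto simp: cone_def)
    then show "T \<in> pg \<Delta> q"
    proof cases
      case 1 show ?thesis
      proof (cases "card T \<le> q")
        case True
        note D_pure[OF 1 True]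
        then show ?thesis using D_face D_face[OF 1] by (auto simp: pg_def)
      qed (use D_face[OF 1] in \<open>auto simp: pg_def\<close>)
    next case 2
      obtain B where B: "T \<subseteq> B" "B \<subseteq> {1..n}" "card B = q" "1 \<in> B" "B - {1} \<in> \<Gamma>"
        using cone_pure[of T] 2 by (auto simp: cone_def)
      then have "B \<in> \<Delta>" using cone_face by blast
      then show ?thesis using B(1,3) cplx_down[OF fc_cplx] by (auto simp: pg_def)
    qed
  qed
qed

text \<open>By \<open>lower_faces\<close> the faces of size \<open>d\<close> can be exchanged toward
  larger vertices, so the part of size at most \<open>d\<close> is shifted; larger faces are added
  without loss of depth.\<close>

lemma Th_high:
  fixes ty :: "'k::field itself"
  assumes d: "q < d" shows "Th ty n (pg \<Delta> d) d"
proof (rule Th_add_faces[OF pg_cplx[OF fc_cplx]])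
  interpret glue_cone "Th ty n" n by (rule Th_glue_cone)
  have c: "cplx n (pg \<Delta> d)" by (rule pg_cplx[OF fc_cplx])
  show "Th ty n {T \<in> pg \<Delta> d. card T \<le> d} d"
  proof (rule shifted[where V = "{1..n}" and p = "\<lambda>x. - int x"])
    show "cplx n {T \<in> pg \<Delta> d. card T \<le> d}" by (rule cplx_skel[OF c])
    fix T assume T: "T \<in> {T \<in> pg \<Delta> d. card T \<le> d}"
    show "T \<subseteq> {1..n}" "card T \<le> d" using T cplx_sub[OF c] by auto
    obtain B where B: "B \<in> \<Delta>" "T \<subseteq> B" "d \<le> card B" using T by (auto simp: pg_def)
    have fB: "finite B" by (rule cplx_fin[OF fc_cplx B(1)])
    obtain C where C: "T \<subseteq> C" "C \<subseteq> B" "card C = d" using exists_subset_between[OF _ B(3) B(2) fB] T by auto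
    have "C \<in> \<Delta>" by (rule cplx_down[OF fc_cplx B(1) C(2)])
    then show "\<exists>B\<in>{T \<in> pg \<Delta> d. card T \<le> d}. T \<subseteq> B \<and> card B = d" using C by (auto simp: pg_def)
  next
    fix B t y assume B: "B \<in> {T \<in> pg \<Delta> d. card T \<le> d}" "card B = d" "t \<in> B" "y \<in> {1..n} - B" "- int y < - int t"
    have "B \<in> \<Delta>" using B(1) by (simp add: pg_def)
    then have B': "B \<in> \<Delta>" "finite B" "B \<subseteq> {1..n}" using cplx_fin[OF fc_cplx] cplx_sub[OF fc_cplx] by blast+
    have cd: "card (insert y (B - {t})) = d" using card_exchange[OF B'(2) B(3)] B(2,4) by blast
    have "slex (insert y (B - {t})) B" unfolding slex_def by (rule exI[of _ t]) (use B in auto)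
    then have "insert y (B - {t}) \<in> \<Delta>" using lower_faces[OF d B'(1) B(2) _ cd] B(4) B'(3) by auto
    then show "insert y (B - {t}) \<in> {T \<in> pg \<Delta> d. card T \<le> d}" using cd by (auto simp: pg_def)
  qed (auto simp: inj_on_def)
qed

text \<open>Generators have size \<open>q\<close>, so all smaller sets are faces and the relevant
  skeleton is that of the full simplex.\<close>

lemma Th_low:
  fixes ty :: "'k::field itself"
  assumes d: "d < q" shows "Th ty n (pg \<Delta> d) d"
proof (rule Th_add_faces[OF pg_cplx[OF fc_cplx]])
  interpret glue_cone "Th ty n" n by (rule Th_glue_cone)
  have f: "T \<in> \<Delta>" if T: "T \<subseteq> {1..n}" "card T < q" for T
  proof -
    have "card W < q" if "W \<subseteq> T" for W using card_mono[OF fin[OF T(1)] that] T(2) by simp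
    then have "xmon W \<notin> L" if W: "W \<subseteq> T" for W using mem_L[OF subset_trans[OF W T(1)]] W by auto
    then show ?thesis using T(1) by (simp add: fc_def)
  qed
  have ex: "\<exists>B. T \<subseteq> B \<and> B \<subseteq> {1..n} \<and> card B = d" if T: "T \<subseteq> {1..n}" "card T \<le> d" for T
    using exists_subset_between[OF T(2) _ T(1)] d qn by auto
  have "{T \<in> pg \<Delta> d. card T \<le> d} = {T. T \<subseteq> {1..n} \<and> card T \<le> d}" (is "_ = ?S")
  proof
    show "{T \<in> pg \<Delta> d. card T \<le> d} \<subseteq> ?S" by (auto simp: pg_def fc_def)
    show "?S \<subseteq> {T \<in> pg \<Delta> d. card T \<le> d}"
    proof
      fix T assume T: "T \<in> ?S"
      then obtain B where "T \<subseteq> B" "B \<subseteq> {1..n}" "card B = d" using ex by blast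
      then show "T \<in> {T \<in> pg \<Delta> d. card T \<le> d}" using f[of T] f[of B] T d by (auto simp: pg_def)
    qed
  qed
  moreover have "Th ty n ?S d"
  proof (rule shifted[where V = "{1..n}" and p = int])
    show "cplx n ?S" by (rule cplxI) (auto intro: order_trans[OF card_mono] fin)
    show "\<exists>B\<in>?S. T \<subseteq> B \<and> card B = d" if "T \<in> ?S" for T using ex[of T] that by auto
    show "insert y (B - {t}) \<in> ?S" if "B \<in> ?S" "card B = d" "t \<in> B" "y \<in> {1..n} - B" for B t y
      using card_exchange[of B t y] that fin[of B] by auto
  qed (auto simp: inj_on_def)
  ultimately show "Th ty n {T \<in> pg \<Delta> d. card T \<le> d} d" by simp
qed

definition "X = D \<inter> cone 1 \<Gamma>"

lemma X_eq: "X = {T \<in> Dc n vl. T - {1} \<in> Gc n 1 fl \<and> card T \<le> length fl}"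
  using D1 \<Gamma>_card by (auto simp: X_def cone_def fl(3) simp flip: D_def \<Gamma>_def)

lemma Th_D: "Th ty n D q" for ty :: "'k::field itself"
proof -
  interpret glue_cone "Th ty n" n by (rule Th_glue_cone)
  show ?thesis using Th_add_faces[OF D_cplx] Dc_skel[OF vl(1,4), of q] vl(3) unfolding D_def by simp
qed

lemma Th_cone\<Gamma>: "Th ty n (cone 1 \<Gamma>) q" for ty :: "'k::field itself"
proof -
  interpret glue_cone "Th ty n" n by (rule Th_glue_cone)
  have "Th ty n (cone 1 \<Gamma>) (Suc (q - 1))"
  proof (rule cone[OF \<Gamma>_cplx])
    show "1 \<in> {1..n}" using qn by simp
    show "1 \<notin> T \<and> card T \<le> q - 1" if "T \<in> \<Gamma>" for T using \<Gamma>_sub[OF that] \<Gamma>_card[OF that] by auto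
    show "Th ty n \<Gamma> (q - 1)" using Gc[OF fl(1,4)] unfolding fl(3) \<Gamma>_def .
  qed
  then show ?thesis using q by simp
qed

lemma cone_cplx: "cplx n (cone 1 \<Gamma>)" by (rule cplx_cone[OF \<Gamma>_cplx]) (use qn in simp)

text \<open>The filtration yields only the weak depth \<open>Dep\<close>, while producing a
  filtration takes the strong \<open>Th\<close>. For \<open>X\<close>, regularity of the dual ideal
  mediates between them, with \<open>transfer_lexseg\<close> used once in each direction.\<close>

theorem seqCM_iff_Reg:
  fixes ty :: "'k::field itself"
  shows "sequentially_CM_ideal n (mon_ideal n L :: 'k pol set) \<longleftrightarrow> Reg ty n X (q - 1)"
proof -
  have tl: "set vl \<subseteq> {1..n}" "set fl \<subseteq> {1<..n}" "length vl = Suc (length fl)" "(1::nat) \<le> 1"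
    using vl fl q by auto
  have Sq: "Suc (q - 1) = q" using q by simp
  show ?thesis unfolding mon_ideal_MI[OF L_sf]
  proof
    assume "sequentially_CM_ideal n (MI n (- \<Delta>) :: 'k pol set)"
    then have "Dep ty n (D \<union> cone 1 \<Gamma>) q" using seqCM_imp_Dep[OF fc_cplx, of n L q ty] q unfolding pg_q by simp
    moreover interpret C: glue_conv "Th ty n" n "Dep ty n" by (rule Dep_glue_conv)
    have "Dep ty n D q" "Dep ty n (cone 1 \<Gamma>) q" using Th_Dep D_cplx cone_cplx Th_D Th_cone\<Gamma> by blast+
    ultimately have "Dep ty n X (q - 1)"
      unfolding X_def using C.convglue[OF D_cplx cone_cplx, of "q - 1"] unfolding Sq by blast
    then show "Reg ty n X (q - 1)"
      using C.transfer_lexseg[OF Reg_glue_cone vl(1) tl(1) fl(1) tl(2,3,4)] unfolding X_eq fl(3) by blast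
  next
    assume R: "Reg ty n X (q - 1)"
    interpret C: glue_conv "Reg ty n" n "Reg ty n" by (rule Reg_glue_conv)
    interpret G: glue_cone "Th ty n" n by (rule Th_glue_cone)
    have "Th ty n X (q - 1)"
      using C.transfer_lexseg[OF Th_glue_cone vl(1) tl(1) fl(1) tl(2,3,4)] R unfolding X_eq fl(3) by blast
    then have "Th ty n (pg \<Delta> q) q"
      using G.glue[OF D_cplx cone_cplx, of "q - 1"] Th_D Th_cone\<Gamma> unfolding pg_q X_def Sq by blast
    then have "Th ty n (pg \<Delta> d) d" for d
      using Th_low[of d] Th_high[of d] by (cases d q rule: linorder_cases) auto
    then show "sequentially_CM_ideal n (MI n (- \<Delta>) :: 'k pol set)" by (rule Th_imp_seqCM[OF fc_cplx])
  qed
qed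

section \<open>Alexander duals of the initial and final segments\<close>

lemma dual_ideal:
  assumes M: "M = xmon ` {W. W \<subseteq> {1..n} \<and> card W = n - q \<and> R ({1..n} - W)}"
    and Y: "\<And>T. T \<subseteq> {1..n} \<Longrightarrow> T \<in> Y \<longleftrightarrow> (\<exists>B. T \<subseteq> B \<and> B \<subseteq> {1..n} \<and> card B = q \<and> R B)"
  shows "mon_ideal n M = (MI n (du n Y) :: 'k::field pol set)"
proof -
  have "M \<subseteq> sf_mon n (n - q)" unfolding M sf_mon_eq by blast
  note mon_ideal_MI[OF this]
  also have "(MI n (- fc n M) :: 'k pol set) = MI n (du n Y)"
  proof (rule MI_cong)
    fix A assume A: "A \<subseteq> {1..n}"
    have xM: "xmon W \<in> M \<longleftrightarrow> card W = n - q \<and> R ({1..n} - W)" if "W \<subseteq> {1..n}" for W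
      unfolding M using xmon_inj fin[OF that] fin that by blast
    have cc: "card ({1..n} - W) = n - card W" if "W \<subseteq> {1..n}" for W
      using that fin[OF that] by (simp add: card_Diff_subset)
    have "A \<in> - fc n M \<longleftrightarrow> (\<exists>W\<subseteq>A. card W = n - q \<and> R ({1..n} - W))" using A xM by (auto simp: fc_def)
    also have "\<dots> \<longleftrightarrow> (\<exists>B. {1..n} - A \<subseteq> B \<and> B \<subseteq> {1..n} \<and> card B = q \<and> R B)"
    proof
      assume "\<exists>W\<subseteq>A. card W = n - q \<and> R ({1..n} - W)"
      then obtain W where W: "W \<subseteq> A" "card W = n - q" "R ({1..n} - W)" by blast
      have "card ({1..n} - W) = q" using cc[of W] W(1,2) A qn by auto
      then show "\<exists>B. {1..n} - A \<subseteq> B \<and> B \<subseteq> {1..n} \<and> card B = q \<and> R B"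
        using W by (intro exI[of _ "{1..n} - W"]) auto
    next
      assume "\<exists>B. {1..n} - A \<subseteq> B \<and> B \<subseteq> {1..n} \<and> card B = q \<and> R B"
      then obtain B where B: "{1..n} - A \<subseteq> B" "B \<subseteq> {1..n}" "card B = q" "R B" by blast
      then show "\<exists>W\<subseteq>A. card W = n - q \<and> R ({1..n} - W)"
        using cc[OF B(2)] double_diff[OF B(2) order_refl] by (intro exI[of _ "{1..n} - B"]) auto
    qed
    also have "\<dots> \<longleftrightarrow> A \<in> du n Y" using Y[of "{1..n} - A"] by (simp add: du_def)
    finally show "A \<in> - fc n M \<longleftrightarrow> A \<in> du n Y" .
  qed
  finally show ?thesis .
qed

text \<open>The sets below \<open>V\<close> are those up to its successor \<open>B0\<close>, and
  complementing reverses the order; so the dual generators form an initial segment ending at the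
  complement of \<open>B0\<close>.\<close>

lemma init_part:
  assumes B0: "B0 \<subseteq> {1..n}" "\<And>B. B \<subseteq> {1..n} \<Longrightarrow> card B = q \<Longrightarrow> slex B V \<longleftrightarrow> \<not> slex B0 B"
  shows "mon_ideal n (init_lexseg n (n - q) (xmon ({1..n} - B0))) = (MI n (du n {T \<in> D. card T \<le> q}) :: 'k::field pol set)"
proof (rule dual_ideal)
  show "init_lexseg n (n - q) (xmon ({1..n} - B0)) = xmon ` {W. W \<subseteq> {1..n} \<and> card W = n - q \<and> slex ({1..n} - W) V}"
  proof -
    have "xmon ({1..n} - B0) \<le> xmon W \<longleftrightarrow> slex ({1..n} - W) V" if W: "W \<subseteq> {1..n}" "card W = n - q" for W
    proof -
      have c: "card ({1..n} - W) = q" using W fin[OF W(1)] qn by (simp add: card_Diff_subset)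
      have "xmon ({1..n} - B0) \<le> xmon W \<longleftrightarrow> \<not> slex W ({1..n} - B0)"
        using xmon_less[OF fin[OF W(1)], of "{1..n} - B0"] by (simp add: not_less[symmetric])
      also have "\<dots> \<longleftrightarrow> \<not> slex B0 ({1..n} - W)"
        using slex_compl[OF W(1), of "{1..n} - B0"] double_diff[OF B0(1) order_refl] by simp
      finally show ?thesis using B0(2)[OF _ c] by simp
    qed
    then show ?thesis unfolding init_lexseg_def sf_mon_eq by blast
  qed
  fix T assume T: "T \<subseteq> {1..n}"
  have BD: "B \<in> D \<longleftrightarrow> slex B V" if "B \<subseteq> {1..n}" "card B = q" for B
    using Dc_slex[OF vl(1) that(1)] that(2) by (simp add: D_def vl)
  show "T \<in> {T \<in> D. card T \<le> q} \<longleftrightarrow> (\<exists>B. T \<subseteq> B \<and> B \<subseteq> {1..n} \<and> card B = q \<and> slex B V)"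
  proof
    assume "T \<in> {T \<in> D. card T \<le> q}"
    then obtain B where B: "B \<in> D" "T \<subseteq> B" "card B = q" using D_pure by blast
    have "B \<subseteq> {1..n}" by (rule cplx_sub[OF D_cplx B(1)])
    then show "\<exists>B. T \<subseteq> B \<and> B \<subseteq> {1..n} \<and> card B = q \<and> slex B V" using B BD by blast
  next
    assume "\<exists>B. T \<subseteq> B \<and> B \<subseteq> {1..n} \<and> card B = q \<and> slex B V"
    then obtain B where B: "T \<subseteq> B" "B \<subseteq> {1..n}" "card B = q" "slex B V" by blast
    have "T \<in> D" using cplx_down[OF D_cplx _ B(1)] BD[OF B(2,3)] B(4) by blast
    then show "T \<in> {T \<in> D. card T \<le> q}" using card_mono[OF fin[OF B(2)] B(1)] B(3) by simp
  qed
qed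

text \<open>Sets strictly above \<open>insert 1 F\<close> have complements strictly below that of
  \<open>insert 1 F\<close>, which the successor turns into a closed final segment. The assumption
  makes the set under \<open>Max\<close> nonempty, so that the successor exists.\<close>

lemma final_part:
  assumes ne: "\<exists>B. B \<subseteq> {1..n} \<and> card B = q \<and> slex (insert 1 F) B"
  shows "mon_ideal n (final_lexseg n (n - q) (lex_succ n (xmon ({1..n} - insert 1 F)))) = (MI n (du n (cone 1 \<Gamma>)) :: 'k::field pol set)"
proof (rule dual_ideal)
  let ?m = "xmon ({1..n} - insert 1 F)"
  let ?S = "{w \<in> sf_mon n (n - q). w < ?m}"
  have d: "mdeg ?m = n - q" using mdeg_xmon[of "{1..n} - insert 1 F"] card_U F' finF by (simp add: card_Diff_subset)
  have lt: "xmon W < ?m \<longleftrightarrow> slex (insert 1 F) ({1..n} - W)" if W: "W \<subseteq> {1..n}" for W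
    using xmon_less[OF fin[OF W], of "{1..n} - insert 1 F"] slex_compl[OF W, of "{1..n} - insert 1 F"]
      double_diff[OF F' order_refl] by simp
  obtain B where B: "B \<subseteq> {1..n}" "card B = q" "slex (insert 1 F) B" using ne by blast
  have "card ({1..n} - B) = n - q" using B fin[OF B(1)] by (simp add: card_Diff_subset)
  then have "xmon ({1..n} - B) \<in> ?S" using xmon_sf lt[of "{1..n} - B"] B double_diff[OF B(1) order_refl] by simp
  then have ne: "?S \<noteq> {}" by blast
  have fS: "finite ?S" unfolding sf_mon_eq by simp
  have "lex_succ n ?m = Max ?S" unfolding lex_succ_def d ..
  moreover have "Max ?S \<in> ?S" by (rule Max_in[OF fS ne])
  ultimately have sm: "lex_succ n ?m < ?m" "\<And>w. w \<in> ?S \<Longrightarrow> w \<le> lex_succ n ?m" using Max_ge[OF fS] by auto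
  have "final_lexseg n (n - q) (lex_succ n ?m) = ?S"
  proof
    show "final_lexseg n (n - q) (lex_succ n ?m) \<subseteq> ?S"
      unfolding final_lexseg_def using le_less_trans[OF _ sm(1)] by blast
    show "?S \<subseteq> final_lexseg n (n - q) (lex_succ n ?m)" unfolding final_lexseg_def using sm(2) by blast
  qed
  also have "?S = xmon ` {W \<in> {W. W \<subseteq> {1..n} \<and> card W = n - q}. xmon W < ?m}" unfolding sf_mon_eq by blast
  also have "{W \<in> {W. W \<subseteq> {1..n} \<and> card W = n - q}. xmon W < ?m} =
    {W. W \<subseteq> {1..n} \<and> card W = n - q \<and> slex (insert 1 F) ({1..n} - W)}"
    by (rule Collect_cong) (use lt in \<open>simp cong: conj_cong\<close>)
  finally show "final_lexseg n (n - q) (lex_succ n ?m) = xmon ` {W. W \<subseteq> {1..n} \<and> card W = n - q \<and> slex (insert 1 F) ({1..n} - W)}" .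
  fix T assume T: "T \<subseteq> {1..n}"
  show "T \<in> cone 1 \<Gamma> \<longleftrightarrow> (\<exists>B. T \<subseteq> B \<and> B \<subseteq> {1..n} \<and> card B = q \<and> slex (insert 1 F) B)"
  proof
    assume "T \<in> cone 1 \<Gamma>"
    then show "\<exists>B. T \<subseteq> B \<and> B \<subseteq> {1..n} \<and> card B = q \<and> slex (insert 1 F) B" using cone_pure U_\<Gamma> by blast
  next
    assume "\<exists>B. T \<subseteq> B \<and> B \<subseteq> {1..n} \<and> card B = q \<and> slex (insert 1 F) B"
    then obtain B where B: "T \<subseteq> B" "B \<subseteq> {1..n}" "card B = q" "slex (insert 1 F) B" by blast
    have "1 \<in> B" using U_slex[OF B(2)] B(4) by simp
    then have "B \<in> cone 1 \<Gamma>" using U_\<Gamma>[OF B(2,3)] B(4) by (simp add: cone_def)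
    then show "T \<in> cone 1 \<Gamma>" by (rule cplx_down[OF cone_cplx _ B(1)])
  qed
qed

text \<open>A member of \<open>D\<close> avoids 1, so in the cone it lies in \<open>\<Gamma>\<close>
  itself and already has at most \<open>q - 1\<close> elements.\<close>

lemma X_parts: "{T \<in> D. card T \<le> q} \<inter> cone 1 \<Gamma> = X" using D1 \<Gamma>_card by (fastforce simp: X_def cone_def)

theorem seqCM_iff_linear:
  "sequentially_CM_ideal n (mon_ideal n L :: 'k::field pol set) \<longleftrightarrow>
    has_linear_resolution n (n - q + 1) (MI n (du n X) :: 'k pol set)"
proof -
  have e: "n - q + 1 = n - (q - 1)" using q qn by simp
  have "has_linear_resolution n (n - (q - 1)) (MI n (du n X) :: 'k pol set) \<longleftrightarrow> Reg TYPE('k) n X (q - 1)"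
  proof (rule linear_iff_Reg)
    show "cplx n X" unfolding X_def by (rule cplx_Int[OF D_cplx cone_cplx])
    show "card T \<le> q - 1" if "T \<in> X" for T using that unfolding X_eq fl(3) by blast
    show "q - 1 \<le> n" using qn by simp
  qed
  then show ?thesis unfolding e seqCM_iff_Reg[of "TYPE('k)"] by blast
qed

end

theorem theorem3p12:
  fixes n q s :: nat
    and i j :: "nat \<Rightarrow> nat"
    and F :: "nat set" and A :: "nat \<Rightarrow> nat set"
    and u v :: mon
    and I :: "(mon \<Rightarrow>\<^sub>0 'k::field) set"
  assumes q: "2 \<le> q"
    and i: "strict_mono_on {2..q} i" "i ` {2..q} \<subseteq> {2..n}"
    and F: "F = i ` {2..q}"
    and u: "u = Poly_Mapping.single 1 1 + xmon F"
    and j: "strict_mono_on {1..q} j" "j ` {1..q} \<subseteq> {2..n}"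
    and v: "v = xmon (j ` {1..q})"
    and I: "I = mon_ideal n (lexseg n q u v)"
    and completely: "completely_sf_lexseg n q (lexseg n q u v)"
    and not_initial: "\<not> initial_sf_lexseg_ideal n I"
    and not_final: "\<not> final_sf_lexseg_ideal n I"
    and A: "\<And>t. t \<in> {1..q} \<Longrightarrow> A t = {1..j t} - j ` {1..<t}"
    and s: "s \<in> {1..q}" "card (A s) \<le> n - q" "s < q \<Longrightarrow> card (A (s + 1)) = n - q + 1"
  shows "sequentially_CM_ideal n I \<longleftrightarrow>
    has_linear_resolution n (n - q + 1)
      ((mon_ideal n (init_lexseg n (n - q) (xmon (A s) + xmon {q + j s - s + 2..n})) \<inter>
        mon_ideal n (final_lexseg n (n - q) (lex_succ n (xmon ({1..n} - F - {1})))))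
       :: (mon \<Rightarrow>\<^sub>0 'k) set)"
proof -
  define V where "V = j ` {1..q}"
  have inj: "inj_on i {2..q}" "inj_on j {1..q}" using i(1) j(1) by (simp_all add: strict_mono_on_imp_inj_on)
  have cF: "card F = q - 1" unfolding F card_image[OF inj(1)] using q by simp
  have cV: "card V = q" unfolding V_def card_image[OF inj(2)] by simp
  have finF: "finite F" unfolding F by simp
  have F1: "1 \<notin> F" using i(2) unfolding F by fastforce
  have u': "u = xmon (insert 1 F)" unfolding u using xmon_insert[OF finF F1] by (simp add: add.commute)
  have v': "v = xmon V" unfolding v V_def ..
  interpret sqlex n q F V
    by unfold_locales (use q i(2) j(2) cF cV completely in \<open>simp_all add: F[symmetric] V_def[symmetric] u' v'\<close>)
  have I': "I = mon_ideal n L" unfolding I u' v' ..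

  define a where "a = j s"
  \<comment> \<open>The lexicographic successor of \<open>V\<close>: the \<open>s\<close>-th entry
    moves up by one and the later entries close up behind it. Its complement is the monomial that
    determines the initial segment in the statement.\<close>
  define B0 where "B0 = V \<inter> {..<a} \<union> {a<..a + q - s + 1}"
  have s1: "1 \<le> s" "s \<le> q" using s(1) by auto
  have jm: "j x < j y \<longleftrightarrow> x < y" if "x \<in> {1..q}" "y \<in> {1..q}" for x y using strict_mono_on_less[OF j(1) that] .
  have aV: "a \<in> V" unfolding a_def V_def using s(1) by blast
  have an: "a \<in> {1..n}" using aV V' by blast
  have below: "V \<inter> {..<j t} = j ` {1..<t}" if t: "t \<in> {1..q}" for t
    unfolding V_def using jm t by (auto simp: image_iff Bex_def)
  have cbelow: "card (j ` {1..<t}) = t - 1" if t: "t \<in> {1..q}" for t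
  proof -
    have "{1..<t} \<subseteq> {1..q}" using t by auto
    from card_image[OF inj_on_subset[OF inj(2) this]] show ?thesis by simp
  qed
  have cA: "card (A t) + (t - 1) = j t" if t: "t \<in> {1..q}" for t
  proof -
    have sub: "j ` {1..<t} \<subseteq> {1..j t}" unfolding below[OF t, symmetric] using V' by auto
    have "card (A t) = j t - (t - 1)" unfolding A[OF t] using card_Diff_subset[OF _ sub] cbelow[OF t] by simp
    moreover have "t - 1 \<le> j t" using card_mono[OF _ sub] cbelow[OF t] by simp
    ultimately show ?thesis by simp
  qed
  \<comment> \<open>The bound on \<open>card (A s)\<close> says exactly that the successor still
    fits into the available indices.\<close>
  have e: "a + q - s + 1 \<le> n" using cA[OF s(1)] s(2) s1 qn unfolding a_def by linarith
  \<comment> \<open>That \<open>card (A (s + 1))\<close> equals \<open>n - q + 1\<close> places the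
    next entry at \<open>n - q + s + 1\<close>, which leaves no freedom for the later ones; for
    \<open>s = q\<close> both sides are empty.\<close>
  have tail: "V \<inter> {a<..} = {n - q + s + 1..n}"
  proof (rule card_subset_eq)
    have "j t \<le> a" if "t \<in> {1..q}" "\<not> s < t" for t using jm[OF s(1) that(1)] that(2) unfolding a_def by simp
    then have up: "V \<inter> {a<..} = j ` {s + 1..q}"
      unfolding V_def using jm s(1) unfolding a_def by (auto simp: image_iff Bex_def Suc_le_eq)
    have "card (j ` {s + 1..q}) = q - s"
      using card_image[OF inj_on_subset[OF inj(2)], of "{s + 1..q}"] s1 by simp
    then show "card (V \<inter> {a<..}) = card {n - q + s + 1..n}" unfolding up using s1 qn by simp
    show "V \<inter> {a<..} \<subseteq> {n - q + s + 1..n}"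
    proof
      fix x assume "x \<in> V \<inter> {a<..}"
      then obtain t where t: "x = j t" "s + 1 \<le> t" "t \<le> q" unfolding up by auto
      have sq: "s < q" "s + 1 \<in> {1..q}" using t(2,3) by auto
      have "j (s + 1) = n - q + s + 1" using cA[OF sq(2)] s(3)[OF sq(1)] by simp
      moreover have "j (s + 1) \<le> j t" using jm[of t "s + 1"] t sq s1 by (auto simp: not_less[symmetric])
      moreover have "x \<le> n" using \<open>x \<in> V \<inter> {a<..}\<close> V' by auto
      ultimately show "x \<in> {n - q + s + 1..n}" using t(1) by simp
    qed
  qed simp
  have cs: "card (V \<inter> {..<a}) + 1 = s" using below[OF s(1)] cbelow[OF s(1)] s1 unfolding a_def by simp
  have B0n: "B0 \<subseteq> {1..n}" unfolding B0_def using V' e by auto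
  have A_s: "A s = {1..a} - V \<inter> {..<a}" unfolding A[OF s(1)] a_def below[OF s(1)] ..
  have W0: "xmon (A s) + xmon {q + j s - s + 2..n} = xmon ({1..n} - B0)"
  proof -
    \<comment> \<open>The block of the successor ends at \<open>a + q - s + 1\<close>, so the
      complement resumes one place later. For \<open>card (A s) = n - q\<close> the block ends at
      \<open>n\<close> and the interval is empty, in accordance with the convention in the
      statement.\<close>
    have eq: "q + j s - s + 2 = a + q - s + 1 + 1" unfolding a_def using s1 by simp
    have "{1..n} - B0 = A s \<union> {q + j s - s + 2..n}" unfolding eq A_s B0_def using an e s1 by auto
    moreover have "A s \<inter> {q + j s - s + 2..n} = {}" unfolding eq A_s using s1 by auto
    ultimately show ?thesis unfolding xmon_def A_s by (simp add: sum.union_disjoint)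
  qed
  have init: "mon_ideal n (init_lexseg n (n - q) (xmon (A s) + xmon {q + j s - s + 2..n}))
      = (MI n (du n {T \<in> D. card T \<le> q}) :: 'k pol set)" unfolding W0
    by (rule init_part[OF B0n], rule slex_next[OF V' V(2) aV cs s1(2) tail e B0_def])

  \<comment> \<open>That the ideal is not initial enters here: if nothing lay above
    \<open>u\<close>, the lexsegment would be an initial one. The same set provides the successor
    needed for the final segment.\<close>
  have "\<exists>B. B \<subseteq> {1..n} \<and> card B = q \<and> slex (insert 1 F) B"
  proof (rule ccontr)
    assume no: "\<not> ?thesis"
    have "w \<le> u" if w: "w \<in> sf_mon n q" for w
    proof -
      obtain W where W: "W \<subseteq> {1..n}" "card W = q" "w = xmon W" using w unfolding sf_mon_eq by blast
      have "\<not> slex (insert 1 F) W" using no W by blast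
      then show ?thesis using xmon_less[of "insert 1 F" W] finF fin[OF W(1)] unfolding u' W(3) by simp
    qed
    then have "lexseg n q u v = init_lexseg n q v" by (auto simp: lexseg_def init_lexseg_def)
    moreover have "v \<in> sf_mon n q" unfolding v' using xmon_sf[OF V'] V(2) by simp
    ultimately have "initial_sf_lexseg_ideal n I" unfolding initial_sf_lexseg_ideal_def I by metis
    then show False using not_initial by blast
  qed
  note final = final_part[OF this]
  have F_eq: "{1..n} - F - {1} = {1..n} - insert 1 F" by auto
  show ?thesis
    unfolding init F_eq final MI_Int[symmetric] du_Int[symmetric] X_parts I' by (rule seqCM_iff_linear)
qed

end
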